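(* There exist a function $f$ with $f(n)=o(n)$ and a constant $C$ such that for all integers $m\ge1$, $n\ge 0$ and every multiset $M$ of $n$ elements from $[m]$, there is an indexable multiset representation of $M$ using at most $\mathcal{B}(n,m+n)+f(n)+C\lg\lg m$ bits, i.e. one supporting $\mathrm{rank}_m(x,M)$ and $\mathrm{select}_m(i,M)$ in constant time on the word RAM with word size $\Theta(\lg(m+n))$.
   Context: $[m]=\{0,\dots,m-1\}$, $\lg=\log_2$, $\mathcal{B}(n,m)=\lceil\lg\binom{m}{n}\rceil$. For a multiset $M$ (elements counted with multiplicity): $\mathrm{rank}_m(x,M)$, for $x\in[m]$, returns $-1$ if $x\notin M$ and $|\{y\in M: y<x\}|$ (counting multiplicities) otherwise; $\mathrm{select}_m(i,M)$, for $i\in\{1,\dots,n\}$, returns the largest element $x\in M$ with $\mathrm{rank}_m(x,M)\le i-1$. Word RAM: words of $w$ bits, constant-time arithmetic and bitwise operations; constant time means a bound independent of $n,m,M$. *)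

theory Defs
  imports Complex_Main "HOL-Library.Multiset" "HOL-Library.Landau_Symbols"
begin

definition mrank :: "nat \<Rightarrow> nat multiset \<Rightarrow> int" where
  "mrank x M = (if x \<in># M then int (size (filter_mset (\<lambda>y. y < x) M)) else -1)"

definition mselect :: "nat \<Rightarrow> nat multiset \<Rightarrow> nat" where
  "mselect i M = Max {x \<in> set_mset M. mrank x M \<le> int i - 1}"

definition info_bound :: "nat \<Rightarrow> nat \<Rightarrow> int" where
  "info_bound n m = \<lceil>log 2 (real (m choose n))\<rceil>"


text \<open>
  Words are natural numbers below \<open>2 ^ w\<close>. A program is a finite instruction list that does not
  depend on \<open>w\<close>. It names its registers (the working space) statically; memory cells are
  addressed indirectly, by the content of a register. Every instruction costs one time unit.
\<close>

datatype binop = Add | Sub | Mul | Div | Mod | And | Or | Xor | Shl | Shr | Less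

fun eval_binop :: "nat \<Rightarrow> binop \<Rightarrow> nat \<Rightarrow> nat \<Rightarrow> nat" where
  "eval_binop w Add x y = (x + y) mod 2 ^ w"
| "eval_binop w Sub x y = nat ((int x - int y) mod 2 ^ w)"
| "eval_binop w Mul x y = (x * y) mod 2 ^ w"
| "eval_binop w Div x y = x div y"
| "eval_binop w Mod x y = x mod y"
| "eval_binop w And x y = Bit_Operations.and x y"
| "eval_binop w Or x y = Bit_Operations.or x y"
| "eval_binop w Xor x y = Bit_Operations.xor x y"
| "eval_binop w Shl x y = (x * 2 ^ y) mod 2 ^ w"
| "eval_binop w Shr x y = x div 2 ^ y"
| "eval_binop w Less x y = of_bool (x < y)"

datatype instr =
    Const nat nat            \<comment> \<open>\<open>Const d k\<close>: register \<open>d\<close> gets the constant \<open>k\<close>\<close>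
  | Move nat nat             \<comment> \<open>\<open>Move d s\<close>\<close>
  | Not nat nat              \<comment> \<open>\<open>Not d s\<close>: bitwise complement\<close>
  | Op binop nat nat nat     \<comment> \<open>\<open>Op f d s t\<close>\<close>
  | Load nat nat             \<comment> \<open>\<open>Load d a\<close>: register \<open>d\<close> gets the cell addressed by register \<open>a\<close>\<close>
  | Store nat nat            \<comment> \<open>\<open>Store a s\<close>: the cell addressed by register \<open>a\<close> gets register \<open>s\<close>\<close>
  | Jump nat
  | JumpZero nat nat         \<comment> \<open>\<open>JumpZero s l\<close>: go to \<open>l\<close> if register \<open>s\<close> is zero\<close>
  | Halt

type_synonym prog = "instr list"

record config =
  pc :: nat
  regs :: "nat \<Rightarrow> nat"
  mem :: "nat \<Rightarrow> nat"

fun exec :: "nat \<Rightarrow> instr \<Rightarrow> config \<Rightarrow> config" where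
  "exec w (Const d k) c = c\<lparr>pc := Suc (pc c), regs := (regs c)(d := k mod 2 ^ w)\<rparr>"
| "exec w (Move d s) c = c\<lparr>pc := Suc (pc c), regs := (regs c)(d := regs c s)\<rparr>"
| "exec w (Not d s) c = c\<lparr>pc := Suc (pc c), regs := (regs c)(d := 2 ^ w - 1 - regs c s)\<rparr>"
| "exec w (Op f d s t) c =
     c\<lparr>pc := Suc (pc c), regs := (regs c)(d := eval_binop w f (regs c s) (regs c t))\<rparr>"
| "exec w (Load d a) c = c\<lparr>pc := Suc (pc c), regs := (regs c)(d := mem c (regs c a))\<rparr>"
| "exec w (Store a s) c = c\<lparr>pc := Suc (pc c), mem := (mem c)(regs c a := regs c s)\<rparr>"
| "exec w (Jump l) c = c\<lparr>pc := l\<rparr>"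
| "exec w (JumpZero s l) c = c\<lparr>pc := (if regs c s = 0 then l else Suc (pc c))\<rparr>"
| "exec w Halt c = c"

definition halted :: "prog \<Rightarrow> config \<Rightarrow> bool" where
  "halted P c \<longleftrightarrow> pc c \<ge> length P \<or> P ! pc c = Halt"

definition step :: "nat \<Rightarrow> prog \<Rightarrow> config \<Rightarrow> config" where
  "step w P c = (if halted P c then c else exec w (P ! pc c) c)"

text \<open>
  A bit string is stored from address 0 on, \<open>w\<close> bits per cell, least significant bit first;
  the last cell is padded with zeros and all further cells are zero.
\<close>

definition pack :: "nat \<Rightarrow> bool list \<Rightarrow> nat \<Rightarrow> nat" where
  "pack w bs a = horner_sum of_bool 2 (take w (drop (w * a) bs))"

definition initial :: "nat \<Rightarrow> bool list \<Rightarrow> nat list \<Rightarrow> config" where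
  "initial w bs args =
     \<lparr>pc = 0, regs = (\<lambda>r. if r < length args then args ! r else 0), mem = pack w bs\<rparr>"

text \<open>
  The answer is read from register 0, in two's complement, so that \<open>-1\<close> is the all-ones word.
  The query must leave the stored bit string as it found it.
\<close>

definition answers ::
    "nat \<Rightarrow> prog \<Rightarrow> nat \<Rightarrow> bool list \<Rightarrow> nat list \<Rightarrow> int \<Rightarrow> bool" where
  "answers w P T bs args v \<longleftrightarrow>
     (\<exists>t\<le>T. let c = (step w P ^^ t) (initial w bs args) in
        halted P c \<and> int (regs c 0) = v mod 2 ^ w \<and> mem c = pack w bs)"


text \<open>
  Besides the query argument, the programs know the word size, the number of elements and the
  universe \<open>{..<m}\<close>. The latter is passed as its largest element \<open>m - 1\<close>, because \<open>m\<close> need not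
  fit into a word: if the multiset is empty, \<open>m = 2 ^ w\<close> is possible.
\<close>

definition indexable_multiset_rep ::
    "nat \<Rightarrow> prog \<Rightarrow> prog \<Rightarrow> nat \<Rightarrow> nat \<Rightarrow> nat multiset \<Rightarrow> bool list \<Rightarrow> bool" where
  "indexable_multiset_rep w Pr Ps T m M bs \<longleftrightarrow>
     (\<forall>x<m. answers w Pr T bs [x, size M, m - 1, w] (mrank x M)) \<and>
     (\<forall>i\<in>{1..size M}. answers w Ps T bs [i, size M, m - 1, w] (int (mselect i M)))"

text \<open>
  Word size \<open>\<Theta>(lg N)\<close> with an arbitrary upper constant \<open>\<kappa>\<close>. The lower constant is 1, so that
  query arguments, answers and addresses fit into one word; the maximum with 1 matters only for
  \<open>N = 1\<close>.
\<close>

definition word_size_theta :: "real \<Rightarrow> nat \<Rightarrow> nat \<Rightarrow> bool" where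
  "word_size_theta \<kappa> N w \<longleftrightarrow>
     max 1 (log 2 (real N)) \<le> real w \<and> real w \<le> \<kappa> * max 1 (log 2 (real N))"

end

theory Submission
  imports Defs
begin

text \<open>
  Split every element into its \<open>s\<close> low bits and a high part below \<open>U\<close>, where \<open>U\<close> is about \<open>2\<^sup>b n\<close> for a slowly
  growing \<open>b\<close> (and \<open>s = 0\<close> if \<open>m\<close> is smaller than that). Then \<open>s n + lg C(U + n, n)\<close> exceeds
  \<open>lg C(m + n, n)\<close> by \<open>O(n / 2\<^sup>b)\<close> only. The high parts form a monotone sequence. Coded as if its
  gaps were independent and geometrically distributed, it takes \<open>lg C(U + n, n) + o(n)\<close> bits: blocks of gaps get Shannon
  codes that are decoded by table lookup, and directories of relative values lead to the blocks.

  The low bits of all elements with the same high part are kept in one bin, whose address follows from the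
  number of preceding elements. A bin of many elements needs \<open>O(1)\<close> further bits per element to be searchable in
  constant time. They are paid for by the code: a repeated high part is a zero gap, and giving zero gaps an
  extra share of the probability makes them cheaper by far more than that. Within a bin, leading bits are split
  off until the saved space pays for perfect hashing. All hash functions of the structure start with two
  global reductions modulo numbers of \<open>O(lg n + lg lg m)\<close> bits; such moduli exist because the least common
  multiple of \<open>1, \<dots>, 2 k\<close> is at least \<open>2\<^sup>k\<close>.

  Query programs are straight-line expressions with conditionals; whether a function of the machine state is
  computed by such an expression is closed under everything the queries need.
\<close>

section \<open>Expressions and their compilation\<close>

text \<open>The budget has two parts: o(n), which may depend on n alone, and O(lg lg m) once.
  Nothing that grows with m can therefore be paid per bin or per element, except against elements of
  large bins, whose repeated high parts are coded below their ideal length. The parameter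
  \<open>b\<close> is about a quarter of lg lg n. Then 2^(4b) is at most lg n, a block of 2^(3b)
  gaps has a code of at most 33 b 2^(3b) bits, far below lg n, so that tables over all codes take
  o(n) bits; losses of the form b n / 2^(b/2) are o(n) as well. These estimates need n beyond a
  fixed bound. A smaller multiset is a plain list that is scanned, and for words below a fixed size
  all answers are tabulated; beyond the information bound either costs at most a constant plus O(lg
  lg m), and the constant disappears into f.\<close>

datatype ex = Arg nat | Num nat | Bin binop ex ex | Ld ex | Ite ex ex ex

text \<open>A query has four arguments; reducing the index modulo 4 makes every \<open>Arg\<close>
  meaningful without a side condition. Likewise \<open>Num k\<close> is reduced just as the machine
  reduces constants.\<close>

fun ev :: "nat \<Rightarrow> (nat \<Rightarrow> nat) \<Rightarrow> nat list \<Rightarrow> ex \<Rightarrow> nat" where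
  "ev w me as (Arg k) = as ! (k mod 4)"
| "ev w me as (Num k) = k mod 2 ^ w"
| "ev w me as (Bin f a b) = eval_binop w f (ev w me as a) (ev w me as b)"
| "ev w me as (Ld a) = me (ev w me as a)"
| "ev w me as (Ite c a b) = (if ev w me as c = 0 then ev w me as b else ev w me as a)"

fun clen :: "ex \<Rightarrow> nat" where
  "clen (Arg k) = 1"
| "clen (Num k) = 1"
| "clen (Bin f a b) = clen a + clen b + 1"
| "clen (Ld a) = clen a + 1"
| "clen (Ite c a b) = clen c + clen a + clen b + 2"

text \<open>Registers from \<open>d\<close> on serve as a stack: the value of the expression is left
  in register \<open>d\<close> and nothing below \<open>d\<close> is touched. Jump targets are
  absolute, hence the start address \<open>p\<close>.\<close>

fun comp :: "nat \<Rightarrow> ex \<Rightarrow> nat \<Rightarrow> prog" where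
  "comp p (Arg k) d = [Move d (k mod 4)]"
| "comp p (Num k) d = [Const d k]"
| "comp p (Bin f a b) d = comp p a d @ comp (p + clen a) b (Suc d) @ [Op f d d (Suc d)]"
| "comp p (Ld a) d = comp p a d @ [Load d d]"
| "comp p (Ite c a b) d = comp p c d @ [JumpZero d (p + clen c + clen a + 2)] @
     comp (p + clen c + 1) a d @ [Jump (p + clen c + clen a + clen b + 2)] @
     comp (p + clen c + clen a + 2) b d"

lemma length_comp [simp]: "length (comp p e d) = clen e"
  by (induction e arbitrary: p d) auto

definition code_at :: "prog \<Rightarrow> nat \<Rightarrow> prog \<Rightarrow> bool" where
  "code_at P p cs \<longleftrightarrow> (\<forall>i<length cs. p + i < length P \<and> P ! (p + i) = cs ! i)"

lemma code_at_append [simp]: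
  "code_at P p (xs @ ys) \<longleftrightarrow> code_at P p xs \<and> code_at P (p + length xs) ys"
proof
  assume a: "code_at P p (xs @ ys)"
  have "p + i < length P \<and> P ! (p + i) = xs ! i" if "i < length xs" for i
    using a[unfolded code_at_def, rule_format, of i] that by (auto simp: nth_append)
  moreover have "p + length xs + i < length P \<and> P ! (p + length xs + i) = ys ! i" if "i < length ys" for i
    using a[unfolded code_at_def, rule_format, of "length xs + i"] that
    by (auto simp: nth_append add.assoc)
  ultimately show "code_at P p xs \<and> code_at P (p + length xs) ys"
    by (auto simp: code_at_def)
next
  assume a: "code_at P p xs \<and> code_at P (p + length xs) ys"
  have "p + i < length P \<and> P ! (p + i) = (xs @ ys) ! i" if i: "i < length (xs @ ys)" for i
  proof (cases "i < length xs")
    case True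
    then show ?thesis using a by (auto simp: code_at_def nth_append)
  next
    case False
    then have "i - length xs < length ys" using i by auto
    then show ?thesis
      using a[unfolded code_at_def, THEN conjunct2, rule_format, of "i - length xs"] False
      by (auto simp: nth_append)
  qed
  then show "code_at P p (xs @ ys)" by (auto simp: code_at_def)
qed

lemma step_code_at:
  assumes "code_at P p [i]" "i \<noteq> Halt" "pc c = p"
  shows "step w P c = exec w i c"
  using assms by (auto simp: step_def halted_def code_at_def)

text \<open>An upper bound on the time rather than its exact value, because the two branches of a
  conditional may differ in length.\<close>

definition runs :: "nat \<Rightarrow> prog \<Rightarrow> nat \<Rightarrow> config \<Rightarrow> config \<Rightarrow> bool" where
  "runs w P T c c' \<longleftrightarrow> (\<exists>t\<le>T. (step w P ^^ t) c = c')"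

lemma runs_trans: "runs w P T c c' \<Longrightarrow> runs w P T' c' c'' \<Longrightarrow> runs w P (T + T') c c''"
  unfolding runs_def
proof (elim exE conjE)
  fix t t' assume "t \<le> T" "t' \<le> T'" "(step w P ^^ t) c = c'" "(step w P ^^ t') c' = c''"
  then have "t' + t \<le> T + T' \<and> (step w P ^^ (t' + t)) c = c''" by (auto simp: funpow_add)
  then show "\<exists>t\<le>T + T'. (step w P ^^ t) c = c''" by blast
qed

lemma runs_step: "step w P c = c' \<Longrightarrow> runs w P 1 c c'"
  unfolding runs_def by (intro exI[of _ 1]) auto

lemma runs_mono: "runs w P T c c' \<Longrightarrow> T \<le> T' \<Longrightarrow> runs w P T' c c'"
  unfolding runs_def using le_trans by blast

text \<open>The stack discipline is the induction invariant: registers below \<open>d\<close> and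
  the memory stay as they are, and \<open>4 <= d\<close> protects the arguments. There are no
  backward jumps, so the length of the code also bounds the running time.\<close>

lemma comp_runs:
  assumes "code_at P p (comp p e d)" "4 \<le> d" "\<forall>k<4. R k = as ! k"
  shows "\<exists>R'. runs w P (clen e) \<lparr>pc = p, regs = R, mem = me\<rparr> \<lparr>pc = p + clen e, regs = R', mem = me\<rparr>
     \<and> R' d = ev w me as e \<and> (\<forall>r<d. R' r = R r)"
  using assms
proof (induction e arbitrary: p d R)
  case (Arg k)
  have k: "R (k mod 4) = as ! (k mod 4)" using Arg.prems by simp
  have "runs w P 1 \<lparr>pc = p, regs = R, mem = me\<rparr> \<lparr>pc = p + 1, regs = R(d := R (k mod 4)), mem = me\<rparr>"
    using Arg.prems(1) by (intro runs_step) (simp add: step_code_at[of P p "Move d (k mod 4)"])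
  then show ?case unfolding k by (intro exI[of _ "R(d := as ! (k mod 4))"]) (simp add: fun_upd_def)
next
  case (Num k)
  have "runs w P 1 \<lparr>pc = p, regs = R, mem = me\<rparr> \<lparr>pc = p + 1, regs = R(d := k mod 2 ^ w), mem = me\<rparr>"
    using Num by (intro runs_step) (simp add: step_code_at[of P p "Const d k"])
  then show ?case using Num.prems by (intro exI[of _ "R(d := k mod 2 ^ w)"]) (auto simp: fun_upd_def)
next
  case (Bin f a b)
  obtain R1 where R1: "runs w P (clen a) \<lparr>pc = p, regs = R, mem = me\<rparr> \<lparr>pc = p + clen a, regs = R1, mem = me\<rparr>"
    "R1 d = ev w me as a" "\<forall>r<d. R1 r = R r"
    using Bin.IH(1)[of p d R] Bin.prems by auto
  obtain R2 where R2: "runs w P (clen b) \<lparr>pc = p + clen a, regs = R1, mem = me\<rparr>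
      \<lparr>pc = p + clen a + clen b, regs = R2, mem = me\<rparr>"
    "R2 (Suc d) = ev w me as b" "\<forall>r<Suc d. R2 r = R1 r"
    using Bin.IH(2)[of "p + clen a" "Suc d" R1] Bin.prems R1 by auto
  have "runs w P 1 \<lparr>pc = p + clen a + clen b, regs = R2, mem = me\<rparr>
     \<lparr>pc = p + clen a + clen b + 1, regs = R2(d := eval_binop w f (R2 d) (R2 (Suc d))), mem = me\<rparr>"
    using Bin by (intro runs_step) (simp add: step_code_at[of P "p + clen a + clen b" "Op f d d (Suc d)"])
  from runs_trans[OF runs_trans[OF R1(1) R2(1)] this]
  show ?case using R1 R2
    by (intro exI[of _ "R2(d := eval_binop w f (R2 d) (R2 (Suc d)))"]) (auto simp: add.assoc fun_upd_def)
next
  case (Ld a)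
  obtain R1 where R1: "runs w P (clen a) \<lparr>pc = p, regs = R, mem = me\<rparr> \<lparr>pc = p + clen a, regs = R1, mem = me\<rparr>"
    "R1 d = ev w me as a" "\<forall>r<d. R1 r = R r"
    using Ld.IH(1)[of p d R] Ld.prems by auto
  have "runs w P 1 \<lparr>pc = p + clen a, regs = R1, mem = me\<rparr>
     \<lparr>pc = p + clen a + 1, regs = R1(d := me (R1 d)), mem = me\<rparr>"
    using Ld by (intro runs_step) (simp add: step_code_at[of P "p + clen a" "Load d d"])
  from runs_trans[OF R1(1) this] show ?case using R1
    by (intro exI[of _ "R1(d := me (R1 d))"]) (auto simp: add.assoc fun_upd_def)
next
  case (Ite c a b)
  have code: "code_at P p (comp p c d)" "code_at P (p + clen c) [JumpZero d (p + clen c + clen a + 2)]"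
    "code_at P (p + clen c + 1) (comp (p + clen c + 1) a d)"
    "code_at P (p + clen c + 1 + clen a) [Jump (p + clen c + clen a + clen b + 2)]"
    "code_at P (p + clen c + clen a + 2) (comp (p + clen c + clen a + 2) b d)"
    using Ite.prems(1) unfolding comp.simps code_at_append length_comp
    by (simp_all add: add.assoc add.commute add.left_commute del: code_at_append)
  obtain R1 where R1: "runs w P (clen c) \<lparr>pc = p, regs = R, mem = me\<rparr> \<lparr>pc = p + clen c, regs = R1, mem = me\<rparr>"
    "R1 d = ev w me as c" "\<forall>r<d. R1 r = R r"
    using Ite.IH(1)[OF code(1) Ite.prems(2,3)] by auto
  have j: "runs w P 1 \<lparr>pc = p + clen c, regs = R1, mem = me\<rparr>
     \<lparr>pc = if R1 d = 0 then p + clen c + clen a + 2 else p + clen c + 1, regs = R1, mem = me\<rparr>"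
    by (intro runs_step) (simp add: step_code_at[OF code(2)])
  note r1 = runs_trans[OF R1(1) j]
  show ?case
  proof (cases "R1 d = 0")
    case True
    obtain R2 where R2: "runs w P (clen b) \<lparr>pc = p + clen c + clen a + 2, regs = R1, mem = me\<rparr>
        \<lparr>pc = p + clen c + clen a + 2 + clen b, regs = R2, mem = me\<rparr>"
      "R2 d = ev w me as b" "\<forall>r<d. R2 r = R1 r"
      using Ite.IH(3)[OF code(5) Ite.prems(2), of R1] Ite.prems R1 by auto
    from runs_trans[OF r1[unfolded if_P[OF True]] R2(1)]
    show ?thesis using R1 R2 True
      by (intro exI[of _ R2]) (auto elim!: runs_mono simp: algebra_simps)
  next
    case False
    obtain R2 where R2: "runs w P (clen a) \<lparr>pc = p + clen c + 1, regs = R1, mem = me\<rparr>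
        \<lparr>pc = p + clen c + 1 + clen a, regs = R2, mem = me\<rparr>"
      "R2 d = ev w me as a" "\<forall>r<d. R2 r = R1 r"
      using Ite.IH(2)[OF code(3) Ite.prems(2), of R1] Ite.prems R1 by auto
    have "runs w P 1 \<lparr>pc = p + clen c + 1 + clen a, regs = R2, mem = me\<rparr>
       \<lparr>pc = p + clen c + clen a + clen b + 2, regs = R2, mem = me\<rparr>"
      by (intro runs_step) (simp add: step_code_at[OF code(4)])
    from runs_trans[OF runs_trans[OF r1[unfolded if_not_P[OF False]] R2(1)] this]
    show ?thesis using R1 R2 False
      by (intro exI[of _ R2]) (auto elim!: runs_mono simp: algebra_simps)
  qed
qed

text \<open>Register 4 is the first one that is not an argument. The program halts by running past
  its last instruction, the move into the answer register.\<close>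

definition prog_of :: "ex \<Rightarrow> prog" where
  "prog_of e = comp 0 e 4 @ [Move 0 4]"

lemma answers_prog_of:
  assumes "length as = 4" "int (ev w (pack w bs) as e) = v mod 2 ^ w"
  shows "answers w (prog_of e) (clen e + 1) bs as v"
proof -
  let ?P = "prog_of e" and ?R = "\<lambda>r. if r < length as then as ! r else 0"
  have c: "code_at ?P 0 (comp 0 e 4 @ [Move 0 4])"
    by (simp only: prog_of_def code_at_def) auto
  then have c1: "code_at ?P 0 (comp 0 e 4)" and c2: "code_at ?P (clen e) [Move 0 4]"
    unfolding code_at_append by simp_all
  obtain R' where R': "runs w ?P (clen e) \<lparr>pc = 0, regs = ?R, mem = pack w bs\<rparr>
      \<lparr>pc = clen e, regs = R', mem = pack w bs\<rparr>" "R' 4 = ev w (pack w bs) as e"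
    using comp_runs[OF c1, of ?R as w "pack w bs"] assms by auto
  have "runs w ?P 1 \<lparr>pc = clen e, regs = R', mem = pack w bs\<rparr>
     \<lparr>pc = clen e + 1, regs = R'(0 := R' 4), mem = pack w bs\<rparr>"
    by (intro runs_step) (simp add: step_code_at[OF c2])
  from runs_trans[OF R'(1) this] obtain t where t: "t \<le> clen e + 1"
    "(step w ?P ^^ t) (initial w bs as) = \<lparr>pc = clen e + 1, regs = R'(0 := R' 4), mem = pack w bs\<rparr>"
    unfolding runs_def initial_def by auto
  then show ?thesis unfolding answers_def
    by (intro exI[of _ t]) (simp add: Let_def R' assms halted_def prog_of_def)
qed

section \<open>Computable functions of the query state\<close>

text \<open>A state carries, besides what a query program sees, the encoded object as ghost data, so
  that queries can be specified as functions of it.\<close>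

record st = ww :: nat  bb :: "bool list"  aa :: "nat list"  mm :: nat  MM :: "nat multiset"

text \<open>One expression has to serve all states of \<open>V\<close>; this uniformity is what
  makes the program and its running time independent of the multiset. The function \<open>F\<close>
  itself may mention ghost data that the expression cannot see.\<close>

definition cmp :: "st set \<Rightarrow> (st \<Rightarrow> nat) \<Rightarrow> bool" where
  "cmp V F \<longleftrightarrow> (\<exists>e. \<forall>Z\<in>V. ev (ww Z) (pack (ww Z) (bb Z)) (aa Z) e = F Z)"

abbreviation cmpP :: "st set \<Rightarrow> (st \<Rightarrow> bool) \<Rightarrow> bool" where
  "cmpP V Q \<equiv> cmp V (\<lambda>Z. of_bool (Q Z))"

lemma cmp_cong: "cmp V F \<Longrightarrow> (\<And>Z. Z \<in> V \<Longrightarrow> F Z = G Z) \<Longrightarrow> cmp V G"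
  unfolding cmp_def by (metis (no_types, lifting))

lemma cmp_mono: "cmp V F \<Longrightarrow> V' \<subseteq> V \<Longrightarrow> cmp V' F"
  unfolding cmp_def by blast

lemma cmp_arg: "k < 4 \<Longrightarrow> cmp V (\<lambda>Z. aa Z ! k)"
  unfolding cmp_def by (intro exI[of _ "Arg k"]) auto

lemma cmp_const: "(\<And>Z. Z \<in> V \<Longrightarrow> k < 2 ^ ww Z) \<Longrightarrow> cmp V (\<lambda>Z. k)"
  unfolding cmp_def by (intro exI[of _ "Num k"]) auto

lemma cmp_0: "cmp V (\<lambda>Z. 0)" by (rule cmp_const) auto

lemma cmp_bin: "cmp V F \<Longrightarrow> cmp V G \<Longrightarrow> (\<And>Z. Z \<in> V \<Longrightarrow> eval_binop (ww Z) f (F Z) (G Z) = H Z) \<Longrightarrow> cmp V H"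
proof -
  assume a: "cmp V F" "cmp V G" "\<And>Z. Z \<in> V \<Longrightarrow> eval_binop (ww Z) f (F Z) (G Z) = H Z"
  then obtain e1 e2 where "\<forall>Z\<in>V. ev (ww Z) (pack (ww Z) (bb Z)) (aa Z) e1 = F Z"
    "\<forall>Z\<in>V. ev (ww Z) (pack (ww Z) (bb Z)) (aa Z) e2 = G Z"
    unfolding cmp_def by auto
  with a(3) show ?thesis unfolding cmp_def by (intro exI[of _ "Bin f e1 e2"]) auto
qed

lemma cmp_add: "cmp V F \<Longrightarrow> cmp V G \<Longrightarrow> (\<And>Z. Z \<in> V \<Longrightarrow> F Z + G Z < 2 ^ ww Z) \<Longrightarrow> cmp V (\<lambda>Z. F Z + G Z)"
  by (rule cmp_bin[where f = Add and F = F and G = G]) auto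

lemma cmp_sub:
  assumes "cmp V F" "cmp V G" "\<And>Z. Z \<in> V \<Longrightarrow> G Z \<le> F Z" "\<And>Z. Z \<in> V \<Longrightarrow> F Z < 2 ^ ww Z"
  shows "cmp V (\<lambda>Z. F Z - G Z)"
proof (rule cmp_bin[where f = Sub, OF assms(1,2)])
  fix Z assume "Z \<in> V"
  then have "G Z \<le> F Z" "F Z < 2 ^ ww Z" using assms by auto
  then have "(int (F Z) - int (G Z)) mod 2 ^ ww Z = int (F Z - G Z)"
    by (subst of_nat_diff, simp, intro mod_pos_pos_trivial)
       (auto intro: le_less_trans[of _ "int (F Z)"])
  then show "eval_binop (ww Z) Sub (F Z) (G Z) = F Z - G Z" by simp
qed

lemma cmp_mul: "cmp V F \<Longrightarrow> cmp V G \<Longrightarrow> (\<And>Z. Z \<in> V \<Longrightarrow> F Z * G Z < 2 ^ ww Z) \<Longrightarrow> cmp V (\<lambda>Z. F Z * G Z)"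
  by (rule cmp_bin[where f = Mul and F = F and G = G]) auto

lemma cmp_mulmod: "cmp V F \<Longrightarrow> cmp V G \<Longrightarrow> cmp V (\<lambda>Z. (F Z * G Z) mod 2 ^ ww Z)"
  by (rule cmp_bin[where f = Mul and F = F and G = G]) auto

lemma cmp_div: "cmp V F \<Longrightarrow> cmp V G \<Longrightarrow> cmp V (\<lambda>Z. F Z div G Z)"
  by (rule cmp_bin[where f = Div and F = F and G = G]) auto

lemma cmp_mod: "cmp V F \<Longrightarrow> cmp V G \<Longrightarrow> cmp V (\<lambda>Z. F Z mod G Z)"
  by (rule cmp_bin[where f = Mod and F = F and G = G]) auto

lemma cmp_shr: "cmp V F \<Longrightarrow> cmp V G \<Longrightarrow> cmp V (\<lambda>Z. F Z div 2 ^ G Z)"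
  by (rule cmp_bin[where f = Shr and F = F and G = G]) auto

lemma cmp_shlmod: "cmp V F \<Longrightarrow> cmp V G \<Longrightarrow> cmp V (\<lambda>Z. (F Z * 2 ^ G Z) mod 2 ^ ww Z)"
  by (rule cmp_bin[where f = Shl and F = F and G = G]) auto

lemma cmp_shl: "cmp V F \<Longrightarrow> cmp V G \<Longrightarrow> (\<And>Z. Z \<in> V \<Longrightarrow> F Z * 2 ^ G Z < 2 ^ ww Z) \<Longrightarrow> cmp V (\<lambda>Z. F Z * 2 ^ G Z)"
  by (rule cmp_bin[where f = Shl and F = F and G = G]) auto

lemma cmp_and: "cmp V F \<Longrightarrow> cmp V G \<Longrightarrow> cmp V (\<lambda>Z. Bit_Operations.and (F Z) (G Z))"
  by (rule cmp_bin[where f = And and F = F and G = G]) auto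

lemma cmp_less: "cmp V F \<Longrightarrow> cmp V G \<Longrightarrow> cmpP V (\<lambda>Z. F Z < G Z)"
  by (rule cmp_bin[where f = Less and F = F and G = G]) auto

lemma cmp_load: "cmp V F \<Longrightarrow> cmp V (\<lambda>Z. pack (ww Z) (bb Z) (F Z))"
proof -
  assume "cmp V F"
  then obtain e where "\<forall>Z\<in>V. ev (ww Z) (pack (ww Z) (bb Z)) (aa Z) e = F Z"
    unfolding cmp_def by auto
  then show ?thesis unfolding cmp_def by (intro exI[of _ "Ld e"]) auto
qed

text \<open>Each branch has to be computable only on the states that reach it, so range conditions
  may use the test. With equal branches the rule becomes a case distinction: one function, computed
  in two ways on two parts of \<open>V\<close>.\<close>

lemma cmp_if:
  assumes "cmpP V Q" "cmp (V \<inter> {Z. Q Z}) F" "cmp (V \<inter> {Z. \<not> Q Z}) G"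
  shows "cmp V (\<lambda>Z. if Q Z then F Z else G Z)"
proof -
  from assms obtain c a b where
    c: "\<forall>Z\<in>V. ev (ww Z) (pack (ww Z) (bb Z)) (aa Z) c = of_bool (Q Z)" and
    a: "\<forall>Z\<in>V \<inter> {Z. Q Z}. ev (ww Z) (pack (ww Z) (bb Z)) (aa Z) a = F Z" and
    b: "\<forall>Z\<in>V \<inter> {Z. \<not> Q Z}. ev (ww Z) (pack (ww Z) (bb Z)) (aa Z) b = G Z"
    unfolding cmp_def by auto
  show ?thesis unfolding cmp_def by (rule exI[of _ "Ite c a b"]) (use a b c in auto)
qed

definition pos :: "st set \<Rightarrow> bool" where "pos V \<longleftrightarrow> (\<forall>Z\<in>V. 0 < ww Z)"

lemma cmp_1: "pos V \<Longrightarrow> cmp V (\<lambda>Z. 1)" by (rule cmp_const) (auto simp: pos_def one_less_power simp del: One_nat_def)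

lemma cmp_not: "pos V \<Longrightarrow> cmpP V Q \<Longrightarrow> cmpP V (\<lambda>Z. \<not> Q Z)"
  by (rule cmp_cong[OF cmp_less[OF _ cmp_1]]) auto

lemma cmp_le: "pos V \<Longrightarrow> cmp V F \<Longrightarrow> cmp V G \<Longrightarrow> cmpP V (\<lambda>Z. F Z \<le> G Z)"
  by (rule cmp_cong[OF cmp_not[OF _ cmp_less, of V G F]]) auto

lemma cmp_conj: "cmpP V Q \<Longrightarrow> cmpP (V \<inter> {Z. Q Z}) R \<Longrightarrow> cmpP V (\<lambda>Z. Q Z \<and> R Z)"
  by (rule cmp_cong[OF cmp_if[OF _ _ cmp_0]]) auto

lemma cmp_eq: "pos V \<Longrightarrow> cmp V F \<Longrightarrow> cmp V G \<Longrightarrow> cmpP V (\<lambda>Z. F Z = G Z)"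
  by (rule cmp_cong[OF cmp_conj[OF cmp_le cmp_mono[OF cmp_le]], of V F G V G F]) auto

lemma cmp_disj: "pos V \<Longrightarrow> cmpP V Q \<Longrightarrow> cmpP (V \<inter> {Z. \<not> Q Z}) R \<Longrightarrow> cmpP V (\<lambda>Z. Q Z \<or> R Z)"
  by (rule cmp_cong[OF cmp_if[OF _ cmp_1]]) (auto simp: pos_def)

lemma cmp_min: "pos V \<Longrightarrow> cmp V F \<Longrightarrow> cmp V G \<Longrightarrow> cmp V (\<lambda>Z. min (F Z) (G Z))"
  by (rule cmp_cong[OF cmp_if[OF cmp_le, of V F G F G]]) (auto intro: cmp_mono)

lemma cmp_sub0:
  assumes "pos V" "cmp V F" "cmp V G" "\<And>Z. Z \<in> V \<Longrightarrow> F Z < 2 ^ ww Z"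
  shows "cmp V (\<lambda>Z. F Z - G Z)"
  by (rule cmp_cong[OF cmp_if[OF cmp_le, of V G F "\<lambda>Z. F Z - G Z" "\<lambda>Z. 0"]])
     (use assms in \<open>auto intro!: cmp_sub cmp_0 intro: cmp_mono\<close>)

section \<open>Bit fields\<close>

definition bv :: "bool list \<Rightarrow> nat" where "bv bs = horner_sum of_bool 2 bs"

definition get :: "bool list \<Rightarrow> nat \<Rightarrow> nat \<Rightarrow> nat" where "get bs A l = bv (take l (drop A bs))"

lemma bit_bv: "bit (bv bs) i \<longleftrightarrow> i < length bs \<and> bs ! i"
  by (simp add: bv_def bit_horner_sum_bit_iff)

lemma bit_get: "bit (get bs A l) i \<longleftrightarrow> i < l \<and> A + i < length bs \<and> bs ! (A + i)"
  by (auto simp: get_def bit_bv)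

lemma pack_get: "pack w bs a = get bs (w * a) w"
  by (simp add: pack_def get_def bv_def)

lemma bv_less: "bv bs < 2 ^ length bs"
  unfolding bv_def using horner_sum_of_bool_2_less[of bs, where ?'a = nat] by simp

lemma get_less: "get bs A l < 2 ^ l"
proof -
  have "get bs A l < 2 ^ length (take l (drop A bs))" unfolding get_def by (rule bv_less)
  also have "\<dots> \<le> 2 ^ l" by (rule power_increasing) auto
  finally show ?thesis .
qed

text \<open>A field of at most \<open>w\<close> bits meets at most two consecutive words. Its two
  pieces, shifted into place, have no common bit, so their sum is their disjunction; shifting up and
  down by \<open>w - l\<close> cuts off the excess bits.\<close>

lemma get_two_words:
  assumes "r < w" "l \<le> w"
  shows "get bs (w * q + r) l =
    (((get bs (w * q) w div 2 ^ r + (get bs (w * (q + 1)) w * 2 ^ (w - r)) mod 2 ^ w) * 2 ^ (w - l)) mod 2 ^ w) div 2 ^ (w - l)"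
proof -
  let ?x = "drop_bit r (get bs (w * q) w)" and ?y = "take_bit w (push_bit (w - r) (get bs (w * (q + 1)) w))"
  have "?x + ?y = or ?x ?y"
  proof (rule disjunctive_add)
    fix n show "\<not> bit ?x n \<or> \<not> bit ?y n"
      by (auto simp: bit_drop_bit_eq bit_get bit_take_bit_iff bit_push_bit_iff)
  qed
  then have "drop_bit (w - l) (take_bit w (push_bit (w - l) (?x + ?y))) = get bs (w * q + r) l"
    using assms
    by (intro bit_eqI)
      (auto simp: bit_drop_bit_eq bit_get bit_take_bit_iff bit_push_bit_iff bit_or_iff add.assoc algebra_simps)
  then show ?thesis by (simp add: drop_bit_eq_div take_bit_eq_mod push_bit_eq_mult)
qed

text \<open>From \<open>8 <= w\<close> on, \<open>8 * w < 2 ^ w\<close>. Hence small multiples of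
  bit lengths and constants up to 64 fit into a word.\<close>

definition wf :: "st set \<Rightarrow> bool" where
  "wf V \<longleftrightarrow> (\<forall>Z\<in>V. 8 \<le> ww Z \<and> length (aa Z) = 4 \<and> aa Z ! 3 = ww Z)"

lemma wf_pos: "wf V \<Longrightarrow> pos V" by (auto simp: wf_def pos_def)
lemma wf_sub: "wf V \<Longrightarrow> V' \<subseteq> V \<Longrightarrow> wf V'" by (auto simp: wf_def)
lemma wf_inter: "wf V \<Longrightarrow> wf (V \<inter> X)" by (auto simp: wf_def)
lemma pos_inter: "pos V \<Longrightarrow> pos (V \<inter> X)" by (auto simp: pos_def)
lemma cmp_inter: "cmp V F \<Longrightarrow> cmp (V \<inter> X) F" by (rule cmp_mono) auto

lemma self_less_pow: "(w::nat) < 2 ^ w" by (rule less_exp)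

lemma cmp_ww: "(\<And>Z. Z \<in> V \<Longrightarrow> aa Z ! 3 = ww Z) \<Longrightarrow> cmp V ww"
  by (rule cmp_cong[OF cmp_arg[of 3]]) auto

lemma cmp_wword:
  assumes "pos V" and w: "\<And>Z. Z \<in> V \<Longrightarrow> aa Z ! 3 = ww Z"
    and q: "cmp V q" and r: "cmp V r" and l: "cmp V l"
    and b: "\<And>Z. Z \<in> V \<Longrightarrow> r Z < ww Z \<and> l Z \<le> ww Z \<and> (r Z = 0 \<or> q Z + 1 < 2 ^ ww Z)"
  shows "cmp V (\<lambda>Z. get (bb Z) (ww Z * q Z + r Z) (l Z))"
proof -
  note W = cmp_ww[OF w]
  \<comment> \<open>A field starting at a word boundary lies in one word. The test avoids forming
    \<open>q + 1\<close>, which need not be a word when \<open>q\<close> addresses the last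
    cell.\<close>
  let ?H = "\<lambda>Z. if r Z = 0 then 0 else (get (bb Z) (ww Z * (q Z + 1)) (ww Z) * 2 ^ (ww Z - r Z)) mod 2 ^ ww Z"
  let ?X = "\<lambda>Z. get (bb Z) (ww Z * q Z) (ww Z) div 2 ^ r Z"
  have H: "cmp V ?H"
  proof (rule cmp_if)
    show "cmpP V (\<lambda>Z. r Z = 0)" by (intro cmp_eq cmp_0 r assms(1))
    let ?V = "V \<inter> {Z. r Z \<noteq> 0}"
    have q1: "cmp ?V (\<lambda>Z. q Z + 1)"
      by (rule cmp_add[OF cmp_inter[OF q] cmp_1[OF pos_inter[OF assms(1)]]]) (use b in fastforce)
    have d: "cmp ?V (\<lambda>Z. ww Z - r Z)"
      by (rule cmp_sub[OF cmp_inter[OF W] cmp_inter[OF r]]) (use b self_less_pow in \<open>auto intro: less_imp_le\<close>)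
    show "cmp ?V (\<lambda>Z. (get (bb Z) (ww Z * (q Z + 1)) (ww Z) * 2 ^ (ww Z - r Z)) mod 2 ^ ww Z)"
      by (rule cmp_shlmod[OF cmp_load[OF q1, unfolded pack_get] d])
  qed (rule cmp_0)
  have X: "cmp V ?X" by (intro cmp_shr cmp_load[unfolded pack_get] q r)
  have Heq: "?H Z = (get (bb Z) (ww Z * (q Z + 1)) (ww Z) * 2 ^ (ww Z - r Z)) mod 2 ^ ww Z" for Z by simp
  \<comment> \<open>No overflow: the part from the lower word is below \<open>2 ^ (w - r)\<close>,
    and the other part is a multiple of \<open>2 ^ (w - r)\<close> below
    \<open>2 ^ w\<close>.\<close>
  have lt: "?X Z + ?H Z < 2 ^ ww Z" if "Z \<in> V" for Z
  proof (cases "r Z = 0")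
    case True then show ?thesis using get_less by simp
  next
    case False
    let ?w = "ww Z" and ?r = "r Z"
    have rw: "?r < ?w" using b that by auto
    then have e: "(2::nat) ^ ?w = 2 ^ ?r * 2 ^ (?w - ?r)" by (simp flip: power_add)
    have 1: "?X Z < 2 ^ (?w - ?r)"
      using get_less[of "bb Z" "?w * q Z" ?w] unfolding e by (simp add: less_mult_imp_div_less mult.commute)
    let ?g = "get (bb Z) (?w * (q Z + 1)) ?w"
    have "(?g * 2 ^ (?w - ?r)) mod 2 ^ ?w = (?g mod 2 ^ ?r) * 2 ^ (?w - ?r)"
      unfolding e by (simp add: mult_mod_left)
    also have "\<dots> \<le> (2 ^ ?r - 1) * 2 ^ (?w - ?r)"
      by (intro mult_right_mono) (auto simp: Suc_leI less_Suc_eq_le[symmetric])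
    also have "\<dots> = 2 ^ ?w - 2 ^ (?w - ?r)" unfolding e by (simp add: algebra_simps)
    finally have "?H Z \<le> 2 ^ ?w - 2 ^ (?w - ?r)" unfolding Heq .
    moreover have "(2::nat) ^ (?w - ?r) \<le> 2 ^ ?w" by (rule power_increasing) auto
    ultimately show ?thesis using 1 by linarith
  qed
  have d: "cmp V (\<lambda>Z. ww Z - l Z)" by (rule cmp_sub[OF W l]) (use b self_less_pow in auto)
  have "cmp V (\<lambda>Z. (((?X Z + ?H Z) * 2 ^ (ww Z - l Z)) mod 2 ^ ww Z) div 2 ^ (ww Z - l Z))"
    by (intro cmp_shr cmp_shlmod cmp_add[OF X H] d lt)
  then show ?thesis
    by (rule cmp_cong) (use b get_two_words in \<open>auto simp only: Heq\<close>)
qed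

lemma cmp_get:
  assumes V: "pos V" "\<And>Z. Z \<in> V \<Longrightarrow> aa Z ! 3 = ww Z" and "cmp V A" "cmp V l"
    and b: "\<And>Z. Z \<in> V \<Longrightarrow> l Z \<le> ww Z \<and> A Z < 2 ^ ww Z"
  shows "cmp V (\<lambda>Z. get (bb Z) (A Z) (l Z))"
proof -
  note W = cmp_ww[OF V(2)]
  have "cmp V (\<lambda>Z. get (bb Z) (ww Z * (A Z div ww Z) + A Z mod ww Z) (l Z))"
  proof (rule cmp_wword[OF V])
    show "cmp V (\<lambda>Z. A Z div ww Z)" "cmp V (\<lambda>Z. A Z mod ww Z)" "cmp V l" using assms W by (auto intro: cmp_div cmp_mod)
    fix Z assume s: "Z \<in> V"
    have "A Z div ww Z + 1 < 2 ^ ww Z" if "A Z mod ww Z \<noteq> 0"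
    proof -
      have "ww Z \<noteq> 1" using that by auto
      then have w2: "2 \<le> ww Z" using V(1) s by (auto simp: pos_def)
      then have "A Z div ww Z \<le> A Z div 2" by (intro div_le_mono2) auto
      moreover have "(2::nat)^2 \<le> 2 ^ ww Z" using w2 by (intro power_increasing) auto
      moreover have "2 * (A Z div 2) \<le> A Z" by simp
      ultimately show ?thesis using b[OF s] unfolding power2_eq_square by linarith
    qed
    then show "A Z mod ww Z < ww Z \<and> l Z \<le> ww Z \<and> (A Z mod ww Z = 0 \<or> A Z div ww Z + 1 < 2 ^ ww Z)"
      using b[OF s] V(1) s by (auto simp: pos_def)
  qed
  then show ?thesis by simp
qed

text \<open>The bit address \<open>4 * A\<close> may exceed a word. So the word index and the offset
  are formed from \<open>A div w\<close> and \<open>A mod w\<close>; since \<open>w >= 8\<close>,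
  the quotient leaves room for the factor 4.\<close>

lemma cmp_get4:
  assumes V: "wf V" and "cmp V A" "cmp V l"
    and b: "\<And>Z. Z \<in> V \<Longrightarrow> l Z \<le> ww Z \<and> A Z < 2 ^ ww Z"
  shows "cmp V (\<lambda>Z. get (bb Z) (4 * A Z) (l Z))"
proof -
  have p: "pos V" using V by (rule wf_pos)
  have w: "\<And>Z. Z \<in> V \<Longrightarrow> aa Z ! 3 = ww Z" using V by (auto simp: wf_def)
  note W = cmp_ww[OF w]
  have w8: "\<And>Z. Z \<in> V \<Longrightarrow> 8 \<le> ww Z" using V by (auto simp: wf_def)
  have big: "8 * n < 2 ^ n" if "8 \<le> n" for n :: nat
    using that by (induction n rule: dec_induct) auto
  let ?q = "\<lambda>Z. A Z div ww Z * 4 + (A Z mod ww Z * 4) div ww Z" and ?r = "\<lambda>Z. (A Z mod ww Z * 4) mod ww Z"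
  have bq: "?q Z + 1 < 2 ^ ww Z" "A Z div ww Z * 4 < 2 ^ ww Z" "A Z mod ww Z * 4 < 2 ^ ww Z" if s: "Z \<in> V" for Z
  proof -
    have m: "A Z mod ww Z < ww Z" using w8[OF s] by auto
    have "A Z div ww Z \<le> A Z div 8" using w8[OF s] by (intro div_le_mono2) auto
    moreover have "(A Z mod ww Z * 4) div ww Z < 4" using m w8[OF s] by (simp add: less_mult_imp_div_less mult.commute)
    moreover have "(2::nat)^8 \<le> 2 ^ ww Z" using w8[OF s] by (intro power_increasing) auto
    moreover have "A Z < 2 ^ ww Z" using b[OF s] by auto
    ultimately show "?q Z + 1 < 2 ^ ww Z" "A Z div ww Z * 4 < 2 ^ ww Z" by simp_all
    show "A Z mod ww Z * 4 < 2 ^ ww Z" using m big[OF w8[OF s]] by linarith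
  qed
  have c4: "cmp V (\<lambda>Z. 4)"
  proof (rule cmp_const)
    fix Z assume "Z \<in> V"
    then have "(2::nat)^8 \<le> 2 ^ ww Z" using w8 by (intro power_increasing) auto
    then show "(4::nat) < 2 ^ ww Z" by simp
  qed
  have "cmp V (\<lambda>Z. get (bb Z) (ww Z * ?q Z + ?r Z) (l Z))"
  proof (rule cmp_wword[OF p w])
    show "cmp V ?q" "cmp V ?r"
      by (auto intro!: cmp_add cmp_mul cmp_div cmp_mod assms W c4 bq add_lessD1[OF bq(1)])
    show "\<And>Z. Z \<in> V \<Longrightarrow> ?r Z < ww Z \<and> l Z \<le> ww Z \<and> (?r Z = 0 \<or> ?q Z + 1 < 2 ^ ww Z)"
      using b bq(1) w8 by (smt (verit) less_le_trans mod_less_divisor zero_less_numeral)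
  qed (auto intro: assms)
  moreover have "ww Z * ?q Z + ?r Z = 4 * A Z" for Z
  proof -
    have "ww Z * ?q Z + ?r Z = 4 * (ww Z * (A Z div ww Z)) + (ww Z * ((A Z mod ww Z * 4) div ww Z) + ?r Z)"
      by (simp add: algebra_simps)
    also have "ww Z * ((A Z mod ww Z * 4) div ww Z) + ?r Z = A Z mod ww Z * 4"
      by (rule mult_div_mod_eq)
    also have "4 * (ww Z * (A Z div ww Z)) + A Z mod ww Z * 4 = 4 * (ww Z * (A Z div ww Z) + A Z mod ww Z)"
      by (simp only: distrib_left mult.commute)
    also have "\<dots> = 4 * A Z" by (simp only: mult_div_mod_eq)
    finally show ?thesis .
  qed
  ultimately show ?thesis by simp
qed

section \<open>Bit lengths, and strings composed of fixed-width fields\<close>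

definition bits :: "nat \<Rightarrow> nat" where "bits n = (LEAST k. n < 2 ^ k)"

lemma less_bits: "n < 2 ^ bits n"
  unfolding bits_def by (rule LeastI[of _ n]) (rule less_exp)

lemma bits_le: "n < 2 ^ k \<Longrightarrow> bits n \<le> k"
  unfolding bits_def by (rule Least_le)

lemma bits_ge: "0 < n \<Longrightarrow> 2 ^ (bits n - 1) \<le> n"
proof (rule ccontr)
  assume "0 < n" "\<not> 2 ^ (bits n - 1) \<le> n"
  then have "bits n \<le> bits n - 1" by (intro bits_le) auto
  then have "bits n = 0" by auto
  with less_bits[of n] \<open>0 < n\<close> show False by auto
qed

lemma bits_0 [simp]: "bits 0 = 0" using bits_le[of 0 0] by auto

lemma bits_pos: "0 < n \<Longrightarrow> 0 < bits n"
  using less_bits[of n] by (cases "bits n") auto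

lemma bits_mono: "m \<le> n \<Longrightarrow> bits m \<le> bits n"
  by (rule bits_le) (use less_bits[of n] in linarith)

lemma bits_le_self: "bits n \<le> n"
  by (rule bits_le) (rule less_exp)

text \<open>With \<open>u = n div 2 ^ p\<close> this is \<open>u + 1 <= 2 ^ u\<close>. It replaces
  the concavity of the logarithm: being linear in \<open>n\<close> with a free \<open>p\<close>, it
  can be summed over blocks whose values have a bounded total.\<close>

lemma bits_add_le: "bits n \<le> p + n div 2 ^ p"
proof (rule bits_le)
  let ?u = "n div 2 ^ p"
  have "n < (?u + 1) * 2 ^ p" using dividend_less_times_div[of "2 ^ p" n] by (simp add: algebra_simps)
  also have "?u + 1 \<le> 2 ^ ?u" using less_exp[of ?u] by (simp only: Suc_eq_plus1[symmetric] Suc_le_eq)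
  finally show "n < 2 ^ (p + ?u)" by (simp add: power_add mult.commute)
qed

definition tobits :: "nat \<Rightarrow> nat \<Rightarrow> bool list" where "tobits l v = map (bit v) [0..<l]"

lemma length_tobits [simp]: "length (tobits l v) = l" by (simp add: tobits_def)

lemma bv_tobits: "bv (tobits l v) = v mod 2 ^ l"
  by (simp add: bv_def tobits_def horner_sum_bit_eq_take_bit take_bit_eq_mod)

definition sub :: "bool list \<Rightarrow> nat \<Rightarrow> bool list \<Rightarrow> bool" where
  "sub bs A xs \<longleftrightarrow> take (length xs) (drop A bs) = xs"

lemma sub_append: "sub bs A (xs @ ys) \<longleftrightarrow> sub bs A xs \<and> sub bs (A + length xs) ys"
proof -
  have "take (length xs + length ys) (drop A bs)
     = take (length xs) (drop A bs) @ take (length ys) (drop (A + length xs) bs)"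
    by (simp add: take_add add.commute)
  then have "sub bs A (xs @ ys) \<longleftrightarrow>
      take (length xs) (drop A bs) @ take (length ys) (drop (A + length xs) bs) = xs @ ys"
    by (simp add: sub_def)
  also have "\<dots> \<longleftrightarrow> sub bs A xs \<and> sub bs (A + length xs) ys"
  proof
    assume a: "take (length xs) (drop A bs) @ take (length ys) (drop (A + length xs) bs) = xs @ ys"
    then have "length (take (length xs) (drop A bs) @ take (length ys) (drop (A + length xs) bs)) = length xs + length ys"
      by simp
    then have "length (take (length xs) (drop A bs)) = length xs" by auto
    with a show "sub bs A xs \<and> sub bs (A + length xs) ys" by (simp add: sub_def)
  qed (simp add: sub_def)
  finally show ?thesis .
qed

lemma sub_get: "sub bs A (tobits l v) \<Longrightarrow> get bs A l = v mod 2 ^ l"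
  by (simp add: sub_def get_def bv_tobits)

lemma sub_prefix: "sub (xs @ ys @ zs) (length xs) ys" by (simp add: sub_def)

definition arr :: "nat \<Rightarrow> nat list \<Rightarrow> bool list" where "arr l vs = concat (map (tobits l) vs)"

lemma length_arr [simp]: "length (arr l vs) = length vs * l"
  by (induction vs) (auto simp: arr_def)

lemma arr_Cons: "arr l (v # vs) = tobits l v @ arr l vs" by (simp add: arr_def)

lemma sub_arr:
  assumes "sub bs A (arr l vs)" "i < length vs"
  shows "get bs (A + i * l) l = vs ! i mod 2 ^ l"
  using assms
proof (induction vs arbitrary: A i)
  case (Cons v vs)
  then have s: "sub bs A (tobits l v)" "sub bs (A + l) (arr l vs)" by (auto simp: arr_Cons sub_append)
  show ?case
  proof (cases i)
    case 0 then show ?thesis using sub_get[OF s(1)] by simp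
  next
    case (Suc j)
    then show ?thesis using Cons.IH[OF s(2), of j] Cons.prems by (simp add: algebra_simps)
  qed
qed simp

text \<open>Field widths depend on \<open>n\<close> and may exceed \<open>w\<close>. A value that
  fits into a word is found in the lower \<open>w\<close> bits of its field.\<close>

lemma get_min: "get bs A l < 2 ^ w \<Longrightarrow> get bs A (min l w) = get bs A l"
proof (intro bit_eqI)
  fix i assume a: "get bs A l < 2 ^ w"
  have "\<not> bit (get bs A l) i" if "w \<le> i"
    using a that by (metis bit_take_bit_iff leD take_bit_nat_eq_self_iff)
  then show "bit (get bs A (min l w)) i = bit (get bs A l) i"
    by (auto simp: bit_get) (meson leI)
qed

lemma wf_aa: "wf V \<Longrightarrow> Z \<in> V \<Longrightarrow> aa Z ! 3 = ww Z" by (auto simp: wf_def)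

lemma cmp_get_min:
  assumes "wf V" "cmp V A" "cmp V l" "\<And>Z. Z \<in> V \<Longrightarrow> A Z < 2 ^ ww Z \<and> get (bb Z) (A Z) (l Z) < 2 ^ ww Z"
  shows "cmp V (\<lambda>Z. get (bb Z) (A Z) (l Z))"
  by (rule cmp_cong[OF cmp_get[where A = A and l = "\<lambda>Z. min (l Z) (ww Z)"]])
     (use assms wf_pos wf_aa cmp_ww get_min in \<open>auto intro!: cmp_min\<close>)

lemma cmp_field:
  assumes "wf V" "cmp V A" "cmp V l"
    "\<And>Z. Z \<in> V \<Longrightarrow> sub (bb Z) (A Z) (tobits (l Z) (v Z)) \<and> v Z < 2 ^ l Z \<and> v Z < 2 ^ ww Z \<and> A Z < 2 ^ ww Z"
  shows "cmp V v"
  by (rule cmp_cong[OF cmp_get_min[OF assms(1-3)]]) (use assms(4) sub_get in \<open>fastforce+\<close>)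

lemma cmp_arr:
  assumes "wf V" "cmp V A" "cmp V l" "cmp V i"
    "\<And>Z. Z \<in> V \<Longrightarrow> sub (bb Z) (A Z) (arr (l Z) (vs Z)) \<and> i Z < length (vs Z) \<and> vs Z ! i Z < 2 ^ l Z
       \<and> vs Z ! i Z < 2 ^ ww Z \<and> A Z + i Z * l Z < 2 ^ ww Z"
  shows "cmp V (\<lambda>Z. vs Z ! i Z)"
proof -
  have g: "get (bb Z) (A Z + i Z * l Z) (l Z) = vs Z ! i Z" if "Z \<in> V" for Z
    using sub_arr[of "bb Z" "A Z" "l Z" "vs Z" "i Z"] assms(5)[OF that] by simp
  have c: "cmp V (\<lambda>Z. A Z + i Z * l Z)"
    by (intro cmp_add cmp_mul assms) (use assms(5) in \<open>auto dest: add_lessD1 intro: le_less_trans[OF le_add2]\<close>)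
  show ?thesis
    by (rule cmp_cong[OF cmp_get_min[OF assms(1) c assms(3)]]) (use assms(5) g in auto)
qed

definition cat :: "(nat \<Rightarrow> bool list) \<Rightarrow> nat \<Rightarrow> bool list" where "cat f n = concat (map f [0..<n])"

lemma cat_Suc: "cat f (Suc n) = cat f n @ f n" by (simp add: cat_def)
lemma cat_0 [simp]: "cat f 0 = []" by (simp add: cat_def)

lemma length_cat: "length (cat f n) = (\<Sum>v<n. length (f v))"
  by (induction n) (auto simp: cat_Suc)

lemma sub_cat: "sub bs A (cat f n) \<Longrightarrow> v < n \<Longrightarrow> sub bs (A + (\<Sum>u<v. length (f u))) (f v)"
proof (induction n)
  case (Suc n)
  then show ?case by (cases "v = n") (auto simp: cat_Suc sub_append length_cat)
qed simp

definition padto :: "nat \<Rightarrow> bool list \<Rightarrow> bool list" where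
  "padto n xs = xs @ replicate (n - length xs) False"

lemma length_padto: "length xs \<le> n \<Longrightarrow> length (padto n xs) = n" by (simp add: padto_def)

lemma sub_padto: "sub bs A (padto n xs) \<Longrightarrow> sub bs A xs" by (simp add: padto_def sub_append)

section \<open>Searching short lists\<close>

text \<open>The index of the first occurrence, or the length if there is none. One number thus
  carries membership and, in a sorted list, the rank.\<close>

definition fo :: "nat list \<Rightarrow> nat \<Rightarrow> nat" where "fo xs x = length (takeWhile (\<lambda>y. y \<noteq> x) xs)"

lemma fo_le: "fo xs x \<le> length xs" by (simp add: fo_def length_takeWhile_le)

lemma fo_less_iff: "fo xs x < length xs \<longleftrightarrow> x \<in> set xs"
  by (induction xs) (auto simp: fo_def)

lemma fo_nth: "x \<in> set xs \<Longrightarrow> xs ! fo xs x = x"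
  using nth_length_takeWhile[of "\<lambda>y. y \<noteq> x" xs] fo_less_iff[of xs x] by (simp add: fo_def)

lemma fo_unique: "i < length xs \<Longrightarrow> xs ! i = x \<Longrightarrow> (\<And>j. j < i \<Longrightarrow> xs ! j \<noteq> x) \<Longrightarrow> fo xs x = i"
  unfolding fo_def by (rule takeWhile_eq_take_P_nth[of i xs, THEN arg_cong[of _ _ length], THEN trans]) auto

text \<open>Expressions have no loops, so the search is unrolled for the constant bound
  \<open>K\<close>: the induction goes down from \<open>K\<close>, each step adding one comparison
  in front of the search in the remaining suffix.\<close>

lemma cmp_scan:
  assumes "wf V" "cmp V X" "cmp V (\<lambda>Z. length (vs Z))" "\<And>Z. Z \<in> V \<Longrightarrow> length (vs Z) \<le> K \<and> K < 2 ^ ww Z"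
    "\<And>i. i < K \<Longrightarrow> cmp (V \<inter> {Z. i < length (vs Z)}) (\<lambda>Z. vs Z ! i)"
  shows "cmp V (\<lambda>Z. fo (vs Z) (X Z))"
proof -
  have "cmp (V \<inter> {Z. j \<le> length (vs Z)}) (\<lambda>Z. j + fo (drop j (vs Z)) (X Z))" if "j \<le> K" for j
    using that
  proof (induction rule: inc_induct)
    case base
    show ?case by (rule cmp_cong[OF cmp_inter[OF assms(3)]]) (use assms(4) in \<open>fastforce simp: fo_def\<close>)
  next
    case (step j)
    let ?V = "V \<inter> {Z. j \<le> length (vs Z)}"
    have j: "cmp ?V (\<lambda>Z. j)" by (rule cmp_const) (use assms(4) step(2) order_less_trans in blast)
    have "cmp ?V (\<lambda>Z. if j < length (vs Z) then (if vs Z ! j = X Z then j else Suc j + fo (drop (Suc j) (vs Z)) (X Z)) else length (vs Z))"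
    proof (intro cmp_if cmp_less cmp_eq)
      show "cmp (?V \<inter> {Z. j < length (vs Z)}) (\<lambda>Z. vs Z ! j)"
        by (rule cmp_mono[OF assms(5)]) (use step in auto)
      show "cmp (?V \<inter> {Z. j < length (vs Z)} \<inter> {Z. vs Z ! j \<noteq> X Z}) (\<lambda>Z. Suc j + fo (drop (Suc j) (vs Z)) (X Z))"
        by (rule cmp_mono[OF step.IH]) auto
      show "cmp ?V (\<lambda>Z. j)" "cmp (?V \<inter> {Z. j < length (vs Z)} \<inter> {Z. vs Z ! j = X Z}) (\<lambda>Z. j)"
        by (intro cmp_inter j)+
      show "cmp ?V (\<lambda>Z. length (vs Z))" "cmp (?V \<inter> {Z. \<not> j < length (vs Z)}) (\<lambda>Z. length (vs Z))"
        "cmp (?V \<inter> {Z. j < length (vs Z)}) X" "pos (?V \<inter> {Z. j < length (vs Z)})"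
        by (intro cmp_inter pos_inter assms wf_pos)+
    qed
    then show ?case
      by (rule cmp_cong) (auto simp: fo_def Cons_nth_drop_Suc[symmetric])
  qed
  from this[of 0] show ?thesis by simp
qed

section \<open>Monotone arrays\<close>

text \<open>Blocks of \<open>g\<close> consecutive values are stored relative to their first value, with just as many
  bits as the block needs; the first value, the width and the position of each block are stored in
  full.\<close>

definition ma_wd :: "nat \<Rightarrow> (nat \<Rightarrow> nat) \<Rightarrow> nat \<Rightarrow> nat" where
  "ma_wd g A J = bits (A ((J + 1) * g) - A (J * g))"

definition ma_body :: "nat \<Rightarrow> (nat \<Rightarrow> nat) \<Rightarrow> nat \<Rightarrow> bool list" where
  "ma_body g A J = arr (ma_wd g A J) (map (\<lambda>k. A (J * g + k) - A (J * g)) [0..<g])"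

definition ma_addr :: "nat \<Rightarrow> (nat \<Rightarrow> nat) \<Rightarrow> nat \<Rightarrow> nat" where
  "ma_addr g A J = (\<Sum>u<J. length (ma_body g A u))"

definition ma :: "nat \<Rightarrow> nat \<Rightarrow> nat \<Rightarrow> (nat \<Rightarrow> nat) \<Rightarrow> bool list" where
  "ma W g N A = arr W (map (\<lambda>J. A (J * g)) [0..<N]) @ arr W (map (ma_wd g A) [0..<N]) @
     arr W (map (ma_addr g A) [0..<N]) @ cat (ma_body g A) N"

text \<open>Each block width is at most \<open>p\<close> plus the increase of \<open>A\<close> over
  the block divided by \<open>2 ^ p\<close>. The increases telescope, so only
  \<open>A (N * g) div 2 ^ p\<close> remains; \<open>p\<close> is chosen later.\<close>

lemma length_ma_le:
  assumes "mono A"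
  shows "length (ma W g N A) \<le> 3 * W * N + g * (N * p + A (N * g) div 2 ^ p)"
proof -
  have "(\<Sum>J<n. ma_wd g A J) \<le> n * p + A (n * g) div 2 ^ p" for n
  proof (induction n)
    case (Suc n)
    have le: "A (n * g) \<le> A (Suc n * g)" using assms by (auto simp: mono_def)
    have "ma_wd g A n \<le> p + (A (Suc n * g) - A (n * g)) div 2 ^ p"
      unfolding ma_wd_def using bits_add_le by simp
    moreover have "A (n * g) div 2 ^ p + (A (Suc n * g) - A (n * g)) div 2 ^ p \<le> A (Suc n * g) div 2 ^ p"
      using div_add1_eq[of "A (n * g)" "A (Suc n * g) - A (n * g)" "2 ^ p"] le by simp
    ultimately show ?case using Suc by simp
  qed simp
  moreover have "length (cat (ma_body g A) N) = g * (\<Sum>J<N. ma_wd g A J)"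
    by (simp add: length_cat ma_body_def sum_distrib_left)
  ultimately have "length (cat (ma_body g A) N) \<le> g * (N * p + A (N * g) div 2 ^ p)" by (metis mult_le_mono2)
  then show ?thesis by (simp add: ma_def algebra_simps)
qed

lemma cmp_ma:
  assumes wf: "wf V" and B: "cmp V B" and W: "cmp V W" and g: "cmp V g" and N: "cmp V N" and i: "cmp V i"
    and a: "\<And>Z. Z \<in> V \<Longrightarrow> sub (bb Z) (B Z) (ma (W Z) (g Z) (N Z) (A Z)) \<and> mono (A Z) \<and> i Z < N Z * g Z
       \<and> A Z (N Z * g Z) < 2 ^ ww Z \<and> A Z (N Z * g Z) < 2 ^ W Z
       \<and> length (ma (W Z) (g Z) (N Z) (A Z)) < 2 ^ W Z
       \<and> B Z + length (ma (W Z) (g Z) (N Z) (A Z)) < 2 ^ ww Z"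
  shows "cmp V (\<lambda>Z. A Z (i Z))"
proof -
  let ?J = "\<lambda>Z. i Z div g Z" and ?o = "\<lambda>Z. i Z mod g Z"
  have J: "cmp V ?J" and o: "cmp V ?o" by (intro cmp_div cmp_mod i g)+
  have f: "?J Z < N Z \<and> ?o Z < g Z \<and> ?J Z * g Z + ?o Z = i Z
     \<and> A Z (?J Z * g Z) \<le> A Z (i Z) \<and> A Z (i Z) \<le> A Z ((?J Z + 1) * g Z) \<and> A Z ((?J Z + 1) * g Z) \<le> A Z (N Z * g Z)"
    if "Z \<in> V" for Z
  proof -
    have "0 < g Z" using a[OF that] by (cases "g Z") auto
    moreover have "?J Z < N Z" using a[OF that] by (simp add: less_mult_imp_div_less)
    moreover have "(?J Z + 1) * g Z \<le> N Z * g Z" using calculation by (intro mult_right_mono) auto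
    moreover have "i Z \<le> (?J Z + 1) * g Z" using calculation(1) dividend_less_times_div[of "g Z" "i Z"] by (simp add: algebra_simps)
    ultimately show ?thesis using a[OF that] by (auto simp: mono_def)
  qed
  have wd: "ma_wd (g Z) (A Z) (?J Z) \<le> W Z \<and> ma_wd (g Z) (A Z) (?J Z) \<le> ww Z" if "Z \<in> V" for Z
    unfolding ma_wd_def using f[OF that] a[OF that]
    by (auto intro!: bits_le intro: le_less_trans[of _ "A Z (N Z * g Z)"])
  have wd2: "ma_wd (g Z) (A Z) (?J Z) < 2 ^ W Z \<and> ma_wd (g Z) (A Z) (?J Z) < 2 ^ ww Z" if "Z \<in> V" for Z
    using wd[OF that] le_less_trans less_exp by blast
  let ?T = "\<lambda>Z. N Z * W Z"
  have len: "length (ma (W Z) (g Z) (N Z) (A Z)) = 3 * ?T Z + length (cat (ma_body (g Z) (A Z)) (N Z))" for Z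
    by (simp add: ma_def)
  have ad: "ma_addr (g Z) (A Z) (?J Z) + ?o Z * ma_wd (g Z) (A Z) (?J Z) \<le> length (cat (ma_body (g Z) (A Z)) (N Z))"
    if s: "Z \<in> V" for Z
  proof -
    have "ma_addr (g Z) (A Z) (?J Z) + length (ma_body (g Z) (A Z) (?J Z)) = (\<Sum>u<Suc (?J Z). length (ma_body (g Z) (A Z) u))"
      by (simp add: ma_addr_def)
    also have "\<dots> \<le> (\<Sum>u<N Z. length (ma_body (g Z) (A Z) u))" using f[OF s] by (intro sum_mono2) auto
    finally show ?thesis using f[OF s]
      by (simp add: length_cat ma_body_def) (meson add_left_mono le_trans less_imp_le mult_le_mono1)
  qed
  have JW: "?J Z * W Z \<le> ?T Z" if "Z \<in> V" for Z using f[OF that] by simp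
  have bnd: "B Z + 3 * ?T Z + length (cat (ma_body (g Z) (A Z)) (N Z)) < 2 ^ ww Z" if "Z \<in> V" for Z
    using a[OF that] len[of Z] by simp
  have jw: "B Z + ?J Z * W Z < 2 ^ ww Z" "B Z + ?T Z + ?J Z * W Z < 2 ^ ww Z"
    "B Z + ?T Z + ?T Z + ?J Z * W Z < 2 ^ ww Z" if "Z \<in> V" for Z
    using bnd[OF that] JW[OF that] by linarith+
  have T: "cmp V ?T" "cmp V (\<lambda>Z. B Z + ?T Z)" "cmp V (\<lambda>Z. B Z + ?T Z + ?T Z)" "cmp V (\<lambda>Z. B Z + ?T Z + ?T Z + ?T Z)"
    by (intro cmp_add cmp_mul B N W; use bnd in fastforce)+
  have s: "sub (bb Z) (B Z) (arr (W Z) (map (\<lambda>J. A Z (J * g Z)) [0..<N Z]))"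
    "sub (bb Z) (B Z + ?T Z) (arr (W Z) (map (ma_wd (g Z) (A Z)) [0..<N Z]))"
    "sub (bb Z) (B Z + ?T Z + ?T Z) (arr (W Z) (map (ma_addr (g Z) (A Z)) [0..<N Z]))"
    "sub (bb Z) (B Z + ?T Z + ?T Z + ?T Z) (cat (ma_body (g Z) (A Z)) (N Z))" if "Z \<in> V" for Z
    using a[OF that] by (auto simp: ma_def sub_append add.assoc)
  have c1: "cmp V (\<lambda>Z. map (\<lambda>J. A Z (J * g Z)) [0..<N Z] ! ?J Z)"
  proof (rule cmp_arr[OF wf B W J])
    fix Z assume v: "Z \<in> V"
    have "A Z (?J Z * g Z) \<le> A Z (N Z * g Z)" using f[OF v] by linarith
    then show "sub (bb Z) (B Z) (arr (W Z) (map (\<lambda>J. A Z (J * g Z)) [0..<N Z])) \<and> ?J Z < length (map (\<lambda>J. A Z (J * g Z)) [0..<N Z])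
      \<and> map (\<lambda>J. A Z (J * g Z)) [0..<N Z] ! ?J Z < 2 ^ W Z \<and> map (\<lambda>J. A Z (J * g Z)) [0..<N Z] ! ?J Z < 2 ^ ww Z \<and> B Z + ?J Z * W Z < 2 ^ ww Z"
      using s(1)[OF v] f[OF v] jw[OF v] a[OF v] by auto
  qed
  have c2: "cmp V (\<lambda>Z. map (ma_wd (g Z) (A Z)) [0..<N Z] ! ?J Z)"
  proof (rule cmp_arr[OF wf T(2) W J])
    fix Z assume v: "Z \<in> V"
    show "sub (bb Z) (B Z + ?T Z) (arr (W Z) (map (ma_wd (g Z) (A Z)) [0..<N Z])) \<and> ?J Z < length (map (ma_wd (g Z) (A Z)) [0..<N Z])
      \<and> map (ma_wd (g Z) (A Z)) [0..<N Z] ! ?J Z < 2 ^ W Z \<and> map (ma_wd (g Z) (A Z)) [0..<N Z] ! ?J Z < 2 ^ ww Z \<and> B Z + ?T Z + ?J Z * W Z < 2 ^ ww Z"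
      using s[OF v] f[OF v] wd[OF v] jw[OF v] a[OF v] len[of Z] wd2[OF v] by auto
  qed
  have c3: "cmp V (\<lambda>Z. map (ma_addr (g Z) (A Z)) [0..<N Z] ! ?J Z)"
  proof (rule cmp_arr[OF wf T(3) W J])
    fix Z assume v: "Z \<in> V"
    show "sub (bb Z) (B Z + ?T Z + ?T Z) (arr (W Z) (map (ma_addr (g Z) (A Z)) [0..<N Z])) \<and> ?J Z < length (map (ma_addr (g Z) (A Z)) [0..<N Z])
      \<and> map (ma_addr (g Z) (A Z)) [0..<N Z] ! ?J Z < 2 ^ W Z \<and> map (ma_addr (g Z) (A Z)) [0..<N Z] ! ?J Z < 2 ^ ww Z \<and> B Z + ?T Z + ?T Z + ?J Z * W Z < 2 ^ ww Z"
      using s[OF v] f[OF v] ad[OF v] jw[OF v] a[OF v] len[of Z] by auto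
  qed
  let ?b = "\<lambda>Z. A Z (?J Z * g Z)" and ?w = "\<lambda>Z. ma_wd (g Z) (A Z) (?J Z)" and ?a = "\<lambda>Z. ma_addr (g Z) (A Z) (?J Z)"
  have d: "cmp V ?b" "cmp V ?w" "cmp V ?a"
    by (rule cmp_cong[OF c1] cmp_cong[OF c2] cmp_cong[OF c3]; use f in simp)+
  have aa: "cmp V (\<lambda>Z. B Z + ?T Z + ?T Z + ?T Z + ?a Z)"
    by (intro cmp_add T d) (use ad bnd in fastforce)
  have c4: "cmp V (\<lambda>Z. map (\<lambda>k. A Z (?J Z * g Z + k) - A Z (?J Z * g Z)) [0..<g Z] ! ?o Z)"
  proof (rule cmp_arr[OF wf aa d(2) o])
    fix Z assume v: "Z \<in> V"
    have "A Z (i Z) - ?b Z \<le> A Z ((?J Z + 1) * g Z) - ?b Z" using f[OF v] by auto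
    also have "\<dots> < 2 ^ ?w Z" unfolding ma_wd_def by (rule less_bits)
    finally have "A Z (i Z) - ?b Z < 2 ^ ?w Z" .
    moreover have "sub (bb Z) (B Z + ?T Z + ?T Z + ?T Z + ?a Z) (ma_body (g Z) (A Z) (?J Z))"
      unfolding ma_addr_def by (rule sub_cat[OF s(4)[OF v]]) (use f[OF v] in auto)
    ultimately show "sub (bb Z) (B Z + ?T Z + ?T Z + ?T Z + ?a Z)
        (arr (?w Z) (map (\<lambda>k. A Z (?J Z * g Z + k) - A Z (?J Z * g Z)) [0..<g Z]))
      \<and> ?o Z < length (map (\<lambda>k. A Z (?J Z * g Z + k) - A Z (?J Z * g Z)) [0..<g Z])
      \<and> map (\<lambda>k. A Z (?J Z * g Z + k) - A Z (?J Z * g Z)) [0..<g Z] ! ?o Z < 2 ^ ?w Z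
      \<and> map (\<lambda>k. A Z (?J Z * g Z + k) - A Z (?J Z * g Z)) [0..<g Z] ! ?o Z < 2 ^ ww Z
      \<and> B Z + ?T Z + ?T Z + ?T Z + ?a Z + ?o Z * ?w Z < 2 ^ ww Z"
      using f[OF v] a[OF v] ad[OF v] len[of Z] by (auto simp: ma_body_def)
  qed
  have "cmp V (\<lambda>Z. ?b Z + map (\<lambda>k. A Z (?J Z * g Z + k) - A Z (?J Z * g Z)) [0..<g Z] ! ?o Z)"
    by (intro cmp_add d c4) (use f a in \<open>fastforce\<close>)
  then show ?thesis by (rule cmp_cong) (use f in auto)
qed

section \<open>Hashing\<close>

subsection \<open>Injective reduction modulo a small number\<close>

text \<open>This is the recursion of Leibniz's harmonic triangle, 1/((k+1) C(n,k+1)) = 1/(k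
  C(n-1,k)) - 1/(k C(n,k)), multiplied by the least common multiple: if both terms on the right
  become integers, so does the left one.\<close>

lemma binomial_dvd_Lcm:
  fixes k N :: nat
  assumes "1 \<le> k" "k \<le> n" "n \<le> N"
  shows "k * (n choose k) dvd Lcm {1..N}"
  using assms
proof (induction k arbitrary: n rule: dec_induct)
  case base
  then show ?case by (auto intro: dvd_Lcm)
next
  case (step k)
  let ?L = "Lcm {1..N}" and ?c = "(n - 1) choose k"
  have n: "0 < n" "k < n" "n - 1 \<le> N" "k \<le> n - 1" using step by auto
  obtain p where p: "?L = k * ?c * p" using step.IH[of "n - 1"] n by (auto simp: dvd_def)
  obtain q where q: "?L = k * (n choose k) * q" using step.IH[of n] step.prems n by (auto simp: dvd_def)
  have X: "Suc k * (n choose Suc k) = n * ?c"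
    using binomial_absorption[of k n] by (simp only: mult.commute)
  have Z: "(n - k) * (n choose k) = n * ?c" using binomial_absorb_comp[of n k] by simp
  have "k * int ?L = k * (int n * int ?c * (int p - int q))"
  proof -
    have "int ?L = k * int ?c * p" using p by (metis of_nat_mult)
    moreover have "int (n - k) * int ?L = k * (int n * int ?c) * q"
    proof -
      have "(n - k) * ?L = k * (n * ?c) * q" unfolding q using Z by (simp add: algebra_simps)
      then show ?thesis by (metis of_nat_mult)
    qed
    moreover have "int (n - k) = int n - int k" using n by simp
    ultimately show ?thesis by algebra
  qed
  then have "int ?L = int n * int ?c * (int p - int q)" using step by simp
  then have "int (n * ?c) dvd int ?L" by simp
  then show ?case unfolding X by (simp only: of_nat_dvd_iff)
qed

text \<open>The central binomial coefficient C(2K,K) is at least 2^K and, times K, divides the least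
  common multiple.\<close>

lemma Lcm_lower_bound: "0 < K \<Longrightarrow> 2 ^ K \<le> Lcm {1..2 * K :: nat}"
proof -
  assume K: "0 < K"
  have "(real (2 * K) / real K) ^ K \<le> real ((2 * K) choose K)"
    using binomial_ge_n_over_k_pow_k[of K "2 * K", where 'a = real] by simp
  then have "real (2 ^ K) \<le> real ((2 * K) choose K)" using K by simp
  then have "2 ^ K \<le> (2 * K) choose K" by (simp only: of_nat_le_iff)
  also have "\<dots> \<le> K * ((2 * K) choose K)" using K by simp
  also have "\<dots> \<le> Lcm {1..2 * K}"
    by (intro dvd_imp_le binomial_dvd_Lcm) (use K in \<open>auto intro!: Nat.gr0I simp: Lcm_0_iff_nat\<close>)
  finally show ?thesis .
qed

text \<open>If every modulus up to the bound failed, each would divide a difference of two elements,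
  and their least common multiple would divide the product \<open>?D\<close> of all differences. But
  \<open>?D\<close> is at most \<open>2 ^ (v * k ^ 2)\<close>, too small for that.\<close>

lemma ex_injective_mod:
  fixes S :: "nat set"
  assumes S: "finite S" "S \<subseteq> {..<2 ^ v}" "card S \<le> k"
  shows "\<exists>q. 0 < q \<and> q \<le> 2 * (v * k ^ 2 + 1) \<and> inj_on (\<lambda>x. x mod q) S"
proof (rule ccontr)
  assume a: "\<not> ?thesis"
  let ?K = "v * k ^ 2 + 1" and ?P = "{(x, y) \<in> S \<times> S. x < y}"
  let ?D = "\<Prod>(x, y)\<in>?P. y - x"
  have fP: "finite ?P" by (rule finite_subset[of _ "S \<times> S"]) (use S in auto)
  have "q dvd ?D" if q: "q \<in> {1..2 * ?K}" for q
  proof -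
    from a q obtain x y where xy: "x \<in> S" "y \<in> S" "x \<noteq> y" "x mod q = y mod q"
      by (force simp: inj_on_def)
    obtain x' y' where *: "(x', y') \<in> ?P" "x' mod q = y' mod q"
      using xy by (cases "x < y") force+
    then have "q dvd y' - x'" by (metis (no_types, lifting) case_prodD less_imp_le mem_Collect_eq mod_eq_dvd_iff_nat)
    also have "y' - x' dvd ?D" using dvd_prodI[OF fP *(1), of "\<lambda>(x, y). y - x"] by simp
    finally show ?thesis .
  qed
  then have "Lcm {1..2 * ?K} dvd ?D" by (intro Lcm_least) auto
  moreover have "0 < ?D" by (intro prod_pos) auto
  ultimately have "Lcm {1..2 * ?K} \<le> ?D" by (intro dvd_imp_le) auto
  also have "?D \<le> (\<Prod>p\<in>?P. 2 ^ v)" by (intro prod_mono) (use S in \<open>auto simp: subset_iff intro: order_trans[OF diff_le_self] less_imp_le\<close>)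
  also have "\<dots> = 2 ^ (v * card ?P)" by (simp add: power_mult)
  also have "\<dots> \<le> 2 ^ (v * k ^ 2)"
  proof -
    have "card ?P \<le> card (S \<times> S)" by (rule card_mono) (use S in auto)
    also have "\<dots> \<le> k ^ 2" using S by (simp add: card_cartesian_product power2_eq_square mult_mono)
    finally show ?thesis by (intro power_increasing) auto
  qed
  finally have "Lcm {1..2 * ?K} \<le> 2 ^ (v * k ^ 2)" .
  with Lcm_lower_bound[of ?K] have "(2::nat) ^ ?K \<le> 2 ^ (v * k ^ 2)" by linarith
  then show False by simp
qed

text \<open>The modulus \<^term>\<open>0 :: nat\<close> stands for the identity, since \<^term>\<open>x mod 0 = (x::nat)\<close>.\<close>

lemma ex_reduction:
  fixes S :: "nat set"
  assumes S: "finite S" "S \<subseteq> {..<2 ^ v}" "card S \<le> k" and u: "v \<le> u \<or> 2 * (v * k ^ 2 + 1) < 2 ^ u"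
  shows "\<exists>q<2 ^ u. inj_on (\<lambda>x. x mod q) S \<and> (\<forall>x<2 ^ v. x mod q < 2 ^ u)"
proof (cases "v \<le> u")
  case True
  then have "(2::nat) ^ v \<le> 2 ^ u" by (intro power_increasing) auto
  then show ?thesis by (intro exI[of _ 0]) (auto simp: inj_on_def intro: order.strict_trans2[of _ "2 ^ v"])
next
  case False
  obtain q where q: "0 < q" "q \<le> 2 * (v * k ^ 2 + 1)" "inj_on (\<lambda>x. x mod q) S"
    using ex_injective_mod[OF S] by auto
  have "q < 2 ^ u" using q u False by linarith
  then show ?thesis using q(1,3) by (intro exI[of _ q]) (auto intro: less_trans[OF mod_less_divisor])
qed

subsection \<open>Multiply-shift hashing\<close>

definition msh :: "nat \<Rightarrow> nat \<Rightarrow> nat \<Rightarrow> nat \<Rightarrow> nat" where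
  "msh u r a z = (a * z mod 2 ^ u) div 2 ^ (u - r)"

lemma msh_less: "r \<le> u \<Longrightarrow> msh u r a z < 2 ^ r"
proof -
  assume "r \<le> u"
  then have "(2::nat) ^ u = 2 ^ r * 2 ^ (u - r)" by (simp flip: power_add)
  then have "a * z mod 2 ^ u < 2 ^ r * 2 ^ (u - r)" by (metis mod_less_divisor zero_less_numeral zero_less_power)
  then show ?thesis unfolding msh_def by (simp add: less_mult_imp_div_less)
qed

lemma odd_part: "0 < (d::nat) \<Longrightarrow> \<exists>t c. d = 2 ^ t * c \<and> odd c"
proof (induction d rule: less_induct)
  case (less d)
  show ?case
  proof (cases "even d")
    case True
    then obtain e where e: "d = 2 * e" by blast
    then obtain t c where "e = 2 ^ t * c" "odd c" using less.IH[of e] less.prems by auto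
    then show ?thesis using e by (intro exI[of _ "Suc t"] exI[of _ c]) auto
  qed (intro exI[of _ 0] exI[of _ d], auto)
qed

lemma odd_mult_mod_cancel:
  fixes a b c :: nat
  assumes "odd c" "a * c mod 2 ^ k = b * c mod 2 ^ k"
  shows "a mod 2 ^ k = b mod 2 ^ k"
proof -
  have "int (a * c) mod 2 ^ k = int (b * c) mod 2 ^ k"
    using assms(2) by (metis of_nat_mod of_nat_numeral of_nat_power)
  then have "2 ^ k dvd int (a * c) - int (b * c)" by (simp add: mod_eq_dvd_iff)
  then have "2 ^ k dvd (int a - int b) * int c" by (simp add: algebra_simps)
  moreover have "coprime (2 ^ k) (int c)" using assms(1) by simp
  ultimately have "2 ^ k dvd int a - int b" using coprime_dvd_mult_left_iff by blast
  then have "int a mod 2 ^ k = int b mod 2 ^ k" by (simp add: mod_eq_dvd_iff)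
  then have "int (a mod 2 ^ k) = int (b mod 2 ^ k)" by (simp add: of_nat_mod)
  then show ?thesis by (simp only: of_nat_eq_iff)
qed

lemma div_eq_imp_near:
  fixes A B p :: nat
  assumes "A div p = B div p" "0 < p"
  shows "A < B + p"
proof -
  have "p * (B div p) + A mod p = A" using assms(1) by (metis mult_div_mod_eq)
  moreover have "p * (B div p) + B mod p = B" by simp
  ultimately show ?thesis using mod_less_divisor[OF assms(2), of A] by linarith
qed

text \<open>Two products with the same leading \<open>r\<close> bits differ by less than
  \<open>2 ^ (u - r)\<close>; modulo \<open>2 ^ u\<close> their difference is therefore close to 0
  from above or from below.\<close>

lemma msh_collision_near:
  assumes "msh u r a z = msh u r a z'" "z' < z" "r \<le> u"
  shows "a * (z - z') mod 2 ^ u < 2 ^ (u - r) \<or> 2 ^ u < a * (z - z') mod 2 ^ u + 2 ^ (u - r)"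
proof -
  let ?p = "2 ^ (u - r) :: nat" and ?A = "a * z mod 2 ^ u" and ?B = "a * z' mod 2 ^ u"
  have d: "?A div ?p = ?B div ?p" using assms(1) by (simp add: msh_def)
  have AB: "?A < ?B + ?p" "?B < ?A + ?p"
    using div_eq_imp_near[OF d] div_eq_imp_near[OF d[symmetric]] by auto
  have i: "int (a * (z - z') mod 2 ^ u) = (int ?A - int ?B) mod 2 ^ u"
  proof -
    have "int (a * (z - z')) = int (a * z) - int (a * z')" using assms(2) by (simp add: algebra_simps)
    then show ?thesis by (simp add: of_nat_mod mod_diff_eq)
  qed
  have lt: "?A < 2 ^ u" "?B < 2 ^ u" by simp_all
  show ?thesis
  proof (cases "?B \<le> ?A")
    case True
    then have "(int ?A - int ?B) mod 2 ^ u = int ?A - int ?B"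
      by (intro mod_pos_pos_trivial) (use lt in \<open>auto simp: of_nat_mod[symmetric] simp del: of_nat_mod intro: le_less_trans[of _ "int ?A"]\<close>)
    then have "int (a * (z - z') mod 2 ^ u) = int ?A - int ?B" using i by simp
    then show ?thesis using AB True by linarith
  next
    case False
    have "(int ?A - int ?B) mod 2 ^ u = (int ?A - int ?B + 2 ^ u) mod 2 ^ u" by simp
    also have "\<dots> = int ?A - int ?B + 2 ^ u"
    proof (intro mod_pos_pos_trivial)
      have "int ?B < 2 ^ u" using lt(2) by (metis of_nat_less_iff of_nat_numeral of_nat_power)
      then show "0 \<le> int ?A - int ?B + 2 ^ u" by linarith
      show "int ?A - int ?B + 2 ^ u < 2 ^ u" using False by linarith
    qed
    finally have "int (a * (z - z') mod 2 ^ u) + int ?B = int ?A + int (2 ^ u)" using i by simp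
    then have "a * (z - z') mod 2 ^ u + ?B = ?A + 2 ^ u" by linarith
    then show ?thesis using AB by linarith
  qed
qed

text \<open>As \<open>N\<close> and \<open>p\<close> are even, each end of the range holds exactly
  half of \<open>p\<close> odd numbers.\<close>

lemma card_odd_ends:
  fixes N p :: nat
  assumes "even N" "even p"
  shows "card {X. X < N \<and> odd X \<and> (X < p \<or> N < X + p)} \<le> p"
proof -
  let ?G = "{X. X < N \<and> odd X \<and> (X < p \<or> N < X + p)}"
  have "?G \<subseteq> (\<lambda>i. 2 * i + 1) ` {..<p div 2} \<union> (\<lambda>i. N - 1 - 2 * i) ` {..<p div 2}"
  proof
    fix X assume "X \<in> ?G"
    then have X: "X < N" "odd X" and o: "X < p \<or> N < X + p" by auto
    from o show "X \<in> (\<lambda>i. 2 * i + 1) ` {..<p div 2} \<union> (\<lambda>i. N - 1 - 2 * i) ` {..<p div 2}"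
    proof
      assume "X < p"
      then have "X div 2 < p div 2" "X = 2 * (X div 2) + 1" using X assms by presburger+
      then show ?thesis by blast
    next
      assume "N < X + p"
      moreover obtain N' p' X' where "N = 2 * N'" "p = 2 * p'" "X = 2 * X' + 1" using assms X(2) by (auto elim!: evenE oddE)
      ultimately have "(N - X) div 2 < p div 2" "X = N - 1 - 2 * ((N - X) div 2)" using X(1) by auto
      then show ?thesis by blast
    qed
  qed
  then have "card ?G \<le> card ((\<lambda>i. 2 * i + 1) ` {..<p div 2} \<union> (\<lambda>i. N - 1 - 2 * i) ` {..<p div 2})"
    by (intro card_mono) auto
  also have "\<dots> \<le> card ((\<lambda>i. 2 * i + 1) ` {..<p div 2}) + card ((\<lambda>i. N - 1 - 2 * i) ` {..<p div 2})"
    by (rule card_Un_le)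
  also have "\<dots> \<le> p div 2 + p div 2"
    by (intro add_mono) (metis card_image_le card_lessThan finite_lessThan)+
  finally show ?thesis by simp
qed

text \<open>Let \<open>z - z' = 2 ^ t * c\<close> with \<open>c\<close> odd. In a collision the odd
  number \<open>X a = a * c mod 2 ^ (u - t)\<close> lies within \<open>p = 2 ^ (u - r - t)\<close>
  of an end of its range, which leaves \<open>p\<close> values; \<open>X a\<close> determines
  \<open>a\<close> up to its top \<open>t\<close> bits, which leaves a factor
  \<open>2 ^ t\<close>.\<close>

lemma card_msh_collisions:
  assumes z: "z < 2 ^ u" "z' < 2 ^ u" "z' < z" and r: "r \<le> u"
  shows "card {a. a < 2 ^ u \<and> odd a \<and> msh u r a z = msh u r a z'} \<le> 2 ^ (u - r)"
proof -
  let ?C = "{a. a < 2 ^ u \<and> odd a \<and> msh u r a z = msh u r a z'}"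
  obtain t c where tc: "z - z' = 2 ^ t * c" "odd c" using odd_part[of "z - z'"] z by auto
  have "0 < c" using tc by (cases c) auto
  then have "(2::nat) ^ t \<le> z - z'" using tc by simp
  also have "\<dots> < 2 ^ u" using z by linarith
  finally have t: "t < u" by simp
  define N where "N = (2::nat) ^ (u - t)"
  have Nu: "(2::nat) ^ u = 2 ^ t * N" using t by (simp add: N_def flip: power_add)
  have eN: "even N" using t by (simp add: N_def)
  define X where "X a = a * c mod N" for a
  have Xeq: "a * (z - z') mod 2 ^ u = 2 ^ t * X a" for a
    unfolding tc X_def Nu by (metis mult.left_commute mult_mod_right)
  have X1: "X a < N" for a by (simp add: X_def N_def)
  have X2: "odd (X a)" if "odd a" for a
    using that tc(2) eN unfolding X_def by (simp add: dvd_mod_iff)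
  have near: "2 ^ t * X a < 2 ^ (u - r) \<or> 2 ^ u < 2 ^ t * X a + 2 ^ (u - r)" if "a \<in> ?C" for a
    using msh_collision_near[of u r a z z'] that z r by (auto simp: Xeq)
  show ?thesis
  proof (cases "t < u - r")
    case False
    \<comment> \<open>An odd multiple of \<open>2 ^ t\<close> is at distance at least
      \<open>2 ^ t\<close> from 0 and from \<open>2 ^ u\<close>, and no collision comes that
      far.\<close>
    have "?C = {}"
    proof (rule ccontr)
      assume "?C \<noteq> {}"
      then obtain a where a: "a \<in> ?C" by blast
      have p: "(2::nat) ^ (u - r) \<le> 2 ^ t" using False by (intro power_increasing) auto
      have "odd (X a)" using X2 a by auto
      then have "1 \<le> X a" by (cases "X a") auto
      then have "(2::nat) ^ t \<le> 2 ^ t * X a" by simp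
      moreover have "2 ^ t * X a + 2 ^ t \<le> 2 ^ u"
        using X1[of a] unfolding Nu by (metis Suc_leI add.commute mult_Suc_right mult_le_mono2)
      ultimately show False using near[OF a] p by linarith
    qed
    then show ?thesis by (metis card.empty zero_le)
  next
    case True
    define p where "p = (2::nat) ^ (u - r - t)"
    have pe: "(2::nat) ^ (u - r) = 2 ^ t * p" using True by (simp add: p_def flip: power_add)
    have "even p" using True by (simp add: p_def)
    let ?G = "{X. X < N \<and> odd X \<and> (X < p \<or> N < X + p)}"
    have nearX: "X a < p \<or> N < X a + p" if "a \<in> ?C" for a
      using near[OF that] unfolding pe Nu by (simp flip: distrib_left)
    have inj: "inj_on (\<lambda>a. (X a, a div N)) ?C"
    proof (rule inj_onI)
      fix a b assume "a \<in> ?C" "b \<in> ?C" "(X a, a div N) = (X b, b div N)"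
      then have "a mod N = b mod N" "a div N = b div N"
        using odd_mult_mod_cancel[OF tc(2), of a "u - t" b] by (auto simp: X_def N_def)
      then show "a = b" by (metis div_mult_mod_eq)
    qed
    have "(\<lambda>a. (X a, a div N)) ` ?C \<subseteq> ?G \<times> {..<2 ^ t}"
    proof
      fix y assume "y \<in> (\<lambda>a. (X a, a div N)) ` ?C"
      then obtain a where a: "a \<in> ?C" "y = (X a, a div N)" by blast
      have "a div N < 2 ^ t" using a(1) Nu by (simp add: less_mult_imp_div_less)
      then show "y \<in> ?G \<times> {..<2 ^ t}" using a X1[of a] X2[of a] nearX[of a] by auto
    qed
    then have "card ?C \<le> card (?G \<times> {..<2 ^ t :: nat})"
      using inj by (intro card_inj_on_le) auto
    also have "\<dots> \<le> p * 2 ^ t" using card_odd_ends[OF eN \<open>even p\<close>] by (simp add: card_cartesian_product)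
    finally show ?thesis unfolding pe by (simp add: mult.commute)
  qed
qed

definition colls :: "nat \<Rightarrow> nat \<Rightarrow> nat \<Rightarrow> nat set \<Rightarrow> (nat \<times> nat) set" where
  "colls u r a Z = {(x, y) \<in> Z \<times> Z. x \<noteq> y \<and> msh u r a x = msh u r a y}"

text \<open>Averaging over the \<open>2 ^ (u - 1)\<close> odd multipliers: every ordered pair
  collides for at most \<open>2 ^ (u - r)\<close> of them, so some multiplier has at most
  \<open>2 * card Z ^ 2 / 2 ^ r\<close> colliding pairs.\<close>

lemma ex_few_collisions:
  assumes Z: "finite Z" "Z \<subseteq> {..<2 ^ u}" and u: "0 < u" "r \<le> u"
  shows "\<exists>a<2 ^ u. odd a \<and> card (colls u r a Z) * 2 ^ r \<le> 2 * card Z ^ 2"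
proof (rule ccontr)
  assume n: "\<not> ?thesis"
  let ?O = "{a::nat. a < 2 ^ u \<and> odd a}" and ?Q = "{(x, y) \<in> Z \<times> Z. x \<noteq> y}"
  have fO: "finite ?O" by (rule finite_subset[of _ "{..<2 ^ u}"]) auto
  have fQ: "finite ?Q" by (rule finite_subset[of _ "Z \<times> Z"]) (use Z in auto)
  have cO: "card ?O = 2 ^ (u - 1)"
  proof -
    have "?O = (\<lambda>i. 2 * i + 1) ` {..<2 ^ (u - 1)}"
    proof (intro set_eqI iffI)
      fix a assume "a \<in> ?O"
      then have "a = 2 * (a div 2) + 1" "a div 2 < 2 ^ (u - 1)"
        using u by (auto simp: less_mult_imp_div_less power_eq_if)
      then show "a \<in> (\<lambda>i. 2 * i + 1) ` {..<2 ^ (u - 1)}" by blast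
    next
      fix a :: nat assume "a \<in> (\<lambda>i. 2 * i + 1) ` {..<2 ^ (u - 1)}"
      then show "a \<in> ?O" using u by (auto simp: power_eq_if[of 2 u])
    qed
    then show ?thesis by (simp add: card_image inj_on_def)
  qed
  have "(\<Sum>a\<in>?O. card (colls u r a Z)) = (\<Sum>a\<in>?O. \<Sum>q\<in>?Q. of_bool (msh u r a (fst q) = msh u r a (snd q)))"
  proof (intro sum.cong refl)
    fix a
    have "colls u r a Z = ?Q \<inter> {q. msh u r a (fst q) = msh u r a (snd q)}" by (auto simp: colls_def)
    then show "card (colls u r a Z) = (\<Sum>q\<in>?Q. of_bool (msh u r a (fst q) = msh u r a (snd q)))"
      using fQ by (simp add: sum_of_bool_eq)
  qed
  also have "\<dots> = (\<Sum>q\<in>?Q. \<Sum>a\<in>?O. of_bool (msh u r a (fst q) = msh u r a (snd q)))" by (rule sum.swap)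
  also have "\<dots> \<le> (\<Sum>q\<in>?Q. 2 ^ (u - r))"
  proof (rule sum_mono)
    fix q assume q: "q \<in> ?Q"
    obtain x y where xy: "q = (x, y)" "x < 2 ^ u" "y < 2 ^ u" "x \<noteq> y" using q Z by auto
    have "(\<Sum>a\<in>?O. of_bool (msh u r a (fst q) = msh u r a (snd q)))
       = card {a. a < 2 ^ u \<and> odd a \<and> msh u r a x = msh u r a y}"
      using fO by (simp add: sum_of_bool_eq xy Int_def conj_assoc)
    also have "\<dots> \<le> 2 ^ (u - r)"
    proof (cases "y < x")
      case True then show ?thesis using card_msh_collisions[of x u y r] xy u by simp
    next
      case False then show ?thesis using card_msh_collisions[of y u x r] xy u by (simp add: eq_commute)
    qed
    finally show "(\<Sum>a\<in>?O. of_bool (msh u r a (fst q) = msh u r a (snd q))) \<le> (2 ^ (u - r)::nat)" .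
  qed
  also have "\<dots> \<le> card Z ^ 2 * 2 ^ (u - r)"
  proof -
    have "card ?Q \<le> card (Z \<times> Z)" by (rule card_mono) (use Z in auto)
    then show ?thesis by (simp add: card_cartesian_product power2_eq_square)
  qed
  finally have "(\<Sum>a\<in>?O. card (colls u r a Z)) * 2 ^ r \<le> card Z ^ 2 * 2 ^ (u - r) * 2 ^ r"
    by (rule mult_le_mono1)
  also have "\<dots> = card Z ^ 2 * 2 ^ u" using u by (simp add: mult.assoc flip: power_add)
  also have "\<dots> = (\<Sum>a\<in>?O. 2 * card Z ^ 2)" using cO u by (cases u) auto
  also have "\<dots> < (\<Sum>a\<in>?O. card (colls u r a Z) * 2 ^ r)"
    by (rule sum_strict_mono) (use fO cO n in \<open>force simp: not_le\<close>)+
  finally show False by (simp add: sum_distrib_right)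
qed

text \<open>With a range above \<open>2 * card Z ^ 2\<close> the average number of collisions is
  below one. If keys have fewer bits than that range, multiplier 1 with \<open>r = u\<close> is the
  identity.\<close>

lemma ex_injective_msh:
  assumes Z: "finite Z" "Z \<subseteq> {..<2 ^ u}" and u: "0 < u"
  shows "\<exists>a<2 ^ u. inj_on (msh u (min u (bits (2 * card Z ^ 2))) a) Z"
proof (cases "bits (2 * card Z ^ 2) \<le> u")
  case True
  obtain a where a: "a < 2 ^ u" "card (colls u (bits (2 * card Z ^ 2)) a Z) * 2 ^ bits (2 * card Z ^ 2) \<le> 2 * card Z ^ 2"
    using ex_few_collisions[OF Z u True] by auto
  have "card (colls u (bits (2 * card Z ^ 2)) a Z) = 0"
    using a(2) less_bits[of "2 * card Z ^ 2"] by (cases "card (colls u (bits (2 * card Z ^ 2)) a Z)") auto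
  moreover have "finite (colls u (bits (2 * card Z ^ 2)) a Z)"
    by (rule finite_subset[of _ "Z \<times> Z"]) (use Z in \<open>auto simp: colls_def\<close>)
  ultimately show ?thesis using a(1) True
    by (intro exI[of _ a]) (auto simp: colls_def inj_on_def min_absorb2)
next
  case False
  have "msh u u 1 x = x" if "x \<in> Z" for x using that Z by (auto simp: msh_def)
  then show ?thesis using False u by (intro exI[of _ 1]) (auto simp: inj_on_def min_absorb1 one_less_power simp del: One_nat_def)
qed

text \<open>Two-level hashing in the manner of Fredman, Komlos and Szemeredi. The squares of the
  bucket sizes add up to at most \<open>card Z\<close> plus the number of collisions, hence to at
  most \<open>3 * card Z\<close>; a bucket gets a quadratic table of its own, and prefix sums keep
  these tables apart.\<close>

lemma ex_perfect_hash:
  assumes Z: "finite Z" "Z \<subseteq> {..<2 ^ u}" and u: "0 < u" "r \<le> u" "card Z \<le> 2 ^ r"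
  shows "\<exists>a av rv. a < 2 ^ u \<and> (\<forall>v. av v < 2 ^ u \<and> rv v \<le> u \<and> rv v \<le> bits (2 * card Z ^ 2)) \<and>
     (\<Sum>v<2 ^ r. 2 ^ rv v) \<le> 12 * card Z + 2 ^ r \<and>
     inj_on (\<lambda>z. (\<Sum>v<msh u r a z. 2 ^ rv v) + msh u (rv (msh u r a z)) (av (msh u r a z)) z) Z"
proof -
  obtain a where a: "a < 2 ^ u" "card (colls u r a Z) * 2 ^ r \<le> 2 * card Z ^ 2"
    using ex_few_collisions[OF Z u(1,2)] by auto
  define B where "B v = {z \<in> Z. msh u r a z = v}" for v
  have fB: "finite (B v)" and B: "B v \<subseteq> Z" for v using Z by (auto simp: B_def)
  define rv where "rv v = min u (bits (2 * card (B v) ^ 2))" for v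
  have "\<forall>v. \<exists>a<2 ^ u. inj_on (msh u (rv v) a) (B v)"
    unfolding rv_def using ex_injective_msh[OF fB _ u(1)] B Z by (meson subset_trans)
  then obtain av where av: "\<And>v. av v < 2 ^ u \<and> inj_on (msh u (rv v) (av v)) (B v)" by metis
  have cB: "card (B v) \<le> card Z" for v by (rule card_mono) (use Z B in auto)
  have rv: "rv v \<le> u \<and> rv v \<le> bits (2 * card Z ^ 2)" for v
    unfolding rv_def using cB[of v] by (auto intro!: min.coboundedI2 bits_mono power_mono)
  \<comment> \<open>\<open>2 ^ bits x <= 2 * x\<close> for \<open>x = 2 * card (B v) ^ 2\<close>;
    the summand 1 is the single cell of an empty bucket.\<close>
  have p: "2 ^ rv v \<le> 4 * card (B v) ^ 2 + 1" for v
  proof (cases "card (B v) = 0")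
    case False
    then have "2 ^ (bits (2 * card (B v) ^ 2) - 1) \<le> 2 * card (B v) ^ 2" by (intro bits_ge) auto
    moreover have "(2::nat) ^ rv v \<le> 2 ^ bits (2 * card (B v) ^ 2)" unfolding rv_def by (intro power_increasing) auto
    moreover have "(2::nat) ^ bits (2 * card (B v) ^ 2) = 2 * 2 ^ (bits (2 * card (B v) ^ 2) - 1)"
      using bits_pos[of "2 * card (B v) ^ 2"] False by (cases "bits (2 * card (B v) ^ 2)") auto
    ultimately show ?thesis by linarith
  qed (simp add: rv_def)
  have cells: "(\<Sum>v<2 ^ r. 2 ^ rv v) \<le> 12 * card Z + 2 ^ r"
  proof -
    have "(\<Sum>v<2 ^ r. card (B v) ^ 2) = card (\<Union>v<2 ^ r. B v \<times> B v)"
    proof (subst card_UN_disjoint)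
      show "\<forall>i\<in>{..<2 ^ r}. \<forall>j\<in>{..<2 ^ r}. i \<noteq> j \<longrightarrow> B i \<times> B i \<inter> B j \<times> B j = {}" by (auto simp: B_def)
    qed (use fB in \<open>auto simp: card_cartesian_product power2_eq_square\<close>)
    also have "\<dots> \<le> card (Z \<times> Z \<inter> {(x, y). x = y} \<union> colls u r a Z)"
      by (rule card_mono) (use Z in \<open>auto simp: B_def colls_def intro: finite_subset[of _ "Z \<times> Z"]\<close>)
    also have "\<dots> \<le> card (Z \<times> Z \<inter> {(x, y). x = y}) + card (colls u r a Z)" by (rule card_Un_le)
    also have "Z \<times> Z \<inter> {(x, y). x = y} = (\<lambda>x. (x, x)) ` Z" by auto
    also have "card \<dots> = card Z" by (intro card_image inj_onI) auto
    finally have 1: "(\<Sum>v<2 ^ r. card (B v) ^ 2) \<le> card Z + card (colls u r a Z)" .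
    have "card (colls u r a Z) * 2 ^ r \<le> 2 * card Z * 2 ^ r"
      using a(2) u(3) by (metis (no_types, lifting) le_trans mult.assoc mult_le_mono2 power2_eq_square)
    then have 2: "card (colls u r a Z) \<le> 2 * card Z" by simp
    have "(\<Sum>v<2 ^ r. 2 ^ rv v) \<le> (\<Sum>v<2 ^ r. 4 * card (B v) ^ 2 + 1)" by (intro sum_mono p)
    also have "\<dots> = 4 * (\<Sum>v<2 ^ r. card (B v) ^ 2) + 2 ^ r" by (simp only: sum.distrib sum_distrib_left) simp
    finally show ?thesis using 1 2 by linarith
  qed
  let ?h = "msh u r a" and ?off = "\<lambda>m. \<Sum>v<m. (2::nat) ^ rv v"
  have inj: "inj_on (\<lambda>z. ?off (?h z) + msh u (rv (?h z)) (av (?h z)) z) Z"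
  proof (rule inj_onI)
    fix x y assume xy: "x \<in> Z" "y \<in> Z"
      and e: "?off (?h x) + msh u (rv (?h x)) (av (?h x)) x = ?off (?h y) + msh u (rv (?h y)) (av (?h y)) y"
    have lt: "?off (?h x) + msh u (rv (?h x)) (av (?h x)) x < ?off (?h y)" if "?h x < ?h y" for x y
    proof -
      have "?off (?h x) + msh u (rv (?h x)) (av (?h x)) x < ?off (Suc (?h x))"
        using msh_less[of "rv (?h x)" u] rv by simp
      also have "\<dots> \<le> ?off (?h y)" using that by (intro sum_mono2) auto
      finally show ?thesis .
    qed
    have "?h x = ?h y" using lt[of x y] lt[of y x] e by (metis linorder_neqE_nat not_add_less1)
    moreover from this have "msh u (rv (?h x)) (av (?h x)) x = msh u (rv (?h x)) (av (?h x)) y" using e by simp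
    moreover have "x \<in> B (?h x)" "y \<in> B (?h x)" using xy calculation(1) by (auto simp: B_def)
    ultimately show "x = y" using av[of "?h x"] by (auto dest: inj_onD)
  qed
  show ?thesis by (intro exI[of _ a] exI[of _ av] exI[of _ rv]) (use a av rv cells inj in auto)
qed

section \<open>Dictionaries for one bin\<close>

definition cnt :: "('a \<Rightarrow> nat) \<Rightarrow> 'a list \<Rightarrow> nat \<Rightarrow> nat" where
  "cnt f xs v = length (filter (\<lambda>x. f x < v) xs)"

lemma cnt_le: "cnt f xs v \<le> length xs" by (simp add: cnt_def)

lemma cnt_mono: "v \<le> v' \<Longrightarrow> cnt f xs v \<le> cnt f xs v'"
proof -
  assume a: "v \<le> v'"
  have "length (filter (\<lambda>x. f x < v) xs) \<le> length (filter (\<lambda>x. f x < v') xs)"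
    using a by (induction xs) auto
  then show ?thesis by (simp add: cnt_def)
qed

lemma cnt_iff: "sorted (map f xs) \<Longrightarrow> i < length xs \<Longrightarrow> f (xs ! i) < v \<longleftrightarrow> i < cnt f xs v"
proof (induction xs arbitrary: i)
  case (Cons x xs)
  show ?case
  proof (cases "f x < v")
    case True
    then show ?thesis using Cons by (cases i) (auto simp: cnt_def)
  next
    case False
    then have "\<forall>y\<in>set (x # xs). \<not> f y < v" using Cons.prems by auto
    then have "filter (\<lambda>x. f x < v) (x # xs) = []" by (simp only: filter_empty_conv)
    moreover have "\<not> f ((x # xs) ! i) < v" using \<open>\<forall>y\<in>_. _\<close> Cons.prems nth_mem by blast
    ultimately show ?thesis by (simp only: cnt_def) simp
  qed
qed simp

definition seg :: "('a \<Rightarrow> nat) \<Rightarrow> 'a list \<Rightarrow> nat \<Rightarrow> 'a list" where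
  "seg f xs v = take (cnt f xs (v + 1) - cnt f xs v) (drop (cnt f xs v) xs)"

lemma length_seg: "length (seg f xs v) = cnt f xs (v + 1) - cnt f xs v"
  using cnt_le[of f xs "v + 1"] by (simp add: seg_def)

lemma nth_seg: "i < length (seg f xs v) \<Longrightarrow> seg f xs v ! i = xs ! (cnt f xs v + i)"
  using cnt_le[of f xs v] by (simp add: seg_def)

lemma sorted_seg: "sorted xs \<Longrightarrow> sorted (seg f xs v)"
  by (simp add: seg_def sorted_wrt_take sorted_wrt_drop)

lemma set_seg: "sorted (map f xs) \<Longrightarrow> set (seg f xs v) = {x \<in> set xs. f x = v}"
proof (intro set_eqI iffI)
  assume s: "sorted (map f xs)"
  fix x assume "x \<in> set (seg f xs v)"
  then obtain i where i: "i < length (seg f xs v)" "x = xs ! (cnt f xs v + i)"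
    by (metis in_set_conv_nth nth_seg)
  then have l: "cnt f xs v + i < cnt f xs (v + 1)" "cnt f xs v + i < length xs"
    using length_seg[of f xs v] cnt_le[of f xs "v + 1"] by auto
  then have "f x < v + 1" "\<not> f x < v" using cnt_iff[OF s l(2)] i by auto
  then show "x \<in> {x \<in> set xs. f x = v}" using i l by auto
next
  assume s: "sorted (map f xs)"
  fix x assume "x \<in> {x \<in> set xs. f x = v}"
  then obtain i where i: "i < length xs" "x = xs ! i" "f x = v" by (auto simp: in_set_conv_nth)
  then have "cnt f xs v \<le> i" "i < cnt f xs (v + 1)" using cnt_iff[OF s i(1)] by (auto simp: not_less[symmetric])
  then have "i - cnt f xs v < length (seg f xs v)" "seg f xs v ! (i - cnt f xs v) = x"
    using length_seg[of f xs v] nth_seg[of "i - cnt f xs v" f xs v] i by auto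
  then show "x \<in> set (seg f xs v)" by (metis nth_mem)
qed

lemma nth_before_fo: "j < fo xs x \<Longrightarrow> xs ! j \<noteq> x"
  unfolding fo_def by (metis (mono_tags, lifting) nth_mem set_takeWhileD takeWhile_nth)

text \<open>Equal elements have equal keys, so \<open>x\<close> can occur only in the group of its
  own key, and the groups before it shift the position by \<open>cnt\<close>.\<close>

lemma fo_seg:
  assumes s: "sorted (map f xs)"
  shows "fo xs x = (if fo (seg f xs (f x)) x < length (seg f xs (f x)) then cnt f xs (f x) + fo (seg f xs (f x)) x else length xs)"
proof (cases "x \<in> set xs")
  case True
  let ?g = "seg f xs (f x)" and ?c = "cnt f xs (f x)"
  have m: "x \<in> set ?g" using True set_seg[OF s] by auto
  then have lt: "fo ?g x < length ?g" by (simp add: fo_less_iff)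
  have l: "?c + fo ?g x < length xs" using lt length_seg[of f xs "f x"] cnt_le[of f xs "f x + 1"] by linarith
  have "fo xs x = ?c + fo ?g x"
  proof (rule fo_unique[OF l])
    show "xs ! (?c + fo ?g x) = x" using nth_seg[OF lt] fo_nth[OF m] by simp
    fix j assume j: "j < ?c + fo ?g x"
    show "xs ! j \<noteq> x"
    proof (cases "j < ?c")
      case True
      then have "f (xs ! j) < f x" using cnt_iff[OF s] l j by auto
      then show ?thesis by auto
    next
      case False
      then have jj: "j - ?c < fo ?g x" using j by auto
      then have "?g ! (j - ?c) \<noteq> x" by (rule nth_before_fo)
      then show ?thesis using nth_seg[of "j - ?c" f xs "f x"] jj lt False by simp
    qed
  qed
  then show ?thesis using lt by simp
next
  case False
  then have "x \<notin> set (seg f xs (f x))" using set_seg[OF s] by auto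
  then have "\<not> fo (seg f xs (f x)) x < length (seg f xs (f x))" by (simp add: fo_less_iff)
  moreover have "fo xs x = length xs" using False fo_less_iff[of xs x] fo_le[of xs x] by auto
  ultimately show ?thesis by simp
qed

text \<open>\<open>pu\<close> bounds the bit length of the values of the global hash function, \<open>ph\<close> is the width of a stored bit
  length, and \<open>pa\<close>, \<open>pb\<close> are the logarithmic and doubly logarithmic terms in the widths of a bin's own moduli.\<close>

record prm = pq :: nat  pq' :: nat  pu :: nat  ph :: nat  pa :: nat  pb :: nat

text \<open>The first modulus brings elements of O(lg m) bits down to O(lg n + lg lg m) bits, the
  second one to O(lg n + lg lg lg m). The second step makes the terms of each bin that still depend
  on \<open>m\<close> small enough to be paid for.\<close>

definition zf :: "prm \<Rightarrow> nat \<Rightarrow> nat" where "zf P x = x mod pq P mod pq' P"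

text \<open>Bins up to this size are scanned. A larger bin has enough elements to spread its fields
  of constant number over them.\<close>

definition K0 :: nat where "K0 = 100000"
text \<open>A perfect hash table costs 24 bits per element for each bit of the bin size's logarithm,
  and \<open>tau\<close> is a quarter of that logarithm: 96 = 24 * 4 units have to be saved.\<close>

definition A0 :: nat where "A0 = 96"

text \<open>What remains of the leaf cost per element beside the units of \<open>tau\<close>. The
  constant is 96 + 16 from the arrays, 8 from the moduli, and 1 for rounding the quotient by
  \<open>K0\<close> up.\<close>

definition e0 :: "prm \<Rightarrow> nat" where "e0 P = 2 * pb P + 121 + (ph P + pa P + 2 * pb P) div K0"
text \<open>Cost per element of one splitting level: 80 for the arrays of the split, and 1 again for
  rounding up.\<close>

definition ed :: "prm \<Rightarrow> nat" where "ed P = 81 + ph P div K0"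

text \<open>Widths after the bin's own two reductions. A modulus for \<open>k\<close> keys of
  \<open>u\<close> bits has about lg u + 2 lg k bits, where \<open>pa\<close> stands for lg
  \<open>pu\<close>. In the second reduction lg (2 lg k + \<open>pa\<close>) is bounded by lg k +
  \<open>pb\<close>, whence the factor 3 in \<open>u3\<close>.\<close>

definition u2 :: "prm \<Rightarrow> nat \<Rightarrow> nat" where "u2 P k = min (pu P) (2 * bits k + pa P)"
definition u3 :: "prm \<Rightarrow> nat \<Rightarrow> nat" where "u3 P k = min (u2 P k) (3 * bits k + pb P)"
definition ur :: "prm \<Rightarrow> nat \<Rightarrow> nat" where "ur P k = min (bits k) (u3 P k)"

type_synonym fkspar = "nat \<times> nat \<times> nat \<times> (nat \<Rightarrow> nat) \<times> (nat \<Rightarrow> nat)"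

definition z3 :: "prm \<Rightarrow> fkspar \<Rightarrow> nat \<Rightarrow> nat" where
  "z3 P D x = (case D of (q2, q3, a, av, rv) \<Rightarrow> zf P x mod q2 mod q3)"

definition bk :: "prm \<Rightarrow> nat \<Rightarrow> fkspar \<Rightarrow> nat \<Rightarrow> nat" where
  "bk P k D x = (case D of (q2, q3, a, av, rv) \<Rightarrow> msh (u3 P k) (ur P k) a (z3 P D x))"

definition off :: "fkspar \<Rightarrow> nat \<Rightarrow> nat" where
  "off D m = (case D of (q2, q3, a, av, rv) \<Rightarrow> (\<Sum>v<m. 2 ^ rv v))"

definition cl :: "prm \<Rightarrow> nat \<Rightarrow> fkspar \<Rightarrow> nat \<Rightarrow> nat" where
  "cl P k D x = (case D of (q2, q3, a, av, rv) \<Rightarrow>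
     off D (bk P k D x) + msh (u3 P k) (rv (bk P k D x)) (av (bk P k D x)) (z3 P D x))"

definition fks_ok :: "prm \<Rightarrow> nat list \<Rightarrow> fkspar \<Rightarrow> bool" where
  "fks_ok P xs D \<longleftrightarrow> (case D of (q2, q3, a, av, rv) \<Rightarrow> let k = length xs in
     q2 < 2 ^ u2 P k \<and> q3 < 2 ^ u3 P k \<and> a < 2 ^ u3 P k \<and>
     (\<forall>v. av v < 2 ^ u3 P k \<and> rv v \<le> u3 P k \<and> rv v \<le> 2 * bits k + 1) \<and>
     off D (2 ^ ur P k) \<le> 14 * k \<and> inj_on (cl P k D) (set xs))"

definition node_ok :: "prm \<Rightarrow> nat \<Rightarrow> nat \<Rightarrow> nat list \<Rightarrow> bool" where
  "node_ok P w s xs \<longleftrightarrow> sorted xs \<and> (\<forall>x\<in>set xs. \<forall>y\<in>set xs. x div 2 ^ s = y div 2 ^ s) \<and> inj_on (zf P) (set xs) \<and>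
     (\<forall>x\<in>set xs. zf P x < 2 ^ pu P) \<and> pu P \<le> w \<and> 0 < pu P \<and> 2 * (pu P + 1) \<le> 2 ^ pa P \<and> 2 * (pa P + 2) \<le> 2 ^ pb P \<and>
     bits (length xs) < 2 ^ ph P \<and> s \<le> w \<and> ph P \<le> w \<and> pa P \<le> w \<and> pb P \<le> w \<and> K0 < 2 ^ w"

lemma bits_upper: "0 < k \<Longrightarrow> 2 ^ bits k \<le> 2 * k"
  using bits_ge[of k] bits_pos[of k] by (cases "bits k") auto

lemma double_le_pow: "0 < n \<Longrightarrow> 2 * n \<le> 2 ^ (n::nat)"
  by (induction n rule: nat_induct_non_zero) auto

lemma mult_bound_aux: "(k::nat) < p \<Longrightarrow> 4 \<le> p \<Longrightarrow> 2 * (u * k + 1) \<le> 2 * (u + 1) * p - 1"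
proof -
  assume "k < p" "4 \<le> p"
  have *: "a \<le> b \<Longrightarrow> 2 * (a + 1) \<le> 2 * (b + p) - 1" for a b :: nat using \<open>4 \<le> p\<close> by arith
  have "u * k \<le> u * p" using \<open>k < p\<close> by simp
  from *[OF this] show ?thesis by (simp add: algebra_simps)
qed

text \<open>\<open>node_ok\<close> bounds \<open>2 * (pu P + 1)\<close> and
  \<open>2 * (pa P + 2)\<close> by powers of two, exactly what the two applications of
  \<open>ex_reduction\<close> ask for; perfect hashing is then applied to the reduced keys.\<close>

lemma ex_fks:
  assumes ok: "node_ok P w s xs" and ne: "xs \<noteq> []"
  shows "\<exists>D. fks_ok P xs D"
proof -
  let ?k = "length xs" and ?o = "bits (length xs)"
  have o: "0 < ?o" using ne by (intro bits_pos) auto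
  have k2: "?k ^ 2 < 2 ^ (2 * ?o)"
    using power_strict_mono[OF less_bits[of ?k], of 2] by (simp only: power_mult[symmetric] mult.commute)
  have p4: "(4::nat) \<le> 2 ^ (2 * ?o)" using power_increasing[of 2 "2 * ?o" "2::nat"] o by simp
  let ?Z1 = "zf P ` set xs"
  have cz: "card ?Z1 \<le> ?k" by (meson card_image_le card_length finite_set le_trans)
  have "2 * (pu P * ?k ^ 2 + 1) \<le> 2 * (pu P + 1) * 2 ^ (2 * ?o) - 1"
    by (rule mult_bound_aux[OF k2 p4])
  also have "\<dots> < 2 ^ pa P * 2 ^ (2 * ?o)"
  proof -
    have "2 * (pu P + 1) * 2 ^ (2 * ?o) \<le> 2 ^ pa P * 2 ^ (2 * ?o)" using ok by (intro mult_le_mono1) (simp add: node_ok_def)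
    moreover have "0 < (2::nat) ^ pa P * 2 ^ (2 * ?o)" by simp
    ultimately show ?thesis by linarith
  qed
  finally have c1: "2 * (pu P * ?k ^ 2 + 1) < 2 ^ (2 * ?o + pa P)" by (simp add: power_add mult.commute)
  have "\<exists>q<2 ^ u2 P ?k. inj_on (\<lambda>x. x mod q) ?Z1 \<and> (\<forall>x<2 ^ pu P. x mod q < 2 ^ u2 P ?k)"
    by (rule ex_reduction[of _ _ ?k]) (use ok cz c1 in \<open>auto simp: u2_def node_ok_def min_def\<close>)
  then obtain q2 where q2: "q2 < 2 ^ u2 P ?k" "inj_on (\<lambda>x. x mod q2) ?Z1" "\<And>x. x < 2 ^ pu P \<Longrightarrow> x mod q2 < 2 ^ u2 P ?k" by auto
  let ?Z2 = "(\<lambda>x. x mod q2) ` ?Z1"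
  have cz2: "card ?Z2 \<le> ?k" by (meson card_image_le cz finite_imageI finite_set le_trans)
  have c2: "2 * (u2 P ?k * ?k ^ 2 + 1) < 2 ^ (3 * ?o + pb P)"
  proof -
    have "u2 P ?k \<le> 2 * ?o + pa P" by (simp add: u2_def)
    moreover have "2 * ?o \<le> 2 ^ ?o" using double_le_pow[OF o] .
    moreover have "(1::nat) \<le> 2 ^ ?o" by simp
    moreover have "pa P \<le> pa P * 2 ^ ?o" by simp
    ultimately have "u2 P ?k + 1 \<le> (pa P + 2) * 2 ^ ?o" unfolding distrib_right by linarith
    then have "2 * (u2 P ?k + 1) \<le> 2 * (pa P + 2) * 2 ^ ?o" by simp
    also have "\<dots> \<le> 2 ^ pb P * 2 ^ ?o" using ok by (intro mult_le_mono1) (simp add: node_ok_def)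
    finally have "2 * (u2 P ?k + 1) * 2 ^ (2 * ?o) \<le> 2 ^ pb P * 2 ^ ?o * 2 ^ (2 * ?o)" by (rule mult_le_mono1)
    also have "\<dots> = 2 ^ (3 * ?o + pb P)" by (simp flip: power_add add: algebra_simps)
    finally have 1: "2 * (u2 P ?k + 1) * 2 ^ (2 * ?o) \<le> 2 ^ (3 * ?o + pb P)" .
    have "2 * (u2 P ?k * ?k ^ 2 + 1) \<le> 2 * (u2 P ?k + 1) * 2 ^ (2 * ?o) - 1"
      by (rule mult_bound_aux[OF k2 p4])
    moreover have "0 < 2 * (u2 P ?k + 1) * (2::nat) ^ (2 * ?o)" by simp
    ultimately show ?thesis using 1 by linarith
  qed
  have "\<exists>q<2 ^ u3 P ?k. inj_on (\<lambda>x. x mod q) ?Z2 \<and> (\<forall>x<2 ^ u2 P ?k. x mod q < 2 ^ u3 P ?k)"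
  proof (rule ex_reduction[of _ _ ?k])
    show "?Z2 \<subseteq> {..<2 ^ u2 P ?k}" using q2(3) ok by (auto simp: node_ok_def)
    show "u2 P ?k \<le> u3 P ?k \<or> 2 * (u2 P ?k * ?k ^ 2 + 1) < 2 ^ u3 P ?k" using c2 by (auto simp: u3_def min_def)
  qed (use cz2 in auto)
  then obtain q3 where q3: "q3 < 2 ^ u3 P ?k" "inj_on (\<lambda>x. x mod q3) ?Z2" "\<And>x. x < 2 ^ u2 P ?k \<Longrightarrow> x mod q3 < 2 ^ u3 P ?k" by auto
  let ?Z3 = "(\<lambda>x. x mod q3) ` ?Z2"
  have Z3: "finite ?Z3" "?Z3 \<subseteq> {..<2 ^ u3 P ?k}" using q2(3) q3(3) ok by (auto simp: node_ok_def)
  have "card ?Z3 \<le> card ?Z2" by (rule card_image_le) auto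
  then have cz3: "card ?Z3 \<le> ?k" using cz2 by (rule le_trans)
  have cz3': "card ?Z3 \<le> 2 ^ u3 P ?k" using card_mono[OF _ Z3(2)] by simp
  have u3: "0 < u3 P ?k" using o ok by (auto simp: u3_def u2_def node_ok_def)
  have cr: "card ?Z3 \<le> 2 ^ ur P ?k"
    unfolding ur_def min_def using cz3 cz3' less_bits[of ?k] by auto
  obtain a av rv where h: "a < 2 ^ u3 P ?k" "\<forall>v. av v < 2 ^ u3 P ?k \<and> rv v \<le> u3 P ?k \<and> rv v \<le> bits (2 * card ?Z3 ^ 2)"
    "(\<Sum>v<2 ^ ur P ?k. 2 ^ rv v) \<le> 12 * card ?Z3 + 2 ^ ur P ?k"
    "inj_on (\<lambda>z. (\<Sum>v<msh (u3 P ?k) (ur P ?k) a z. 2 ^ rv v) + msh (u3 P ?k) (rv (msh (u3 P ?k) (ur P ?k) a z)) (av (msh (u3 P ?k) (ur P ?k) a z)) z) ?Z3"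
    using ex_perfect_hash[OF Z3 u3 _ cr] by (auto simp: ur_def)
  let ?D = "(q2, q3, a, av, rv)"
  have "rv v \<le> 2 * ?o + 1" for v
  proof -
    have "2 * card ?Z3 ^ 2 \<le> 2 * ?k ^ 2" using cz3 by (simp add: power_mono)
    also have "\<dots> < 2 ^ (2 * ?o + 1)" using k2 by simp
    finally have "bits (2 * card ?Z3 ^ 2) \<le> 2 * ?o + 1" by (rule bits_le)
    then show ?thesis using h(2) le_trans by blast
  qed
  moreover have "off ?D (2 ^ ur P ?k) \<le> 14 * ?k"
  proof -
    have "(2::nat) ^ ur P ?k \<le> 2 ^ ?o" by (intro power_increasing) (auto simp: ur_def)
    also have "\<dots> \<le> 2 * ?k" using ne by (intro bits_upper) auto
    finally show ?thesis using h(3) cz3 by (simp add: off_def)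
  qed
  moreover have "inj_on (cl P ?k ?D) (set xs)"
  proof -
    have "inj_on (z3 P ?D) (set xs)"
      using comp_inj_on[OF comp_inj_on[OF _ q2(2)] q3(2)[unfolded image_comp]] ok
      by (auto simp: z3_def node_ok_def comp_def inj_on_def)
    moreover have "z3 P ?D ` set xs = ?Z3" by (auto simp: z3_def image_image)
    ultimately show ?thesis using comp_inj_on[of "z3 P ?D" "set xs", OF _ h(4)[folded \<open>z3 P ?D ` set xs = ?Z3\<close>]]
      unfolding cl_def[abs_def] bk_def off_def comp_def by simp
  qed
  ultimately have "fks_ok P xs ?D" using q2 q3 h by (auto simp: fks_ok_def Let_def)
  then show ?thesis by blast
qed

definition plain :: "nat \<Rightarrow> nat list \<Rightarrow> bool list" where
  "plain s xs = arr s (map (\<lambda>x. x mod 2 ^ s) xs)"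

definition fpar :: "prm \<Rightarrow> nat list \<Rightarrow> fkspar" where "fpar P xs = (SOME D. fks_ok P xs D)"

text \<open>The position to try for hash cell \<open>c\<close>. Empty cells get the arbitrary
  position 0; this does no harm, since a query compares the element found there with its
  argument.\<close>

definition fct :: "prm \<Rightarrow> nat list \<Rightarrow> nat \<Rightarrow> nat" where
  "fct P xs c = (if \<exists>x\<in>set xs. cl P (length xs) (fpar P xs) x = c
     then fo xs (SOME x. x \<in> set xs \<and> cl P (length xs) (fpar P xs) x = c) else 0)"

text \<open>The machine has no instruction for bit lengths, so that of the bin size is stored in
  front and all other widths are derived from it. Offsets are at most 14 times the bin size, which
  explains fields of \<open>d + 4\<close> bits.\<close>

definition fks :: "prm \<Rightarrow> nat \<Rightarrow> nat list \<Rightarrow> bool list" where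
  "fks P s xs = (case fpar P xs of (q2, q3, a, av, rv) \<Rightarrow> let k = length xs; d = bits k; N = 2 ^ ur P k in
     tobits (ph P) d @ tobits (u2 P k) q2 @ tobits (u3 P k) q3 @ tobits (u3 P k) a @ plain s xs @
     arr (u3 P k) (map av [0..<N]) @ arr (d + 4) (map (off (fpar P xs)) [0..<N]) @ arr (d + 4) (map rv [0..<N]) @
     arr d (map (fct P xs) [0..<off (fpar P xs) N]))"

lemma fpar_ok: "node_ok P w s xs \<Longrightarrow> xs \<noteq> [] \<Longrightarrow> fks_ok P xs (fpar P xs)"
  unfolding fpar_def by (rule someI_ex) (rule ex_fks)

lemma fct_cl: "fks_ok P xs (fpar P xs) \<Longrightarrow> x \<in> set xs \<Longrightarrow> fct P xs (cl P (length xs) (fpar P xs) x) = fo xs x"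
proof -
  assume a: "fks_ok P xs (fpar P xs)" "x \<in> set xs"
  let ?c = "cl P (length xs) (fpar P xs)"
  let ?y = "SOME y. y \<in> set xs \<and> ?c y = ?c x"
  have "?y \<in> set xs \<and> ?c ?y = ?c x" by (rule someI[of _ x]) (use a in auto)
  moreover have "inj_on ?c (set xs)" using a(1) by (auto simp: fks_ok_def Let_def split: prod.splits)
  ultimately have "?y = x" using a(2) by (auto dest: inj_onD)
  then show ?thesis using a(2) by (auto simp: fct_def)
qed

lemma fct_less: "xs \<noteq> [] \<Longrightarrow> fct P xs c < length xs"
proof -
  assume ne: "xs \<noteq> []"
  show ?thesis
  proof (cases "\<exists>x\<in>set xs. cl P (length xs) (fpar P xs) x = c")
    case True
    then have "(SOME x. x \<in> set xs \<and> cl P (length xs) (fpar P xs) x = c) \<in> set xs"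
      by (metis (mono_tags, lifting) someI_ex)
    then show ?thesis using True by (simp add: fct_def fo_less_iff)
  next
    case False
    then show ?thesis using ne by (auto simp: fct_def)
  qed
qed

text \<open>At most \<open>2 * k\<close> buckets and \<open>14 * k\<close> cells give the
  coefficient 24 of \<open>bits k\<close>, namely 2 * (3 + 2) + 14. The fields occurring once are
  divided among more than \<open>K0\<close> elements.\<close>

lemma length_fks_le:
  assumes ok: "node_ok P w s xs" and k: "K0 < length xs"
  shows "length (fks P s xs) \<le> length xs * (s + A0 * ((bits (length xs) - 1) div 4) + e0 P)"
proof -
  let ?k = "length xs" and ?o = "bits (length xs)" and ?t = "(bits (length xs) - 1) div 4"
  obtain q2 q3 a av rv where D: "fpar P xs = (q2, q3, a, av, rv)" by (metis prod_cases5)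
  have ne: "xs \<noteq> []" using k by auto
  have n: "off (fpar P xs) (2 ^ ur P ?k) \<le> 14 * ?k"
    using fpar_ok[OF ok ne] by (auto simp: fks_ok_def Let_def D)
  have r: "(2::nat) ^ ur P ?k \<le> 2 * ?k"
  proof -
    have "(2::nat) ^ ur P ?k \<le> 2 ^ ?o" by (rule power_increasing) (auto simp: ur_def)
    also have "\<dots> \<le> 2 * ?k" using ne by (intro bits_upper) auto
    finally show ?thesis .
  qed
  have u: "u2 P ?k \<le> 2 * ?o + pa P" "u3 P ?k \<le> 3 * ?o + pb P" by (auto simp: u2_def u3_def)
  have o: "?o \<le> 4 * ?t + 4" "?o \<le> ?k" using bits_le_self[of ?k] by auto
  have "length (fks P s xs) = ph P + u2 P ?k + 2 * u3 P ?k + ?k * s + 2 ^ ur P ?k * (u3 P ?k + 2 * (?o + 4))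
      + off (fpar P xs) (2 ^ ur P ?k) * ?o"
    by (simp add: fks_def D Let_def plain_def algebra_simps)
  also have "\<dots> \<le> ph P + (2 * ?o + pa P) + 2 * (3 * ?o + pb P) + ?k * s + 2 * ?k * (3 * ?o + pb P + 2 * (?o + 4)) + 14 * ?k * ?o"
    using u n r by (intro add_mono mult_mono) auto
  also have "\<dots> = ?k * s + ?k * (24 * ?o + 2 * pb P + 16) + (ph P + pa P + 2 * pb P) + 8 * ?o" by (simp add: algebra_simps)
  also have "\<dots> \<le> ?k * s + ?k * (24 * (4 * ?t + 4) + 2 * pb P + 16) + ?k * ((ph P + pa P + 2 * pb P) div K0 + 1) + ?k * 8"
  proof (intro add_mono mult_le_mono2)
    let ?x = "ph P + pa P + 2 * pb P"
    have "?x \<le> K0 * (?x div K0 + 1)" using dividend_less_times_div[of K0 ?x] by (simp add: K0_def)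
    also have "\<dots> \<le> ?k * (?x div K0 + 1)" using k by (intro mult_le_mono1) auto
    finally show "?x \<le> ?k * (?x div K0 + 1)" .
  qed (use o in auto)
  also have "\<dots> = ?k * (s + A0 * ?t + e0 P)" by (simp add: e0_def A0_def algebra_simps)
  finally show ?thesis .
qed

definition pcmp :: "st set \<Rightarrow> (st \<Rightarrow> prm) \<Rightarrow> bool" where
  "pcmp V P \<longleftrightarrow> cmp V (\<lambda>Z. pq (P Z)) \<and> cmp V (\<lambda>Z. pq' (P Z)) \<and> cmp V (\<lambda>Z. pu (P Z)) \<and> cmp V (\<lambda>Z. ph (P Z)) \<and>
     cmp V (\<lambda>Z. pa (P Z)) \<and> cmp V (\<lambda>Z. pb (P Z))"

lemma pcmp_mono: "pcmp V P \<Longrightarrow> V' \<subseteq> V \<Longrightarrow> pcmp V' P"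
  unfolding pcmp_def by (auto intro: cmp_mono)

text \<open>Moving the product up by \<open>w - u\<close> drops all bits above the
  \<open>u\<close>-th in the overflow; one shift down by \<open>w - r\<close> then undoes this and
  selects the top \<open>r\<close> bits.\<close>

lemma cmp_msh:
  assumes "wf V" "cmp V u" "cmp V r" "cmp V a" "cmp V z" "\<And>Z. Z \<in> V \<Longrightarrow> r Z \<le> u Z \<and> u Z \<le> ww Z"
  shows "cmp V (\<lambda>Z. msh (u Z) (r Z) (a Z) (z Z))"
proof -
  have W: "cmp V ww" by (rule cmp_ww) (use assms(1) wf_aa in auto)
  have "cmp V (\<lambda>Z. (((a Z * z Z) mod 2 ^ ww Z * 2 ^ (ww Z - u Z)) mod 2 ^ ww Z) div 2 ^ (ww Z - r Z))"
    by (intro cmp_shr cmp_shlmod cmp_mulmod cmp_sub W assms) (use assms(6) self_less_pow in \<open>auto intro: le_trans\<close>)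
  moreover have "((x mod 2 ^ w * 2 ^ (w - u)) mod 2 ^ w) div 2 ^ (w - r) = (x mod 2 ^ u) div 2 ^ (u - r)"
    if "r \<le> u" "u \<le> w" for x w u r :: nat
  proof -
    have e: "(2::nat) ^ w = 2 ^ u * 2 ^ (w - u)" "(2::nat) ^ (w - r) = 2 ^ (w - u) * 2 ^ (u - r)"
      using that by (simp_all flip: power_add)
    have "(x mod 2 ^ w * 2 ^ (w - u)) mod 2 ^ w = (x mod 2 ^ w mod 2 ^ u) * 2 ^ (w - u)"
      unfolding e(1) by (rule mult_mod_left[symmetric])
    also have "x mod 2 ^ w mod 2 ^ u = x mod 2 ^ u" using that by (simp add: mod_mod_cancel le_imp_power_dvd)
    finally show ?thesis unfolding e(2) by (simp add: div_mult2_eq)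
  qed
  ultimately show ?thesis unfolding msh_def by (rule cmp_cong) (use assms(6) in auto)
qed

lemma big_word: "8 \<le> w \<Longrightarrow> 8 * w < (2::nat) ^ w"
proof (induction w rule: dec_induct)
  case (step n) then show ?case by simp
qed simp

lemma cmp_small: "wf V \<Longrightarrow> k \<le> 64 \<Longrightarrow> cmp V (\<lambda>Z. k)"
proof (rule cmp_const)
  fix Z assume "wf V" "k \<le> 64" "Z \<in> V"
  then have "8 * ww Z < 2 ^ ww Z" "8 \<le> ww Z" using big_word by (auto simp: wf_def)
  then show "k < 2 ^ ww Z" using \<open>k \<le> 64\<close> by linarith
qed

lemma cmp_plain_nth:
  assumes "wf V" "cmp V A" "cmp V s" "cmp V I"
    "\<And>Z. Z \<in> V \<Longrightarrow> sub (bb Z) (A Z) (plain (s Z) (xs Z)) \<and> A Z + length (xs Z) * s Z < 2 ^ ww Z \<and> s Z \<le> ww Z \<and> I Z < length (xs Z)"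
  shows "cmp V (\<lambda>Z. xs Z ! I Z mod 2 ^ s Z)"
proof -
  have "cmp V (\<lambda>Z. map (\<lambda>x. x mod 2 ^ s Z) (xs Z) ! I Z)"
  proof (rule cmp_arr[OF assms(1-4)])
    fix Z assume v: "Z \<in> V"
    have "I Z * s Z \<le> length (xs Z) * s Z" using assms(5)[OF v] by (intro mult_le_mono1) auto
    moreover have "xs Z ! I Z mod 2 ^ s Z < 2 ^ s Z" by simp
    moreover have "(2::nat) ^ s Z \<le> 2 ^ ww Z" using assms(5)[OF v] by (intro power_increasing) auto
    ultimately have "A Z + I Z * s Z < 2 ^ ww Z" "xs Z ! I Z mod 2 ^ s Z < 2 ^ ww Z"
      using assms(5)[OF v] by linarith+
    then show "sub (bb Z) (A Z) (arr (s Z) (map (\<lambda>x. x mod 2 ^ s Z) (xs Z))) \<and> I Z < length (map (\<lambda>x. x mod 2 ^ s Z) (xs Z)) \<and>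
        map (\<lambda>x. x mod 2 ^ s Z) (xs Z) ! I Z < 2 ^ s Z \<and> map (\<lambda>x. x mod 2 ^ s Z) (xs Z) ! I Z < 2 ^ ww Z \<and> A Z + I Z * s Z < 2 ^ ww Z"
      using assms(5)[OF v] by (auto simp: plain_def)
  qed
  then show ?thesis by (rule cmp_cong) (use assms(5) in auto)
qed

section \<open>Evaluation of the perfect hash table by a query\<close>

abbreviation "fq2 P xs \<equiv> fst (fpar P xs)"
abbreviation "fq3 P xs \<equiv> fst (snd (fpar P xs))"
abbreviation "fa P xs \<equiv> fst (snd (snd (fpar P xs)))"
abbreviation "fav P xs \<equiv> fst (snd (snd (snd (fpar P xs))))"
abbreviation "frv P xs \<equiv> snd (snd (snd (snd (fpar P xs))))"

lemma fks_eq: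
  "fks P s xs = tobits (ph P) (bits (length xs)) @ tobits (u2 P (length xs)) (fq2 P xs) @
     tobits (u3 P (length xs)) (fq3 P xs) @ tobits (u3 P (length xs)) (fa P xs) @ plain s xs @
     arr (u3 P (length xs)) (map (fav P xs) [0..<2 ^ ur P (length xs)]) @
     arr (bits (length xs) + 4) (map (off (fpar P xs)) [0..<2 ^ ur P (length xs)]) @
     arr (bits (length xs) + 4) (map (frv P xs) [0..<2 ^ ur P (length xs)]) @
     arr (bits (length xs)) (map (fct P xs) [0..<off (fpar P xs) (2 ^ ur P (length xs))])"
  by (simp add: fks_def Let_def split: prod.splits)

lemma fks_okD:
  assumes "fks_ok P xs (fpar P xs)"
  shows "fq2 P xs < 2 ^ u2 P (length xs)" "fq3 P xs < 2 ^ u3 P (length xs)" "fa P xs < 2 ^ u3 P (length xs)"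
    "fav P xs v < 2 ^ u3 P (length xs)" "frv P xs v \<le> u3 P (length xs)" "frv P xs v \<le> 2 * bits (length xs) + 1"
    "off (fpar P xs) (2 ^ ur P (length xs)) \<le> 14 * length xs"
  using assms by (auto simp: fks_ok_def Let_def split: prod.splits)

lemma off_mono: "m \<le> n \<Longrightarrow> off D m \<le> off D n"
  by (cases D) (auto simp: off_def intro: sum_mono2)

lemma off_Suc: "off D (Suc m) = off D m + 2 ^ snd (snd (snd (snd D))) m"
  by (cases D) (auto simp: off_def)

lemma cl_eq: "cl P k D x = off D (bk P k D x) +
   msh (u3 P k) (snd (snd (snd (snd D))) (bk P k D x)) (fst (snd (snd (snd D))) (bk P k D x)) (z3 P D x)"
  by (cases D) (auto simp: cl_def)

lemma bk_eq: "bk P k D x = msh (u3 P k) (ur P k) (fst (snd (snd D))) (z3 P D x)"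
  by (cases D) (auto simp: bk_def)

lemma z3_eq: "z3 P D x = zf P x mod fst D mod fst (snd D)"
  by (cases D) (auto simp: z3_def)

lemma pcmpD:
  assumes "pcmp V P"
  shows "cmp V (\<lambda>Z. pq (P Z))" "cmp V (\<lambda>Z. pq' (P Z))" "cmp V (\<lambda>Z. pu (P Z))" "cmp V (\<lambda>Z. ph (P Z))"
     "cmp V (\<lambda>Z. pa (P Z))" "cmp V (\<lambda>Z. pb (P Z))"
  using assms by (auto simp: pcmp_def)

lemma cmp_zf: "pcmp V P \<Longrightarrow> cmp V X \<Longrightarrow> cmp V (\<lambda>Z. zf (P Z) (X Z))"
  unfolding zf_def by (intro cmp_mod pcmpD)

text \<open>Hash values stay within the table for every argument, member or not, so the search
  always arrives at a valid position. Since the argument agrees with all elements of the bin above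
  bit \<open>s\<close>, comparing the low bits decides membership.\<close>

lemma
  assumes wf: "wf V" and P: "pcmp V P" and A: "cmp V A" and s: "cmp V s" and k: "cmp V (\<lambda>Z. length (xs Z))"
    and ok: "\<And>Z. Z \<in> V \<Longrightarrow> node_ok (P Z) (ww Z) (s Z) (xs Z) \<and> xs Z \<noteq> [] \<and> 0 < s Z \<and>
       sub (bb Z) (A Z) (fks (P Z) (s Z) (xs Z)) \<and> A Z + length (fks (P Z) (s Z) (xs Z)) < 2 ^ ww Z"
  shows cmp_fks_nth: "cmp V I \<Longrightarrow> (\<And>Z. Z \<in> V \<Longrightarrow> I Z < length (xs Z)) \<Longrightarrow> cmp V (\<lambda>Z. xs Z ! I Z mod 2 ^ s Z)"
    and cmp_fks_fo: "cmp V X \<Longrightarrow> (\<And>Z x. Z \<in> V \<Longrightarrow> x \<in> set (xs Z) \<Longrightarrow> x div 2 ^ s Z = X Z div 2 ^ s Z) \<Longrightarrow>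
      cmp V (\<lambda>Z. fo (xs Z) (X Z))"
proof -
  let ?k = "\<lambda>Z. length (xs Z)"
  define d where "d Z = bits (?k Z)" for Z
  define v2 where "v2 Z = u2 (P Z) (?k Z)" for Z
  define v3 where "v3 Z = u3 (P Z) (?k Z)" for Z
  define N where "N Z = (2::nat) ^ ur (P Z) (?k Z)" for Z
  define D where "D Z = fpar (P Z) (xs Z)" for Z
  have wf': "8 * ww Z < 2 ^ ww Z" "8 \<le> ww Z" if "Z \<in> V" for Z using wf that big_word by (auto simp: wf_def)
  have D: "fks_ok (P Z) (xs Z) (fpar (P Z) (xs Z))" if "Z \<in> V" for Z using fpar_ok ok[OF that] by blast
  note Dok = fks_okD[OF D]
  have nk: "node_ok (P Z) (ww Z) (s Z) (xs Z)" if "Z \<in> V" for Z using ok[OF that] by blast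
  have bnd: "A Z + ph (P Z) + v2 Z + v3 Z + v3 Z + ?k Z * s Z + N Z * v3 Z + N Z * (d Z + 4) + N Z * (d Z + 4)
      + off (D Z) (N Z) * d Z < 2 ^ ww Z" if "Z \<in> V" for Z
    using ok[OF that] by (simp add: fks_eq d_def v2_def v3_def N_def D_def plain_def algebra_simps)
  have small: "?k Z < 2 ^ ww Z" "d Z \<le> ww Z" "0 < d Z" "v2 Z \<le> ww Z" "v3 Z \<le> v2 Z" "0 < v3 Z" "N Z < 2 ^ ww Z" "ur (P Z) (?k Z) \<le> v3 Z" "pa (P Z) \<le> ww Z" "pb (P Z) \<le> ww Z"
    "s Z \<le> ww Z" "ph (P Z) \<le> ww Z" "d Z < 2 ^ ph (P Z)" if v: "Z \<in> V" for Z
  proof -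
    \<comment> \<open>A bin stores at least one bit per element, so its size fits into a word
      because its end address does.\<close>
    have "?k Z \<le> ?k Z * s Z" using ok[OF v] by simp
    then show kk: "?k Z < 2 ^ ww Z" using bnd[OF v] by linarith
    then show "d Z \<le> ww Z" unfolding d_def by (rule bits_le)
    show "0 < d Z" unfolding d_def using ok[OF v] by (intro bits_pos) auto
    then show "0 < v3 Z" using nk[OF v] by (auto simp: v3_def u3_def u2_def d_def node_ok_def)
    then have "N Z \<le> N Z * v3 Z" by simp
    then show "N Z < 2 ^ ww Z" using bnd[OF v] by linarith
  qed (use nk[OF v] in \<open>auto simp: v2_def v3_def u2_def u3_def ur_def d_def node_ok_def\<close>)
  have subs: "sub (bb Z) (A Z) (tobits (ph (P Z)) (d Z))"
     "sub (bb Z) (A Z + ph (P Z)) (tobits (v2 Z) (fst (D Z)))"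
     "sub (bb Z) (A Z + ph (P Z) + v2 Z) (tobits (v3 Z) (fst (snd (D Z))))"
     "sub (bb Z) (A Z + ph (P Z) + v2 Z + v3 Z) (tobits (v3 Z) (fst (snd (snd (D Z)))))"
     "sub (bb Z) (A Z + ph (P Z) + v2 Z + v3 Z + v3 Z) (plain (s Z) (xs Z))"
     "sub (bb Z) (A Z + ph (P Z) + v2 Z + v3 Z + v3 Z + ?k Z * s Z) (arr (v3 Z) (map (fst (snd (snd (snd (D Z))))) [0..<N Z]))"
     "sub (bb Z) (A Z + ph (P Z) + v2 Z + v3 Z + v3 Z + ?k Z * s Z + N Z * v3 Z) (arr (d Z + 4) (map (off (D Z)) [0..<N Z]))"
     "sub (bb Z) (A Z + ph (P Z) + v2 Z + v3 Z + v3 Z + ?k Z * s Z + N Z * v3 Z + N Z * (d Z + 4)) (arr (d Z + 4) (map (snd (snd (snd (snd (D Z))))) [0..<N Z]))"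
     "sub (bb Z) (A Z + ph (P Z) + v2 Z + v3 Z + v3 Z + ?k Z * s Z + N Z * v3 Z + N Z * (d Z + 4) + N Z * (d Z + 4)) (arr (d Z) (map (fct (P Z) (xs Z)) [0..<off (D Z) (N Z)]))"
     if "Z \<in> V" for Z
    using ok[OF that] unfolding fks_eq sub_append d_def[symmetric] v2_def[symmetric] v3_def[symmetric] N_def[symmetric] D_def[symmetric]
    by (simp_all add: plain_def add.assoc)
  have pw: "(2::nat) ^ v2 Z \<le> 2 ^ ww Z" "(2::nat) ^ v3 Z \<le> 2 ^ ww Z" if "Z \<in> V" for Z
    using small[OF that] by (auto intro!: power_increasing)
  note c = pcmpD[OF P]
  have cd: "cmp V d" by (rule cmp_field[OF wf A c(4)]) (use subs(1) small bnd less_exp in \<open>fastforce intro: le_less_trans\<close>)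
  have c2: "cmp V (\<lambda>Z. 2 * d Z + pa (P Z))"
    by (intro cmp_add cmp_mul cmp_small wf cd c) (use small wf' in \<open>fastforce+\<close>)
  have c3: "cmp V (\<lambda>Z. 3 * d Z + pb (P Z))"
    by (intro cmp_add cmp_mul cmp_small wf cd c) (use small wf' in \<open>fastforce+\<close>)
  have cv2: "cmp V v2" unfolding v2_def u2_def d_def[symmetric] by (intro cmp_min wf_pos wf c c2)
  have cv3: "cmp V v3" unfolding v3_def u3_def v2_def[symmetric] d_def[symmetric] by (intro cmp_min wf_pos wf c3 cv2)
  have cur: "cmp V (\<lambda>Z. ur (P Z) (?k Z))" unfolding ur_def v3_def[symmetric] d_def[symmetric] by (intro cmp_min wf_pos wf cd cv3)
  have cN: "cmp V N"
    by (rule cmp_cong[OF cmp_shl[OF cmp_1[OF wf_pos[OF wf]] cur]]) (use small(7) in \<open>auto simp: N_def\<close>)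
  have cd4: "cmp V (\<lambda>Z. d Z + 4)" by (intro cmp_add cmp_small wf cd) (use small wf' in \<open>fastforce+\<close>)
  have a1: "cmp V (\<lambda>Z. A Z + ph (P Z))" by (intro cmp_add A c) (use bnd in fastforce)
  have a2: "cmp V (\<lambda>Z. A Z + ph (P Z) + v2 Z)" by (intro cmp_add a1 cv2) (use bnd in fastforce)
  have a3: "cmp V (\<lambda>Z. A Z + ph (P Z) + v2 Z + v3 Z)" by (intro cmp_add a2 cv3) (use bnd in fastforce)
  have a4: "cmp V (\<lambda>Z. A Z + ph (P Z) + v2 Z + v3 Z + v3 Z)" by (intro cmp_add a3 cv3) (use bnd in fastforce)
  have a5: "cmp V (\<lambda>Z. A Z + ph (P Z) + v2 Z + v3 Z + v3 Z + ?k Z * s Z)" by (intro cmp_add a4 cmp_mul k s; frule bnd; linarith)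
  have a6: "cmp V (\<lambda>Z. A Z + ph (P Z) + v2 Z + v3 Z + v3 Z + ?k Z * s Z + N Z * v3 Z)"
    by (intro cmp_add a5 cmp_mul cN cv3; frule bnd; linarith)
  have a7: "cmp V (\<lambda>Z. A Z + ph (P Z) + v2 Z + v3 Z + v3 Z + ?k Z * s Z + N Z * v3 Z + N Z * (d Z + 4))"
    by (rule cmp_add[OF a6 cmp_mul[OF cN cd4]]; frule bnd; linarith)
  have a8: "cmp V (\<lambda>Z. A Z + ph (P Z) + v2 Z + v3 Z + v3 Z + ?k Z * s Z + N Z * v3 Z + N Z * (d Z + 4) + N Z * (d Z + 4))"
    by (rule cmp_add[OF a7 cmp_mul[OF cN cd4]]; frule bnd; linarith)
  show nth: "cmp V (\<lambda>Z. xs Z ! I Z mod 2 ^ s Z)" if "cmp V I" "\<And>Z. Z \<in> V \<Longrightarrow> I Z < length (xs Z)" for I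
  proof (rule cmp_plain_nth[OF wf a4 s that(1)])
    fix Z assume v: "Z \<in> V"
    show "sub (bb Z) (A Z + ph (P Z) + v2 Z + v3 Z + v3 Z) (plain (s Z) (xs Z)) \<and>
         A Z + ph (P Z) + v2 Z + v3 Z + v3 Z + ?k Z * s Z < 2 ^ ww Z \<and> s Z \<le> ww Z \<and> I Z < ?k Z"
      using subs(5)[OF v] bnd[OF v] small(11)[OF v] that(2)[OF v] by linarith
  qed
  have cq2: "cmp V (\<lambda>Z. fst (D Z))"
  proof (rule cmp_field[OF wf a1 cv2])
    fix Z assume v: "Z \<in> V"
    have "fst (D Z) < 2 ^ v2 Z" using Dok(1)[OF v] by (simp add: D_def v2_def)
    then show "sub (bb Z) (A Z + ph (P Z)) (tobits (v2 Z) (fst (D Z))) \<and> fst (D Z) < 2 ^ v2 Z \<and> fst (D Z) < 2 ^ ww Z \<and> A Z + ph (P Z) < 2 ^ ww Z"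
      using subs(2)[OF v] bnd[OF v] pw[OF v] by linarith
  qed
  have cq3: "cmp V (\<lambda>Z. fst (snd (D Z)))"
  proof (rule cmp_field[OF wf a2 cv3])
    fix Z assume v: "Z \<in> V"
    have "fst (snd (D Z)) < 2 ^ v3 Z" using Dok(2)[OF v] by (simp add: D_def v3_def)
    then show "sub (bb Z) (A Z + ph (P Z) + v2 Z) (tobits (v3 Z) (fst (snd (D Z)))) \<and> fst (snd (D Z)) < 2 ^ v3 Z \<and> fst (snd (D Z)) < 2 ^ ww Z \<and> A Z + ph (P Z) + v2 Z < 2 ^ ww Z"
      using subs(3)[OF v] bnd[OF v] pw[OF v] by linarith
  qed
  have ca: "cmp V (\<lambda>Z. fst (snd (snd (D Z))))"
  proof (rule cmp_field[OF wf a3 cv3])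
    fix Z assume v: "Z \<in> V"
    have "fst (snd (snd (D Z))) < 2 ^ v3 Z" using Dok(3)[OF v] by (simp add: D_def v3_def)
    then show "sub (bb Z) (A Z + ph (P Z) + v2 Z + v3 Z) (tobits (v3 Z) (fst (snd (snd (D Z))))) \<and> fst (snd (snd (D Z))) < 2 ^ v3 Z \<and> fst (snd (snd (D Z))) < 2 ^ ww Z \<and> A Z + ph (P Z) + v2 Z + v3 Z < 2 ^ ww Z"
      using subs(4)[OF v] bnd[OF v] pw[OF v] by linarith
  qed
  show "cmp V (\<lambda>Z. fo (xs Z) (X Z))" if X: "cmp V X" and pre: "\<And>Z x. Z \<in> V \<Longrightarrow> x \<in> set (xs Z) \<Longrightarrow> x div 2 ^ s Z = X Z div 2 ^ s Z" for X
  proof -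
    define z where "z Z = z3 (P Z) (D Z) (X Z)" for Z
    define b where "b Z = bk (P Z) (?k Z) (D Z) (X Z)" for Z
    have cz: "cmp V z" unfolding z_def z3_eq by (intro cmp_mod cmp_zf P X cq2 cq3)
    have cb: "cmp V b" unfolding b_def bk_eq v3_def[symmetric] z_def[symmetric]
      by (intro cmp_msh wf cv3 cur ca cz) (use small in \<open>fastforce intro: le_trans\<close>)
    have bN: "b Z < N Z" if "Z \<in> V" for Z
      unfolding b_def bk_eq N_def by (rule msh_less) (simp add: ur_def)
    have ble: "b Z * x \<le> N Z * x" if "Z \<in> V" for Z x using bN[OF that] by simp
    have offN: "off (D Z) (N Z) < 2 ^ (d Z + 4)" "off (D Z) (b Z) < 2 ^ ww Z" "off (D Z) (Suc (b Z)) \<le> off (D Z) (N Z)" "off (D Z) (N Z) < 2 ^ ww Z"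
      "off (D Z) (b Z) \<le> off (D Z) (N Z)" if v: "Z \<in> V" for Z
    proof -
      have "off (D Z) (N Z) \<le> 14 * ?k Z" using Dok(7)[OF v] by (simp add: D_def N_def)
      also have "\<dots> < 16 * 2 ^ d Z" using less_bits[of "?k Z"] unfolding d_def by linarith
      finally show "off (D Z) (N Z) < 2 ^ (d Z + 4)" by (simp add: power_add)
      have "off (D Z) (N Z) \<le> off (D Z) (N Z) * d Z" using small(3)[OF v] by simp
      then show 1: "off (D Z) (N Z) < 2 ^ ww Z" using bnd[OF v] by linarith
      show "off (D Z) (Suc (b Z)) \<le> off (D Z) (N Z)" "off (D Z) (b Z) \<le> off (D Z) (N Z)" using bN[OF v] by (auto intro!: off_mono)
      then show "off (D Z) (b Z) < 2 ^ ww Z" using 1 by linarith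
    qed
    have cav: "cmp V (\<lambda>Z. map (fst (snd (snd (snd (D Z))))) [0..<N Z] ! b Z)"
    proof (rule cmp_arr[OF wf a5 cv3 cb])
      fix Z assume v: "Z \<in> V"
      have "fst (snd (snd (snd (D Z)))) (b Z) < 2 ^ v3 Z" using Dok(4)[OF v] by (simp add: D_def v3_def)
      then have 1: "fst (snd (snd (snd (D Z)))) (b Z) < 2 ^ v3 Z" "fst (snd (snd (snd (D Z)))) (b Z) < 2 ^ ww Z" using pw(2)[OF v] by linarith+
      have "A Z + ph (P Z) + v2 Z + v3 Z + v3 Z + ?k Z * s Z + b Z * v3 Z < 2 ^ ww Z" using bnd[OF v] ble[OF v, of "v3 Z"] by linarith
      then show "sub (bb Z) (A Z + ph (P Z) + v2 Z + v3 Z + v3 Z + ?k Z * s Z) (arr (v3 Z) (map (fst (snd (snd (snd (D Z))))) [0..<N Z])) \<and>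
        b Z < length (map (fst (snd (snd (snd (D Z))))) [0..<N Z]) \<and> map (fst (snd (snd (snd (D Z))))) [0..<N Z] ! b Z < 2 ^ v3 Z \<and>
        map (fst (snd (snd (snd (D Z))))) [0..<N Z] ! b Z < 2 ^ ww Z \<and> A Z + ph (P Z) + v2 Z + v3 Z + v3 Z + ?k Z * s Z + b Z * v3 Z < 2 ^ ww Z"
        using subs(6)[OF v] 1 bN[OF v] by simp
    qed
    have coff: "cmp V (\<lambda>Z. map (off (D Z)) [0..<N Z] ! b Z)"
    proof (rule cmp_arr[OF wf a6 cd4 cb])
      fix Z assume v: "Z \<in> V"
      have "A Z + ph (P Z) + v2 Z + v3 Z + v3 Z + ?k Z * s Z + N Z * v3 Z + b Z * (d Z + 4) < 2 ^ ww Z" using bnd[OF v] ble[OF v, of "d Z + 4"] by linarith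
      then show "sub (bb Z) (A Z + ph (P Z) + v2 Z + v3 Z + v3 Z + ?k Z * s Z + N Z * v3 Z) (arr (d Z + 4) (map (off (D Z)) [0..<N Z])) \<and>
        b Z < length (map (off (D Z)) [0..<N Z]) \<and> map (off (D Z)) [0..<N Z] ! b Z < 2 ^ (d Z + 4) \<and>
        map (off (D Z)) [0..<N Z] ! b Z < 2 ^ ww Z \<and> A Z + ph (P Z) + v2 Z + v3 Z + v3 Z + ?k Z * s Z + N Z * v3 Z + b Z * (d Z + 4) < 2 ^ ww Z"
        using subs(7)[OF v] offN[OF v] bN[OF v] by simp
    qed
    have crv: "cmp V (\<lambda>Z. map (snd (snd (snd (snd (D Z))))) [0..<N Z] ! b Z)"
    proof (rule cmp_arr[OF wf a7 cd4 cb])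
      fix Z assume v: "Z \<in> V"
      have r: "snd (snd (snd (snd (D Z)))) (b Z) \<le> v3 Z" "snd (snd (snd (snd (D Z)))) (b Z) \<le> 2 * d Z + 1"
        using Dok(5,6)[OF v] by (simp_all add: D_def v3_def d_def)
      have 1: "snd (snd (snd (snd (D Z)))) (b Z) < 2 ^ ww Z" using r small[OF v] less_exp[of "ww Z"] by linarith
      have "snd (snd (snd (snd (D Z)))) (b Z) < 2 ^ d Z * 16" using r(2) less_exp[of "d Z"] by linarith
      then have 2: "snd (snd (snd (snd (D Z)))) (b Z) < 2 ^ (d Z + 4)" by (simp add: power_add)
      have "A Z + ph (P Z) + v2 Z + v3 Z + v3 Z + ?k Z * s Z + N Z * v3 Z + N Z * (d Z + 4) + b Z * (d Z + 4) < 2 ^ ww Z" using bnd[OF v] ble[OF v, of "d Z + 4"] by linarith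
      then show "sub (bb Z) (A Z + ph (P Z) + v2 Z + v3 Z + v3 Z + ?k Z * s Z + N Z * v3 Z + N Z * (d Z + 4)) (arr (d Z + 4) (map (snd (snd (snd (snd (D Z))))) [0..<N Z])) \<and>
        b Z < length (map (snd (snd (snd (snd (D Z))))) [0..<N Z]) \<and> map (snd (snd (snd (snd (D Z))))) [0..<N Z] ! b Z < 2 ^ (d Z + 4) \<and>
        map (snd (snd (snd (snd (D Z))))) [0..<N Z] ! b Z < 2 ^ ww Z \<and> A Z + ph (P Z) + v2 Z + v3 Z + v3 Z + ?k Z * s Z + N Z * v3 Z + N Z * (d Z + 4) + b Z * (d Z + 4) < 2 ^ ww Z"
        using subs(8)[OF v] 1 2 bN[OF v] by simp
    qed
    define av where "av Z = fst (snd (snd (snd (D Z)))) (b Z)" for Z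
    define rv where "rv Z = snd (snd (snd (snd (D Z)))) (b Z)" for Z
    have c': "cmp V av" "cmp V (\<lambda>Z. off (D Z) (b Z))" "cmp V rv"
      by (rule cmp_cong[OF cav] cmp_cong[OF coff] cmp_cong[OF crv]; use bN in \<open>simp add: av_def rv_def\<close>)+
    have rv3: "rv Z \<le> v3 Z" if "Z \<in> V" for Z using Dok(5)[OF that] by (simp add: D_def v3_def rv_def)
    define e where "e Z = cl (P Z) (?k Z) (D Z) (X Z)" for Z
    have ee: "e Z = off (D Z) (b Z) + msh (v3 Z) (rv Z) (av Z) (z Z)" for Z
      unfolding e_def cl_eq b_def v3_def rv_def av_def z_def ..
    have elt: "e Z < off (D Z) (N Z)" if v: "Z \<in> V" for Z
    proof -
      have "e Z < off (D Z) (Suc (b Z))" unfolding ee off_Suc using msh_less[OF rv3[OF v]] by (simp add: rv_def)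
      then show ?thesis using offN(3)[OF v] by linarith
    qed
    have cm: "cmp V (\<lambda>Z. msh (v3 Z) (rv Z) (av Z) (z Z))"
      by (intro cmp_msh wf cv3 c' cz) (use small rv3 in \<open>fastforce intro: le_trans\<close>)
    have ce: "cmp V e"
    proof (rule cmp_cong[OF cmp_add[OF c'(2) cm]])
      fix Z assume v: "Z \<in> V"
      show "off (D Z) (b Z) + msh (v3 Z) (rv Z) (av Z) (z Z) < 2 ^ ww Z" using elt[OF v] offN(4)[OF v] ee[of Z] by linarith
    qed (simp add: ee)
    define p where "p Z = fct (P Z) (xs Z) (e Z)" for Z
    have pk: "p Z < ?k Z" if "Z \<in> V" for Z unfolding p_def using ok[OF that] fct_less by blast
    have "cmp V (\<lambda>Z. map (fct (P Z) (xs Z)) [0..<off (D Z) (N Z)] ! e Z)"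
    proof (rule cmp_arr[OF wf a8 cd ce])
      fix Z assume v: "Z \<in> V"
      have "e Z * d Z \<le> off (D Z) (N Z) * d Z" using elt[OF v] by simp
      then have 1: "A Z + ph (P Z) + v2 Z + v3 Z + v3 Z + ?k Z * s Z + N Z * v3 Z + N Z * (d Z + 4) + N Z * (d Z + 4) + e Z * d Z < 2 ^ ww Z" using bnd[OF v] by linarith
      have "p Z < 2 ^ d Z" "p Z < 2 ^ ww Z" using pk[OF v] less_bits[of "?k Z"] small(1)[OF v] unfolding d_def by linarith+
      then show "sub (bb Z) (A Z + ph (P Z) + v2 Z + v3 Z + v3 Z + ?k Z * s Z + N Z * v3 Z + N Z * (d Z + 4) + N Z * (d Z + 4)) (arr (d Z) (map (fct (P Z) (xs Z)) [0..<off (D Z) (N Z)])) \<and>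
        e Z < length (map (fct (P Z) (xs Z)) [0..<off (D Z) (N Z)]) \<and> map (fct (P Z) (xs Z)) [0..<off (D Z) (N Z)] ! e Z < 2 ^ d Z \<and>
        map (fct (P Z) (xs Z)) [0..<off (D Z) (N Z)] ! e Z < 2 ^ ww Z \<and> A Z + ph (P Z) + v2 Z + v3 Z + v3 Z + ?k Z * s Z + N Z * v3 Z + N Z * (d Z + 4) + N Z * (d Z + 4) + e Z * d Z < 2 ^ ww Z"
        using subs(9)[OF v] 1 elt[OF v] by (simp add: p_def)
    qed
    then have cp: "cmp V p" by (rule cmp_cong) (use elt in \<open>simp add: p_def\<close>)
    have cs: "cmp V (\<lambda>Z. X Z mod 2 ^ s Z)"
    proof -
      have W: "cmp V ww" by (rule cmp_ww) (use wf wf_aa in auto)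
      have "cmp V (\<lambda>Z. msh (s Z) (s Z) 1 (X Z))"
        by (intro cmp_msh wf s cmp_1 wf_pos X) (use small(11) in auto)
      then show ?thesis by (simp add: msh_def)
    qed
    have "cmp V (\<lambda>Z. if xs Z ! p Z mod 2 ^ s Z = X Z mod 2 ^ s Z then p Z else ?k Z)"
      by (intro cmp_if cmp_eq wf_pos wf nth cp pk cs cmp_inter[OF cp] cmp_inter[OF k])
    then show ?thesis
    proof (rule cmp_cong)
      fix Z assume v: "Z \<in> V"
      show "(if xs Z ! p Z mod 2 ^ s Z = X Z mod 2 ^ s Z then p Z else ?k Z) = fo (xs Z) (X Z)"
      proof (cases "X Z \<in> set (xs Z)")
        case True
        then have "p Z = fo (xs Z) (X Z)" unfolding p_def e_def D_def by (rule fct_cl[OF D[OF v]])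
        then show ?thesis using fo_nth[OF True] by simp
      next
        case False
        have "xs Z ! p Z \<in> set (xs Z)" using pk[OF v] by simp
        then have "xs Z ! p Z mod 2 ^ s Z \<noteq> X Z mod 2 ^ s Z"
          using pre[OF v] False by (metis div_mult_mod_eq)
        then show ?thesis using False fo_less_iff[of "xs Z" "X Z"] fo_le[of "xs Z" "X Z"] by auto
      qed
    qed
  qed
qed

subsection \<open>Splitting a bin by leading bits\<close>

text \<open>About a quarter of lg k: \<open>2 ^ (4 * tau k) <= k < 2 ^ (4 * tau k + 4)\<close>.
  Arrays with about \<open>2 ^ (3 * tau k)\<close> entries of \<open>bits k\<close> bits therefore
  take O(k) bits.\<close>

definition tau :: "nat \<Rightarrow> nat" where "tau k = (bits k - 1) div 4"
definition tt :: "nat \<Rightarrow> nat \<Rightarrow> nat" where "tt s k = min s (tau k)"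
definition sb :: "nat \<Rightarrow> nat \<Rightarrow> nat \<Rightarrow> nat" where "sb s t x = (x mod 2 ^ s) div 2 ^ (s - t)"
text \<open>Cells of about the square root of \<open>k\<close> positions, so that both the cells and
  the pairs of a group and an offset within a cell are few enough to be tabulated.\<close>

definition cs :: "nat \<Rightarrow> nat" where "cs k = 2 ^ (2 * tau k)"
definition ncl :: "nat \<Rightarrow> nat" where "ncl k = (k - 1) div cs k + 1"

abbreviation sbx :: "nat \<Rightarrow> nat list \<Rightarrow> nat \<Rightarrow> nat" where "sbx s xs \<equiv> sb s (tt s (length xs))"

text \<open>The entry of index \<^term>\<open>v * cs k + i\<close> describes position \<open>i\<close> of the one cell of positions whose
  first element has leading bits \<open>v\<close> and some later element has not.\<close>

definition spY :: "nat \<Rightarrow> nat list \<Rightarrow> nat \<Rightarrow> nat" where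
  "spY s xs j = (let k = length xs; f = sbx s xs; i = cs k * (cnt f xs (j div cs k + 1) div cs k) + j mod cs k
     in if i < k then f (xs ! i) else 0)"

definition spt :: "prm \<Rightarrow> nat \<Rightarrow> nat list \<Rightarrow> bool list" where
  "spt P s xs = (let k = length xs; d = bits k; f = sbx s xs; n = 2 ^ tt s k in
     tobits (ph P) d @ arr d (map (cnt f xs) [0..<n + 1]) @ arr d (map (\<lambda>c. f (xs ! (c * cs k))) [0..<ncl k]) @
     arr d (map (spY s xs) [0..<n * cs k]))"

text \<open>Bits reserved per element for the children. Using one rate for all of them makes the
  address of a child a multiple of the number of preceding elements.\<close>

definition stride :: "nat \<Rightarrow> prm \<Rightarrow> nat \<Rightarrow> nat \<Rightarrow> nat" where
  "stride j P s k = s + (A0 - Suc j) * tau k + e0 P + j * ed P"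

text \<open>Splitting off \<open>tau k\<close> leading bits saves as many bits per element; \<open>A0\<close> such levels pay for perfect hashing at the leaves.\<close>

primrec enc :: "nat \<Rightarrow> prm \<Rightarrow> nat \<Rightarrow> nat list \<Rightarrow> bool list" where
  "enc 0 P s xs = (if s = 0 then [] else if length xs \<le> K0 then plain s xs else fks P s xs)"
| "enc (Suc j) P s xs = (if s = 0 then [] else if length xs \<le> K0 then plain s xs else
     spt P s xs @ cat (\<lambda>v. padto (stride j P s (length xs) * length (seg (sbx s xs) xs v))
       (enc j P (s - tt s (length xs)) (seg (sbx s xs) xs v))) (2 ^ tt s (length xs)))"

lemma sb_less: "t \<le> s \<Longrightarrow> sb s t x < 2 ^ t"
proof -
  assume "t \<le> s"
  then have "(2::nat) ^ s = 2 ^ t * 2 ^ (s - t)" by (simp flip: power_add)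
  then have "x mod 2 ^ s < 2 ^ t * 2 ^ (s - t)" by (metis mod_less_divisor zero_less_numeral zero_less_power)
  then show ?thesis unfolding sb_def by (simp add: less_mult_imp_div_less)
qed

lemma sb_decomp: "t \<le> s \<Longrightarrow> x mod 2 ^ s = sb s t x * 2 ^ (s - t) + x mod 2 ^ (s - t)"
proof -
  assume "t \<le> s"
  have "x mod 2 ^ s = (x mod 2 ^ s) div 2 ^ (s - t) * 2 ^ (s - t) + (x mod 2 ^ s) mod 2 ^ (s - t)"
    by (simp only: div_mult_mod_eq)
  also have "(x mod 2 ^ s) mod 2 ^ (s - t) = x mod 2 ^ (s - t)" by (simp add: mod_mod_cancel le_imp_power_dvd)
  finally show ?thesis by (simp add: sb_def)
qed

lemma sb_prefix: "t \<le> s \<Longrightarrow> x div 2 ^ (s - t) = (x div 2 ^ s) * 2 ^ t + sb s t x"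
proof -
  assume t: "t \<le> s"
  have e: "(2::nat) ^ s = 2 ^ t * 2 ^ (s - t)" using t by (simp flip: power_add)
  have "x = (x div 2 ^ s) * 2 ^ s + x mod 2 ^ s" by (rule div_mult_mod_eq[symmetric])
  then have "x div 2 ^ (s - t) = ((x div 2 ^ s * 2 ^ t) * 2 ^ (s - t) + x mod 2 ^ s) div 2 ^ (s - t)"
    unfolding e by (metis mult.assoc)
  also have "\<dots> = x div 2 ^ s * 2 ^ t + (x mod 2 ^ s) div 2 ^ (s - t)" by simp
  finally show ?thesis by (simp add: sb_def)
qed

lemma tt_le: "tt s k \<le> s" by (simp add: tt_def)

lemma sorted_sb:
  assumes "sorted xs" "\<forall>x\<in>set xs. \<forall>y\<in>set xs. x div 2 ^ s = y div 2 ^ s"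
  shows "sorted (map (sb s t) xs)"
proof -
  have "sb s t x \<le> sb s t y" if "x \<le> y" "x \<in> set xs" "y \<in> set xs" for x y
  proof -
    have e: "x div 2 ^ s = y div 2 ^ s" using that assms(2) by blast
    have "x div 2 ^ s * 2 ^ s + x mod 2 ^ s \<le> y div 2 ^ s * 2 ^ s + y mod 2 ^ s" using that by (simp only: div_mult_mod_eq)
    then have "x mod 2 ^ s \<le> y mod 2 ^ s" unfolding e by simp
    then show ?thesis unfolding sb_def by (rule div_le_mono)
  qed
  then show ?thesis using assms(1) sorted_wrt_mono_rel[of xs "(\<le>)" "\<lambda>x y. sb s t x \<le> sb s t y"]
    unfolding sorted_map by blast
qed

lemma node_ok_sorted: "node_ok P w s xs \<Longrightarrow> sorted (map (sb s t) xs)"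
  unfolding node_ok_def by (rule sorted_sb) blast+

lemma node_ok_seg:
  assumes "node_ok P w s xs"
  shows "node_ok P w (s - tt s (length xs)) (seg (sbx s xs) xs v)"
proof -
  let ?t = "tt s (length xs)" and ?g = "seg (sbx s xs) xs v"
  have so: "sorted (map (sbx s xs) xs)" using assms by (rule node_ok_sorted)
  have st: "set ?g = {x \<in> set xs. sb s ?t x = v}" by (rule set_seg[OF so])
  have "length ?g \<le> length xs" by (simp add: seg_def)
  then have "bits (length ?g) < 2 ^ ph P" using bits_mono[of "length ?g" "length xs"] assms by (auto simp: node_ok_def)
  moreover have "x div 2 ^ (s - ?t) = y div 2 ^ (s - ?t)" if "x \<in> set ?g" "y \<in> set ?g" for x y
  proof -
    have "x div 2 ^ s = y div 2 ^ s" using that assms st unfolding node_ok_def by blast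
    then show ?thesis using that st sb_prefix[OF tt_le, of x s "length xs"] sb_prefix[OF tt_le, of y s "length xs"] by auto
  qed
  moreover have "sorted ?g" using assms by (intro sorted_seg) (simp only: node_ok_def)
  moreover have "set ?g \<subseteq> set xs" using st by blast
  moreover from this have "inj_on (zf P) (set ?g)" "\<forall>x\<in>set ?g. zf P x < 2 ^ pu P"
    using assms unfolding node_ok_def by (blast intro: inj_on_subset)+
  moreover have "s - ?t \<le> w" using assms unfolding node_ok_def by linarith
  ultimately show ?thesis using assms unfolding node_ok_def by (intro conjI) blast+
qed

lemma tau_bound: "0 < k \<Longrightarrow> 2 ^ (4 * tau k) \<le> k" "k < 2 ^ (4 * tau k + 4)"
proof -
  assume "0 < k"
  have "(2::nat) ^ (4 * tau k) \<le> 2 ^ (bits k - 1)" by (intro power_increasing) (auto simp: tau_def)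
  then show "2 ^ (4 * tau k) \<le> k" using bits_ge[OF \<open>0 < k\<close>] by linarith
next
  have "k < 2 ^ bits k" by (rule less_bits)
  also have "(2::nat) ^ bits k \<le> 2 ^ (4 * tau k + 4)" by (intro power_increasing) (auto simp: tau_def)
  finally show "k < 2 ^ (4 * tau k + 4)" .
qed

lemma length_spt: "length (spt P s xs) = ph P + (2 ^ tt s (length xs) + 1) * bits (length xs)
    + ncl (length xs) * bits (length xs) + 2 ^ tt s (length xs) * cs (length xs) * bits (length xs)"
  by (simp add: spt_def Let_def)

text \<open>With \<open>T = 2 ^ tau k\<close> the three arrays have at most \<open>T + 1\<close>,
  \<open>16 * T ^ 2\<close> and \<open>T ^ 3\<close> entries, together at most
  \<open>20 * T ^ 3\<close>, each of at most \<open>4 * T\<close> bits; and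
  \<open>T ^ 4 <= k\<close>.\<close>

lemma length_spt_le:
  assumes "xs \<noteq> []"
  shows "length (spt P s xs) \<le> ph P + 80 * length xs"
proof -
  let ?k = "length xs" and ?T = "(2::nat) ^ tau (length xs)"
  have T1: "1 \<le> ?T" by simp
  have t: "(2::nat) ^ tt s ?k \<le> ?T" by (intro power_increasing) (auto simp: tt_def)
  have c: "cs ?k = ?T * ?T" by (simp add: cs_def power_add[symmetric] mult_2)
  have k1: "?T * ?T * ?T * ?T \<le> ?k" using tau_bound(1)[of ?k] assms by (simp add: power_add[symmetric] mult.commute[of 4] algebra_simps numeral_eq_Suc)
  have k2: "?k < 16 * (?T * ?T) * (?T * ?T)" using tau_bound(2)[of ?k] by (simp add: power_add numeral_eq_Suc algebra_simps)
  have b: "bits ?k \<le> 4 * ?T"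
  proof -
    have "bits ?k \<le> 4 * tau ?k + 4" by (auto simp: tau_def)
    also have "\<dots> \<le> 4 * ?T" using Suc_leI[OF less_exp[of "tau ?k"]] by linarith
    finally show ?thesis .
  qed
  have n: "ncl ?k \<le> 16 * (?T * ?T)"
  proof -
    have "(?k - 1) div cs ?k < 16 * (?T * ?T)" using k2 unfolding c by (intro less_mult_imp_div_less) linarith
    then show ?thesis unfolding ncl_def by simp
  qed
  have "length (spt P s xs) = ph P + (2 ^ tt s ?k + 1 + ncl ?k + 2 ^ tt s ?k * cs ?k) * bits ?k"
    by (simp add: length_spt algebra_simps)
  also have "\<dots> \<le> ph P + (?T + 1 + 16 * (?T * ?T) + ?T * (?T * ?T)) * (4 * ?T)"
    using t n b c by (intro add_mono mult_mono) auto
  also have "\<dots> \<le> ph P + (20 * (?T * ?T * ?T)) * (4 * ?T)"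
  proof -
    have "?T \<le> ?T * (?T * ?T)" "1 \<le> ?T * (?T * ?T)" "?T * ?T \<le> ?T * (?T * ?T)" by simp_all
    then have "?T + 1 + 16 * (?T * ?T) + ?T * (?T * ?T) \<le> 20 * (?T * ?T * ?T)" unfolding mult.assoc by linarith
    then show ?thesis by (intro add_mono mult_mono) auto
  qed
  also have "\<dots> \<le> ph P + 80 * ?k" using k1 by (simp add: algebra_simps)
  finally show ?thesis .
qed

text \<open>A leaf needs \<open>A0\<close> units of \<open>tau\<close> per element beyond its low
  bits. Each level above saves one, because the children keep \<open>tau k\<close> bits less per
  element and their own \<open>tau\<close> is no larger; at level \<open>j = A0\<close> no unit is
  left.\<close>

lemma length_enc_le:
  assumes "node_ok P w s xs" "j \<le> A0"
  shows "length (enc j P s xs) \<le> length xs * (s + (A0 - j) * tau (length xs) + e0 P + j * ed P)"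
  using assms
proof (induction j arbitrary: s xs)
  case 0
  then show ?case using length_fks_le[of P w s xs] by (auto simp: plain_def tau_def)
next
  case (Suc j)
  let ?k = "length xs" and ?f = "sbx s xs" and ?t = "tt s (length xs)" and ?S = "stride j P s (length xs)"
  show ?case
  proof (cases "s = 0 \<or> ?k \<le> K0")
    case True
    then show ?thesis by (auto simp: plain_def)
  next
    case False
    have fit: "length (enc j P (s - ?t) (seg ?f xs v)) \<le> ?S * length (seg ?f xs v)" for v
    proof (cases "tau ?k \<le> s")
      case True
      then have t: "?t = tau ?k" by (simp add: tt_def)
      let ?g = "seg ?f xs v"
      have "length ?g \<le> ?k" by (simp add: seg_def)
      then have "tau (length ?g) \<le> tau ?k" unfolding tau_def by (intro div_le_mono diff_le_mono bits_mono)
      then have "(A0 - j) * tau (length ?g) \<le> (A0 - j) * tau ?k" by simp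
      also have "(A0 - j) * tau ?k = tau ?k + (A0 - Suc j) * tau ?k"
        using Suc.prems by (metis Suc_diff_Suc Suc_le_lessD mult_Suc)
      finally have 1: "(A0 - j) * tau (length ?g) \<le> tau ?k + (A0 - Suc j) * tau ?k" .
      have "length (enc j P (s - ?t) ?g) \<le> length ?g * ((s - ?t) + (A0 - j) * tau (length ?g) + e0 P + j * ed P)"
        using Suc.prems by (intro Suc.IH node_ok_seg) auto
      also have "\<dots> \<le> length ?g * ?S" using 1 True unfolding t stride_def by (intro mult_le_mono2) linarith
      finally show ?thesis by (simp add: mult.commute)
    next
      case False
      \<comment> \<open>Fewer than \<open>tau k\<close> low bits were left, so the split uses them
        up and the children store nothing.\<close>
      then have "s - ?t = 0" by (simp add: tt_def)
      then show ?thesis by (cases j) auto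
    qed
    have "(\<Sum>v<2 ^ ?t. length (padto (?S * length (seg ?f xs v)) (enc j P (s - ?t) (seg ?f xs v))))
       = (\<Sum>v<2 ^ ?t. ?S * length (seg ?f xs v))" using fit by (intro sum.cong) (auto simp: length_padto)
    also have "\<dots> = ?S * (\<Sum>v<2 ^ ?t. length (seg ?f xs v))" by (simp add: sum_distrib_left)
    also have "(\<Sum>v<n. length (seg ?f xs v)) = cnt ?f xs n" for n
      by (induction n) (use cnt_mono[of _ _ ?f xs] in \<open>auto simp: length_seg cnt_def\<close>)
    also have "cnt ?f xs (2 ^ ?t) \<le> ?k" by (rule cnt_le)
    finally have 1: "(\<Sum>v<2 ^ ?t. length (padto (?S * length (seg ?f xs v)) (enc j P (s - ?t) (seg ?f xs v)))) \<le> ?S * ?k" by simp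
    have ph: "ph P \<le> ?k * (ph P div K0 + 1)"
    proof -
      have "ph P \<le> K0 * (ph P div K0 + 1)" using dividend_less_times_div[of K0 "ph P"] by (simp add: K0_def)
      also have "\<dots> \<le> ?k * (ph P div K0 + 1)" using False by (intro mult_le_mono1) auto
      finally show ?thesis .
    qed
    have "xs \<noteq> []" using False by auto
    then have "length (enc (Suc j) P s xs) \<le> ph P + 80 * ?k + ?S * ?k"
      using False 1 length_spt_le[of xs P s] by (simp add: length_cat)
    also have "\<dots> \<le> ?k * (ph P div K0 + 1) + 80 * ?k + ?S * ?k" using ph by simp
    also have "\<dots> = ?k * (s + (A0 - Suc j) * tau ?k + e0 P + Suc j * ed P)"
      by (simp add: stride_def ed_def algebra_simps)
    finally show ?thesis .
  qed
qed

lemma length_child: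
  assumes "node_ok P w s xs" "Suc j \<le> A0"
  shows "length (enc j P (s - tt s (length xs)) (seg (sbx s xs) xs v)) \<le> stride j P s (length xs) * length (seg (sbx s xs) xs v)"
proof (cases "tau (length xs) \<le> s")
  case True
  let ?g = "seg (sbx s xs) xs v" and ?k = "length xs"
  have t: "tt s ?k = tau ?k" using True by (simp add: tt_def)
  have "length ?g \<le> ?k" by (simp add: seg_def)
  then have "tau (length ?g) \<le> tau ?k" unfolding tau_def by (intro div_le_mono diff_le_mono bits_mono)
  then have "(A0 - j) * tau (length ?g) \<le> (A0 - j) * tau ?k" by simp
  also have "(A0 - j) * tau ?k = tau ?k + (A0 - Suc j) * tau ?k"
    using assms by (metis Suc_diff_Suc Suc_le_lessD mult_Suc)
  finally have 1: "(A0 - j) * tau (length ?g) \<le> tau ?k + (A0 - Suc j) * tau ?k" .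
  have "length (enc j P (s - tt s ?k) ?g) \<le> length ?g * ((s - tt s ?k) + (A0 - j) * tau (length ?g) + e0 P + j * ed P)"
    using assms by (intro length_enc_le node_ok_seg) auto
  also have "\<dots> \<le> length ?g * stride j P s ?k" using 1 True unfolding t stride_def by (intro mult_le_mono2) linarith
  finally show ?thesis by (simp add: mult.commute)
next
  case False
  then have "s - tt s (length xs) = 0" by (simp add: tt_def)
  then show ?thesis by (cases j) auto
qed

lemma sum_length_seg: "(\<Sum>v<n. length (seg f xs v)) = cnt f xs n"
  by (induction n) (use cnt_mono[of _ _ f xs] in \<open>auto simp: length_seg cnt_def\<close>)

lemma sub_child:
  assumes "node_ok P w s xs" "Suc j \<le> A0" "0 < s" "K0 < length xs" "sub bs A (enc (Suc j) P s xs)" "v < 2 ^ tt s (length xs)"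
  shows "sub bs (A + length (spt P s xs) + stride j P s (length xs) * cnt (sbx s xs) xs v)
      (enc j P (s - tt s (length xs)) (seg (sbx s xs) xs v))"
    and "length (spt P s xs) + stride j P s (length xs) * cnt (sbx s xs) xs v +
       length (enc j P (s - tt s (length xs)) (seg (sbx s xs) xs v)) \<le> length (enc (Suc j) P s xs)"
proof -
  let ?S = "stride j P s (length xs)" and ?g = "seg (sbx s xs) xs" and ?t = "tt s (length xs)"
  let ?F = "\<lambda>v. padto (?S * length (?g v)) (enc j P (s - ?t) (?g v))"
  have e: "enc (Suc j) P s xs = spt P s xs @ cat ?F (2 ^ ?t)" using assms by simp
  have l: "length (?F v) = ?S * length (?g v)" for v by (rule length_padto) (rule length_child[OF assms(1,2)])
  have sl: "(\<Sum>u<n. length (?F u)) = ?S * cnt (sbx s xs) xs n" for n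
    unfolding l by (simp add: sum_distrib_left[symmetric] sum_length_seg)
  have "sub bs (A + length (spt P s xs)) (cat ?F (2 ^ ?t))" using assms(5) unfolding e sub_append by blast
  from sub_cat[OF this assms(6)] have "sub bs (A + length (spt P s xs) + ?S * cnt (sbx s xs) xs v) (?F v)" unfolding sl .
  then show "sub bs (A + length (spt P s xs) + ?S * cnt (sbx s xs) xs v) (enc j P (s - ?t) (?g v))" by (rule sub_padto)
  have "(\<Sum>u<Suc v. length (?F u)) \<le> (\<Sum>u<2 ^ ?t. length (?F u))" using assms(6) by (intro sum_mono2) auto
  moreover have "(\<Sum>u<Suc v. length (?F u)) = ?S * cnt (sbx s xs) xs v + length (?F v)"
    unfolding sum.lessThan_Suc by (simp only: sl)
  ultimately have "?S * cnt (sbx s xs) xs v + length (?F v) \<le> length (cat ?F (2 ^ ?t))"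
    unfolding length_cat by linarith
  then show "length (spt P s xs) + ?S * cnt (sbx s xs) xs v + length (enc j P (s - ?t) (?g v)) \<le> length (enc (Suc j) P s xs)"
    using length_child[OF assms(1,2), of v] l[of v] unfolding e by simp
qed

lemma stride_le_length:
  assumes "node_ok P w s xs" "Suc j \<le> A0" "0 < s" "K0 < length xs"
  shows "stride j P s (length xs) \<le> length (enc (Suc j) P s xs)"
proof -
  let ?S = "stride j P s (length xs)" and ?g = "seg (sbx s xs) xs" and ?t = "tt s (length xs)"
  let ?F = "\<lambda>v. padto (?S * length (?g v)) (enc j P (s - ?t) (?g v))"
  have "cnt (sbx s xs) xs (2 ^ ?t) = length xs"
    unfolding cnt_def using sb_less[OF tt_le] by (intro arg_cong[of _ _ length] filter_True) auto
  then have "?S * length xs = (\<Sum>u<2 ^ ?t. length (?F u))"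
    using length_child[OF assms(1,2)] by (simp add: length_padto sum_distrib_left[symmetric] sum_length_seg)
  moreover have "?S \<le> ?S * length xs" using assms(4) by (cases "length xs") auto
  ultimately show ?thesis using assms by (simp add: length_cat)
qed

text \<open>The cell of \<open>i\<close> starts inside group \<open>v\<close> and \<open>i\<close>
  lies beyond the end of that group, so the cell contains the end. Hence \<open>v\<close> alone
  determines the cell, and an array indexed by \<open>v\<close> and the offset suffices.\<close>

lemma spY_mixed:
  assumes so: "sorted (map (sbx s xs) xs)" and i: "i < length xs"
    and v: "v = sbx s xs (xs ! (i div cs (length xs) * cs (length xs)))" "\<not> i < cnt (sbx s xs) xs (v + 1)"
  shows "spY s xs (v * cs (length xs) + i mod cs (length xs)) = sbx s xs (xs ! i)"
proof -
  let ?c = "cs (length xs)" and ?f = "sbx s xs"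
  have c: "0 < ?c" by (simp add: cs_def)
  have le: "i div ?c * ?c \<le> i" by simp
  have 1: "i div ?c * ?c < cnt ?f xs (v + 1)" using cnt_iff[OF so, of "i div ?c * ?c" "v + 1"] le i v(1) by auto
  have "cnt ?f xs (v + 1) div ?c = i div ?c"
  proof (rule antisym)
    show "cnt ?f xs (v + 1) div ?c \<le> i div ?c" using v(2) by (intro div_le_mono) auto
    have "(i div ?c * ?c) div ?c \<le> cnt ?f xs (v + 1) div ?c" using 1 by (intro div_le_mono) auto
    then show "i div ?c \<le> cnt ?f xs (v + 1) div ?c" using c by simp
  qed
  moreover have "(v * ?c + i mod ?c) div ?c = v" "(v * ?c + i mod ?c) mod ?c = i mod ?c" using c by auto
  moreover have "?c * (i div ?c) + i mod ?c = i" by simp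
  ultimately show ?thesis unfolding spY_def Let_def using i by simp
qed

lemma spY_pure:
  assumes so: "sorted (map (sbx s xs) xs)" and i: "i < length xs"
    and v: "v = sbx s xs (xs ! (i div cs (length xs) * cs (length xs)))" "i < cnt (sbx s xs) xs (v + 1)"
  shows "sbx s xs (xs ! i) = v"
proof -
  let ?c = "cs (length xs)" and ?f = "sbx s xs"
  have le: "i div ?c * ?c \<le> i" by simp
  have "?f (xs ! i) < v + 1" using cnt_iff[OF so i] v(2) by simp
  moreover have "map ?f xs ! (i div ?c * ?c) \<le> map ?f xs ! i" using so le i by (intro sorted_nth_mono) auto
  ultimately show ?thesis using v(1) i le by simp
qed

lemma fo_map_inj: "(\<And>x. x \<in> set xs \<Longrightarrow> (f x = f y) = (x = y)) \<Longrightarrow> fo (map f xs) (f y) = fo xs y"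
  by (induction xs) (auto simp: fo_def)

lemma cmp_modpow: "wf V \<Longrightarrow> cmp V X \<Longrightarrow> cmp V s \<Longrightarrow> (\<And>Z. Z \<in> V \<Longrightarrow> s Z \<le> ww Z) \<Longrightarrow> cmp V (\<lambda>Z. X Z mod 2 ^ s Z)"
  by (rule cmp_cong[OF cmp_msh[of V s s "\<lambda>Z. 1" X]]) (auto simp: msh_def simp del: One_nat_def intro: cmp_1 wf_pos)

lemma
  assumes wf: "wf V" and A: "cmp V A" and s: "cmp V s" and k: "cmp V (\<lambda>Z. length (xs Z))"
    and ok: "\<And>Z. Z \<in> V \<Longrightarrow> s Z \<le> ww Z \<and> K0 < 2 ^ ww Z \<and> (s Z \<noteq> 0 \<longrightarrow> length (xs Z) \<le> K0 \<longrightarrow>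
       sub (bb Z) (A Z) (plain (s Z) (xs Z)) \<and> A Z + length (plain (s Z) (xs Z)) < 2 ^ ww Z)"
  shows cmp_leaf_nth: "cmp V I \<Longrightarrow> (\<And>Z. Z \<in> V \<Longrightarrow> I Z < length (xs Z)) \<Longrightarrow>
      cmp (V \<inter> {Z. s Z \<noteq> 0 \<and> K0 < length (xs Z)}) (\<lambda>Z. xs Z ! I Z mod 2 ^ s Z) \<Longrightarrow> cmp V (\<lambda>Z. xs Z ! I Z mod 2 ^ s Z)"
    and cmp_leaf_fo: "cmp V X \<Longrightarrow> (\<And>Z x. Z \<in> V \<Longrightarrow> x \<in> set (xs Z) \<Longrightarrow> x div 2 ^ s Z = X Z div 2 ^ s Z) \<Longrightarrow>
      cmp (V \<inter> {Z. s Z \<noteq> 0 \<and> K0 < length (xs Z)}) (\<lambda>Z. fo (xs Z) (X Z)) \<Longrightarrow> cmp V (\<lambda>Z. fo (xs Z) (X Z))"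
proof -
  have pos: "pos V" using wf by (rule wf_pos)
  have K: "cmp V (\<lambda>Z. K0)" by (rule cmp_const) (use ok in auto)
  let ?W = "V \<inter> {Z. s Z \<noteq> 0} \<inter> {Z. \<not> K0 < length (xs Z)}"
  have split: "cmp V F" if "cmp (V \<inter> {Z. s Z = 0}) F" "cmp ?W F" "cmp (V \<inter> {Z. s Z \<noteq> 0 \<and> K0 < length (xs Z)}) F" for F
  proof -
    have "cmp V (\<lambda>Z. if s Z = 0 then F Z else if K0 < length (xs Z) then F Z else F Z)"
      by (intro cmp_if cmp_eq pos s cmp_0 cmp_less cmp_inter[OF K] cmp_inter[OF k]) (use that in \<open>auto intro: cmp_mono\<close>)
    then show ?thesis by (simp only: if_cancel)
  qed
  have nth: "cmp (?W \<inter> U) (\<lambda>Z. xs Z ! I Z mod 2 ^ s Z)" if "cmp (?W \<inter> U) I" "\<And>Z. Z \<in> ?W \<inter> U \<Longrightarrow> I Z < length (xs Z)" for I U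
    by (rule cmp_plain_nth[OF wf_inter[OF wf_inter[OF wf_inter[OF wf]]] cmp_inter[OF cmp_inter[OF cmp_inter[OF A]]]
        cmp_inter[OF cmp_inter[OF cmp_inter[OF s]]] that(1)])
      (use that(2) ok in \<open>auto simp: plain_def not_less\<close>)
  show "cmp V (\<lambda>Z. xs Z ! I Z mod 2 ^ s Z)" if I: "cmp V I" "\<And>Z. Z \<in> V \<Longrightarrow> I Z < length (xs Z)"
    "cmp (V \<inter> {Z. s Z \<noteq> 0 \<and> K0 < length (xs Z)}) (\<lambda>Z. xs Z ! I Z mod 2 ^ s Z)" for I
  proof (rule split[OF _ _ I(3)])
    show "cmp (V \<inter> {Z. s Z = 0}) (\<lambda>Z. xs Z ! I Z mod 2 ^ s Z)" by (rule cmp_cong[OF cmp_0]) auto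
    show "cmp ?W (\<lambda>Z. xs Z ! I Z mod 2 ^ s Z)" using nth[of UNIV I] I(1,2) by (auto intro: cmp_mono)
  qed
  show "cmp V (\<lambda>Z. fo (xs Z) (X Z))" if X: "cmp V X" "\<And>Z x. Z \<in> V \<Longrightarrow> x \<in> set (xs Z) \<Longrightarrow> x div 2 ^ s Z = X Z div 2 ^ s Z"
    "cmp (V \<inter> {Z. s Z \<noteq> 0 \<and> K0 < length (xs Z)}) (\<lambda>Z. fo (xs Z) (X Z))" for X
  proof (rule split[OF _ _ X(3)])
    show "cmp (V \<inter> {Z. s Z = 0}) (\<lambda>Z. fo (xs Z) (X Z))"
    \<comment> \<open>Without low bits every element of the bin equals the argument and is found at
      position 0; for the empty bin 0 is the length and signals absence.\<close>
    proof (rule cmp_cong[OF cmp_0])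
      fix Z assume "Z \<in> V \<inter> {Z. s Z = 0}"
      then have "\<forall>x\<in>set (xs Z). x = X Z" using X(2)[of Z] by simp
      then show "0 = fo (xs Z) (X Z)" by (cases "xs Z") (auto simp: fo_def)
    qed
    have "cmp ?W (\<lambda>Z. fo (map (\<lambda>x. x mod 2 ^ s Z) (xs Z)) (X Z mod 2 ^ s Z))"
    proof (rule cmp_scan[of _ _ _ K0])
      show "wf ?W" by (intro wf_inter wf)
      show "cmp ?W (\<lambda>Z. X Z mod 2 ^ s Z)"
        by (rule cmp_modpow[OF wf_inter[OF wf_inter[OF wf]] cmp_inter[OF cmp_inter[OF X(1)]] cmp_inter[OF cmp_inter[OF s]]]) (use ok in auto)
      show "cmp ?W (\<lambda>Z. length (map (\<lambda>x. x mod 2 ^ s Z) (xs Z)))" using k by (auto intro: cmp_mono)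
      show "\<And>Z. Z \<in> ?W \<Longrightarrow> length (map (\<lambda>x. x mod 2 ^ s Z) (xs Z)) \<le> K0 \<and> K0 < 2 ^ ww Z" using ok by auto
      fix i assume i: "i < K0"
      let ?U = "{Z. i < length (map (\<lambda>x. x mod 2 ^ s Z) (xs Z))}"
      have "cmp (?W \<inter> ?U) (\<lambda>Z. xs Z ! i mod 2 ^ s Z)"
        by (rule nth) (use ok i in \<open>fastforce intro!: cmp_const\<close>)+
      then show "cmp (?W \<inter> ?U) (\<lambda>Z. map (\<lambda>x. x mod 2 ^ s Z) (xs Z) ! i)" by (rule cmp_cong) auto
    qed
    then show "cmp ?W (\<lambda>Z. fo (xs Z) (X Z))"
    proof (rule cmp_cong)
      fix Z assume "Z \<in> ?W"
      then have v: "Z \<in> V" by auto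
      show "fo (map (\<lambda>x. x mod 2 ^ s Z) (xs Z)) (X Z mod 2 ^ s Z) = fo (xs Z) (X Z)"
        by (rule fo_map_inj[of "xs Z" "\<lambda>x. x mod 2 ^ s Z"]) (metis X(2)[OF v] div_mult_mod_eq)
    qed
  qed
qed

lemma stride_cmp:
  assumes wf: "wf V" and P: "pcmp V P" and s: "cmp V s" and t: "cmp V t" and "Suc j \<le> A0"
    and b: "\<And>Z. Z \<in> V \<Longrightarrow> s Z + (A0 - Suc j) * t Z + e0 (P Z) + j * ed (P Z) < 2 ^ ww Z \<and> K0 < 2 ^ ww Z \<and> ph (P Z) \<le> ww Z \<and> pa (P Z) \<le> ww Z \<and> pb (P Z) \<le> ww Z"
  shows "cmp V (\<lambda>Z. s Z + (A0 - Suc j) * t Z + e0 (P Z) + j * ed (P Z))"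
proof -
  note c = pcmpD[OF P]
  have K: "cmp V (\<lambda>Z. n)" if "n \<le> K0" for n by (rule cmp_const) (use b that in \<open>auto intro: le_less_trans\<close>)
  have K': "A0 - Suc j \<le> K0" "j \<le> K0" "121 \<le> K0" "81 \<le> K0" "2 \<le> K0" using assms(5) by (auto simp: K0_def A0_def)
  have w: "8 * ww Z < 2 ^ ww Z" if "Z \<in> V" for Z using wf that big_word by (auto simp: wf_def)
  have e: "cmp V (\<lambda>Z. e0 (P Z))" unfolding e0_def
  proof (intro cmp_add cmp_mul cmp_div K K' c order_refl)
    fix Z assume v: "Z \<in> V"
    have l: "e0 (P Z) < 2 ^ ww Z" using b[OF v] by linarith
    then show "2 * pb (P Z) + 121 + (ph (P Z) + pa (P Z) + 2 * pb (P Z)) div K0 < 2 ^ ww Z" unfolding e0_def .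
    then show "2 * pb (P Z) + 121 < 2 ^ ww Z" "2 * pb (P Z) < 2 ^ ww Z" by linarith+
    show "2 * pb (P Z) < 2 ^ ww Z" using w[OF v] b[OF v] by linarith
    show "ph (P Z) + pa (P Z) + 2 * pb (P Z) < 2 ^ ww Z" "ph (P Z) + pa (P Z) < 2 ^ ww Z" using w[OF v] b[OF v] by linarith+
  qed
  have "17 \<le> n" if "K0 < 2 ^ n" for n
  proof (rule ccontr)
    assume "\<not> 17 \<le> n"
    then have "(2::nat) ^ n \<le> 2 ^ 16" by (intro power_increasing) auto
    then show False using that by (simp add: K0_def)
  qed
  then have d': "ed (P Z) < 2 ^ ww Z" if "Z \<in> V" for Z
  proof -
    have "ed (P Z) \<le> 81 + ww Z" using b[OF that] div_le_dividend[of "ph (P Z)" K0] unfolding ed_def by linarith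
    moreover have "17 \<le> ww Z" using b[OF that] \<open>\<And>n. K0 < 2 ^ n \<Longrightarrow> 17 \<le> n\<close> by blast
    ultimately show ?thesis using w[OF that] by linarith
  qed
  have d: "cmp V (\<lambda>Z. ed (P Z))" unfolding ed_def
    by (intro cmp_add cmp_div K K' c order_refl) (use d' in \<open>auto simp: ed_def\<close>)
  show ?thesis
  proof (intro cmp_add cmp_mul K K' s t e d)
    fix Z assume "Z \<in> V"
    from b[OF this] show "s Z + (A0 - Suc j) * t Z + e0 (P Z) + j * ed (P Z) < 2 ^ ww Z" "s Z + (A0 - Suc j) * t Z + e0 (P Z) < 2 ^ ww Z"
      "s Z + (A0 - Suc j) * t Z < 2 ^ ww Z" "(A0 - Suc j) * t Z < 2 ^ ww Z" "j * ed (P Z) < 2 ^ ww Z" by linarith+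
  qed
qed

text \<open>The recursion over \<open>j\<close> unfolds into one finite expression, as the number of
  levels is constant. Access and search are proved together, since both descend into a child through
  the same address computation.\<close>

lemma cmp_enc:
  assumes "j \<le> A0" and wf: "wf V" and P: "pcmp V P" and A: "cmp V A" and s: "cmp V s" and k: "cmp V (\<lambda>Z. length (xs Z))"
    and ok: "\<And>Z. Z \<in> V \<Longrightarrow> node_ok (P Z) (ww Z) (s Z) (xs Z) \<and> sub (bb Z) (A Z) (enc j (P Z) (s Z) (xs Z)) \<and>
       A Z + length (enc j (P Z) (s Z) (xs Z)) < 2 ^ ww Z"
  shows "(\<forall>I. cmp V I \<longrightarrow> (\<forall>Z\<in>V. I Z < length (xs Z)) \<longrightarrow> cmp V (\<lambda>Z. xs Z ! I Z mod 2 ^ s Z)) \<and>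
     (\<forall>X. cmp V X \<longrightarrow> (\<forall>Z\<in>V. \<forall>x\<in>set (xs Z). x div 2 ^ s Z = X Z div 2 ^ s Z) \<longrightarrow> cmp V (\<lambda>Z. fo (xs Z) (X Z)))"
  using assms
proof (induction j arbitrary: V A s xs)
  case 0
  note [simp] = less_imp_le
  have leaf: "s Z \<le> ww Z \<and> K0 < 2 ^ ww Z \<and> (s Z \<noteq> 0 \<longrightarrow> length (xs Z) \<le> K0 \<longrightarrow>
       sub (bb Z) (A Z) (plain (s Z) (xs Z)) \<and> A Z + length (plain (s Z) (xs Z)) < 2 ^ ww Z)" if "Z \<in> V" for Z
    using 0(7)[OF that] by (auto simp: node_ok_def)
  let ?U = "V \<inter> {Z. s Z \<noteq> 0 \<and> K0 < length (xs Z)}"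
  have u: "wf ?U" "pcmp ?U P" "cmp ?U A" "cmp ?U s" "cmp ?U (\<lambda>Z. length (xs Z))"
    using 0 by (auto intro: wf_inter cmp_inter pcmp_mono)
  have uo: "node_ok (P Z) (ww Z) (s Z) (xs Z) \<and> xs Z \<noteq> [] \<and> 0 < s Z \<and>
       sub (bb Z) (A Z) (fks (P Z) (s Z) (xs Z)) \<and> A Z + length (fks (P Z) (s Z) (xs Z)) < 2 ^ ww Z" if "Z \<in> ?U" for Z
    using 0(7)[of Z] that by auto
  show ?case
  proof (intro conjI allI impI)
    fix I assume I: "cmp V I" "\<forall>Z\<in>V. I Z < length (xs Z)"
    show "cmp V (\<lambda>Z. xs Z ! I Z mod 2 ^ s Z)"
      by (rule cmp_leaf_nth[OF 0(2,4,5,6) leaf I(1)])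
        (use I cmp_fks_nth[OF u uo, of I] in \<open>auto intro: cmp_inter\<close>)
  next
    fix X assume X: "cmp V X" "\<forall>Z\<in>V. \<forall>x\<in>set (xs Z). x div 2 ^ s Z = X Z div 2 ^ s Z"
    show "cmp V (\<lambda>Z. fo (xs Z) (X Z))"
      by (rule cmp_leaf_fo[OF 0(2,4,5,6) leaf X(1)])
        (use X cmp_fks_fo[OF u uo, of X] in \<open>auto intro: cmp_inter\<close>)
  qed
next
  case (Suc j)
  have leaf: "s Z \<le> ww Z \<and> K0 < 2 ^ ww Z \<and> (s Z \<noteq> 0 \<longrightarrow> length (xs Z) \<le> K0 \<longrightarrow>
       sub (bb Z) (A Z) (plain (s Z) (xs Z)) \<and> A Z + length (plain (s Z) (xs Z)) < 2 ^ ww Z)" if "Z \<in> V" for Z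
    using Suc.prems(7)[OF that] by (auto simp: node_ok_def)
  let ?U = "V \<inter> {Z. s Z \<noteq> 0 \<and> K0 < length (xs Z)}" and ?k = "\<lambda>Z. length (xs Z)"
  have u: "wf ?U" "pcmp ?U P" "cmp ?U A" "cmp ?U s" "cmp ?U ?k"
    using Suc.prems by (auto intro: wf_inter cmp_inter pcmp_mono)
  note c = pcmpD[OF u(2)] and posU = wf_pos[OF u(1)]
  have uo: "node_ok (P Z) (ww Z) (s Z) (xs Z)" "0 < s Z" "K0 < ?k Z" "xs Z \<noteq> []"
     "sub (bb Z) (A Z) (enc (Suc j) (P Z) (s Z) (xs Z))" "A Z + length (enc (Suc j) (P Z) (s Z) (xs Z)) < 2 ^ ww Z"
     "sub (bb Z) (A Z) (spt (P Z) (s Z) (xs Z))" if "Z \<in> ?U" for Z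
    using Suc.prems(7)[of Z] that by (auto simp: sub_append)
  define d where "d Z = bits (?k Z)" for Z
  define t where "t Z = tt (s Z) (?k Z)" for Z
  define n where "n Z = (2::nat) ^ t Z" for Z
  define C where "C Z = cs (?k Z)" for Z
  define f where "f Z = sb (s Z) (t Z)" for Z
  define L where "L Z = length (spt (P Z) (s Z) (xs Z))" for Z
  have fe: "f Z = sbx (s Z) (xs Z)" for Z by (simp add: f_def t_def)
  have so: "sorted (map (f Z) (xs Z))" if "Z \<in> ?U" for Z unfolding f_def by (rule node_ok_sorted[OF uo(1)[OF that]])
  have Lle: "L Z \<le> length (enc (Suc j) (P Z) (s Z) (xs Z))" if "Z \<in> ?U" for Z using uo(2,3)[OF that] by (simp add: L_def)
  have Le: "L Z = ph (P Z) + (n Z + 1) * d Z + ncl (?k Z) * d Z + n Z * C Z * d Z" for Z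
    by (simp add: L_def length_spt n_def t_def d_def C_def)
  have bnd: "A Z + ph (P Z) + (n Z + 1) * d Z + ncl (?k Z) * d Z + n Z * C Z * d Z < 2 ^ ww Z" if "Z \<in> ?U" for Z
    using Lle[OF that] uo(6)[OF that] Le[of Z] by linarith
  have w8: "8 * ww Z < 2 ^ ww Z" if "Z \<in> ?U" for Z using u(1) that big_word by (auto simp: wf_def)
  have small: "0 < d Z" "n Z + 1 < 2 ^ ww Z" "n Z * C Z < 2 ^ ww Z" "C Z < 2 ^ ww Z" "0 < C Z" "0 < n Z" "t Z \<le> s Z" "s Z \<le> ww Z" "?k Z < 2 ^ ww Z" "d Z \<le> ww Z"
    "d Z < 2 ^ ph (P Z)" if v: "Z \<in> ?U" for Z
  proof -
    show d: "0 < d Z" unfolding d_def using uo[OF v] by (intro bits_pos) auto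
    have xd: "x \<le> x * d Z" for x using d by simp
    show 1: "n Z + 1 < 2 ^ ww Z" using bnd[OF v] xd[of "n Z + 1"] by linarith
    show 2: "n Z * C Z < 2 ^ ww Z" using bnd[OF v] xd[of "n Z * C Z"] by linarith
    show n: "0 < n Z" by (simp add: n_def)
    then have "C Z \<le> n Z * C Z" by simp
    then show "C Z < 2 ^ ww Z" using 2 by linarith
    \<comment> \<open>The children occupy \<open>stride\<close> bits per element and
      \<open>stride\<close> is positive; so the bin size is bounded by the length of the code and
      fits into a word.\<close>
    have "stride j (P Z) (s Z) (?k Z) * ?k Z \<le> length (enc (Suc j) (P Z) (s Z) (xs Z))"
    proof -
      have "cnt (sbx (s Z) (xs Z)) (xs Z) (2 ^ t Z) = ?k Z"
        unfolding cnt_def t_def using sb_less[OF tt_le] by (intro arg_cong[of _ _ length] filter_True) auto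
      moreover obtain m where m: "2 ^ t Z = Suc m" by (metis n n_def gr0_implies_Suc)
      ultimately have "cnt (sbx (s Z) (xs Z)) (xs Z) m + length (seg (sbx (s Z) (xs Z)) (xs Z) m) = ?k Z"
        using cnt_mono[of m "Suc m" "sbx (s Z) (xs Z)" "xs Z"] by (simp add: length_seg)
      then show ?thesis using uo(2,3)[OF v]
        by (simp add: length_cat length_padto length_child[OF uo(1)[OF v] Suc.prems(1)] sum_distrib_left[symmetric] sum_length_seg
           \<open>cnt (sbx (s Z) (xs Z)) (xs Z) (2 ^ t Z) = ?k Z\<close>[unfolded t_def] mult.commute)
    qed
    moreover have "?k Z \<le> stride j (P Z) (s Z) (?k Z) * ?k Z" using uo(2)[OF v] by (simp add: stride_def)
    ultimately show k: "?k Z < 2 ^ ww Z" using uo(6)[OF v] by linarith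
    show "d Z \<le> ww Z" unfolding d_def using k by (rule bits_le)
    show "0 < C Z" by (simp add: C_def cs_def)
    show "t Z \<le> s Z" unfolding t_def by (rule tt_le)
    show "s Z \<le> ww Z" "d Z < 2 ^ ph (P Z)" using uo(1)[OF v] unfolding node_ok_def d_def by blast+
  qed
  have subs: "sub (bb Z) (A Z) (tobits (ph (P Z)) (d Z))"
    "sub (bb Z) (A Z + ph (P Z)) (arr (d Z) (map (cnt (f Z) (xs Z)) [0..<n Z + 1]))"
    "sub (bb Z) (A Z + ph (P Z) + (n Z + 1) * d Z) (arr (d Z) (map (\<lambda>c. f Z (xs Z ! (c * C Z))) [0..<ncl (?k Z)]))"
    "sub (bb Z) (A Z + ph (P Z) + (n Z + 1) * d Z + ncl (?k Z) * d Z) (arr (d Z) (map (spY (s Z) (xs Z)) [0..<n Z * C Z]))"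
    if "Z \<in> ?U" for Z
    using uo(7)[OF that] unfolding spt_def Let_def sub_append d_def[symmetric] t_def[symmetric] n_def[symmetric] C_def[symmetric] f_def[symmetric]
    by (simp_all add: add.assoc algebra_simps)
  have cd: "cmp ?U d"
  proof (rule cmp_field[OF u(1,3) c(4)])
    fix Z assume v: "Z \<in> ?U"
    have "d Z < 2 ^ ww Z" using small(10)[OF v] less_exp[of "ww Z"] by linarith
    then show "sub (bb Z) (A Z) (tobits (ph (P Z)) (d Z)) \<and> d Z < 2 ^ ph (P Z) \<and> d Z < 2 ^ ww Z \<and> A Z < 2 ^ ww Z"
      using subs(1)[OF v] small(11)[OF v] bnd[OF v] by linarith
  qed
  have dw: "d Z < 2 ^ ww Z" if "Z \<in> ?U" for Z using small(10)[OF that] less_exp[of "ww Z"] by linarith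
  have ctau: "cmp ?U (\<lambda>Z. tau (?k Z))" unfolding tau_def d_def[symmetric]
    by (intro cmp_div cmp_sub cmp_small cd u(1) cmp_1 posU) (use small(1) dw in \<open>auto simp: Suc_le_eq\<close>)
  have ct: "cmp ?U t" unfolding t_def tt_def by (intro cmp_min posU u ctau)
  have cn: "cmp ?U n"
  proof (rule cmp_cong[OF cmp_shl[OF cmp_1[OF posU] ct]])
    fix Z assume v: "Z \<in> ?U"
    show "1 * 2 ^ t Z = n Z" by (simp add: n_def)
    show "(1::nat) * 2 ^ t Z < 2 ^ ww Z" using small(2)[OF v] unfolding n_def by linarith
  qed
  have cn1: "cmp ?U (\<lambda>Z. n Z + 1)" by (intro cmp_add cn cmp_1 posU) (use small(2) in auto)
  have cC: "cmp ?U C"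
  proof (rule cmp_cong[OF cmp_shl[OF cmp_1[OF posU] cmp_mul[OF cmp_small[OF u(1)] ctau]]])
    show "(2::nat) \<le> 64" by simp
    fix Z assume v: "Z \<in> ?U"
    have "2 * tau (?k Z) \<le> d Z" by (simp add: tau_def d_def)
    then show "2 * tau (?k Z) < 2 ^ ww Z" using dw[OF v] by linarith
    show "1 * 2 ^ (2 * tau (?k Z)) = C Z" by (simp add: C_def cs_def)
    then show "(1::nat) * 2 ^ (2 * tau (?k Z)) < 2 ^ ww Z" using small(4)[OF v] by simp
  qed
  have cncl: "cmp ?U (\<lambda>Z. ncl (?k Z))"
  proof -
    have "ncl (?k Z) < 2 ^ ww Z" if v: "Z \<in> ?U" for Z
    proof -
      have "ncl (?k Z) \<le> ncl (?k Z) * d Z" using small(1)[OF v] by simp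
      then show ?thesis using bnd[OF v] by linarith
    qed
    then show ?thesis unfolding ncl_def C_def[symmetric]
      by (intro cmp_add cmp_div cmp_sub cmp_1 posU u cC) (use small(9) uo(4) in \<open>auto simp: Suc_le_eq\<close>)
  qed
  have a1: "cmp ?U (\<lambda>Z. A Z + ph (P Z))" by (rule cmp_add[OF u(3) c(4)]; frule bnd; linarith)
  have a2: "cmp ?U (\<lambda>Z. A Z + ph (P Z) + (n Z + 1) * d Z)" by (rule cmp_add[OF a1 cmp_mul[OF cn1 cd]]; frule bnd; linarith)
  have a3: "cmp ?U (\<lambda>Z. A Z + ph (P Z) + (n Z + 1) * d Z + ncl (?k Z) * d Z)" by (rule cmp_add[OF a2 cmp_mul[OF cncl cd]]; frule bnd; linarith)
  have cnC: "cmp ?U (\<lambda>Z. n Z * C Z)" by (rule cmp_mul[OF cn cC]) (rule small(3))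
  have a4: "cmp ?U (\<lambda>Z. A Z + L Z)"
    by (rule cmp_cong[OF cmp_add[OF a3 cmp_mul[OF cnC cd]]]; (frule bnd)?; (simp only: Le)?; linarith)
  have fn: "f Z x < n Z" for Z x unfolding f_def n_def by (rule sb_less) (simp add: t_def tt_le)
  have cle: "cnt (f Z) (xs Z) v < 2 ^ d Z" "cnt (f Z) (xs Z) v \<le> ?k Z" for Z v
    using cnt_le[of "f Z" "xs Z" v] less_bits[of "?k Z"] unfolding d_def by linarith+
  have nd: "n Z < 2 ^ d Z" "n Z < 2 ^ ww Z" if "Z \<in> ?U" for Z
  proof -
    have "n Z \<le> 2 ^ tau (?k Z)" unfolding n_def t_def tt_def by (intro power_increasing) auto
    also have "\<dots> < 2 ^ d Z" using small(1)[OF that] unfolding tau_def d_def by (intro power_strict_increasing) auto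
    finally show "n Z < 2 ^ d Z" .
    show "n Z < 2 ^ ww Z" using small(2)[OF that] by linarith
  qed
  have ccnt: "cmp ?U (\<lambda>Z. cnt (f Z) (xs Z) (v Z))" if v: "cmp ?U v" "\<And>Z. Z \<in> ?U \<Longrightarrow> v Z \<le> n Z" for v
  proof -
    have "cmp ?U (\<lambda>Z. map (cnt (f Z) (xs Z)) [0..<n Z + 1] ! v Z)"
    proof (rule cmp_arr[OF u(1) a1 cd v(1)])
      fix Z assume m: "Z \<in> ?U"
      have "v Z * d Z \<le> (n Z + 1) * d Z" using v(2)[OF m] by (intro mult_le_mono1) simp
      then have 1: "A Z + ph (P Z) + v Z * d Z < 2 ^ ww Z" using bnd[OF m] by linarith
      have "map (cnt (f Z) (xs Z)) [0..<n Z + 1] ! v Z = cnt (f Z) (xs Z) (v Z)" using v(2)[OF m] by (simp del: upt_Suc)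
      then show "sub (bb Z) (A Z + ph (P Z)) (arr (d Z) (map (cnt (f Z) (xs Z)) [0..<n Z + 1])) \<and> v Z < length (map (cnt (f Z) (xs Z)) [0..<n Z + 1]) \<and>
         map (cnt (f Z) (xs Z)) [0..<n Z + 1] ! v Z < 2 ^ d Z \<and> map (cnt (f Z) (xs Z)) [0..<n Z + 1] ! v Z < 2 ^ ww Z \<and> A Z + ph (P Z) + v Z * d Z < 2 ^ ww Z"
        using subs(2)[OF m] 1 v(2)[OF m] cle[of Z "v Z"] small(9)[OF m] by (simp del: upt_Suc)
    qed
    then show ?thesis
    proof (rule cmp_cong)
      fix Z assume m: "Z \<in> ?U"
      show "map (cnt (f Z) (xs Z)) [0..<n Z + 1] ! v Z = cnt (f Z) (xs Z) (v Z)" using v(2)[OF m] by (simp del: upt_Suc)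
    qed
  qed
  have cS: "cmp ?U (\<lambda>Z. stride j (P Z) (s Z) (?k Z))" unfolding stride_def
  proof (rule stride_cmp[OF u(1,2,4) ctau Suc.prems(1)])
    fix Z assume m: "Z \<in> ?U"
    show "s Z + (A0 - Suc j) * tau (?k Z) + e0 (P Z) + j * ed (P Z) < 2 ^ ww Z \<and> K0 < 2 ^ ww Z \<and> ph (P Z) \<le> ww Z \<and> pa (P Z) \<le> ww Z \<and> pb (P Z) \<le> ww Z"
      using stride_le_length[OF uo(1)[OF m] Suc.prems(1) uo(2,3)[OF m]] uo(6)[OF m] uo(1)[OF m] unfolding stride_def node_ok_def by linarith
  qed
  have child: "(\<forall>I. cmp ?U I \<longrightarrow> (\<forall>Z\<in>?U. I Z < length (seg (f Z) (xs Z) (v Z))) \<longrightarrow> cmp ?U (\<lambda>Z. seg (f Z) (xs Z) (v Z) ! I Z mod 2 ^ (s Z - t Z))) \<and>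
     (\<forall>X. cmp ?U X \<longrightarrow> (\<forall>Z\<in>?U. \<forall>x\<in>set (seg (f Z) (xs Z) (v Z)). x div 2 ^ (s Z - t Z) = X Z div 2 ^ (s Z - t Z)) \<longrightarrow> cmp ?U (\<lambda>Z. fo (seg (f Z) (xs Z) (v Z)) (X Z)))
     \<and> cmp ?U (\<lambda>Z. length (seg (f Z) (xs Z) (v Z)))"
    if v: "cmp ?U v" "\<And>Z. Z \<in> ?U \<Longrightarrow> v Z < n Z" for v
  proof -
    have v1: "cmp ?U (\<lambda>Z. v Z + 1)" by (intro cmp_add v cmp_1 posU) (use v(2) nd(2) in \<open>fastforce\<close>)
    have cv: "cmp ?U (\<lambda>Z. cnt (f Z) (xs Z) (v Z))" by (rule ccnt[OF v(1)]) (use v(2) in fastforce)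
    have cv1: "cmp ?U (\<lambda>Z. cnt (f Z) (xs Z) (v Z + 1))" by (rule ccnt[OF v1]) (use v(2) in fastforce)
    have cl: "cmp ?U (\<lambda>Z. length (seg (f Z) (xs Z) (v Z)))" unfolding length_seg
    proof (rule cmp_sub[OF cv1 cv])
      fix Z assume m: "Z \<in> ?U"
      show "cnt (f Z) (xs Z) (v Z) \<le> cnt (f Z) (xs Z) (v Z + 1)" by (rule cnt_mono) simp
      show "cnt (f Z) (xs Z) (v Z + 1) < 2 ^ ww Z" using cle(2)[of Z "v Z + 1"] small(9)[OF m] by linarith
    qed
    have sc: "sub (bb Z) (A Z + L Z + stride j (P Z) (s Z) (?k Z) * cnt (f Z) (xs Z) (v Z)) (enc j (P Z) (s Z - t Z) (seg (f Z) (xs Z) (v Z)))"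
      "L Z + stride j (P Z) (s Z) (?k Z) * cnt (f Z) (xs Z) (v Z) + length (enc j (P Z) (s Z - t Z) (seg (f Z) (xs Z) (v Z))) \<le> length (enc (Suc j) (P Z) (s Z) (xs Z))"
      if m: "Z \<in> ?U" for Z
      using sub_child[OF uo(1)[OF m] Suc.prems(1) uo(2,3,5)[OF m], of "v Z"] v(2)[OF m] unfolding L_def f_def t_def n_def by auto
    have ca: "cmp ?U (\<lambda>Z. A Z + L Z + stride j (P Z) (s Z) (?k Z) * cnt (f Z) (xs Z) (v Z))"
      by (rule cmp_add[OF a4 cmp_mul[OF cS cv]]; frule sc(2); frule uo(6); linarith)
    have cst: "cmp ?U (\<lambda>Z. s Z - t Z)" by (rule cmp_sub[OF u(4) ct]) (use small(7,8) self_less_pow le_less_trans in blast)+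
    have "(\<forall>I. cmp ?U I \<longrightarrow> (\<forall>Z\<in>?U. I Z < length (seg (f Z) (xs Z) (v Z))) \<longrightarrow> cmp ?U (\<lambda>Z. seg (f Z) (xs Z) (v Z) ! I Z mod 2 ^ (s Z - t Z))) \<and>
     (\<forall>X. cmp ?U X \<longrightarrow> (\<forall>Z\<in>?U. \<forall>x\<in>set (seg (f Z) (xs Z) (v Z)). x div 2 ^ (s Z - t Z) = X Z div 2 ^ (s Z - t Z)) \<longrightarrow> cmp ?U (\<lambda>Z. fo (seg (f Z) (xs Z) (v Z)) (X Z)))"
    proof (rule Suc.IH[OF _ u(1,2) ca cst cl])
      show "j \<le> A0" using Suc.prems(1) by simp
      fix Z assume m: "Z \<in> ?U"
      have "node_ok (P Z) (ww Z) (s Z - t Z) (seg (f Z) (xs Z) (v Z))" unfolding t_def fe by (rule node_ok_seg[OF uo(1)[OF m]])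
      then show "node_ok (P Z) (ww Z) (s Z - t Z) (seg (f Z) (xs Z) (v Z)) \<and>
        sub (bb Z) (A Z + L Z + stride j (P Z) (s Z) (?k Z) * cnt (f Z) (xs Z) (v Z)) (enc j (P Z) (s Z - t Z) (seg (f Z) (xs Z) (v Z))) \<and>
        A Z + L Z + stride j (P Z) (s Z) (?k Z) * cnt (f Z) (xs Z) (v Z) + length (enc j (P Z) (s Z - t Z) (seg (f Z) (xs Z) (v Z))) < 2 ^ ww Z"
        using sc[OF m] uo(6)[OF m] by linarith
    qed
    then show ?thesis using cl by blast
  qed
  show ?case
  proof (intro conjI allI impI)
    fix I assume I: "cmp V I" "\<forall>Z\<in>V. I Z < length (xs Z)"
    have Ik: "I Z < ?k Z" if "Z \<in> ?U" for Z using I(2) that by blast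
    have cI: "cmp ?U I" by (rule cmp_inter[OF I(1)])
    define c0 where "c0 Z = I Z div C Z" for Z
    define v0 where "v0 Z = f Z (xs Z ! (c0 Z * C Z))" for Z
    have cc0: "cmp ?U c0" unfolding c0_def by (intro cmp_div cI cC)
    have c0n: "c0 Z < ncl (?k Z)" if "Z \<in> ?U" for Z
      using Ik[OF that] unfolding c0_def ncl_def C_def by (simp add: less_Suc_eq_le div_le_mono)
    have "cmp ?U (\<lambda>Z. map (\<lambda>c. f Z (xs Z ! (c * C Z))) [0..<ncl (?k Z)] ! c0 Z)"
    proof (rule cmp_arr[OF u(1) a2 cd cc0])
      fix Z assume m: "Z \<in> ?U"
      have "c0 Z * d Z \<le> ncl (?k Z) * d Z" using c0n[OF m] by simp
      then have 1: "A Z + ph (P Z) + (n Z + 1) * d Z + c0 Z * d Z < 2 ^ ww Z" using bnd[OF m] by linarith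
      have "v0 Z < 2 ^ d Z" "v0 Z < 2 ^ ww Z" unfolding v0_def using fn[of Z "xs Z ! (c0 Z * C Z)"] nd[OF m] by linarith+
      then show "sub (bb Z) (A Z + ph (P Z) + (n Z + 1) * d Z) (arr (d Z) (map (\<lambda>c. f Z (xs Z ! (c * C Z))) [0..<ncl (?k Z)])) \<and>
        c0 Z < length (map (\<lambda>c. f Z (xs Z ! (c * C Z))) [0..<ncl (?k Z)]) \<and> map (\<lambda>c. f Z (xs Z ! (c * C Z))) [0..<ncl (?k Z)] ! c0 Z < 2 ^ d Z \<and>
        map (\<lambda>c. f Z (xs Z ! (c * C Z))) [0..<ncl (?k Z)] ! c0 Z < 2 ^ ww Z \<and> A Z + ph (P Z) + (n Z + 1) * d Z + c0 Z * d Z < 2 ^ ww Z"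
        using subs(3)[OF m] 1 c0n[OF m] by (simp add: v0_def)
    qed
    then have cv0: "cmp ?U v0" by (rule cmp_cong) (use c0n in \<open>simp add: v0_def\<close>)
    have v0n: "v0 Z < n Z" for Z unfolding v0_def by (rule fn)
    have cv1: "cmp ?U (\<lambda>Z. v0 Z + 1)" by (rule cmp_add[OF cv0 cmp_1[OF posU]], frule small(2)) (use v0n in \<open>metis add_less_mono1 less_trans\<close>)
    have cst: "cmp ?U (\<lambda>Z. cnt (f Z) (xs Z) (v0 Z + 1))" by (rule ccnt[OF cv1]) (use v0n in \<open>simp add: Suc_le_eq\<close>)
    define y where "y Z = v0 Z * C Z + I Z mod C Z" for Z
    have yn: "y Z < n Z * C Z" if "Z \<in> ?U" for Z
    proof -
      have "y Z < (v0 Z + 1) * C Z" unfolding y_def using small(5)[OF that] by simp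
      also have "\<dots> \<le> n Z * C Z" using v0n[of Z] by (intro mult_le_mono1) simp
      finally show ?thesis .
    qed
    have vC: "v0 Z * C Z < 2 ^ ww Z" "y Z < 2 ^ ww Z" if "Z \<in> ?U" for Z using yn[OF that] small(3)[OF that] unfolding y_def by linarith+
    have cy: "cmp ?U y" unfolding y_def by (intro cmp_add cmp_mul cmp_mod cv0 cC cI) (use vC in \<open>auto simp: y_def\<close>)
    have "cmp ?U (\<lambda>Z. map (spY (s Z) (xs Z)) [0..<n Z * C Z] ! y Z)"
    proof (rule cmp_arr[OF u(1) a3 cd cy])
      fix Z assume m: "Z \<in> ?U"
      have "y Z * d Z \<le> n Z * C Z * d Z" using yn[OF m] by simp
      then have 1: "A Z + ph (P Z) + (n Z + 1) * d Z + ncl (?k Z) * d Z + y Z * d Z < 2 ^ ww Z" using bnd[OF m] by linarith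
      have "spY (s Z) (xs Z) (y Z) < n Z" using fn[of Z] small(6)[OF m] unfolding spY_def Let_def fe[symmetric] by simp
      then have "spY (s Z) (xs Z) (y Z) < 2 ^ d Z" "spY (s Z) (xs Z) (y Z) < 2 ^ ww Z" using nd[OF m] by linarith+
      then show "sub (bb Z) (A Z + ph (P Z) + (n Z + 1) * d Z + ncl (?k Z) * d Z) (arr (d Z) (map (spY (s Z) (xs Z)) [0..<n Z * C Z])) \<and>
        y Z < length (map (spY (s Z) (xs Z)) [0..<n Z * C Z]) \<and> map (spY (s Z) (xs Z)) [0..<n Z * C Z] ! y Z < 2 ^ d Z \<and>
        map (spY (s Z) (xs Z)) [0..<n Z * C Z] ! y Z < 2 ^ ww Z \<and> A Z + ph (P Z) + (n Z + 1) * d Z + ncl (?k Z) * d Z + y Z * d Z < 2 ^ ww Z"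
        using subs(4)[OF m] 1 yn[OF m] by simp
    qed
    then have cY: "cmp ?U (\<lambda>Z. spY (s Z) (xs Z) (y Z))" by (rule cmp_cong) (use yn in simp)
    \<comment> \<open>Position \<open>i\<close> has the leading bits of the first element of its
      cell if it lies before the end of that group, and otherwise lies in the mixed cell of the
      group.\<close>
    have cv: "cmp ?U (\<lambda>Z. f Z (xs Z ! I Z))"
    proof (rule cmp_cong[OF cmp_if[OF cmp_less[OF cI cst] cmp_inter[OF cv0] cmp_inter[OF cY]]])
      fix Z assume m: "Z \<in> ?U"
      show "(if I Z < cnt (f Z) (xs Z) (v0 Z + 1) then v0 Z else spY (s Z) (xs Z) (y Z)) = f Z (xs Z ! I Z)"
        using spY_mixed[of "s Z" "xs Z" "I Z" "v0 Z"] spY_pure[of "s Z" "xs Z" "I Z" "v0 Z"] so[OF m] Ik[OF m]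
        unfolding fe[symmetric] v0_def y_def c0_def C_def by auto
    qed
    let ?v = "\<lambda>Z. f Z (xs Z ! I Z)" and ?c = "\<lambda>Z. cnt (f Z) (xs Z) (f Z (xs Z ! I Z))"
    have cI': "?c Z \<le> I Z" "I Z - ?c Z < length (seg (f Z) (xs Z) (?v Z))" if m: "Z \<in> ?U" for Z
      using cnt_iff[OF so[OF m] Ik[OF m], of "?v Z"] cnt_iff[OF so[OF m] Ik[OF m], of "?v Z + 1"] by (auto simp: length_seg)
    have cc: "cmp ?U ?c" by (rule ccnt[OF cv]) (use fn in \<open>auto intro: less_imp_le\<close>)
    have cd2: "cmp ?U (\<lambda>Z. I Z - ?c Z)" by (rule cmp_sub[OF cI cc]) (use cI' Ik small(9) less_trans in blast)+
    have r: "cmp ?U (\<lambda>Z. seg (f Z) (xs Z) (?v Z) ! (I Z - ?c Z) mod 2 ^ (s Z - t Z))"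
      using child[OF cv] fn cd2 cI' by blast
    have dec: "xs Z ! I Z mod 2 ^ s Z = ?v Z * 2 ^ (s Z - t Z) + seg (f Z) (xs Z) (?v Z) ! (I Z - ?c Z) mod 2 ^ (s Z - t Z)" if m: "Z \<in> ?U" for Z
      using sb_decomp[OF small(7)[OF m], of "xs Z ! I Z"] nth_seg[OF cI'(2)[OF m]] cI'(1)[OF m] by (simp add: f_def)
    have lt: "xs Z ! I Z mod 2 ^ s Z < 2 ^ ww Z" if m: "Z \<in> ?U" for Z
    proof -
      have "xs Z ! I Z mod 2 ^ s Z < 2 ^ s Z" by simp
      also have "(2::nat) ^ s Z \<le> 2 ^ ww Z" using small(8)[OF m] by (intro power_increasing) auto
      finally show ?thesis .
    qed
    have cst': "cmp ?U (\<lambda>Z. s Z - t Z)" by (rule cmp_sub[OF u(4) ct]) (use small(7,8) self_less_pow le_less_trans in blast)+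
    have "cmp ?U (\<lambda>Z. ?v Z * 2 ^ (s Z - t Z) + seg (f Z) (xs Z) (?v Z) ! (I Z - ?c Z) mod 2 ^ (s Z - t Z))"
      by (intro cmp_add cmp_shl cv cst' r) (use lt dec in \<open>fastforce\<close>)+
    then have "cmp ?U (\<lambda>Z. xs Z ! I Z mod 2 ^ s Z)" by (rule cmp_cong) (use dec in simp)
    then show "cmp V (\<lambda>Z. xs Z ! I Z mod 2 ^ s Z)"
      using I by (intro cmp_leaf_nth[OF Suc.prems(2,4,5,6) leaf I(1)]) auto
  next
    fix X assume X: "cmp V X" "\<forall>Z\<in>V. \<forall>x\<in>set (xs Z). x div 2 ^ s Z = X Z div 2 ^ s Z"
    have cX: "cmp ?U X" by (rule cmp_inter[OF X(1)])
    have cst': "cmp ?U (\<lambda>Z. s Z - t Z)" by (rule cmp_sub[OF u(4) ct]) (use small(7,8) self_less_pow le_less_trans in blast)+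
    let ?v = "\<lambda>Z. f Z (X Z)"
    have cv: "cmp ?U ?v" unfolding f_def sb_def
      by (intro cmp_shr cmp_modpow u(1) cX u(4) cst') (use small(8) in auto)
    have pre: "x div 2 ^ (s Z - t Z) = X Z div 2 ^ (s Z - t Z)" if m: "Z \<in> ?U" and x: "x \<in> set (seg (f Z) (xs Z) (?v Z))" for Z x
    proof -
      have "x \<in> set (xs Z)" "f Z x = f Z (X Z)" using x set_seg[OF so[OF m]] by auto
      then show ?thesis using X(2) m sb_prefix[OF small(7)[OF m], of x] sb_prefix[OF small(7)[OF m], of "X Z"] by (auto simp: f_def)
    qed
    have cf: "cmp ?U (\<lambda>Z. fo (seg (f Z) (xs Z) (?v Z)) (X Z))" and cl: "cmp ?U (\<lambda>Z. length (seg (f Z) (xs Z) (?v Z)))"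
      using child[OF cv] fn cX pre by blast+
    have cc: "cmp ?U (\<lambda>Z. cnt (f Z) (xs Z) (?v Z))" by (rule ccnt[OF cv]) (use fn in \<open>auto intro: less_imp_le\<close>)
    have b: "cnt (f Z) (xs Z) (?v Z) + length (seg (f Z) (xs Z) (?v Z)) < 2 ^ ww Z" if m: "Z \<in> ?U" for Z
      using cnt_mono[of "?v Z" "?v Z + 1" "f Z" "xs Z"] cle(2)[of Z "?v Z + 1"] small(9)[OF m] by (simp add: length_seg)
    have "cmp ?U (\<lambda>Z. if fo (seg (f Z) (xs Z) (?v Z)) (X Z) < length (seg (f Z) (xs Z) (?v Z))
        then cnt (f Z) (xs Z) (?v Z) + fo (seg (f Z) (xs Z) (?v Z)) (X Z) else ?k Z)"
    proof (intro cmp_if cmp_less cf cl cmp_add cmp_inter[OF cf] cmp_inter[OF cc] cmp_inter[OF u(5)])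
      fix Z assume "Z \<in> ?U \<inter> {Z. fo (seg (f Z) (xs Z) (?v Z)) (X Z) < length (seg (f Z) (xs Z) (?v Z))}"
      then have m: "Z \<in> ?U" and l: "fo (seg (f Z) (xs Z) (?v Z)) (X Z) < length (seg (f Z) (xs Z) (?v Z))" by auto
      then show "cnt (f Z) (xs Z) (?v Z) + fo (seg (f Z) (xs Z) (?v Z)) (X Z) < 2 ^ ww Z" using b[OF m] by linarith
    qed
    then have "cmp ?U (\<lambda>Z. fo (xs Z) (X Z))" by (rule cmp_cong) (use fo_seg[OF so] in simp)
    then show "cmp V (\<lambda>Z. fo (xs Z) (X Z))"
      using X by (intro cmp_leaf_fo[OF Suc.prems(2,4,5,6) leaf X(1)]) auto
  qed
qed

section \<open>Monotone sequences over a dense universe\<close>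

text \<open>A sequence of \<open>dn\<close> values below \<open>dU\<close> is cut into blocks of \<open>dbe\<close> positions, which are sparse if they span \<open>dD\<close>
  or more values, and into cells of \<open>dg\<close> values. \<open>dga\<close> is the block length of the monotone arrays, which have \<open>dNB\<close> or
  \<open>dNC\<close> blocks, \<open>dW\<close> the width of a full field and \<open>dNI\<close> a bound for the block codes. The other components are
  addresses. \<open>bC\<close> counts units of four bits, because the block codes may end beyond bit \<open>2 ^ w\<close>.\<close>

record ds = dn :: nat  dU :: nat  dbe :: nat  dg :: nat  dD :: nat  dW :: nat  dga :: nat  dNB :: nat  dNC :: nat  dNI :: nat
  bS :: nat  bZt :: nat  bR :: nat  bF :: nat  bP :: nat  bZ :: nat  bI :: nat  bH :: nat  bHR :: nat  bC :: nat

definition Fh :: "ds \<Rightarrow> (nat \<Rightarrow> nat) \<Rightarrow> nat \<Rightarrow> nat" where "Fh d h j = h (j * dbe d)"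
definition sparse :: "ds \<Rightarrow> (nat \<Rightarrow> nat) \<Rightarrow> nat \<Rightarrow> bool" where "sparse d h j \<longleftrightarrow> dD d \<le> Fh d h (j + 1) - Fh d h j"
text \<open>Only the gaps inside a block are coded; the gap leading to the next block is implied by
  the stored first values.\<close>

definition gaps :: "ds \<Rightarrow> (nat \<Rightarrow> nat) \<Rightarrow> nat \<Rightarrow> nat list" where
  "gaps d h j = map (\<lambda>r. h (j * dbe d + r + 1) - h (j * dbe d + r)) [0..<dbe d - 1]"
definition nb :: "ds \<Rightarrow> nat" where "nb d = dn d div dbe d + 1"
definition gdom :: "ds \<Rightarrow> nat list set" where "gdom d = {gs. length gs = dbe d - 1 \<and> set gs \<subseteq> {..<dD d}}"
text \<open>Code lengths are rounded up to units of four bits, the unit of the code addresses, at a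
  cost of at most three bits per block.\<close>

definition ln4 :: "nat \<Rightarrow> nat" where "ln4 x = (bits x + 3) div 4"
definition rcd :: "ds \<Rightarrow> (nat \<Rightarrow> nat) \<Rightarrow> (nat list \<Rightarrow> nat) \<Rightarrow> nat \<Rightarrow> bool list" where
  "rcd d h c j = (if sparse d h j then arr (dW d) (map (\<lambda>r. h (j * dbe d + r)) [0..<dbe d])
     else tobits (4 * ln4 (c (gaps d h j))) (c (gaps d h j)))"
text \<open>Addresses in units of four bits. The function is constant beyond the last block, so it
  can be kept in a monotone array that has more entries than there are blocks.\<close>

definition Pu :: "ds \<Rightarrow> (nat \<Rightarrow> nat) \<Rightarrow> (nat list \<Rightarrow> nat) \<Rightarrow> nat \<Rightarrow> nat" where
  "Pu d h c j = (\<Sum>i<min j (nb d). length (rcd d h c i) div 4)"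
definition cv :: "ds \<Rightarrow> (nat \<Rightarrow> nat) \<Rightarrow> nat \<Rightarrow> nat" where "cv d h v = cnt h [0..<dn d] v"
text \<open>The positions that come with extra space for the low bits.\<close>

definition exs :: "ds \<Rightarrow> (nat \<Rightarrow> nat) \<Rightarrow> nat \<Rightarrow> nat" where
  "exs d h i = of_bool (sparse d h (i div dbe d) \<or> i mod dbe d \<noteq> 0 \<and> h i = h (i - 1))"
definition Zc :: "ds \<Rightarrow> (nat \<Rightarrow> nat) \<Rightarrow> nat \<Rightarrow> nat" where
  "Zc d h i = (\<Sum>i'<min i (nb d * dbe d). exs d h i')"
definition Ic :: "ds \<Rightarrow> (nat \<Rightarrow> nat) \<Rightarrow> nat \<Rightarrow> nat" where "Ic d h k = cv d h (k * dg d)"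
text \<open>The cells for which all ranks are stored. In any other cell there are fewer positions
  than in a block, so these lie in two consecutive blocks, and unless there are none, neither block
  is sparse and tables apply.\<close>

definition hard :: "ds \<Rightarrow> (nat \<Rightarrow> nat) \<Rightarrow> nat \<Rightarrow> bool" where
  "hard d h k \<longleftrightarrow> dbe d \<le> Ic d h (k + 1) - Ic d h k \<or> (0 < Ic d h (k + 1) - Ic d h k \<and>
     (sparse d h (Ic d h k div dbe d) \<or> sparse d h (Ic d h k div dbe d + 1)))"
definition hrec :: "ds \<Rightarrow> (nat \<Rightarrow> nat) \<Rightarrow> nat \<Rightarrow> bool list" where
  "hrec d h k = (if hard d h k then arr (bits (Ic d h (k + 1) - Ic d h k)) (map (\<lambda>v. cv d h (k * dg d + v) - Ic d h k) [0..<dg d]) else [])"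
definition Hp :: "ds \<Rightarrow> (nat \<Rightarrow> nat) \<Rightarrow> nat \<Rightarrow> nat" where "Hp d h k = (\<Sum>i<k. length (hrec d h i))"

definition gl :: "ds \<Rightarrow> (nat list \<Rightarrow> nat) \<Rightarrow> nat \<Rightarrow> nat list" where
  "gl d c x = (SOME gs. gs \<in> gdom d \<and> c gs = x)"
text \<open>The index combines a code and a position as \<open>code * dbe + r\<close>. Numbers that
  are not codes get the entry 0.\<close>

definition tabS :: "ds \<Rightarrow> (nat list \<Rightarrow> nat) \<Rightarrow> nat \<Rightarrow> nat" where
  "tabS d c x = (if x div dbe d \<in> c ` gdom d then sum_list (take (x mod dbe d) (gl d c (x div dbe d))) else 0)"
text \<open>Position \<open>i > 0\<close> of a block repeats its predecessor if gap
  \<open>i - 1\<close> is zero, and position 0 is never counted; the first \<open>r\<close>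
  positions therefore involve \<open>r - 1\<close> gaps.\<close>

definition tabZ :: "ds \<Rightarrow> (nat list \<Rightarrow> nat) \<Rightarrow> nat \<Rightarrow> nat" where
  "tabZ d c x = (if x div dbe d \<in> c ` gdom d then length (filter (\<lambda>g. g = 0) (take (x mod dbe d - 1) (gl d c (x div dbe d)))) else 0)"
definition tabR :: "ds \<Rightarrow> (nat list \<Rightarrow> nat) \<Rightarrow> nat \<Rightarrow> nat" where
  "tabR d c x = (if x div dD d \<in> c ` gdom d then card {r. r < dbe d \<and> sum_list (take r (gl d c (x div dD d))) < x mod dD d} else 0)"

definition ma_at :: "ds \<Rightarrow> nat \<Rightarrow> bool list \<Rightarrow> nat \<Rightarrow> nat \<Rightarrow> (nat \<Rightarrow> nat) \<Rightarrow> bool" where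
  "ma_at d w bs B N A \<longleftrightarrow> sub bs B (ma (dW d) (dga d) N A) \<and> mono A \<and> A (N * dga d) < 2 ^ w \<and> A (N * dga d) < 2 ^ dW d
     \<and> length (ma (dW d) (dga d) N A) < 2 ^ dW d \<and> B + length (ma (dW d) (dga d) N A) < 2 ^ w"

definition tab_at :: "ds \<Rightarrow> nat \<Rightarrow> bool list \<Rightarrow> nat \<Rightarrow> nat \<Rightarrow> (nat \<Rightarrow> nat) \<Rightarrow> bool" where
  "tab_at d w bs B N f \<longleftrightarrow> sub bs B (arr (dW d) (map f [0..<N])) \<and> B + N * dW d < 2 ^ w"

text \<open>Beyond its end the sequence continues with the value \<open>dU\<close>, larger than all
  others. This sentinel fills up the last block and makes all directories total.\<close>

definition seq_ok :: "ds \<Rightarrow> (nat \<Rightarrow> nat) \<Rightarrow> (nat list \<Rightarrow> nat) \<Rightarrow> bool" where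
  "seq_ok d h c \<longleftrightarrow> mono h \<and> (\<forall>i\<ge>dn d. h i = dU d) \<and> (\<forall>i<dn d. h i < dU d) \<and> 0 < dbe d \<and> 0 < dg d \<and> 0 < dD d \<and> 4 dvd dW d \<and> 0 < dW d \<and>
     inj_on c (gdom d) \<and> (\<forall>gs\<in>gdom d. c gs < dNI d)"

definition dms_ok :: "ds \<Rightarrow> (nat \<Rightarrow> nat) \<Rightarrow> (nat list \<Rightarrow> nat) \<Rightarrow> nat \<Rightarrow> bool list \<Rightarrow> bool" where
  "dms_ok d h c w bs \<longleftrightarrow> seq_ok d h c \<and> (\<forall>gs\<in>gdom d. bits (c gs) + 3 \<le> w) \<and>
     dU d < 2 ^ dW d \<and> dbe d * dD d < 2 ^ dW d \<and> dbe d * dD d < 2 ^ w \<and> dU d + dbe d + dg d < 2 ^ w \<and> dn d < 2 ^ w \<and> nb d + 2 < 2 ^ w \<and>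
     nb d + 2 < dNB d * dga d \<and> dU d div dg d + 2 < dNC d * dga d \<and> dNI d * dbe d < 2 ^ w \<and> dNI d * dD d < 2 ^ w \<and>
     tab_at d w bs (bS d) (dNI d * dbe d) (tabS d c) \<and> tab_at d w bs (bZt d) (dNI d * dbe d) (tabZ d c) \<and>
     tab_at d w bs (bR d) (dNI d * dD d) (tabR d c) \<and>
     ma_at d w bs (bF d) (dNB d) (Fh d h) \<and> ma_at d w bs (bP d) (dNB d) (Pu d h c) \<and> ma_at d w bs (bZ d) (dNB d) (\<lambda>j. Zc d h (j * dbe d)) \<and>
     ma_at d w bs (bI d) (dNC d) (Ic d h) \<and> ma_at d w bs (bH d) (dNC d) (Hp d h) \<and>
     sub bs (bHR d) (cat (hrec d h) (dU d div dg d + 1)) \<and> bHR d + length (cat (hrec d h) (dU d div dg d + 1)) < 2 ^ w \<and>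
     sub bs (4 * bC d) (cat (rcd d h c) (nb d)) \<and> bC d + Pu d h c (nb d) < 2 ^ w"

definition dcmp :: "st set \<Rightarrow> (st \<Rightarrow> ds) \<Rightarrow> bool" where
  "dcmp V d \<longleftrightarrow> cmp V (\<lambda>Z. dn (d Z)) \<and> cmp V (\<lambda>Z. dU (d Z)) \<and> cmp V (\<lambda>Z. dbe (d Z)) \<and> cmp V (\<lambda>Z. dg (d Z)) \<and> cmp V (\<lambda>Z. dD (d Z))
    \<and> cmp V (\<lambda>Z. dW (d Z)) \<and> cmp V (\<lambda>Z. dga (d Z)) \<and> cmp V (\<lambda>Z. dNB (d Z)) \<and> cmp V (\<lambda>Z. dNC (d Z)) \<and> cmp V (\<lambda>Z. dNI (d Z))
    \<and> cmp V (\<lambda>Z. bS (d Z)) \<and> cmp V (\<lambda>Z. bZt (d Z)) \<and> cmp V (\<lambda>Z. bR (d Z)) \<and> cmp V (\<lambda>Z. bF (d Z)) \<and> cmp V (\<lambda>Z. bP (d Z)) \<and> cmp V (\<lambda>Z. bZ (d Z))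
    \<and> cmp V (\<lambda>Z. bI (d Z)) \<and> cmp V (\<lambda>Z. bH (d Z)) \<and> cmp V (\<lambda>Z. bHR (d Z)) \<and> cmp V (\<lambda>Z. bC (d Z))"

section \<open>Ranks, gaps and repetitions within a block\<close>

lemma dcmpD:
  assumes "dcmp V d"
  shows "cmp V (\<lambda>Z. dn (d Z))" "cmp V (\<lambda>Z. dU (d Z))" "cmp V (\<lambda>Z. dbe (d Z))" "cmp V (\<lambda>Z. dg (d Z))" "cmp V (\<lambda>Z. dD (d Z))"
    "cmp V (\<lambda>Z. dW (d Z))" "cmp V (\<lambda>Z. dga (d Z))" "cmp V (\<lambda>Z. dNB (d Z))" "cmp V (\<lambda>Z. dNC (d Z))" "cmp V (\<lambda>Z. dNI (d Z))"
    "cmp V (\<lambda>Z. bS (d Z))" "cmp V (\<lambda>Z. bZt (d Z))" "cmp V (\<lambda>Z. bR (d Z))" "cmp V (\<lambda>Z. bF (d Z))" "cmp V (\<lambda>Z. bP (d Z))" "cmp V (\<lambda>Z. bZ (d Z))"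
    "cmp V (\<lambda>Z. bI (d Z))" "cmp V (\<lambda>Z. bH (d Z))" "cmp V (\<lambda>Z. bHR (d Z))" "cmp V (\<lambda>Z. bC (d Z))"
  using assms unfolding dcmp_def by blast+

lemma dcmp_mono: "dcmp V d \<Longrightarrow> V' \<subseteq> V \<Longrightarrow> dcmp V' d"
  unfolding dcmp_def by (intro conjI) (blast intro: cmp_mono)+

text \<open>The usual adjunction between access and rank in a sorted sequence; for positions past
  the end it holds thanks to the sentinel and \<open>v <= dU d\<close>.\<close>

lemma cv_iff:
  assumes "seq_ok d h c" "v \<le> dU d"
  shows "h i < v \<longleftrightarrow> i < cv d h v"
proof (cases "i < dn d")
  case True
  have "sorted (map h [0..<dn d])" using assms by (auto simp: seq_ok_def sorted_iff_nth_mono mono_def)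
  then show ?thesis using cnt_iff[of h "[0..<dn d]" i v] True by (simp add: cv_def)
next
  case False
  then have "h i = dU d" using assms by (auto simp: seq_ok_def)
  moreover have "cv d h v \<le> dn d" using cnt_le[of h "[0..<dn d]" v] by (simp add: cv_def)
  ultimately show ?thesis using False assms(2) by linarith
qed

lemma cv_le: "cv d h v \<le> dn d" using cnt_le[of h "[0..<dn d]" v] by (simp add: cv_def)

lemma cv_mono: "v \<le> v' \<Longrightarrow> cv d h v \<le> cv d h v'" unfolding cv_def by (rule cnt_mono)

lemma sum_gaps: "mono h \<Longrightarrow> r < dbe d \<Longrightarrow> sum_list (take r (gaps d h j)) = h (j * dbe d + r) - h (j * dbe d)"
proof (induction r)
  case (Suc r)
  have len: "r < length (gaps d h j)" using Suc.prems by (simp add: gaps_def)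
  have m: "h (j * dbe d) \<le> h (j * dbe d + r)" "h (j * dbe d + r) \<le> h (j * dbe d + r + 1)" using Suc.prems by (auto simp: mono_def)
  have "take (Suc r) (gaps d h j) = take r (gaps d h j) @ [gaps d h j ! r]" using len by (rule take_Suc_conv_app_nth)
  moreover have "gaps d h j ! r = h (j * dbe d + r + 1) - h (j * dbe d + r)" using len by (simp add: gaps_def)
  ultimately show ?case using Suc m by simp
qed simp

lemma gaps_in_gdom:
  assumes "seq_ok d h c" "\<not> sparse d h j"
  shows "gaps d h j \<in> gdom d"
proof -
  have m: "mono h" using assms by (simp add: seq_ok_def)
  have "h (j * dbe d + r + 1) - h (j * dbe d + r) < dD d" if "r < dbe d - 1" for r
  proof -
    have "h (j * dbe d) \<le> h (j * dbe d + r)" "h (j * dbe d + r + 1) \<le> h ((j + 1) * dbe d)"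
      using m that by (auto simp: mono_def)
    moreover have "h ((j + 1) * dbe d) - h (j * dbe d) < dD d" using assms(2) by (simp add: sparse_def Fh_def)
    ultimately show ?thesis by linarith
  qed
  then show ?thesis by (auto simp: gdom_def gaps_def)
qed

lemma gl_cid: "inj_on c (gdom d) \<Longrightarrow> gs \<in> gdom d \<Longrightarrow> gl d c (c gs) = gs"
proof -
  assume a: "inj_on c (gdom d)" "gs \<in> gdom d"
  have "gl d c (c gs) \<in> gdom d \<and> c (gl d c (c gs)) = c gs" unfolding gl_def by (rule someI[of _ gs]) (use a in auto)
  then show ?thesis using a by (auto dest: inj_onD)
qed

lemma tabS_gaps:
  assumes "seq_ok d h c" "\<not> sparse d h j" "r < dbe d"
  shows "tabS d c (c (gaps d h j) * dbe d + r) = h (j * dbe d + r) - Fh d h j"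
proof -
  have g: "gaps d h j \<in> gdom d" by (rule gaps_in_gdom[OF assms(1,2)])
  have "gl d c (c (gaps d h j)) = gaps d h j" using assms(1) g by (intro gl_cid) (auto simp: seq_ok_def)
  then show ?thesis using g assms sum_gaps[of h r d j] by (simp add: tabS_def seq_ok_def Fh_def)
qed

lemma tabR_gaps:
  assumes "seq_ok d h c" "\<not> sparse d h j" "x < dD d"
  shows "tabR d c (c (gaps d h j) * dD d + x) = card {r. r < dbe d \<and> h (j * dbe d + r) - Fh d h j < x}"
proof -
  have g: "gaps d h j \<in> gdom d" by (rule gaps_in_gdom[OF assms(1,2)])
  have "gl d c (c (gaps d h j)) = gaps d h j" using assms(1) g by (intro gl_cid) (auto simp: seq_ok_def)
  then have "tabR d c (c (gaps d h j) * dD d + x) = card {r. r < dbe d \<and> sum_list (take r (gaps d h j)) < x}"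
    using g assms by (simp add: tabR_def seq_ok_def)
  also have "{r. r < dbe d \<and> sum_list (take r (gaps d h j)) < x} = {r. r < dbe d \<and> h (j * dbe d + r) - Fh d h j < x}"
    using sum_gaps[of h _ d j] assms(1) by (auto simp: seq_ok_def Fh_def)
  finally show ?thesis .
qed

text \<open>By \<open>cv_iff\<close> the positions of the block with values below \<open>v\<close>
  form an initial segment, and its length is counted from the gaps alone.\<close>

lemma cv_block:
  assumes ok: "seq_ok d h c" and v: "v \<le> dU d" and j: "j * dbe d \<le> cv d h v" "cv d h v \<le> (j + 1) * dbe d"
  shows "cv d h v = j * dbe d + card {r. r < dbe d \<and> h (j * dbe d + r) - Fh d h j < v - Fh d h j}"
proof -
  have iff: "h (j * dbe d + r) - Fh d h j < v - Fh d h j \<longleftrightarrow> j * dbe d + r < cv d h v" for r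
  proof -
    have "Fh d h j \<le> h (j * dbe d + r)" using ok by (auto simp: seq_ok_def mono_def Fh_def)
    then have "h (j * dbe d + r) - Fh d h j < v - Fh d h j \<longleftrightarrow> h (j * dbe d + r) < v" by linarith
    then show ?thesis using cv_iff[OF ok v] by simp
  qed
  have j2: "cv d h v \<le> j * dbe d + dbe d" using j(2) by simp
  have "{r. r < dbe d \<and> h (j * dbe d + r) - Fh d h j < v - Fh d h j} = {..<cv d h v - j * dbe d}"
    unfolding iff by (rule set_eqI, unfold mem_Collect_eq lessThan_iff) (use j(1) j2 in linarith)
  then show ?thesis using j(1) by simp
qed

lemma Zc_block:
  assumes ok: "seq_ok d h c" and j: "j < nb d" and r: "r < dbe d"
  shows "Zc d h (j * dbe d + r) = Zc d h (j * dbe d) + (if sparse d h j then r else tabZ d c (c (gaps d h j) * dbe d + r))"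
proof -
  have b: "0 < dbe d" using ok by (simp add: seq_ok_def)
  have le: "j * dbe d + dbe d \<le> nb d * dbe d" using mult_le_mono1[OF Suc_leI[OF j], of "dbe d"] by simp
  have Zs: "Zc d h (j * dbe d + x) = Zc d h (j * dbe d) + (\<Sum>i<x. exs d h (j * dbe d + i))" if "x < dbe d" for x
  proof -
    have "Zc d h (j * dbe d + x) = (\<Sum>i<j * dbe d + x. exs d h i)" "Zc d h (j * dbe d) = (\<Sum>i<j * dbe d. exs d h i)"
      using le that by (simp_all add: Zc_def min_absorb1)
    moreover have "(\<Sum>i<a + x. exs d h i) = (\<Sum>i<a. exs d h i) + (\<Sum>i<x. exs d h (a + i))" for a
      by (induction x) auto
    ultimately show ?thesis by simp
  qed
  have e: "exs d h (j * dbe d + i) = of_bool (sparse d h j \<or> i \<noteq> 0 \<and> h (j * dbe d + i) = h (j * dbe d + i - 1))" if "i < dbe d" for i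
    using that b by (simp add: exs_def)
  show ?thesis
  proof (cases "sparse d h j")
    case True
    then have "(\<Sum>i<r. exs d h (j * dbe d + i)) = (\<Sum>i<r. 1)" using r e by (intro sum.cong) auto
    then show ?thesis using Zs[OF r] True by simp
  next
    case False
    have g: "gaps d h j \<in> gdom d" by (rule gaps_in_gdom[OF ok False])
    have gl: "gl d c (c (gaps d h j)) = gaps d h j" using ok g by (intro gl_cid) (auto simp: seq_ok_def)
    have "(\<Sum>i<x. exs d h (j * dbe d + i)) = length (filter (\<lambda>g. g = 0) (take (x - 1) (gaps d h j)))" if "x \<le> r" for x
      using that
    proof (induction x)
      case (Suc x)
      have ex: "exs d h (j * dbe d + x) = of_bool (x \<noteq> 0 \<and> h (j * dbe d + x) = h (j * dbe d + x - 1))" using e[of x] Suc.prems r False by simp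
      show ?case
      proof (cases x)
        case 0 then show ?thesis using Suc ex by simp
      next
        case (Suc y)
        have yl: "y < length (gaps d h j)" using Suc Suc.prems r by (simp add: gaps_def)
        have "gaps d h j ! y = h (j * dbe d + y + 1) - h (j * dbe d + y)" using yl by (simp add: gaps_def)
        moreover have "h (j * dbe d + y) \<le> h (j * dbe d + y + 1)" using ok by (auto simp: seq_ok_def mono_def)
        ultimately have "gaps d h j ! y = 0 \<longleftrightarrow> h (j * dbe d + x) = h (j * dbe d + x - 1)" using Suc by auto
        then show ?thesis using Suc.IH Suc.prems ex Suc yl by (simp add: take_Suc_conv_app_nth)
      qed
    qed simp
    then have "(\<Sum>i<r. exs d h (j * dbe d + i)) = tabZ d c (c (gaps d h j) * dbe d + r)"
      using g gl b r by (simp add: tabZ_def)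
    then show ?thesis using Zs[OF r] False by simp
  qed
qed

subsection \<open>Queries\<close>

lemma cmp_ma_at:
  assumes "wf V" "dcmp V d" "cmp V B" "cmp V N" "cmp V i" "\<And>Z. Z \<in> V \<Longrightarrow> ma_at (d Z) (ww Z) (bb Z) (B Z) (N Z) (A Z) \<and> i Z < N Z * dga (d Z)"
  shows "cmp V (\<lambda>Z. A Z (i Z))"
  by (rule cmp_ma[OF assms(1,3) dcmpD(6,7)[OF assms(2)] assms(4,5)]) (use assms(6) in \<open>unfold ma_at_def, blast\<close>)

lemma cmp_tab_at:
  assumes "wf V" "dcmp V d" "cmp V B" "cmp V i"
    "\<And>Z. Z \<in> V \<Longrightarrow> tab_at (d Z) (ww Z) (bb Z) (B Z) (N Z) (f Z) \<and> i Z < N Z \<and> f Z (i Z) < 2 ^ dW (d Z) \<and> f Z (i Z) < 2 ^ ww Z"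
  shows "cmp V (\<lambda>Z. f Z (i Z))"
proof -
  have "cmp V (\<lambda>Z. map (f Z) [0..<N Z] ! i Z)"
  proof (rule cmp_arr[OF assms(1,3) dcmpD(6)[OF assms(2)] assms(4)])
    fix Z assume v: "Z \<in> V"
    have "i Z * dW (d Z) \<le> N Z * dW (d Z)" using assms(5)[OF v] by simp
    then have "B Z + i Z * dW (d Z) < 2 ^ ww Z" using assms(5)[OF v] unfolding tab_at_def by linarith
    then show "sub (bb Z) (B Z) (arr (dW (d Z)) (map (f Z) [0..<N Z])) \<and> i Z < length (map (f Z) [0..<N Z]) \<and>
       map (f Z) [0..<N Z] ! i Z < 2 ^ dW (d Z) \<and> map (f Z) [0..<N Z] ! i Z < 2 ^ ww Z \<and> B Z + i Z * dW (d Z) < 2 ^ ww Z"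
      using assms(5)[OF v] by (simp add: tab_at_def)
  qed
  then show ?thesis by (rule cmp_cong) (use assms(5) in auto)
qed

lemma Pu_step: "j < nb d \<Longrightarrow> Pu d h c (j + 1) = Pu d h c j + length (rcd d h c j) div 4"
  by (simp add: Pu_def min_def)

lemma length_rcd_dvd: "4 dvd dW d \<Longrightarrow> 4 dvd length (rcd d h c j)"
  by (simp add: rcd_def)

lemma Pu_sum: "4 dvd dW d \<Longrightarrow> j \<le> nb d \<Longrightarrow> 4 * Pu d h c j = (\<Sum>i<j. length (rcd d h c i))"
  using length_rcd_dvd[of d h c] by (simp add: Pu_def min_absorb1 sum_distrib_left)

lemma
  assumes wf: "wf V" and d: "dcmp V d" and ok: "\<And>Z. Z \<in> V \<Longrightarrow> dms_ok (d Z) (h Z) (c Z) (ww Z) (bb Z)"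
  shows cmp_Fh: "cmp V j \<Longrightarrow> (\<And>Z. Z \<in> V \<Longrightarrow> j Z \<le> nb (d Z) + 2) \<Longrightarrow> cmp V (\<lambda>Z. Fh (d Z) (h Z) (j Z))"
    and cmp_Pu: "cmp V j \<Longrightarrow> (\<And>Z. Z \<in> V \<Longrightarrow> j Z \<le> nb (d Z) + 2) \<Longrightarrow> cmp V (\<lambda>Z. Pu (d Z) (h Z) (c Z) (j Z))"
    and cmp_ZA: "cmp V j \<Longrightarrow> (\<And>Z. Z \<in> V \<Longrightarrow> j Z \<le> nb (d Z) + 2) \<Longrightarrow> cmp V (\<lambda>Z. Zc (d Z) (h Z) (j Z * dbe (d Z)))"
    and cmp_Ic: "cmp V k \<Longrightarrow> (\<And>Z. Z \<in> V \<Longrightarrow> k Z \<le> dU (d Z) div dg (d Z) + 2) \<Longrightarrow> cmp V (\<lambda>Z. Ic (d Z) (h Z) (k Z))"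
    and cmp_Hp: "cmp V k \<Longrightarrow> (\<And>Z. Z \<in> V \<Longrightarrow> k Z \<le> dU (d Z) div dg (d Z) + 2) \<Longrightarrow> cmp V (\<lambda>Z. Hp (d Z) (h Z) (k Z))"
proof -
  note D = dcmpD[OF d]
  show "cmp V (\<lambda>Z. Fh (d Z) (h Z) (j Z))" "cmp V (\<lambda>Z. Pu (d Z) (h Z) (c Z) (j Z))" "cmp V (\<lambda>Z. Zc (d Z) (h Z) (j Z * dbe (d Z)))"
    if j: "cmp V j" "\<And>Z. Z \<in> V \<Longrightarrow> j Z \<le> nb (d Z) + 2" for j
  proof -
    have "j Z < dNB (d Z) * dga (d Z)" if "Z \<in> V" for Z using j(2)[OF that] ok[OF that] unfolding dms_ok_def by linarith
    then show "cmp V (\<lambda>Z. Fh (d Z) (h Z) (j Z))" "cmp V (\<lambda>Z. Pu (d Z) (h Z) (c Z) (j Z))" "cmp V (\<lambda>Z. Zc (d Z) (h Z) (j Z * dbe (d Z)))"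
      using cmp_ma_at[OF wf d D(14) D(8) j(1), of "\<lambda>Z. Fh (d Z) (h Z)"] cmp_ma_at[OF wf d D(15) D(8) j(1), of "\<lambda>Z. Pu (d Z) (h Z) (c Z)"]
        cmp_ma_at[OF wf d D(16) D(8) j(1), of "\<lambda>Z. (\<lambda>j. Zc (d Z) (h Z) (j * dbe (d Z)))"] ok unfolding dms_ok_def by blast+
  qed
  show "cmp V (\<lambda>Z. Ic (d Z) (h Z) (k Z))" "cmp V (\<lambda>Z. Hp (d Z) (h Z) (k Z))"
    if k: "cmp V k" "\<And>Z. Z \<in> V \<Longrightarrow> k Z \<le> dU (d Z) div dg (d Z) + 2" for k
  proof -
    have "k Z < dNC (d Z) * dga (d Z)" if "Z \<in> V" for Z using k(2)[OF that] ok[OF that] unfolding dms_ok_def by linarith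
    then show "cmp V (\<lambda>Z. Ic (d Z) (h Z) (k Z))" "cmp V (\<lambda>Z. Hp (d Z) (h Z) (k Z))"
      using cmp_ma_at[OF wf d D(17) D(9) k(1), of "\<lambda>Z. Ic (d Z) (h Z)"] cmp_ma_at[OF wf d D(18) D(9) k(1), of "\<lambda>Z. Hp (d Z) (h Z)"]
        ok unfolding dms_ok_def by blast+
  qed
qed

lemma cmp_Suc: "pos V \<Longrightarrow> cmp V F \<Longrightarrow> (\<And>Z. Z \<in> V \<Longrightarrow> F Z + 1 < 2 ^ ww Z) \<Longrightarrow> cmp V (\<lambda>Z. F Z + 1)"
  by (intro cmp_add cmp_1)

lemma nb_bound: "dms_ok d h c w bs \<Longrightarrow> nb d + 2 < 2 ^ w"
  by (simp add: dms_ok_def)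

lemma cmp_sparse:
  assumes wf: "wf V" and d: "dcmp V d" and ok: "\<And>Z. Z \<in> V \<Longrightarrow> dms_ok (d Z) (h Z) (c Z) (ww Z) (bb Z)"
    and j: "cmp V j" "\<And>Z. Z \<in> V \<Longrightarrow> j Z \<le> nb (d Z) + 1"
  shows "cmpP V (\<lambda>Z. sparse (d Z) (h Z) (j Z))"
proof -
  have j1: "cmp V (\<lambda>Z. j Z + 1)"
    by (rule cmp_Suc[OF wf_pos[OF wf] j(1)]; frule ok; drule nb_bound; frule j(2); linarith)
  have F: "cmp V (\<lambda>Z. Fh (d Z) (h Z) (j Z))" "cmp V (\<lambda>Z. Fh (d Z) (h Z) (j Z + 1))"
    by (rule cmp_Fh[OF wf d ok j(1)] cmp_Fh[OF wf d ok j1]; (frule j(2))?; simp)+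
  show ?thesis unfolding sparse_def
  proof (intro cmp_le wf_pos wf dcmpD(5)[OF d] cmp_sub F)
    fix Z assume v: "Z \<in> V"
    have m: "mono (h Z)" and U: "\<forall>i\<ge>dn (d Z). h Z i = dU (d Z)" "\<forall>i<dn (d Z). h Z i < dU (d Z)" and Uw: "dU (d Z) < 2 ^ ww Z"
      using ok[OF v] unfolding dms_ok_def seq_ok_def by (blast | linarith)+
    show "Fh (d Z) (h Z) (j Z) \<le> Fh (d Z) (h Z) (j Z + 1)" using m by (auto simp: Fh_def mono_def)
    have "h Z i \<le> dU (d Z)" for i using U by (cases "i < dn (d Z)") (auto intro: less_imp_le)
    then show "Fh (d Z) (h Z) (j Z + 1) < 2 ^ ww Z" using Uw unfolding Fh_def by (metis le_less_trans)
  qed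
qed

text \<open>The length of a code is not stored: it is the difference of two consecutive addresses.
  This is why the codes need not be prefix-free.\<close>

lemma cmp_cid:
  assumes wf: "wf V" and d: "dcmp V d" and ok: "\<And>Z. Z \<in> V \<Longrightarrow> dms_ok (d Z) (h Z) (c Z) (ww Z) (bb Z)"
    and j: "cmp V j" "\<And>Z. Z \<in> V \<Longrightarrow> j Z < nb (d Z) \<and> \<not> sparse (d Z) (h Z) (j Z)"
  shows "cmp V (\<lambda>Z. c Z (gaps (d Z) (h Z) (j Z)))"
proof -
  note D = dcmpD[OF d]
  let ?x = "\<lambda>Z. c Z (gaps (d Z) (h Z) (j Z))"
  have j1: "cmp V (\<lambda>Z. j Z + 1)"
    by (rule cmp_Suc[OF wf_pos[OF wf] j(1)]; frule ok; drule nb_bound; drule j(2); linarith)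
  have jb: "j Z \<le> nb (d Z) + 2" "j Z + 1 \<le> nb (d Z) + 2" if "Z \<in> V" for Z using j(2)[OF that] by auto
  have P: "cmp V (\<lambda>Z. Pu (d Z) (h Z) (c Z) (j Z))" "cmp V (\<lambda>Z. Pu (d Z) (h Z) (c Z) (j Z + 1))"
    using cmp_Pu[OF wf d ok j(1)] cmp_Pu[OF wf d ok j1] jb by blast+
  have f: "Pu (d Z) (h Z) (c Z) (j Z + 1) = Pu (d Z) (h Z) (c Z) (j Z) + ln4 (?x Z)" "bC (d Z) + Pu (d Z) (h Z) (c Z) (j Z) + ln4 (?x Z) < 2 ^ ww Z"
     "4 * ln4 (?x Z) \<le> ww Z" "get (bb Z) (4 * (bC (d Z) + Pu (d Z) (h Z) (c Z) (j Z))) (4 * ln4 (?x Z)) = ?x Z" if v: "Z \<in> V" for Z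
  proof -
    have so: "seq_ok (d Z) (h Z) (c Z)" using ok[OF v] by (simp add: dms_ok_def)
    have r: "rcd (d Z) (h Z) (c Z) (j Z) = tobits (4 * ln4 (?x Z)) (?x Z)" using j(2)[OF v] by (simp add: rcd_def)
    show P1: "Pu (d Z) (h Z) (c Z) (j Z + 1) = Pu (d Z) (h Z) (c Z) (j Z) + ln4 (?x Z)" using Pu_step[of "j Z" "d Z"] j(2)[OF v] r by simp
    have W4: "4 dvd dW (d Z)" using so by (simp add: seq_ok_def)
    have "Pu (d Z) (h Z) (c Z) (j Z + 1) \<le> Pu (d Z) (h Z) (c Z) (nb (d Z))"
      unfolding Pu_def using j(2)[OF v] by (intro sum_mono2) auto
    then show "bC (d Z) + Pu (d Z) (h Z) (c Z) (j Z) + ln4 (?x Z) < 2 ^ ww Z" using ok[OF v] P1 unfolding dms_ok_def by linarith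
    have "gaps (d Z) (h Z) (j Z) \<in> gdom (d Z)" using gaps_in_gdom[OF so] j(2)[OF v] by blast
    then have "bits (?x Z) + 3 \<le> ww Z" using ok[OF v] unfolding dms_ok_def by blast
    then show "4 * ln4 (?x Z) \<le> ww Z" unfolding ln4_def by linarith
    have "sub (bb Z) (4 * bC (d Z) + (\<Sum>i<j Z. length (rcd (d Z) (h Z) (c Z) i))) (rcd (d Z) (h Z) (c Z) (j Z))"
      by (rule sub_cat[of _ _ _ "nb (d Z)"]) (use ok[OF v] j(2)[OF v] in \<open>auto simp: dms_ok_def\<close>)
    then have "sub (bb Z) (4 * (bC (d Z) + Pu (d Z) (h Z) (c Z) (j Z))) (tobits (4 * ln4 (?x Z)) (?x Z))"
      using Pu_sum[OF W4, of "j Z" "h Z" "c Z"] j(2)[OF v] r by (simp add: distrib_left)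
    then have "get (bb Z) (4 * (bC (d Z) + Pu (d Z) (h Z) (c Z) (j Z))) (4 * ln4 (?x Z)) = ?x Z mod 2 ^ (4 * ln4 (?x Z))" by (rule sub_get)
    moreover have "?x Z < 2 ^ (4 * ln4 (?x Z))"
    proof -
      have "bits (?x Z) \<le> 4 * ln4 (?x Z)" unfolding ln4_def by linarith
      then have "(2::nat) ^ bits (?x Z) \<le> 2 ^ (4 * ln4 (?x Z))" by (intro power_increasing) auto
      then show ?thesis using less_bits[of "?x Z"] by linarith
    qed
    ultimately show "get (bb Z) (4 * (bC (d Z) + Pu (d Z) (h Z) (c Z) (j Z))) (4 * ln4 (?x Z)) = ?x Z" by simp
  qed
  have cl: "cmp V (\<lambda>Z. ln4 (?x Z))"
  proof (rule cmp_cong[OF cmp_sub[OF P(2,1)]])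
    fix Z assume v: "Z \<in> V"
    from f(1,2)[OF v] show "Pu (d Z) (h Z) (c Z) (j Z) \<le> Pu (d Z) (h Z) (c Z) (j Z + 1)" "Pu (d Z) (h Z) (c Z) (j Z + 1) < 2 ^ ww Z"
      "Pu (d Z) (h Z) (c Z) (j Z + 1) - Pu (d Z) (h Z) (c Z) (j Z) = ln4 (?x Z)" by linarith+
  qed
  have cl4: "cmp V (\<lambda>Z. 4 * ln4 (?x Z))"
    by (rule cmp_mul[OF cmp_small[OF wf] cl], simp, drule f(3)) (use less_exp le_less_trans in blast)
  have ca: "cmp V (\<lambda>Z. bC (d Z) + Pu (d Z) (h Z) (c Z) (j Z))" by (rule cmp_add[OF D(20) P(1)]; drule f(2); linarith)
  have "cmp V (\<lambda>Z. get (bb Z) (4 * (bC (d Z) + Pu (d Z) (h Z) (c Z) (j Z))) (4 * ln4 (?x Z)))"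
  proof (rule cmp_get4[OF wf ca cl4])
    fix Z assume v: "Z \<in> V"
    show "4 * ln4 (?x Z) \<le> ww Z \<and> bC (d Z) + Pu (d Z) (h Z) (c Z) (j Z) < 2 ^ ww Z" using f(2,3)[OF v] by linarith
  qed
  then show ?thesis by (rule cmp_cong) (rule f(4))
qed

lemma h_le_U: "seq_ok d h c \<Longrightarrow> h i \<le> dU d"
  by (cases "i < dn d") (auto simp: seq_ok_def intro: less_imp_le)

lemma cid_facts:
  assumes ok: "dms_ok d h c w bs" and j: "\<not> sparse d h j"
  shows "c (gaps d h j) < dNI d" "r < dbe d \<Longrightarrow> c (gaps d h j) * dbe d + r < dNI d * dbe d" "x < dD d \<Longrightarrow> c (gaps d h j) * dD d + x < dNI d * dD d"
proof -
  have so: "seq_ok d h c" using ok by (simp add: dms_ok_def)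
  have "gaps d h j \<in> gdom d" by (rule gaps_in_gdom[OF so j])
  then show 1: "c (gaps d h j) < dNI d" using so by (simp add: seq_ok_def)
  have *: "c (gaps d h j) * y + r < dNI d * y" if "r < y" for r y
  proof -
    have "(c (gaps d h j) + 1) * y \<le> dNI d * y" using 1 by (intro mult_le_mono1) simp
    then show ?thesis using that by simp
  qed
  show "r < dbe d \<Longrightarrow> c (gaps d h j) * dbe d + r < dNI d * dbe d" "x < dD d \<Longrightarrow> c (gaps d h j) * dD d + x < dNI d * dD d" by (rule *; simp)+
qed

lemma cmp_acc:
  assumes wf: "wf V" and d: "dcmp V d" and ok: "\<And>Z. Z \<in> V \<Longrightarrow> dms_ok (d Z) (h Z) (c Z) (ww Z) (bb Z)"
    and i: "cmp V i" "\<And>Z. Z \<in> V \<Longrightarrow> i Z < dn (d Z)"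
  shows "cmp V (\<lambda>Z. h Z (i Z))"
proof -
  note D = dcmpD[OF d] and p = wf_pos[OF wf]
  let ?j = "\<lambda>Z. i Z div dbe (d Z)" and ?r = "\<lambda>Z. i Z mod dbe (d Z)"
  have j: "cmp V ?j" and r: "cmp V ?r" by (intro cmp_div cmp_mod i D)+
  have so: "seq_ok (d Z) (h Z) (c Z)" if "Z \<in> V" for Z using ok[OF that] by (simp add: dms_ok_def)
  have jn: "?j Z < nb (d Z)" if "Z \<in> V" for Z unfolding nb_def using i(2)[OF that] by (simp add: div_le_mono less_Suc_eq_le)
  have b: "0 < dbe (d Z)" "?r Z < dbe (d Z)" "?j Z * dbe (d Z) + ?r Z = i Z" if "Z \<in> V" for Z using so[OF that] by (auto simp: seq_ok_def)
  have Uw: "dU (d Z) < 2 ^ ww Z" "dU (d Z) < 2 ^ dW (d Z)" if "Z \<in> V" for Z using ok[OF that] by (auto simp: dms_ok_def)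
  have hU: "h Z x < 2 ^ ww Z" "h Z x < 2 ^ dW (d Z)" if "Z \<in> V" for Z x using h_le_U[OF so[OF that], of x] Uw[OF that] by linarith+
  let ?S = "V \<inter> {Z. sparse (d Z) (h Z) (?j Z)}" and ?N = "V \<inter> {Z. \<not> sparse (d Z) (h Z) (?j Z)}"
  have sp: "cmp ?S (\<lambda>Z. h Z (i Z))"
  proof -
    have wS: "wf ?S" and dS: "dcmp ?S d" using wf d by (auto intro: wf_inter dcmp_mono)
    have okS: "\<And>Z. Z \<in> ?S \<Longrightarrow> dms_ok (d Z) (h Z) (c Z) (ww Z) (bb Z)" using ok by blast
    let ?A = "\<lambda>Z. bC (d Z) + Pu (d Z) (h Z) (c Z) (?j Z) + ?r Z * (dW (d Z) div 4)"
    have f: "4 * ?A Z = 4 * bC (d Z) + (\<Sum>u<?j Z. length (rcd (d Z) (h Z) (c Z) u)) + ?r Z * dW (d Z)"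
       "bC (d Z) + Pu (d Z) (h Z) (c Z) (?j Z) + dbe (d Z) * (dW (d Z) div 4) < 2 ^ ww Z" "?r Z * (dW (d Z) div 4) \<le> dbe (d Z) * (dW (d Z) div 4)"
       "get (bb Z) (4 * ?A Z) (dW (d Z)) = h Z (i Z)" if v: "Z \<in> ?S" for Z
    proof -
      have v': "Z \<in> V" using v by blast
      have W4: "4 dvd dW (d Z)" using so[OF v'] by (simp add: seq_ok_def)
      have w4: "4 * (dW (d Z) div 4) = dW (d Z)" using W4 by simp
      show 1: "4 * ?A Z = 4 * bC (d Z) + (\<Sum>u<?j Z. length (rcd (d Z) (h Z) (c Z) u)) + ?r Z * dW (d Z)"
        using Pu_sum[OF W4, of "?j Z" "h Z" "c Z"] jn[OF v'] by (simp only: distrib_left mult.left_commute[of 4] w4 less_imp_le)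
      have rc: "rcd (d Z) (h Z) (c Z) (?j Z) = arr (dW (d Z)) (map (\<lambda>r. h Z (?j Z * dbe (d Z) + r)) [0..<dbe (d Z)])"
        using v by (simp add: rcd_def)
      have "length (rcd (d Z) (h Z) (c Z) (?j Z)) div 4 = dbe (d Z) * (dW (d Z) div 4)" using rc W4 by auto
      then have "Pu (d Z) (h Z) (c Z) (?j Z) + dbe (d Z) * (dW (d Z) div 4) = Pu (d Z) (h Z) (c Z) (?j Z + 1)" using Pu_step[OF jn[OF v']] by simp
      also have "\<dots> \<le> Pu (d Z) (h Z) (c Z) (nb (d Z))" unfolding Pu_def using jn[OF v'] by (intro sum_mono2) auto
      finally show "bC (d Z) + Pu (d Z) (h Z) (c Z) (?j Z) + dbe (d Z) * (dW (d Z) div 4) < 2 ^ ww Z" using ok[OF v'] unfolding dms_ok_def by linarith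
      show "?r Z * (dW (d Z) div 4) \<le> dbe (d Z) * (dW (d Z) div 4)" using b(2)[OF v'] by (intro mult_le_mono1) simp
      have "sub (bb Z) (4 * bC (d Z) + (\<Sum>u<?j Z. length (rcd (d Z) (h Z) (c Z) u))) (rcd (d Z) (h Z) (c Z) (?j Z))"
        by (rule sub_cat[of _ _ _ "nb (d Z)"]) (use ok[OF v'] jn[OF v'] in \<open>auto simp: dms_ok_def\<close>)
      from sub_arr[OF this[unfolded rc], of "?r Z"]
      show "get (bb Z) (4 * ?A Z) (dW (d Z)) = h Z (i Z)" unfolding 1 using b[OF v'] hU(2)[OF v'] by simp
    qed
    have jS: "cmp ?S ?j" and rS: "cmp ?S ?r" using j r by (auto intro: cmp_inter)
    have PS: "cmp ?S (\<lambda>Z. Pu (d Z) (h Z) (c Z) (?j Z))"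
      by (rule cmp_Pu[OF wS dS okS jS]) (use jn in \<open>fastforce+\<close>)
    have W4: "cmp ?S (\<lambda>Z. dW (d Z) div 4)" by (intro cmp_div cmp_small wS dcmpD[OF dS]) simp
    have c1: "cmp ?S (\<lambda>Z. bC (d Z) + Pu (d Z) (h Z) (c Z) (?j Z))"
      by (rule cmp_add[OF dcmpD(20)[OF dS] PS]; drule f(2); linarith)
    have c2: "cmp ?S (\<lambda>Z. ?r Z * (dW (d Z) div 4))"
      by (rule cmp_mul[OF rS W4]; frule f(2); drule f(3); linarith)
    have A: "cmp ?S ?A" by (rule cmp_add[OF c1 c2]; frule f(2); drule f(3); linarith)
    have "cmp ?S (\<lambda>Z. get (bb Z) (4 * ?A Z) (min (dW (d Z)) (ww Z)))"
    proof (rule cmp_get4[OF wS A])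
      show "cmp ?S (\<lambda>Z. min (dW (d Z)) (ww Z))" by (intro cmp_min wf_pos wS dcmpD[OF dS] cmp_ww) (use wf_aa[OF wS] in blast)
      fix Z assume "Z \<in> ?S"
      from f(2,3)[OF this] show "min (dW (d Z)) (ww Z) \<le> ww Z \<and> ?A Z < 2 ^ ww Z" by linarith
    qed
    then show ?thesis
    proof (rule cmp_cong)
      fix Z assume v: "Z \<in> ?S"
      show "get (bb Z) (4 * ?A Z) (min (dW (d Z)) (ww Z)) = h Z (i Z)"
        using get_min[of "bb Z" "4 * ?A Z" "dW (d Z)" "ww Z"] f(4)[OF v] hU(1)[of Z] v by simp
    qed
  qed
  have ns: "cmp ?N (\<lambda>Z. h Z (i Z))"
  proof -
    have wN: "wf ?N" and dN: "dcmp ?N d" using wf d by (auto intro: wf_inter dcmp_mono)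
    have okN: "\<And>Z. Z \<in> ?N \<Longrightarrow> dms_ok (d Z) (h Z) (c Z) (ww Z) (bb Z)" using ok by blast
    note E = dcmpD[OF dN]
    have jN: "cmp ?N ?j" and rN: "cmp ?N ?r" using j r by (auto intro: cmp_inter)
    have cx: "cmp ?N (\<lambda>Z. c Z (gaps (d Z) (h Z) (?j Z)))" by (rule cmp_cid[OF wN dN okN jN]) (use jn in \<open>blast+\<close>)
    have ix: "c Z (gaps (d Z) (h Z) (?j Z)) * dbe (d Z) + ?r Z < dNI (d Z) * dbe (d Z)" if "Z \<in> ?N" for Z
      using cid_facts(2)[OF okN[OF that], of "?j Z" "?r Z"] that b(2)[of Z] by blast
    have NIw: "dNI (d Z) * dbe (d Z) < 2 ^ ww Z" if "Z \<in> ?N" for Z using okN[OF that] by (simp add: dms_ok_def)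
    have ci: "cmp ?N (\<lambda>Z. c Z (gaps (d Z) (h Z) (?j Z)) * dbe (d Z) + ?r Z)"
      by (intro cmp_add cmp_mul cx E rN; frule ix; drule NIw; linarith)
    have t: "tabS (d Z) (c Z) (c Z (gaps (d Z) (h Z) (?j Z)) * dbe (d Z) + ?r Z) = h Z (i Z) - Fh (d Z) (h Z) (?j Z)" if "Z \<in> ?N" for Z
      using tabS_gaps[OF so, of Z "?j Z" "?r Z"] that b[of Z] by simp
    have ct: "cmp ?N (\<lambda>Z. tabS (d Z) (c Z) (c Z (gaps (d Z) (h Z) (?j Z)) * dbe (d Z) + ?r Z))"
    proof (rule cmp_tab_at[OF wN dN E(11) ci])
      fix Z assume v: "Z \<in> ?N"
      have "h Z (i Z) - Fh (d Z) (h Z) (?j Z) < 2 ^ dW (d Z)" "h Z (i Z) - Fh (d Z) (h Z) (?j Z) < 2 ^ ww Z" using hU[of Z "i Z"] v by (auto intro: le_less_trans[OF diff_le_self])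
      then show "tab_at (d Z) (ww Z) (bb Z) (bS (d Z)) (dNI (d Z) * dbe (d Z)) (tabS (d Z) (c Z)) \<and>
         c Z (gaps (d Z) (h Z) (?j Z)) * dbe (d Z) + ?r Z < dNI (d Z) * dbe (d Z) \<and>
         tabS (d Z) (c Z) (c Z (gaps (d Z) (h Z) (?j Z)) * dbe (d Z) + ?r Z) < 2 ^ dW (d Z) \<and>
         tabS (d Z) (c Z) (c Z (gaps (d Z) (h Z) (?j Z)) * dbe (d Z) + ?r Z) < 2 ^ ww Z"
        using okN[OF v] ix[OF v] t[OF v] unfolding dms_ok_def by simp
    qed
    have F: "cmp ?N (\<lambda>Z. Fh (d Z) (h Z) (?j Z))" by (rule cmp_Fh[OF wN dN okN jN]) (use jn in \<open>fastforce+\<close>)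
    have Fle: "Fh (d Z) (h Z) (?j Z) \<le> h Z (i Z)" if "Z \<in> V" for Z
    proof -
      have "?j Z * dbe (d Z) \<le> i Z" by simp
      then show ?thesis using so[OF that] unfolding seq_ok_def Fh_def mono_def by blast
    qed
    show ?thesis
    proof (rule cmp_cong[OF cmp_add[OF F ct]])
      fix Z assume v: "Z \<in> ?N"
      then show "Fh (d Z) (h Z) (?j Z) + tabS (d Z) (c Z) (c Z (gaps (d Z) (h Z) (?j Z)) * dbe (d Z) + ?r Z) = h Z (i Z)"
        using t[OF v] Fle[of Z] by simp
      then show "Fh (d Z) (h Z) (?j Z) + tabS (d Z) (c Z) (c Z (gaps (d Z) (h Z) (?j Z)) * dbe (d Z) + ?r Z) < 2 ^ ww Z"
        using hU(1)[of Z "i Z"] v by simp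
    qed
  qed
  have s: "cmpP V (\<lambda>Z. sparse (d Z) (h Z) (?j Z))" by (rule cmp_sparse[OF wf d ok j]) (use jn in \<open>fastforce+\<close>)
  from cmp_if[OF s sp ns] show ?thesis by (simp only: if_cancel)
qed

lemma cmp_Zc:
  assumes wf: "wf V" and d: "dcmp V d" and ok: "\<And>Z. Z \<in> V \<Longrightarrow> dms_ok (d Z) (h Z) (c Z) (ww Z) (bb Z)"
    and i: "cmp V i" "\<And>Z. Z \<in> V \<Longrightarrow> i Z \<le> dn (d Z)"
  shows "cmp V (\<lambda>Z. Zc (d Z) (h Z) (i Z))"
proof -
  note D = dcmpD[OF d] and p = wf_pos[OF wf]
  let ?j = "\<lambda>Z. i Z div dbe (d Z)" and ?r = "\<lambda>Z. i Z mod dbe (d Z)"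
  have j: "cmp V ?j" and r: "cmp V ?r" by (intro cmp_div cmp_mod i D)+
  have so: "seq_ok (d Z) (h Z) (c Z)" if "Z \<in> V" for Z using ok[OF that] by (simp add: dms_ok_def)
  have jn: "?j Z < nb (d Z)" if "Z \<in> V" for Z unfolding nb_def using i(2)[OF that] by (simp add: div_le_mono less_Suc_eq_le)
  have b: "0 < dbe (d Z)" "?r Z < dbe (d Z)" "?j Z * dbe (d Z) + ?r Z = i Z" if "Z \<in> V" for Z using so[OF that] by (auto simp: seq_ok_def)
  let ?N = "V \<inter> {Z. \<not> sparse (d Z) (h Z) (?j Z)}"
  let ?t = "\<lambda>Z. tabZ (d Z) (c Z) (c Z (gaps (d Z) (h Z) (?j Z)) * dbe (d Z) + ?r Z)"
  have ct: "cmp ?N ?t"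
  proof -
    have wN: "wf ?N" and dN: "dcmp ?N d" using wf d by (auto intro: wf_inter dcmp_mono)
    have okN: "\<And>Z. Z \<in> ?N \<Longrightarrow> dms_ok (d Z) (h Z) (c Z) (ww Z) (bb Z)" using ok by blast
    note E = dcmpD[OF dN]
    have jN: "cmp ?N ?j" and rN: "cmp ?N ?r" using j r by (auto intro: cmp_inter)
    have cx: "cmp ?N (\<lambda>Z. c Z (gaps (d Z) (h Z) (?j Z)))" by (rule cmp_cid[OF wN dN okN jN]) (use jn in \<open>blast+\<close>)
    have ix: "c Z (gaps (d Z) (h Z) (?j Z)) * dbe (d Z) + ?r Z < dNI (d Z) * dbe (d Z)" if "Z \<in> ?N" for Z
      using cid_facts(2)[OF okN[OF that], of "?j Z" "?r Z"] that b(2)[of Z] by blast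
    have NIw: "dNI (d Z) * dbe (d Z) < 2 ^ ww Z" if "Z \<in> ?N" for Z using okN[OF that] by (simp add: dms_ok_def)
    have ci: "cmp ?N (\<lambda>Z. c Z (gaps (d Z) (h Z) (?j Z)) * dbe (d Z) + ?r Z)"
      by (intro cmp_add cmp_mul cx E rN; frule ix; drule NIw; linarith)
    show ?thesis
    proof (rule cmp_tab_at[OF wN dN E(12) ci])
      fix Z assume v: "Z \<in> ?N"
      have "?t Z \<le> ?r Z - 1"
        using b[of Z] v by (auto simp: tabZ_def intro!: le_trans[OF length_filter_le])
      moreover have "dbe (d Z) \<le> dbe (d Z) * dD (d Z)" using so[of Z] v by (simp add: seq_ok_def)
      moreover have "?r Z < dbe (d Z)" using b(2)[of Z] v by blast
      moreover have "dbe (d Z) * dD (d Z) < 2 ^ dW (d Z)" "dbe (d Z) * dD (d Z) < 2 ^ ww Z" using okN[OF v] unfolding dms_ok_def by blast+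
      ultimately have "?t Z < 2 ^ dW (d Z)" "?t Z < 2 ^ ww Z" by linarith+
      then show "tab_at (d Z) (ww Z) (bb Z) (bZt (d Z)) (dNI (d Z) * dbe (d Z)) (tabZ (d Z) (c Z)) \<and>
         c Z (gaps (d Z) (h Z) (?j Z)) * dbe (d Z) + ?r Z < dNI (d Z) * dbe (d Z) \<and> ?t Z < 2 ^ dW (d Z) \<and> ?t Z < 2 ^ ww Z"
        using okN[OF v] ix[OF v] unfolding dms_ok_def by simp
    qed
  qed
  have s: "cmpP V (\<lambda>Z. sparse (d Z) (h Z) (?j Z))" by (rule cmp_sparse[OF wf d ok j]) (use jn in \<open>fastforce+\<close>)
  have c2: "cmp V (\<lambda>Z. if sparse (d Z) (h Z) (?j Z) then ?r Z else ?t Z)" by (rule cmp_if[OF s cmp_inter[OF r] ct])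
  have cZ: "cmp V (\<lambda>Z. Zc (d Z) (h Z) (?j Z * dbe (d Z)))" by (rule cmp_ZA[OF wf d ok j]) (use jn in \<open>fastforce+\<close>)
  have eq: "Zc (d Z) (h Z) (?j Z * dbe (d Z)) + (if sparse (d Z) (h Z) (?j Z) then ?r Z else ?t Z) = Zc (d Z) (h Z) (i Z)" if v: "Z \<in> V" for Z
    using Zc_block[OF so[OF v] jn[OF v] b(2)[OF v]] b(3)[OF v] by simp
  have Zle: "Zc d h x \<le> x" for d h x
  proof -
    have "Zc d h x \<le> (\<Sum>i'<min x (nb d * dbe d). 1)" unfolding Zc_def by (intro sum_mono) (simp add: exs_def)
    then show ?thesis by simp
  qed
  show ?thesis
  proof (rule cmp_cong[OF cmp_add[OF cZ c2] eq])
    fix Z assume v: "Z \<in> V"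
    have "Zc (d Z) (h Z) (i Z) \<le> dn (d Z)" using Zle[of "d Z" "h Z" "i Z"] i(2)[OF v] by linarith
    moreover have "dn (d Z) < 2 ^ ww Z" using ok[OF v] by (simp add: dms_ok_def)
    ultimately show "Zc (d Z) (h Z) (?j Z * dbe (d Z)) + (if sparse (d Z) (h Z) (?j Z) then ?r Z else ?t Z) < 2 ^ ww Z" unfolding eq[OF v] by linarith
  qed
qed

text \<open>As \<open>v\<close> is at most the first value of the next block and block
  \<open>j\<close> is not sparse, the offset of \<open>v\<close> in the block is below
  \<open>dD\<close> and indexes the table.\<close>

lemma cmp_block_cv:
  assumes wf: "wf V" and d: "dcmp V d" and ok: "\<And>Z. Z \<in> V \<Longrightarrow> dms_ok (d Z) (h Z) (c Z) (ww Z) (bb Z)"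
    and j: "cmp V j" and v: "cmp V v"
    and jv: "\<And>Z. Z \<in> V \<Longrightarrow> j Z < nb (d Z) \<and> \<not> sparse (d Z) (h Z) (j Z) \<and> v Z \<le> dU (d Z) \<and> j Z * dbe (d Z) \<le> cv (d Z) (h Z) (v Z)
      \<and> cv (d Z) (h Z) (v Z) \<le> (j Z + 1) * dbe (d Z) \<and> v Z \<le> Fh (d Z) (h Z) (j Z + 1)"
  shows "cmp V (\<lambda>Z. cv (d Z) (h Z) (v Z))"
proof -
  note D = dcmpD[OF d] and p = wf_pos[OF wf]
  have so: "seq_ok (d Z) (h Z) (c Z)" if "Z \<in> V" for Z using ok[OF that] by (simp add: dms_ok_def)
  let ?F = "\<lambda>Z. Fh (d Z) (h Z) (j Z)" and ?x = "\<lambda>Z. c Z (gaps (d Z) (h Z) (j Z))"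
  let ?D = "\<lambda>Z. v Z - ?F Z" and ?t = "\<lambda>Z. tabR (d Z) (c Z) (?x Z * dD (d Z) + (v Z - ?F Z))"
  have F: "cmp V ?F" by (rule cmp_Fh[OF wf d ok j]) (use jv in \<open>fastforce+\<close>)
  have vw: "v Z < 2 ^ ww Z" if "Z \<in> V" for Z using jv[OF that] ok[OF that] unfolding dms_ok_def by linarith
  have cD: "cmp V ?D" by (rule cmp_sub0[OF p v F vw])
  have Dlt: "?D Z < dD (d Z)" if "Z \<in> V" for Z using jv[OF that] unfolding sparse_def by linarith
  have cx: "cmp V ?x" by (rule cmp_cid[OF wf d ok j]) (use jv in \<open>blast+\<close>)
  have ix: "?x Z * dD (d Z) + ?D Z < dNI (d Z) * dD (d Z)" if "Z \<in> V" for Z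
    using cid_facts(3)[OF ok[OF that] _ Dlt[OF that]] jv[OF that] by blast
  have NIw: "dNI (d Z) * dD (d Z) < 2 ^ ww Z" if "Z \<in> V" for Z using ok[OF that] by (simp add: dms_ok_def)
  have ci: "cmp V (\<lambda>Z. ?x Z * dD (d Z) + ?D Z)"
    by (intro cmp_add cmp_mul cx D cD; frule ix; drule NIw; linarith)
  have t: "?t Z = card {r. r < dbe (d Z) \<and> h Z (j Z * dbe (d Z) + r) - ?F Z < ?D Z}" if "Z \<in> V" for Z
    using tabR_gaps[OF so[OF that] _ Dlt[OF that]] jv[OF that] by blast
  have tb: "?t Z \<le> dbe (d Z)" if "Z \<in> V" for Z
  proof -
    have "card {r. r < dbe (d Z) \<and> h Z (j Z * dbe (d Z) + r) - ?F Z < ?D Z} \<le> card {..<dbe (d Z)}" by (rule card_mono) auto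
    then show ?thesis unfolding t[OF that] by simp
  qed
  have ct: "cmp V ?t"
  proof (rule cmp_tab_at[OF wf d D(13) ci])
    fix Z assume m: "Z \<in> V"
    have "dbe (d Z) \<le> dbe (d Z) * dD (d Z)" using so[OF m] by (simp add: seq_ok_def)
    then have "?t Z < 2 ^ dW (d Z)" "?t Z < 2 ^ ww Z" using ok[OF m] tb[OF m] unfolding dms_ok_def by linarith+
    then show "tab_at (d Z) (ww Z) (bb Z) (bR (d Z)) (dNI (d Z) * dD (d Z)) (tabR (d Z) (c Z)) \<and>
         ?x Z * dD (d Z) + ?D Z < dNI (d Z) * dD (d Z) \<and> ?t Z < 2 ^ dW (d Z) \<and> ?t Z < 2 ^ ww Z"
      using ok[OF m] ix[OF m] unfolding dms_ok_def by simp
  qed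
  have eq: "j Z * dbe (d Z) + ?t Z = cv (d Z) (h Z) (v Z)" if m: "Z \<in> V" for Z
    unfolding t[OF m] by (rule cv_block[OF so[OF m], symmetric]) (use jv[OF m] in auto)
  have cw: "cv (d Z) (h Z) (v Z) < 2 ^ ww Z" if "Z \<in> V" for Z
    using cv_le[of "d Z" "h Z" "v Z"] ok[OF that] unfolding dms_ok_def by linarith
  show ?thesis
  proof (rule cmp_cong[OF cmp_add[OF cmp_mul[OF j D(3)] ct] eq])
    fix Z assume m: "Z \<in> V"
    show "j Z * dbe (d Z) + ?t Z < 2 ^ ww Z" using eq[OF m] cw[OF m] by simp
    then show "j Z * dbe (d Z) < 2 ^ ww Z" by linarith
  qed
qed

text \<open>The directory encloses the rank between the counts \<open>i0\<close> and
  \<open>i1\<close> at the ends of the cell of \<open>v\<close>. Hard cells list the answer and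
  empty ones have \<open>i0\<close>; otherwise the rank falls into block \<open>j\<close> or
  \<open>j + 1\<close>, and comparing \<open>v\<close> with the first value of block
  \<open>j + 1\<close> tells which.\<close>

lemma cmp_cv:
  assumes wf: "wf V" and d: "dcmp V d" and ok: "\<And>Z. Z \<in> V \<Longrightarrow> dms_ok (d Z) (h Z) (c Z) (ww Z) (bb Z)"
    and v: "cmp V v" "\<And>Z. Z \<in> V \<Longrightarrow> v Z \<le> dU (d Z)"
  shows "cmp V (\<lambda>Z. cv (d Z) (h Z) (v Z))"
proof -
  note D = dcmpD[OF d] and p = wf_pos[OF wf]
  have so: "seq_ok (d Z) (h Z) (c Z)" if "Z \<in> V" for Z using ok[OF that] by (simp add: dms_ok_def)
  define k where "k Z = v Z div dg (d Z)" for Z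
  define i0 where "i0 Z = Ic (d Z) (h Z) (k Z)" for Z
  define i1 where "i1 Z = Ic (d Z) (h Z) (k Z + 1)" for Z
  define j where "j Z = i0 Z div dbe (d Z)" for Z
  have ck: "cmp V k" unfolding k_def by (intro cmp_div v D)
  have kU: "k Z \<le> dU (d Z) div dg (d Z)" if "Z \<in> V" for Z unfolding k_def using v(2)[OF that] by (rule div_le_mono)
  have kU2: "k Z \<le> dU (d Z) div dg (d Z) + 2" "k Z + 1 \<le> dU (d Z) div dg (d Z) + 2" if "Z \<in> V" for Z using kU[OF that] by simp_all
  have Uw: "dU (d Z) + 1 < 2 ^ ww Z" "dn (d Z) < 2 ^ ww Z" "0 < dbe (d Z)" "0 < dg (d Z)" if "Z \<in> V" for Z using ok[OF that] unfolding dms_ok_def seq_ok_def by linarith+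
  have ck1: "cmp V (\<lambda>Z. k Z + 1)"
  proof (rule cmp_Suc[OF p ck])
    fix Z assume m: "Z \<in> V"
    have "k Z \<le> dU (d Z)" using kU[OF m] by (meson div_le_dividend le_trans)
    then show "k Z + 1 < 2 ^ ww Z" using Uw(1)[OF m] by linarith
  qed
  have ci0: "cmp V i0" unfolding i0_def by (rule cmp_Ic[OF wf d ok ck kU2(1)])
  have ci1: "cmp V i1" unfolding i1_def by (rule cmp_Ic[OF wf d ok ck1 kU2(2)])
  have cj: "cmp V j" unfolding j_def by (intro cmp_div ci0 D)
  have vb: "k Z * dg (d Z) \<le> v Z" "v Z \<le> (k Z + 1) * dg (d Z)" "v Z = k Z * dg (d Z) + v Z mod dg (d Z)" if "Z \<in> V" for Z
    unfolding k_def using Uw(4)[OF that] dividend_less_times_div[of "dg (d Z)" "v Z"] by (simp_all add: algebra_simps)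
  have i01: "i0 Z \<le> cv (d Z) (h Z) (v Z)" "cv (d Z) (h Z) (v Z) \<le> i1 Z" "i1 Z \<le> dn (d Z)" if "Z \<in> V" for Z
    unfolding i0_def i1_def Ic_def using vb[OF that] by (auto intro: cv_mono cv_le)
  have jn: "j Z < nb (d Z)" if "Z \<in> V" for Z
    unfolding nb_def j_def using i01[OF that] by (simp add: div_le_mono less_Suc_eq_le)
  have cj1: "cmp V (\<lambda>Z. j Z + 1)" by (rule cmp_Suc[OF p cj]; frule ok; drule nb_bound; drule jn; linarith)
  have cq: "cmp V (\<lambda>Z. i1 Z - i0 Z)" by (rule cmp_sub[OF ci1 ci0]; frule i01(1); frule i01(2); frule i01(3); drule Uw(2); linarith)
  have hd: "hard (d Z) (h Z) (k Z) \<longleftrightarrow> dbe (d Z) \<le> i1 Z - i0 Z \<or> (0 < i1 Z - i0 Z \<and> (sparse (d Z) (h Z) (j Z) \<or> sparse (d Z) (h Z) (j Z + 1)))" for Z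
    unfolding hard_def i0_def i1_def j_def ..
  have chard: "cmpP V (\<lambda>Z. hard (d Z) (h Z) (k Z))" unfolding hd
  proof (intro cmp_disj cmp_conj cmp_le cmp_less p cq cmp_0 D)
    show "pos (V \<inter> {Z. \<not> dbe (d Z) \<le> i1 Z - i0 Z} \<inter> {Z. 0 < i1 Z - i0 Z})" by (intro pos_inter p)
    show "cmp (V \<inter> {Z. \<not> dbe (d Z) \<le> i1 Z - i0 Z}) (\<lambda>Z. i1 Z - i0 Z)" by (rule cmp_inter[OF cq])
    have s1: "cmpP V (\<lambda>Z. sparse (d Z) (h Z) (j Z))" by (rule cmp_sparse[OF wf d ok cj]) (use jn in \<open>fastforce+\<close>)
    have s2: "cmpP V (\<lambda>Z. sparse (d Z) (h Z) (j Z + 1))" by (rule cmp_sparse[OF wf d ok cj1]) (use jn in \<open>fastforce+\<close>)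
    show "cmpP (V \<inter> {Z. \<not> dbe (d Z) \<le> i1 Z - i0 Z} \<inter> {Z. 0 < i1 Z - i0 Z}) (\<lambda>Z. sparse (d Z) (h Z) (j Z))" by (intro cmp_inter s1)
    show "cmpP (V \<inter> {Z. \<not> dbe (d Z) \<le> i1 Z - i0 Z} \<inter> {Z. 0 < i1 Z - i0 Z} \<inter> {Z. \<not> sparse (d Z) (h Z) (j Z)}) (\<lambda>Z. sparse (d Z) (h Z) (j Z + 1))"
      by (intro cmp_inter s2)
  qed
  let ?H = "V \<inter> {Z. hard (d Z) (h Z) (k Z)}" and ?E = "V \<inter> {Z. \<not> hard (d Z) (h Z) (k Z)}"
  have cH: "cmp ?H (\<lambda>Z. cv (d Z) (h Z) (v Z))"
  proof -
    have wH: "wf ?H" and dH: "dcmp ?H d" using wf d by (auto intro: wf_inter dcmp_mono)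
    have okH: "\<And>Z. Z \<in> ?H \<Longrightarrow> dms_ok (d Z) (h Z) (c Z) (ww Z) (bb Z)" using ok by blast
    note E = dcmpD[OF dH]
    define b where "b Z = bits (i1 Z - i0 Z)" for Z
    have P: "cmp ?H (\<lambda>Z. Hp (d Z) (h Z) (k Z))" "cmp ?H (\<lambda>Z. Hp (d Z) (h Z) (k Z + 1))"
      by (rule cmp_Hp[OF wH dH okH cmp_inter[OF ck]] cmp_Hp[OF wH dH okH cmp_inter[OF ck1]]; use kU2 in blast)+
    have hr: "hrec (d Z) (h Z) (k Z) = arr (b Z) (map (\<lambda>u. cv (d Z) (h Z) (k Z * dg (d Z) + u) - i0 Z) [0..<dg (d Z)])" if "Z \<in> ?H" for Z
      using that by (simp add: hrec_def b_def i1_def i0_def)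
    have P1: "Hp (d Z) (h Z) (k Z + 1) = Hp (d Z) (h Z) (k Z) + dg (d Z) * b Z" if "Z \<in> ?H" for Z
      using hr[OF that] by (simp add: Hp_def)
    have Pb: "bHR (d Z) + Hp (d Z) (h Z) (k Z) + dg (d Z) * b Z < 2 ^ ww Z" if m: "Z \<in> ?H" for Z
    proof -
      have "Hp (d Z) (h Z) (k Z + 1) \<le> length (cat (hrec (d Z) (h Z)) (dU (d Z) div dg (d Z) + 1))"
        unfolding length_cat Hp_def using kU[of Z] m by (intro sum_mono2) auto
      then show ?thesis using okH[OF m] P1[OF m] unfolding dms_ok_def by linarith
    qed
    have cb: "cmp ?H b"
    proof (rule cmp_cong[OF cmp_div[OF cmp_sub[OF P(2,1)] E(4)]])
      fix Z assume m: "Z \<in> ?H"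
      from P1[OF m] Pb[OF m] show "Hp (d Z) (h Z) (k Z) \<le> Hp (d Z) (h Z) (k Z + 1)" "Hp (d Z) (h Z) (k Z + 1) < 2 ^ ww Z" by linarith+
      show "(Hp (d Z) (h Z) (k Z + 1) - Hp (d Z) (h Z) (k Z)) div dg (d Z) = b Z" using P1[OF m] Uw(4)[of Z] m by simp
    qed
    have ca: "cmp ?H (\<lambda>Z. bHR (d Z) + Hp (d Z) (h Z) (k Z))" by (rule cmp_add[OF E(19) P(1)]; drule Pb; linarith)
    have cm: "cmp ?H (\<lambda>Z. v Z mod dg (d Z))" by (intro cmp_mod cmp_inter[OF v(1)] E)
    have t: "map (\<lambda>u. cv (d Z) (h Z) (k Z * dg (d Z) + u) - i0 Z) [0..<dg (d Z)] ! (v Z mod dg (d Z)) = cv (d Z) (h Z) (v Z) - i0 Z" if "Z \<in> V" for Z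
      using vb(3)[OF that] Uw(4)[OF that] by simp
    have "cmp ?H (\<lambda>Z. map (\<lambda>u. cv (d Z) (h Z) (k Z * dg (d Z) + u) - i0 Z) [0..<dg (d Z)] ! (v Z mod dg (d Z)))"
    proof (rule cmp_arr[OF wH ca cb cm])
      fix Z assume m: "Z \<in> ?H"
      have m': "Z \<in> V" using m by blast
      have "sub (bb Z) (bHR (d Z) + (\<Sum>u<k Z. length (hrec (d Z) (h Z) u))) (hrec (d Z) (h Z) (k Z))"
        by (rule sub_cat[of _ _ _ "dU (d Z) div dg (d Z) + 1"]) (use okH[OF m] kU[OF m'] in \<open>auto simp: dms_ok_def\<close>)
      then have 1: "sub (bb Z) (bHR (d Z) + Hp (d Z) (h Z) (k Z)) (arr (b Z) (map (\<lambda>u. cv (d Z) (h Z) (k Z * dg (d Z) + u) - i0 Z) [0..<dg (d Z)]))"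
        unfolding Hp_def hr[OF m] .
      have "cv (d Z) (h Z) (v Z) - i0 Z \<le> i1 Z - i0 Z" using i01(2)[OF m'] by simp
      then have 2: "cv (d Z) (h Z) (v Z) - i0 Z < 2 ^ b Z" unfolding b_def using less_bits[of "i1 Z - i0 Z"] by linarith
      have 3: "cv (d Z) (h Z) (v Z) - i0 Z < 2 ^ ww Z" using i01[OF m'] Uw(2)[OF m'] by linarith
      have "v Z mod dg (d Z) * b Z \<le> dg (d Z) * b Z" using Uw(4)[OF m'] by (intro mult_le_mono1) (simp add: less_imp_le)
      then have 4: "bHR (d Z) + Hp (d Z) (h Z) (k Z) + v Z mod dg (d Z) * b Z < 2 ^ ww Z" using Pb[OF m] by linarith
      show "sub (bb Z) (bHR (d Z) + Hp (d Z) (h Z) (k Z)) (arr (b Z) (map (\<lambda>u. cv (d Z) (h Z) (k Z * dg (d Z) + u) - i0 Z) [0..<dg (d Z)])) \<and>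
        v Z mod dg (d Z) < length (map (\<lambda>u. cv (d Z) (h Z) (k Z * dg (d Z) + u) - i0 Z) [0..<dg (d Z)]) \<and>
        map (\<lambda>u. cv (d Z) (h Z) (k Z * dg (d Z) + u) - i0 Z) [0..<dg (d Z)] ! (v Z mod dg (d Z)) < 2 ^ b Z \<and>
        map (\<lambda>u. cv (d Z) (h Z) (k Z * dg (d Z) + u) - i0 Z) [0..<dg (d Z)] ! (v Z mod dg (d Z)) < 2 ^ ww Z \<and>
        bHR (d Z) + Hp (d Z) (h Z) (k Z) + v Z mod dg (d Z) * b Z < 2 ^ ww Z"
        unfolding t[OF m'] using 1 2 3 4 Uw(4)[OF m'] by simp
    qed
    then have c1: "cmp ?H (\<lambda>Z. cv (d Z) (h Z) (v Z) - i0 Z)" by (rule cmp_cong) (use t in blast)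
    show ?thesis
    proof (rule cmp_cong[OF cmp_add[OF cmp_inter[OF ci0] c1]])
      fix Z assume "Z \<in> ?H"
      then have m': "Z \<in> V" by blast
      show "i0 Z + (cv (d Z) (h Z) (v Z) - i0 Z) = cv (d Z) (h Z) (v Z)" using i01[OF m'] by simp
      then show "i0 Z + (cv (d Z) (h Z) (v Z) - i0 Z) < 2 ^ ww Z" using i01[OF m'] Uw(2)[OF m'] by linarith
    qed
  qed
  have cE: "cmp ?E (\<lambda>Z. cv (d Z) (h Z) (v Z))"
  proof -
    let ?Q = "?E \<inter> {Z. 0 < i1 Z - i0 Z}" and ?G = "\<lambda>Z. Fh (d Z) (h Z) (j Z + 1)"
    have cG: "cmp V ?G" by (rule cmp_Fh[OF wf d ok cj1]) (use jn in \<open>fastforce+\<close>)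
    have z: "cmp (?E \<inter> {Z. \<not> 0 < i1 Z - i0 Z}) (\<lambda>Z. cv (d Z) (h Z) (v Z))"
      by (rule cmp_cong[OF cmp_mono[OF ci0]]) (use i01 in fastforce)+
    have fQ: "i1 Z - i0 Z < dbe (d Z)" "\<not> sparse (d Z) (h Z) (j Z)" "\<not> sparse (d Z) (h Z) (j Z + 1)" "Z \<in> V" if "Z \<in> ?Q" for Z
      using that hd[of Z] by auto
    have cQ: "cv (d Z) (h Z) (v Z) \<le> (j Z + 2) * dbe (d Z)" "j Z * dbe (d Z) \<le> cv (d Z) (h Z) (v Z)" if m: "Z \<in> ?Q" for Z
    proof -
      have "i0 Z < (j Z + 1) * dbe (d Z)" unfolding j_def using dividend_less_times_div[of "dbe (d Z)" "i0 Z"] Uw(3)[OF fQ(4)[OF m]] by (simp add: algebra_simps)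
      moreover have "i1 Z < i0 Z + dbe (d Z)" using fQ(1)[OF m] by linarith
      moreover have "(j Z + 2) * dbe (d Z) = (j Z + 1) * dbe (d Z) + dbe (d Z)" by simp
      ultimately show "cv (d Z) (h Z) (v Z) \<le> (j Z + 2) * dbe (d Z)" using i01(2)[OF fQ(4)[OF m]] by linarith
      have "j Z * dbe (d Z) \<le> i0 Z" unfolding j_def by simp
      then show "j Z * dbe (d Z) \<le> cv (d Z) (h Z) (v Z)" using i01(1)[OF fQ(4)[OF m]] by linarith
    qed
    have Giff: "?G Z < v Z \<longleftrightarrow> (j Z + 1) * dbe (d Z) < cv (d Z) (h Z) (v Z)" if "Z \<in> V" for Z
      unfolding Fh_def by (rule cv_iff[OF so[OF that] v(2)[OF that]])
    have c1: "cmp (?Q \<inter> {Z. v Z \<le> ?G Z}) (\<lambda>Z. cv (d Z) (h Z) (v Z))"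
    proof (rule cmp_block_cv[where h = h and c = c])
      show "wf (?Q \<inter> {Z. v Z \<le> ?G Z})" "dcmp (?Q \<inter> {Z. v Z \<le> ?G Z}) d" using wf d by (auto intro: wf_sub dcmp_mono)
      show "cmp (?Q \<inter> {Z. v Z \<le> ?G Z}) j" "cmp (?Q \<inter> {Z. v Z \<le> ?G Z}) v" using cj v(1) by (auto intro: cmp_mono)
      show "\<And>Z. Z \<in> ?Q \<inter> {Z. v Z \<le> ?G Z} \<Longrightarrow> dms_ok (d Z) (h Z) (c Z) (ww Z) (bb Z)" using ok by blast
      fix Z assume m: "Z \<in> ?Q \<inter> {Z. v Z \<le> ?G Z}"
      then have q: "Z \<in> ?Q" and g: "v Z \<le> ?G Z" by blast+
      have "cv (d Z) (h Z) (v Z) \<le> (j Z + 1) * dbe (d Z)" using Giff[OF fQ(4)[OF q]] g by linarith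
      then show "j Z < nb (d Z) \<and> \<not> sparse (d Z) (h Z) (j Z) \<and> v Z \<le> dU (d Z) \<and> j Z * dbe (d Z) \<le> cv (d Z) (h Z) (v Z)
          \<and> cv (d Z) (h Z) (v Z) \<le> (j Z + 1) * dbe (d Z) \<and> v Z \<le> Fh (d Z) (h Z) (j Z + 1)"
        using jn[OF fQ(4)[OF q]] fQ(2)[OF q] v(2)[OF fQ(4)[OF q]] cQ(2)[OF q] g by blast
    qed
    have c2: "cmp (?Q \<inter> {Z. \<not> v Z \<le> ?G Z}) (\<lambda>Z. cv (d Z) (h Z) (v Z))"
    proof (rule cmp_block_cv[where h = h and c = c and j = "\<lambda>Z. j Z + 1"])
      show "wf (?Q \<inter> {Z. \<not> v Z \<le> ?G Z})" "dcmp (?Q \<inter> {Z. \<not> v Z \<le> ?G Z}) d" using wf d by (auto intro: wf_sub dcmp_mono)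
      show "cmp (?Q \<inter> {Z. \<not> v Z \<le> ?G Z}) (\<lambda>Z. j Z + 1)" "cmp (?Q \<inter> {Z. \<not> v Z \<le> ?G Z}) v" using cj1 v(1) by (auto intro: cmp_mono)
      show "\<And>Z. Z \<in> ?Q \<inter> {Z. \<not> v Z \<le> ?G Z} \<Longrightarrow> dms_ok (d Z) (h Z) (c Z) (ww Z) (bb Z)" using ok by blast
      fix Z assume m: "Z \<in> ?Q \<inter> {Z. \<not> v Z \<le> ?G Z}"
      then have q: "Z \<in> ?Q" and g: "\<not> v Z \<le> ?G Z" by blast+
      have 1: "(j Z + 1) * dbe (d Z) < cv (d Z) (h Z) (v Z)" using Giff[OF fQ(4)[OF q]] g by linarith
      have 2: "v Z \<le> Fh (d Z) (h Z) (j Z + 1 + 1)"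
      proof (rule ccontr)
        assume "\<not> ?thesis"
        then have "(j Z + 1 + 1) * dbe (d Z) < cv (d Z) (h Z) (v Z)"
          using cv_iff[OF so[OF fQ(4)[OF q]] v(2)[OF fQ(4)[OF q]], of "(j Z + 1 + 1) * dbe (d Z)"] by (simp add: Fh_def)
        moreover have "(j Z + 1 + 1) = j Z + 2" by simp
        ultimately show False using cQ(1)[OF q] by (metis leD)
      qed
      have 3: "j Z + 1 < nb (d Z)"
      proof -
        have "(j Z + 1) * dbe (d Z) \<le> dn (d Z)" using 1 cv_le[of "d Z" "h Z" "v Z"] by linarith
        then have "j Z + 1 \<le> dn (d Z) div dbe (d Z)" using Uw(3)[OF fQ(4)[OF q]] by (simp add: less_eq_div_iff_mult_less_eq)
        then show ?thesis by (simp add: nb_def)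
      qed
      have "cv (d Z) (h Z) (v Z) \<le> (j Z + 1 + 1) * dbe (d Z)" using cQ(1)[OF q] by (metis add.assoc one_add_one)
      then show "j Z + 1 < nb (d Z) \<and> \<not> sparse (d Z) (h Z) (j Z + 1) \<and> v Z \<le> dU (d Z) \<and> (j Z + 1) * dbe (d Z) \<le> cv (d Z) (h Z) (v Z)
          \<and> cv (d Z) (h Z) (v Z) \<le> (j Z + 1 + 1) * dbe (d Z) \<and> v Z \<le> Fh (d Z) (h Z) (j Z + 1 + 1)"
        using 1 2 3 fQ(3)[OF q] v(2)[OF fQ(4)[OF q]] less_imp_le by blast
    qed
    have t1: "cmpP ?Q (\<lambda>Z. v Z \<le> ?G Z)" by (intro cmp_le pos_inter p cmp_inter[OF cmp_inter[OF v(1)]] cmp_inter[OF cmp_inter[OF cG]] | rule cmp_mono[OF v(1)] cmp_mono[OF cG]; blast)+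
    have cQQ: "cmp ?Q (\<lambda>Z. cv (d Z) (h Z) (v Z))" using cmp_if[OF t1 c1 c2] by (simp only: if_cancel)
    have t2: "cmpP ?E (\<lambda>Z. 0 < i1 Z - i0 Z)" by (rule cmp_less[OF cmp_0 cmp_inter[OF cq]])
    from cmp_if[OF t2 cQQ z] show ?thesis by (simp only: if_cancel)
  qed
  from cmp_if[OF chard cH cE] show ?thesis by (simp only: if_cancel)
qed

section \<open>Rank and select\<close>

definition hf :: "nat \<Rightarrow> nat \<Rightarrow> nat list \<Rightarrow> nat \<Rightarrow> nat" where
  "hf s U ys i = (if i < length ys then ys ! i div 2 ^ s else U)"

abbreviation bin :: "nat \<Rightarrow> nat list \<Rightarrow> nat \<Rightarrow> nat list" where "bin s ys v \<equiv> seg (\<lambda>x. x div 2 ^ s) ys v"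

text \<open>The offset of bin \<open>v\<close>: \<open>s\<close> bits for each preceding element and
  \<open>e\<close> more for each preceding position with extra space. Both counts are rank queries
  on the sequence of high parts.\<close>

definition la :: "ds \<Rightarrow> (nat \<Rightarrow> nat) \<Rightarrow> nat \<Rightarrow> nat \<Rightarrow> nat \<Rightarrow> nat" where
  "la d h s e v = s * cv d h v + e * Zc d h (cv d h v)"

definition low :: "ds \<Rightarrow> (nat \<Rightarrow> nat) \<Rightarrow> prm \<Rightarrow> nat \<Rightarrow> nat \<Rightarrow> nat list \<Rightarrow> bool list" where
  "low d h P s e ys = cat (\<lambda>v. padto (la d h s e (v + 1) - la d h s e v) (enc A0 P s (bin s ys v))) (dU d)"

definition top_ok :: "ds \<Rightarrow> (nat list \<Rightarrow> nat) \<Rightarrow> prm \<Rightarrow> nat \<Rightarrow> nat \<Rightarrow> nat \<Rightarrow> nat list \<Rightarrow> nat \<Rightarrow> bool list \<Rightarrow> bool" where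
  "top_ok d c P s e bL ys w bs \<longleftrightarrow> dms_ok d (hf s (dU d) ys) c w bs \<and> length ys = dn d \<and> sorted ys \<and> (\<forall>v. node_ok P w s (bin s ys v)) \<and>
     (\<forall>v<dU d. length (enc A0 P s (bin s ys v)) \<le> la d (hf s (dU d) ys) s e (v + 1) - la d (hf s (dU d) ys) s e v) \<and>
     sub bs bL (low d (hf s (dU d) ys) P s e ys) \<and> bL + length (low d (hf s (dU d) ys) P s e ys) < 2 ^ w \<and>
     bL + la d (hf s (dU d) ys) s e (dU d) < 2 ^ w"

lemma cnt_map: "cnt f xs v = length (filter (\<lambda>y. y < v) (map f xs))"
  by (simp add: cnt_def filter_map comp_def)

lemma cv_hf: "length ys = dn d \<Longrightarrow> cv d (hf s U ys) v = cnt (\<lambda>x. x div 2 ^ s) ys v"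
proof -
  assume l: "length ys = dn d"
  have "map (hf s U ys) [0..<dn d] = map (\<lambda>x. x div 2 ^ s) ys"
    by (rule nth_equalityI) (auto simp: hf_def l)
  then show ?thesis by (simp only: cv_def cnt_map)
qed

lemma Zc_mono: "i \<le> i' \<Longrightarrow> Zc d h i \<le> Zc d h i'"
  unfolding Zc_def by (intro sum_mono2) auto

lemma la_mono: "v \<le> v' \<Longrightarrow> la d h s e v \<le> la d h s e v'"
  unfolding la_def by (intro add_mono mult_le_mono2 cv_mono Zc_mono) auto

lemma sum_diff_telescope: "(\<And>a b. a \<le> b \<Longrightarrow> f a \<le> f b) \<Longrightarrow> (\<Sum>u<v. f (Suc u) - f u) = f v - (f 0 :: nat)"
proof (induction v)
  case (Suc v)
  have "f 0 \<le> f v" "f v \<le> f (Suc v)" using Suc.prems by simp_all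
  then show ?case using Suc by simp
qed simp

lemma sub_low:
  assumes ok: "top_ok d c P s e bL ys w bs" and v: "v < dU d"
  shows "sub bs (bL + la d (hf s (dU d) ys) s e v) (enc A0 P s (bin s ys v))"
    and "bL + la d (hf s (dU d) ys) s e v + length (enc A0 P s (bin s ys v)) < 2 ^ w"
    and "bL + la d (hf s (dU d) ys) s e v < 2 ^ w"
proof -
  let ?h = "hf s (dU d) ys" and ?la = "la d (hf s (dU d) ys) s e"
  let ?F = "\<lambda>v. padto (?la (v + 1) - ?la v) (enc A0 P s (bin s ys v))"
  have l: "length (?F u) = ?la (u + 1) - ?la u" if "u < dU d" for u
    using ok that by (intro length_padto) (simp add: top_ok_def)
  have cv0: "cv d ?h 0 = 0" by (simp add: cv_def cnt_def)
  then have la0: "?la 0 = 0" by (simp add: la_def Zc_def)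
  have S: "(\<Sum>u<x. length (?F u)) = ?la x" if "x \<le> dU d" for x
  proof -
    have "(\<Sum>u<x. length (?F u)) = (\<Sum>u<x. ?la (Suc u) - ?la u)" using that l by (intro sum.cong) auto
    also have "\<dots> = ?la x - ?la 0" by (rule sum_diff_telescope) (rule la_mono)
    finally show ?thesis using la0 by simp
  qed
  have "sub bs bL (cat ?F (dU d))" using ok by (simp add: top_ok_def low_def)
  from sub_cat[OF this v] have "sub bs (bL + ?la v) (?F v)" using S[of v] v by simp
  then show "sub bs (bL + ?la v) (enc A0 P s (bin s ys v))" by (rule sub_padto)
  have "?la v + length (enc A0 P s (bin s ys v)) \<le> ?la (v + 1)"
    using ok v la_mono[of v "v + 1" d ?h s e] unfolding top_ok_def by fastforce
  also have "\<dots> \<le> ?la (dU d)" using v by (intro la_mono) simp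
  finally have "bL + ?la v + length (enc A0 P s (bin s ys v)) \<le> bL + ?la (dU d)" by simp
  then show "bL + ?la v + length (enc A0 P s (bin s ys v)) < 2 ^ w" using ok unfolding top_ok_def by linarith
  then show "bL + ?la v < 2 ^ w" by linarith
qed

text \<open>The high part of the argument selects a bin, and the position inside the bin is added to
  the number of elements in the bins before it. For access, the high part at a position gives both
  the bin and the leading bits of the answer.\<close>

lemma
  assumes wf: "wf V" and d: "dcmp V d" and P: "pcmp V P" and s: "cmp V s" and e: "cmp V e" and bL: "cmp V bL"
    and ok: "\<And>Z. Z \<in> V \<Longrightarrow> top_ok (d Z) (c Z) (P Z) (s Z) (e Z) (bL Z) (ys Z) (ww Z) (bb Z)"
  shows cmp_top_fo: "cmp V X \<Longrightarrow> (\<And>Z. Z \<in> V \<Longrightarrow> X Z div 2 ^ s Z < dU (d Z)) \<Longrightarrow> cmp V (\<lambda>Z. fo (ys Z) (X Z))"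
    and cmp_top_nth: "cmp V I \<Longrightarrow> (\<And>Z. Z \<in> V \<Longrightarrow> I Z < length (ys Z) \<and> ys Z ! I Z < 2 ^ ww Z) \<Longrightarrow> cmp V (\<lambda>Z. ys Z ! I Z)"
proof -
  define h where "h Z = hf (s Z) (dU (d Z)) (ys Z)" for Z
  note p = wf_pos[OF wf] and D = dcmpD[OF d]
  have dok: "dms_ok (d Z) (h Z) (c Z) (ww Z) (bb Z)" if "Z \<in> V" for Z using ok[OF that] by (simp add: top_ok_def h_def)
  have len: "length (ys Z) = dn (d Z)" "sorted (ys Z)" if "Z \<in> V" for Z using ok[OF that] by (simp_all add: top_ok_def)
  have cve: "cv (d Z) (h Z) v = cnt (\<lambda>x. x div 2 ^ s Z) (ys Z) v" if "Z \<in> V" for Z v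
    unfolding h_def by (rule cv_hf[OF len(1)[OF that]])
  have so: "sorted (map (\<lambda>x. x div 2 ^ s Z) (ys Z))" if "Z \<in> V" for Z
    using len(2)[OF that] by (auto simp: sorted_iff_nth_mono div_le_mono)
  have small: "dU (d Z) + 1 < 2 ^ ww Z" "dn (d Z) < 2 ^ ww Z" if "Z \<in> V" for Z
    using dok[OF that] unfolding dms_ok_def seq_ok_def by linarith+
  have node: "(\<forall>I. cmp V I \<longrightarrow> (\<forall>Z\<in>V. I Z < length (bin (s Z) (ys Z) (v Z))) \<longrightarrow> cmp V (\<lambda>Z. bin (s Z) (ys Z) (v Z) ! I Z mod 2 ^ s Z)) \<and>
     (\<forall>X. cmp V X \<longrightarrow> (\<forall>Z\<in>V. \<forall>x\<in>set (bin (s Z) (ys Z) (v Z)). x div 2 ^ s Z = X Z div 2 ^ s Z) \<longrightarrow> cmp V (\<lambda>Z. fo (bin (s Z) (ys Z) (v Z)) (X Z)))"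
    and cv1: "cmp V (\<lambda>Z. cv (d Z) (h Z) (v Z))" "cmp V (\<lambda>Z. length (bin (s Z) (ys Z) (v Z)))"
    if v1: "cmp V v" and v2: "\<forall>Z\<in>V. v Z < dU (d Z)" for v
  proof -
    have v: "cmp V v" "\<And>Z. Z \<in> V \<Longrightarrow> v Z < dU (d Z)" using v1 v2 by auto
    have vs: "cmp V (\<lambda>Z. v Z + 1)" by (rule cmp_Suc[OF p v(1)]; frule v(2); drule small(1); linarith)
    show c0: "cmp V (\<lambda>Z. cv (d Z) (h Z) (v Z))" by (rule cmp_cv[OF wf d dok v(1)]) (use v(2) in \<open>auto intro: less_imp_le\<close>)
    have c1: "cmp V (\<lambda>Z. cv (d Z) (h Z) (v Z + 1))" by (rule cmp_cv[OF wf d dok vs]) (use v(2) in \<open>auto simp: Suc_le_eq\<close>)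
    show cl: "cmp V (\<lambda>Z. length (bin (s Z) (ys Z) (v Z)))"
    proof (rule cmp_cong[OF cmp_sub[OF c1 c0]])
      fix Z assume m: "Z \<in> V"
      show "cv (d Z) (h Z) (v Z) \<le> cv (d Z) (h Z) (v Z + 1)" by (rule cv_mono) simp
      show "cv (d Z) (h Z) (v Z + 1) < 2 ^ ww Z" using cv_le[of "d Z" "h Z" "v Z + 1"] small(2)[OF m] by linarith
      show "cv (d Z) (h Z) (v Z + 1) - cv (d Z) (h Z) (v Z) = length (bin (s Z) (ys Z) (v Z))" unfolding cve[OF m] length_seg ..
    qed
    have cZ: "cmp V (\<lambda>Z. Zc (d Z) (h Z) (cv (d Z) (h Z) (v Z)))" by (rule cmp_Zc[OF wf d dok c0]) (auto intro: cv_le)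
    have ca: "cmp V (\<lambda>Z. bL Z + (s Z * cv (d Z) (h Z) (v Z) + e Z * Zc (d Z) (h Z) (cv (d Z) (h Z) (v Z))))"
      by (intro cmp_add cmp_mul bL s e c0 cZ; use sub_low(3)[OF ok v(2)] in \<open>fastforce simp: la_def h_def\<close>)
    show "(\<forall>I. cmp V I \<longrightarrow> (\<forall>Z\<in>V. I Z < length (bin (s Z) (ys Z) (v Z))) \<longrightarrow> cmp V (\<lambda>Z. bin (s Z) (ys Z) (v Z) ! I Z mod 2 ^ s Z)) \<and>
     (\<forall>X. cmp V X \<longrightarrow> (\<forall>Z\<in>V. \<forall>x\<in>set (bin (s Z) (ys Z) (v Z)). x div 2 ^ s Z = X Z div 2 ^ s Z) \<longrightarrow> cmp V (\<lambda>Z. fo (bin (s Z) (ys Z) (v Z)) (X Z)))"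
    proof (rule cmp_enc[OF order_refl wf P ca s cl])
      fix Z assume m: "Z \<in> V"
      have "node_ok (P Z) (ww Z) (s Z) (bin (s Z) (ys Z) (v Z))" using ok[OF m] by (simp add: top_ok_def)
      then show "node_ok (P Z) (ww Z) (s Z) (bin (s Z) (ys Z) (v Z)) \<and>
        sub (bb Z) (bL Z + (s Z * cv (d Z) (h Z) (v Z) + e Z * Zc (d Z) (h Z) (cv (d Z) (h Z) (v Z)))) (enc A0 (P Z) (s Z) (bin (s Z) (ys Z) (v Z))) \<and>
        bL Z + (s Z * cv (d Z) (h Z) (v Z) + e Z * Zc (d Z) (h Z) (cv (d Z) (h Z) (v Z))) + length (enc A0 (P Z) (s Z) (bin (s Z) (ys Z) (v Z))) < 2 ^ ww Z"
        using sub_low(1,2)[OF ok[OF m] v(2)[OF m]] unfolding la_def h_def by blast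
    qed
  qed
  show "cmp V (\<lambda>Z. fo (ys Z) (X Z))" if X: "cmp V X" "\<And>Z. Z \<in> V \<Longrightarrow> X Z div 2 ^ s Z < dU (d Z)" for X
  proof -
    let ?v = "\<lambda>Z. X Z div 2 ^ s Z"
    have cv: "cmp V ?v" by (intro cmp_shr X s)
    have X2: "\<forall>Z\<in>V. ?v Z < dU (d Z)" using X(2) by blast
    note nd = node[OF cv X2] and cc = cv1[OF cv X2]
    have cf: "cmp V (\<lambda>Z. fo (bin (s Z) (ys Z) (?v Z)) (X Z))"
      using nd[THEN conjunct2, rule_format, OF X(1)] set_seg[OF so] by (metis (mono_tags, lifting) mem_Collect_eq)
    have cn: "cmp V (\<lambda>Z. length (ys Z))" by (rule cmp_cong[OF D(1)]) (use len in simp)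
    have "cmp V (\<lambda>Z. if fo (bin (s Z) (ys Z) (?v Z)) (X Z) < length (bin (s Z) (ys Z) (?v Z))
        then cv (d Z) (h Z) (?v Z) + fo (bin (s Z) (ys Z) (?v Z)) (X Z) else length (ys Z))"
    proof (intro cmp_if cmp_less cf cc cmp_add cmp_inter[OF cf] cmp_inter[OF cc(1)] cmp_inter[OF cn])
      fix Z assume "Z \<in> V \<inter> {Z. fo (bin (s Z) (ys Z) (?v Z)) (X Z) < length (bin (s Z) (ys Z) (?v Z))}"
      then have m: "Z \<in> V" and l: "fo (bin (s Z) (ys Z) (?v Z)) (X Z) < length (bin (s Z) (ys Z) (?v Z))" by auto
      have "cv (d Z) (h Z) (?v Z) + length (bin (s Z) (ys Z) (?v Z)) \<le> dn (d Z)"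
        using cnt_mono[of "?v Z" "?v Z + 1" "\<lambda>x. x div 2 ^ s Z" "ys Z"] cv_le[of "d Z" "h Z" "?v Z + 1"]
        unfolding cve[OF m] length_seg by linarith
      then show "cv (d Z) (h Z) (?v Z) + fo (bin (s Z) (ys Z) (?v Z)) (X Z) < 2 ^ ww Z" using l small(2)[OF m] by linarith
    qed
    then show ?thesis
    proof (rule cmp_cong)
      fix Z assume m: "Z \<in> V"
      show "(if fo (bin (s Z) (ys Z) (?v Z)) (X Z) < length (bin (s Z) (ys Z) (?v Z))
        then cv (d Z) (h Z) (?v Z) + fo (bin (s Z) (ys Z) (?v Z)) (X Z) else length (ys Z)) = fo (ys Z) (X Z)"
        unfolding cve[OF m] by (rule fo_seg[OF so[OF m], symmetric])
    qed
  qed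
  show "cmp V (\<lambda>Z. ys Z ! I Z)" if I: "cmp V I" "\<And>Z. Z \<in> V \<Longrightarrow> I Z < length (ys Z) \<and> ys Z ! I Z < 2 ^ ww Z" for I
  proof -
    let ?v = "\<lambda>Z. h Z (I Z)"
    have hI: "?v Z = ys Z ! I Z div 2 ^ s Z" "I Z < dn (d Z)" "?v Z < dU (d Z)" if m: "Z \<in> V" for Z
    proof -
      show 1: "?v Z = ys Z ! I Z div 2 ^ s Z" using I(2)[OF m] by (simp add: h_def hf_def)
      show 2: "I Z < dn (d Z)" using I(2)[OF m] len(1)[OF m] by simp
      show "?v Z < dU (d Z)" using dok[OF m] 2 by (simp add: dms_ok_def seq_ok_def)
    qed
    have cv: "cmp V ?v" by (rule cmp_acc[OF wf d dok I(1)]) (use hI in auto)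
    have h2: "\<forall>Z\<in>V. ?v Z < dU (d Z)" using hI(3) by blast
    note nd = node[OF cv h2] and cc = cv1[OF cv h2]
    have r: "cv (d Z) (h Z) (?v Z) \<le> I Z" "I Z - cv (d Z) (h Z) (?v Z) < length (bin (s Z) (ys Z) (?v Z))"
       "bin (s Z) (ys Z) (?v Z) ! (I Z - cv (d Z) (h Z) (?v Z)) = ys Z ! I Z" if m: "Z \<in> V" for Z
    proof -
      have l: "I Z < length (ys Z)" using I(2)[OF m] by simp
      show 1: "cv (d Z) (h Z) (?v Z) \<le> I Z" using cnt_iff[OF so[OF m] l, of "?v Z"] hI(1)[OF m] unfolding cve[OF m] by auto
      have "I Z < cnt (\<lambda>x. x div 2 ^ s Z) (ys Z) (?v Z + 1)" using cnt_iff[OF so[OF m] l, of "?v Z + 1"] hI(1)[OF m] by auto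
      then show 2: "I Z - cv (d Z) (h Z) (?v Z) < length (bin (s Z) (ys Z) (?v Z))" using 1 unfolding cve[OF m] length_seg by linarith
      show "bin (s Z) (ys Z) (?v Z) ! (I Z - cv (d Z) (h Z) (?v Z)) = ys Z ! I Z" using nth_seg[OF 2] 1 unfolding cve[OF m] by simp
    qed
    have ci: "cmp V (\<lambda>Z. I Z - cv (d Z) (h Z) (?v Z))" by (rule cmp_sub[OF I(1) cc(1)]) (use r(1) hI(2) small(2) less_trans in blast)+
    have c1: "cmp V (\<lambda>Z. bin (s Z) (ys Z) (?v Z) ! (I Z - cv (d Z) (h Z) (?v Z)) mod 2 ^ s Z)"
      using nd[THEN conjunct1, rule_format, OF ci] r(2) by blast
    have eq: "?v Z * 2 ^ s Z + bin (s Z) (ys Z) (?v Z) ! (I Z - cv (d Z) (h Z) (?v Z)) mod 2 ^ s Z = ys Z ! I Z" if m: "Z \<in> V" for Z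
      using r(3)[OF m] unfolding hI(1)[OF m] by (simp only: div_mult_mod_eq)
    show ?thesis
    proof (rule cmp_cong[OF cmp_add[OF cmp_shl[OF cv s] c1] eq])
      fix Z assume m: "Z \<in> V"
      show "?v Z * 2 ^ s Z + bin (s Z) (ys Z) (?v Z) ! (I Z - cv (d Z) (h Z) (?v Z)) mod 2 ^ s Z < 2 ^ ww Z"
        using eq[OF m] I(2)[OF m] by simp
      then show "?v Z * 2 ^ s Z < 2 ^ ww Z" by linarith
    qed
  qed
qed

section \<open>Block codes\<close>

text \<open>Numbering the elements by decreasing probability: the first \<open>c + 1\<close> of them
  are each at least as probable as the last, so its probability is at most 1 / (c + 1).\<close>

lemma ex_code:
  fixes p :: "'a \<Rightarrow> real"
  assumes "finite X" "\<And>x. x \<in> X \<Longrightarrow> 0 < p x" "sum p X \<le> 1"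
  shows "\<exists>c. inj_on c X \<and> (\<forall>x\<in>X. c x < card X \<and> real (c x + 1) * p x \<le> 1)"
  using assms
proof (induction "card X" arbitrary: X)
  case 0
  then show ?case by auto
next
  case (Suc k)
  then have ne: "X \<noteq> {}" by auto
  \<comment> \<open>The least probable element receives the largest number; the others are numbered
    by induction.\<close>
  define x where "x = arg_min_on p X"
  have x: "x \<in> X" "\<And>y. y \<in> X \<Longrightarrow> p x \<le> p y"
    using arg_min_if_finite[OF Suc.prems(1) ne, of p] unfolding x_def by (auto simp: not_less)
  have ck: "card (X - {x}) = k" using Suc.hyps(2) x(1) Suc.prems(1) by simp
  have "sum p (X - {x}) \<le> sum p X" using Suc.prems x by (simp add: sum_diff1 less_imp_le)
  then obtain c where c: "inj_on c (X - {x})" "\<forall>y\<in>X - {x}. c y < k \<and> real (c y + 1) * p y \<le> 1"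
    using Suc.hyps(1)[of "X - {x}"] ck Suc.prems by auto
  have "real (card X) * p x = (\<Sum>y\<in>X. p x)" by simp
  also have "\<dots> \<le> sum p X" by (intro sum_mono x)
  finally have "real (k + 1) * p x \<le> 1" using Suc.prems(3) Suc.hyps(2) by simp
  then show ?case using c x Suc.hyps(2)[symmetric]
    by (intro exI[of _ "c(x := k)"]) (auto simp: inj_on_def less_Suc_eq)
qed

lemma sum_prod_list_le_one:
  fixes p :: "nat \<Rightarrow> real"
  assumes "\<And>x. x \<in> A \<Longrightarrow> 0 \<le> p x" "sum p A \<le> 1" "finite A"
  shows "finite {gs. length gs = k \<and> set gs \<subseteq> A} \<and> (\<Sum>gs | length gs = k \<and> set gs \<subseteq> A. prod_list (map p gs)) \<le> 1"
proof (induction k)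
  case (Suc k)
  let ?S = "\<lambda>k. {gs. length gs = k \<and> set gs \<subseteq> A}"
  have S: "?S (Suc k) = (\<lambda>(x, gs). x # gs) ` (A \<times> ?S k)"
    by (auto simp: length_Suc_conv image_iff)
  have inj: "inj_on (\<lambda>(x, gs). x # gs) (A \<times> ?S k)" by (auto simp: inj_on_def)
  have "(\<Sum>gs\<in>?S (Suc k). prod_list (map p gs)) = (\<Sum>(x, gs)\<in>A \<times> ?S k. p x * prod_list (map p gs))"
    unfolding S by (subst sum.reindex[OF inj]) (auto intro!: sum.cong)
  also have "\<dots> = sum p A * (\<Sum>gs\<in>?S k. prod_list (map p gs))"
    using Suc assms(3) by (simp add: sum.cartesian_product[symmetric] sum_product)
  also have "\<dots> \<le> 1 * 1" using Suc assms by (intro mult_mono sum_nonneg prod_list_nonneg) auto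
  finally show ?case using Suc assms(3) unfolding S by simp
next
  case 0
  have "{gs. length gs = 0 \<and> set gs \<subseteq> A} = {[]}" by auto
  then show ?case by simp
qed

lemma bits_le_log: "0 < x \<Longrightarrow> real (bits x) \<le> log 2 (real x) + 1"
proof -
  assume x: "0 < x"
  have "real (bits x - 1) \<le> log 2 (real x)" using le_log2_of_power[OF bits_ge[OF x]] .
  then show ?thesis using bits_pos[OF x] by (simp add: of_nat_diff)
qed

text \<open>A Shannon code for the product distribution. A block loses one bit against its ideal
  length, however many gaps it contains.\<close>

lemma ex_block_code:
  fixes p :: "nat \<Rightarrow> real"
  assumes p: "\<And>x. x < D \<Longrightarrow> 0 < p x" "(\<Sum>x<D. p x) \<le> 1"
  shows "\<exists>c :: nat list \<Rightarrow> nat. inj_on c {gs. length gs = k \<and> set gs \<subseteq> {..<D}} \<and>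
    (\<forall>gs. length gs = k \<and> set gs \<subseteq> {..<D} \<longrightarrow> real (c gs + 1) * prod_list (map p gs) \<le> 1 \<and>
       real (bits (c gs)) \<le> 1 + sum_list (map (\<lambda>g. - log 2 (p g)) gs))"
proof -
  let ?X = "{gs. length gs = k \<and> set gs \<subseteq> {..<D}}"
  have pos: "0 < prod_list (map p gs)" if "set gs \<subseteq> {..<D}" for gs using that by (induction gs) (auto intro!: mult_pos_pos p)
  have lg: "log 2 (prod_list (map p gs)) = sum_list (map (\<lambda>g. log 2 (p g)) gs)" if "set gs \<subseteq> {..<D}" for gs
    using that
  proof (induction gs)
    case (Cons g gs)
    then show ?case using p(1)[of g] pos[of gs] by (simp add: log_mult)
  qed simp
  obtain c where c: "inj_on c ?X" "\<forall>gs\<in>?X. c gs < card ?X \<and> real (c gs + 1) * prod_list (map p gs) \<le> 1"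
  proof -
    have "finite ?X \<and> (\<Sum>gs\<in>?X. prod_list (map p gs)) \<le> 1"
      by (rule sum_prod_list_le_one) (use p in \<open>auto intro: less_imp_le\<close>)
    moreover have "\<And>gs. gs \<in> ?X \<Longrightarrow> 0 < prod_list (map p gs)" using pos by blast
    ultimately show ?thesis using ex_code[of ?X "\<lambda>gs. prod_list (map p gs)"] that by blast
  qed
  have neg: "sum_list (map (\<lambda>g. - log 2 (p g)) gs) = - sum_list (map (\<lambda>g. log 2 (p g)) gs)" for gs
    by (induction gs) auto
  have "real (bits (c gs)) \<le> 1 + sum_list (map (\<lambda>g. - log 2 (p g)) gs)" if gs: "gs \<in> ?X" for gs
  proof (cases "c gs = 0")
    case True
    have "prod_list (map p gs) \<le> 1" using c(2) gs True by auto
    then have "log 2 (prod_list (map p gs)) \<le> 0" using pos[of gs] gs by simp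
    then show ?thesis using True lg[of gs] gs by (simp add: neg)
  next
    case False
    have "real (c gs) * prod_list (map p gs) \<le> 1"
      using c(2) gs pos[of gs] by (auto simp: algebra_simps)
    then have "real (c gs) \<le> 1 / prod_list (map p gs)" using pos[of gs] gs by (simp add: field_simps)
    then have "log 2 (real (c gs)) \<le> log 2 (1 / prod_list (map p gs))"
      using False pos[of gs] gs by (subst log_le_cancel_iff) auto
    also have "\<dots> = - log 2 (prod_list (map p gs))" using pos[of gs] gs by (simp add: log_divide)
    finally show ?thesis using bits_le_log[of "c gs"] False lg[of gs] gs by (simp add: neg)
  qed
  then show ?thesis using c by (intro exI[of _ c]) auto
qed

section \<open>The information bound\<close>

lemma ln2_ge_half: "1 / 2 \<le> ln (2::real)"
proof -
  have "ln (exp 1) \<le> ln (4::real)" using exp_le by (subst ln_le_cancel_iff) auto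
  also have "\<dots> = 2 * ln 2" using ln_realpow[of 2 2] by simp
  finally show ?thesis by simp
qed

text \<open>In the binomial expansion of \<open>(n + U) ^ (n + U)\<close> the term with exponent
  \<open>n\<close> of the base \<open>n\<close> is the largest, as the quotients of successive terms
  show; so it is at least the average of the \<open>U + n + 1\<close> terms.\<close>

lemma binomial_mode:
  fixes n U :: nat
  assumes "0 < n" "0 < U"
  shows "(U + n) ^ (U + n) \<le> (U + n + 1) * ((U + n choose n) * n ^ n * U ^ U)"
proof -
  let ?N = "U + n"
  define a where "a k = (?N choose k) * n ^ k * U ^ (?N - k)" for k
  have rec: "a (Suc k) * (Suc k * U) = a k * ((?N - k) * n)" if "k < ?N" for k
  proof -
    have "Suc k * (?N choose Suc k) = (?N - k) * (?N choose k)"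
      using binomial_absorption[of k ?N] binomial_absorb_comp[of ?N k] by simp
    moreover have "U ^ (?N - k) = U * U ^ (?N - Suc k)" using that by (metis Suc_diff_Suc power_Suc)
    ultimately have e: "Suc k * (?N choose Suc k) * (n * n ^ k) * (U * U ^ (?N - Suc k)) = (?N - k) * (?N choose k) * (n * n ^ k) * U ^ (?N - k)" by simp
    have "a (Suc k) * (Suc k * U) = Suc k * (?N choose Suc k) * (n * n ^ k) * (U * U ^ (?N - Suc k))"
      unfolding a_def power_Suc by (simp only: mult_ac)
    then show ?thesis unfolding e a_def by (simp only: mult_ac)
  qed
  have up: "a k \<le> a (Suc k)" if "k < n" for k
  proof -
    have "a k * (Suc k * U) \<le> a k * ((?N - k) * n)"
      using that by (intro mult_le_mono2) (subst mult.commute, intro mult_mono, auto)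
    also have "\<dots> = a (Suc k) * (Suc k * U)" using rec[of k] that by simp
    finally show ?thesis using assms by simp
  qed
  have down: "a (Suc k) \<le> a k" if "n \<le> k" "k < ?N" for k
  proof -
    have "a (Suc k) * (Suc k * U) = a k * ((?N - k) * n)" by (rule rec[OF that(2)])
    also have "\<dots> \<le> a k * (Suc k * U)"
      using that by (intro mult_le_mono2) (subst (2) mult.commute, intro mult_mono, auto)
    finally show ?thesis using assms by simp
  qed
  have le: "a k \<le> a n" if "k \<le> ?N" for k
  proof (cases "k \<le> n")
    case True
    then show ?thesis by (induction rule: inc_induct) (auto intro: le_trans[OF up])
  next
    case False
    then have "n \<le> k" by simp
    then show ?thesis using that
    proof (induction rule: dec_induct)
      case (step k) then show ?case using down[of k] by simp
    qed simp
  qed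
  have "?N ^ ?N = (n + U) ^ ?N" by (simp add: add.commute)
  also have "\<dots> = (\<Sum>k\<le>?N. a k)" unfolding a_def by (subst binomial) simp
  also have "\<dots> \<le> (\<Sum>k\<le>?N. a n)" by (intro sum_mono le) simp
  also have "\<dots> = (?N + 1) * a n" by simp
  finally show ?thesis by (simp add: a_def)
qed

lemma entropy_le_log_binomial:
  fixes n U :: nat
  assumes "0 < n" "0 < U"
  shows "real n * log 2 (real (U + n) / real n) + real U * log 2 (real (U + n) / real U)
     \<le> log 2 (real (U + n choose n)) + log 2 (real (U + n + 1))"
proof -
  have C: "0 < real (U + n choose n)" by simp
  have "real ((U + n) ^ (U + n)) \<le> real ((U + n + 1) * ((U + n choose n) * n ^ n * U ^ U))"
    using binomial_mode[OF assms] by (simp only: of_nat_le_iff)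
  then have le: "real (U + n) ^ (U + n) \<le> real (U + n + 1) * (real (U + n choose n) * real n ^ n * real U ^ U)"
    unfolding of_nat_mult of_nat_power .
  have "log 2 (real (U + n) ^ (U + n)) \<le> log 2 (real (U + n + 1) * (real (U + n choose n) * real n ^ n * real U ^ U))"
  proof (subst log_le_cancel_iff)
    show "0 < real (U + n) ^ (U + n)" using assms by simp
    show "0 < real (U + n + 1) * (real (U + n choose n) * real n ^ n * real U ^ U)"
      using assms C by (intro mult_pos_pos zero_less_power) auto
  qed (use le in auto)
  also have "\<dots> = log 2 (real (U + n + 1)) + (log 2 (real (U + n choose n)) + real n * log 2 (real n) + real U * log 2 (real U))"
    using assms C by (simp add: log_mult log_nat_power)
  also have "log 2 (real (U + n) ^ (U + n)) = real (U + n) * log 2 (real (U + n))" using assms by (simp add: log_nat_power)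
  finally show ?thesis using assms by (simp add: log_divide algebra_simps)
qed

text \<open>The two binomial coefficients are compared factor by factor. Rounding the universe to a
  multiple of \<open>2 ^ s\<close> and scaling the summand \<open>Suc i\<close> enlarges a factor by
  at most \<open>1 + 2 / c\<close>, because \<open>2 ^ s * n\<close> is at most
  \<open>m / c\<close>; \<open>n\<close> factors lose at most \<open>4 * n / c\<close> bits.\<close>

lemma log_binomial_scale:
  fixes m n s U :: nat and c :: real
  assumes n: "0 < n" and c: "0 < c" and U: "U = (m - 1) div 2 ^ s + 1" and m: "0 < m"
    and s: "s = 0 \<or> 2 ^ s * real n * c \<le> real m"
  shows "real s * real n + log 2 (real (U + n choose n)) \<le> log 2 (real (m + n choose n)) + 4 * real n / c"
proof -
  have fac: "2 ^ s * real (U + Suc i) \<le> real (m + Suc i) * (1 + 2 / c)" if "i < n" for i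
  proof (cases "s = 0")
    case True
    then have "U = m" using U m by simp
    then show ?thesis using True c by (simp add: mult_le_cancel_left1)
  next
    case False
    have "2 ^ s * U \<le> (m - 1) + 2 ^ s" unfolding U by simp
    then have "real (2 ^ s * U) \<le> real (m - 1 + 2 ^ s)" by (simp only: of_nat_le_iff)
    then have 1: "2 ^ s * real U \<le> real m - 1 + 2 ^ s" using m by (simp add: of_nat_diff)
    have "2 ^ s * real (Suc i) \<le> 2 ^ s * real n" using that by simp
    moreover have "2 ^ s \<le> 2 ^ s * real n" using n by simp
    moreover have "2 * (2 ^ s * real n) \<le> 2 * (real m / c)" using s False c by (simp add: field_simps)
    moreover have "2 ^ s * real (U + Suc i) = 2 ^ s * real U + 2 ^ s * real (Suc i)" by (simp add: algebra_simps)
    ultimately have "2 ^ s * real (U + Suc i) \<le> real m + 2 * (real m / c)" using 1 by linarith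
    also have "\<dots> = real m * (1 + 2 / c)" using c by (simp add: field_simps)
    also have "\<dots> \<le> real (m + Suc i) * (1 + 2 / c)" using c by (intro mult_right_mono) auto
    finally show ?thesis .
  qed
  have "real (U + i choose i) * (2 ^ s) ^ i \<le> real (m + i choose i) * (1 + 2 / c) ^ i" if "i \<le> n" for i
    using that
  proof (induction i)
    case (Suc i)
    have B: "real (Suc i) * real (x + Suc i choose Suc i) = real (x + Suc i) * real (x + i choose i)" for x
      using Suc_times_binomial[of i "x + i"] by (metis add_Suc_right of_nat_mult)
    have "real (Suc i) * (real (U + Suc i choose Suc i) * (2 ^ s) ^ Suc i)
       = (2 ^ s * real (U + Suc i)) * (real (U + i choose i) * (2 ^ s) ^ i)"
    proof -
      have "real (Suc i) * (real (U + Suc i choose Suc i) * (2 ^ s) ^ Suc i) = (real (Suc i) * real (U + Suc i choose Suc i)) * (2 ^ s * (2 ^ s) ^ i)"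
        unfolding power_Suc by (simp only: mult_ac)
      then show ?thesis unfolding B by (simp only: mult_ac)
    qed
    also have "\<dots> \<le> (real (m + Suc i) * (1 + 2 / c)) * (real (m + i choose i) * (1 + 2 / c) ^ i)"
      using Suc.prems c by (intro mult_mono[OF fac Suc.IH]) (auto intro!: mult_nonneg_nonneg add_nonneg_nonneg)
    also have "\<dots> = real (Suc i) * (real (m + Suc i choose Suc i) * (1 + 2 / c) ^ Suc i)"
    proof -
      have "real (Suc i) * (real (m + Suc i choose Suc i) * (1 + 2 / c) ^ Suc i) = (real (Suc i) * real (m + Suc i choose Suc i)) * ((1 + 2 / c) * (1 + 2 / c) ^ i)"
        unfolding power_Suc by (simp only: mult_ac)
      then show ?thesis unfolding B by (simp only: mult_ac)
    qed
    finally show ?case by (simp only: mult_le_cancel_left_pos of_nat_0_less_iff zero_less_Suc)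
  qed simp
  from this[of n] have le: "real (U + n choose n) * (2 ^ s) ^ n \<le> real (m + n choose n) * (1 + 2 / c) ^ n" by simp
  have pos: "0 < real (U + n choose n)" "0 < real (m + n choose n)" "0 < 1 + 2 / c" using c by (auto simp: add_pos_pos)
  have "log 2 (real (U + n choose n) * (2 ^ s) ^ n) \<le> log 2 (real (m + n choose n) * (1 + 2 / c) ^ n)"
    using le pos by (subst log_le_cancel_iff) (auto intro: mult_pos_pos)
  then have "log 2 (real (U + n choose n)) + real n * (real s * log 2 2) \<le> log 2 (real (m + n choose n)) + real n * log 2 (1 + 2 / c)"
    using pos by (simp add: log_mult log_nat_power)
  moreover have "log 2 (1 + 2 / c) \<le> 4 / c"
  proof -
    have "ln (1 + 2 / c) \<le> 2 / c" using c by (intro ln_add_one_self_le_self) auto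
    from divide_right_mono[OF this, of "ln 2"] have "log 2 (1 + 2 / c) \<le> 2 / c / ln 2" by (simp only: log_def) simp
    also have "\<dots> \<le> 2 / c / (1 / 2)" using ln2_ge_half c by (intro divide_left_mono) auto
    also have "\<dots> = 4 / c" by simp
    finally show ?thesis .
  qed
  then have "real n * log 2 (1 + 2 / c) \<le> real n * (4 / c)" by (intro mult_left_mono) auto
  ultimately show ?thesis by (simp add: algebra_simps)
qed

section \<open>The distribution of the gaps\<close>

text \<open>The geometric distribution with mean \<open>U / n\<close>. For \<open>n\<close> gaps
  with sum \<open>U\<close> its ideal code length is the entropy expression of
  \<open>entropy_le_log_binomial\<close>, independently of the individual gaps.\<close>

definition geo :: "nat \<Rightarrow> nat \<Rightarrow> nat \<Rightarrow> real" where
  "geo n U x = real n / real (U + n) * (real U / real (U + n)) ^ x"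

text \<open>A mixture with two small admixtures of weight \<open>ep\<close>: a point mass at 0 makes
  repetitions cheap, and the uniform distribution bounds the code length of every gap below
  \<open>D\<close>, which keeps the tables small.\<close>

definition pg :: "nat \<Rightarrow> nat \<Rightarrow> nat \<Rightarrow> real \<Rightarrow> nat \<Rightarrow> real" where
  "pg n U D ep x = (1 - 2 * ep) * geo n U x + ep * of_bool (x = 0) + ep / real D"

lemma sum_geo: "0 < n \<Longrightarrow> (\<Sum>x<D. geo n U x) \<le> 1"
proof -
  assume n: "0 < n"
  let ?q = "real U / real (U + n)"
  have q: "0 \<le> ?q" "?q < 1" using n by auto
  have p: "real n / real (U + n) = 1 - ?q" using n by (simp add: field_simps)
  have "(\<Sum>x<D. geo n U x) = (1 - ?q) * (\<Sum>x<D. ?q ^ x)" unfolding geo_def p by (simp add: sum_distrib_left)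
  also have "\<dots> = 1 - ?q ^ D" using q sum_gp_strict[of ?q D] by simp
  finally show ?thesis using q by simp
qed

text \<open>Each of the three summands of the mixture is by itself a lower bound for the probability
  and gives one of the three bounds on the code length.\<close>

lemma pg_facts:
  assumes n: "0 < n" and U: "0 < U" and D: "0 < D" and ep: "0 < ep" "ep \<le> 1 / 4"
  shows "(\<Sum>x<D. pg n U D ep x) \<le> 1" "0 < pg n U D ep x" "- log 2 (pg n U D ep x) \<le> log 2 (real D / ep)"
    "- log 2 (pg n U D ep 0) \<le> log 2 (1 / ep)"
    "- log 2 (pg n U D ep x) \<le> log 2 (real (U + n) / real n) + real x * log 2 (real (U + n) / real U) + 8 * ep"
proof -
  have g0: "0 < geo n U x" for x using n U by (simp add: geo_def)
  have "(\<Sum>x<D. pg n U D ep x) = (1 - 2 * ep) * (\<Sum>x<D. geo n U x) + ep * (\<Sum>x<D. of_bool (x = 0)) + ep"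
    using D by (simp add: pg_def sum.distrib sum_distrib_left)
  also have "(\<Sum>x<D. of_bool (x = 0)) = (1::real)" using D by simp
  also have "(1 - 2 * ep) * (\<Sum>x<D. geo n U x) \<le> (1 - 2 * ep) * 1" using ep sum_geo[OF n] by (intro mult_left_mono) auto
  finally show "(\<Sum>x<D. pg n U D ep x) \<le> 1" by simp
  have t: "0 < ep / real D" "0 \<le> (1 - 2 * ep) * geo n U x" "0 < (1 - 2 * ep) * geo n U x" for x using ep D g0[of x] by auto
  then show pos: "0 < pg n U D ep x" for x unfolding pg_def using ep by (simp add: add_pos_pos add_nonneg_pos)
  have neg: "- log 2 (pg n U D ep x) \<le> log 2 (1 / a)" if "0 < a" "a \<le> pg n U D ep x" for a x
    using that pos[of x] by (simp add: log_divide)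
  have "ep / real D \<le> pg n U D ep x" unfolding pg_def using t(2)[of x] ep by simp
  from neg[OF t(1) this] show "- log 2 (pg n U D ep x) \<le> log 2 (real D / ep)" by simp
  have "ep \<le> pg n U D ep 0" unfolding pg_def using t(2)[of 0] t(1) by simp
  from neg[OF ep(1) this] show "- log 2 (pg n U D ep 0) \<le> log 2 (1 / ep)" .
  have "(1 - 2 * ep) * geo n U x \<le> pg n U D ep x" unfolding pg_def using t(1) ep by simp
  from neg[OF t(3) this] have "- log 2 (pg n U D ep x) \<le> log 2 (1 / ((1 - 2 * ep) * geo n U x))" .
  also have "\<dots> = - log 2 (1 - 2 * ep) - log 2 (geo n U x)" using ep g0[of x] by (simp add: log_divide log_mult)
  finally have "- log 2 (pg n U D ep x) \<le> - log 2 (1 - 2 * ep) - log 2 (geo n U x)" .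
  moreover have "- log 2 (geo n U x) = log 2 (real (U + n) / real n) + real x * log 2 (real (U + n) / real U)"
    using n U unfolding geo_def by (simp add: log_mult log_divide log_nat_power algebra_simps)
  \<comment> \<open>The weight lost to the admixtures: \<open>- ln (1 - 2 * ep) <= 4 * ep\<close>,
    and \<open>ln 2 >= 1 / 2\<close> doubles it for the binary logarithm.\<close>
  moreover have "- log 2 (1 - 2 * ep) \<le> 8 * ep"
  proof -
    have 1: "- (2 * ep) - 2 * (2 * ep)\<^sup>2 \<le> ln (1 - 2 * ep)" using ep by (intro ln_one_minus_pos_lower_bound) auto
    have "(2 * ep)\<^sup>2 \<le> 2 * ep * (1 / 2)" using ep unfolding power2_eq_square by (intro mult_left_mono) auto
    with 1 have "- ln (1 - 2 * ep) \<le> 4 * ep" by simp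
    from divide_right_mono[OF this, of "ln 2"] have "- log 2 (1 - 2 * ep) \<le> 4 * ep / ln 2" by (simp add: log_def)
    also have "\<dots> \<le> 4 * ep / (1 / 2)" using ln2_ge_half ep by (intro divide_left_mono) auto
    finally show ?thesis by simp
  qed
  ultimately show "- log 2 (pg n U D ep x) \<le> log 2 (real (U + n) / real n) + real x * log 2 (real (U + n) / real U) + 8 * ep" by linarith
qed

section \<open>Space\<close>

lemma of_nat_div_le: "real (a div b) \<le> real a / real b"
proof (cases "b = 0")
  case False
  have "real (a div b * b) \<le> real a" by (simp only: of_nat_le_iff) simp
  then show ?thesis using False by (simp add: field_simps)
qed simp

lemma square_le_pow2: "(4::nat) \<le> k \<Longrightarrow> k * k \<le> 2 ^ k"
proof (induction k rule: dec_induct)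
  case (step k)
  have "2 * k + 1 \<le> k * k" using mult_le_mono1[of 4 k k] step(1) by linarith
  then show ?case using step by simp
qed simp

lemma pow_4b_aux: assumes "50 \<le> b" shows "132 * b \<le> 2 ^ b" "100 * b \<le> 2 ^ (4 * b)" "33 * b * 2 ^ (3 * b) * 4 + 100 * b \<le> 2 * 2 ^ (4 * b)" "5280 \<le> (2::nat) ^ b"
proof -
  show 1: "132 * b \<le> 2 ^ b"
    using assms
  proof (induction b rule: dec_induct)
    case (step k) then show ?case using power_increasing[of 8 k "2::nat"] by simp
  qed simp
  have e: "(2::nat) ^ (4 * b) = 2 ^ b * 2 ^ (3 * b)" by (simp flip: power_add)
  have "33 * b * 2 ^ (3 * b) * 4 = 132 * b * 2 ^ (3 * b)" by simp
  also have "\<dots> \<le> 2 ^ (4 * b)" unfolding e by (rule mult_le_mono1[OF 1])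
  moreover have "2 ^ b \<le> (2::nat) ^ (4 * b)" by (rule power_increasing) auto
  ultimately show "100 * b \<le> 2 ^ (4 * b)" "33 * b * 2 ^ (3 * b) * 4 + 100 * b \<le> 2 * 2 ^ (4 * b)" using 1 by linarith+
  show "5280 \<le> (2::nat) ^ b" using 1 assms by linarith
qed

text \<open>The exponents are spaced so that every error term gains a factor of at least
  \<open>2 ^ b\<close>. In particular fewer than about \<open>3 * n / 2 ^ (31 * b)\<close> blocks
  are sparse, so that even \<open>2 ^ (8 * b)\<close> bits may be spent on each.\<close>

locale space =
  fixes d :: ds and h :: "nat \<Rightarrow> nat" and c :: "nat list \<Rightarrow> nat" and b :: nat
  assumes so: "seq_ok d h c" and be: "dbe d = 2 ^ (3 * b)" and g: "dg d = 2 ^ (2 * b)" and D: "dD d = 2 ^ (32 * b)"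
    and ga: "dga d = 2 ^ (4 * b)" and NB: "dNB d = (nb d + 2) div dga d + 1" and NC: "dNC d = (dU d div dg d + 2) div dga d + 1"
    and b50: "50 \<le> b" and n1: "2 ^ 2 ^ (4 * b) \<le> dn d" and NI: "dNI d = 2 ^ (33 * b * 2 ^ (3 * b))" and W: "dW d \<le> 2 ^ (4 * b + 6)" and Ub: "dU d \<le> 3 * dn d * 2 ^ b"
begin

abbreviation "n \<equiv> dn d"
definition Sp :: "nat set" where "Sp = {j. sparse d h j}"
text \<open>The unit in which directories and tables are measured; all of them are
  O(\<open>b * X\<close>).\<close>

definition X :: real where "X = real n / 2 ^ b"

lemma mono_h: "mono h" using so by (simp add: seq_ok_def)
lemmas pow_4b = pow_4b_aux[OF b50]
lemma pow_le_n: "k \<le> 100 * b \<Longrightarrow> 2 ^ k \<le> n"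
  using n1 power_increasing[of k "2 ^ (4 * b)" "2::nat"] pow_4b(2) by linarith
lemma pow_le_n': "k \<le> 100 * b \<Longrightarrow> 2 ^ k \<le> real n"
  using pow_le_n[of k] by (metis of_nat_le_iff of_nat_numeral of_nat_power)
lemma pow_le_X: "k + b \<le> 100 * b \<Longrightarrow> 2 ^ k \<le> X"
  unfolding X_def using pow_le_n'[of "k + b"] by (simp add: field_simps power_add)
lemma n_pos: "0 < n" using pow_le_n[of 0] by simp
lemma X_pos: "0 < X" unfolding X_def using n_pos by simp
lemma n_div_le: "b \<le> k \<Longrightarrow> real n / 2 ^ k \<le> X"
  unfolding X_def by (intro divide_left_mono power_increasing) auto

lemma nb_le: "real (nb d) \<le> real n / 2 ^ (3 * b) + 1"
proof -
  have "real (n div 2 ^ (3 * b)) \<le> real n / real (2 ^ (3 * b))" by (rule of_nat_div_le)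
  then show ?thesis by (simp add: nb_def be)
qed

lemma nb_le_X: "real (nb d) \<le> 2 * X"
  using nb_le n_div_le[of "3 * b"] pow_le_X[of 0] b50 by simp

lemma nb_be: "nb d * dbe d \<le> n + dbe d" "n < nb d * dbe d"
proof -
  have "nb d * dbe d = n div dbe d * dbe d + dbe d" by (simp add: nb_def)
  then show "nb d * dbe d \<le> n + dbe d" by simp
  show "n < nb d * dbe d" using dividend_less_times_div[of "dbe d" n] so by (simp add: nb_def seq_ok_def algebra_simps)
qed

lemma sparse_less: "sparse d h j \<Longrightarrow> j < nb d"
proof (rule ccontr)
  assume s: "sparse d h j" and "\<not> j < nb d"
  then have "nb d * dbe d \<le> j * dbe d" by simp
  then have "n \<le> j * dbe d" "n \<le> (j + 1) * dbe d" using less_imp_le[OF less_le_trans[OF nb_be(2)], of "j * dbe d"] le_add1[of "j * dbe d" "dbe d"] by (simp_all add: add.commute)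
  then have "Fh d h j = dU d" "Fh d h (j + 1) = dU d" using so by (auto simp: Fh_def seq_ok_def)
  then show False using s so by (simp add: sparse_def seq_ok_def)
qed

lemma finite_Sp: "finite Sp" "Sp \<subseteq> {..<nb d}"
  using sparse_less finite_subset[of Sp "{..<nb d}"] by (auto simp: Sp_def)

lemma Fh_mono: "i \<le> j \<Longrightarrow> Fh d h i \<le> Fh d h j"
  unfolding Fh_def using mono_h by (auto simp: mono_def)

lemma sum_span: "(\<Sum>j<N. Fh d h (Suc j) - Fh d h j) \<le> dU d"
  using sum_diff_telescope[of "Fh d h" N] Fh_mono h_le_U[OF so] by (auto simp: Fh_def intro: le_trans[OF diff_le_self])

text \<open>The spans of the blocks add up to at most \<open>dU d <= 3 * n * 2 ^ b\<close>, and a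
  sparse block takes \<open>2 ^ (32 * b)\<close> of it.\<close>

lemma card_Sp: "real (card Sp) \<le> 3 * real n / 2 ^ (31 * b)"
proof -
  have "card Sp * 2 ^ (32 * b) = (\<Sum>j\<in>Sp. dD d)" by (simp add: D)
  also have "\<dots> \<le> (\<Sum>j\<in>Sp. Fh d h (Suc j) - Fh d h j)" by (rule sum_mono) (auto simp: Sp_def sparse_def)
  also have "\<dots> \<le> (\<Sum>j<nb d. Fh d h (Suc j) - Fh d h j)" using finite_Sp by (intro sum_mono2) auto
  also have "\<dots> \<le> 3 * n * 2 ^ b" using sum_span Ub le_trans by blast
  finally have "real (card Sp * 2 ^ (32 * b)) \<le> real (3 * n * 2 ^ b)" by (simp only: of_nat_le_iff)
  moreover have "(2::real) ^ (32 * b) = 2 ^ (31 * b) * 2 ^ b" by (simp flip: power_add)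
  ultimately have "real (card Sp) * 2 ^ (31 * b) * 2 ^ b \<le> 3 * real n * 2 ^ b" by (simp only: of_nat_mult of_nat_power of_nat_numeral mult.assoc)
  then have "real (card Sp) * 2 ^ (31 * b) \<le> 3 * real n" by (rule mult_right_le_imp_le) simp
  then show ?thesis by (simp add: field_simps)
qed

lemma card_Sp_mult: "k + b \<le> 31 * b \<Longrightarrow> real (card Sp) * 2 ^ k \<le> 3 * X"
proof -
  assume k: "k + b \<le> 31 * b"
  have "real (card Sp) * 2 ^ k \<le> 3 * real n / 2 ^ (31 * b) * 2 ^ k" using card_Sp by (intro mult_right_mono) auto
  also have "\<dots> = 3 * (real n / 2 ^ (31 * b - k))" using k by (simp add: power_diff)
  also have "\<dots> \<le> 3 * X" using k by (intro mult_left_mono n_div_le) auto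
  finally show ?thesis .
qed

subsection \<open>Explicitly stored cells\<close>

definition ql :: "nat \<Rightarrow> nat" where "ql k = Ic d h (k + 1) - Ic d h k"

lemma Ic_mono: "i \<le> j \<Longrightarrow> Ic d h i \<le> Ic d h j" unfolding Ic_def by (intro cv_mono mult_right_mono) auto

lemma sum_ql: "(\<Sum>k<N. ql k) \<le> n"
  using sum_diff_telescope[of "Ic d h" N] Ic_mono cv_le[of d h] unfolding ql_def Ic_def by (auto intro: le_trans[OF diff_le_self])

text \<open>Cells with at least \<open>2 ^ (3 * b)\<close> positions number at most
  \<open>n / 2 ^ (3 * b)\<close>. The others are nonempty and start in a sparse block or in the
  block before one; nonempty cells have distinct starts, so there are at most
  \<open>2 * dbe d\<close> of them for each sparse block.\<close>

lemma card_hard: "real (card {k. k < N \<and> hard d h k}) \<le> 2 * real n / 2 ^ (3 * b)"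
proof -
  let ?H1 = "{k. k < N \<and> dbe d \<le> ql k}" and ?H2 = "{k. k < N \<and> 0 < ql k \<and> (Ic d h k div dbe d \<in> Sp \<or> Ic d h k div dbe d + 1 \<in> Sp)}"
  have "card ?H1 * dbe d = (\<Sum>k\<in>?H1. dbe d)" by simp
  also have "\<dots> \<le> (\<Sum>k\<in>?H1. ql k)" by (rule sum_mono) auto
  also have "\<dots> \<le> (\<Sum>k<N. ql k)" by (intro sum_mono2) auto
  also have "\<dots> \<le> n" by (rule sum_ql)
  finally have "real (card ?H1 * dbe d) \<le> real n" by (simp only: of_nat_le_iff)
  then have 1: "real (card ?H1) \<le> real n / 2 ^ (3 * b)" by (simp add: be field_simps)
  let ?R = "\<lambda>j. {j * dbe d..<(j + 1) * dbe d} \<union> {(j - 1) * dbe d..<(j - 1 + 1) * dbe d}"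
  have "inj_on (Ic d h) ?H2"
  proof (rule linorder_inj_onI)
    fix x y assume "x < y" "x \<in> ?H2"
    then have "Ic d h x < Ic d h (x + 1)" "Ic d h (x + 1) \<le> Ic d h y" using Ic_mono[of "x + 1" y] by (auto simp: ql_def)
    then show "Ic d h x \<noteq> Ic d h y" by linarith
  qed auto
  then have "card ?H2 = card (Ic d h ` ?H2)" by (rule card_image[symmetric])
  also have "\<dots> \<le> card (\<Union>j\<in>Sp. ?R j)"
  proof (rule card_mono)
    show "finite (\<Union>j\<in>Sp. ?R j)" using finite_Sp by auto
    show "Ic d h ` ?H2 \<subseteq> (\<Union>j\<in>Sp. ?R j)"
    proof
      fix i assume "i \<in> Ic d h ` ?H2"
      then have i: "i div dbe d \<in> Sp \<or> i div dbe d + 1 \<in> Sp" by auto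
      have "i \<in> {i div dbe d * dbe d..<(i div dbe d + 1) * dbe d}"
        using dividend_less_times_div[of "dbe d" i] so by (simp add: seq_ok_def algebra_simps)
      then show "i \<in> (\<Union>j\<in>Sp. ?R j)" using i
        by (elim disjE) (rule UN_I[of "i div dbe d"] UN_I[of "i div dbe d + 1"], assumption, simp)+
    qed
  qed
  also have "\<dots> \<le> (\<Sum>j\<in>Sp. card (?R j))" by (rule card_UN_le) (rule finite_Sp)
  also have "\<dots> \<le> (\<Sum>j\<in>Sp. 2 * dbe d)" by (intro sum_mono le_trans[OF card_Un_le]) simp
  finally have "card ?H2 \<le> card Sp * (2 * dbe d)" by simp
  then have "real (card ?H2) \<le> real (card Sp * (2 * dbe d))" by (simp only: of_nat_le_iff)
  also have "\<dots> = 2 * (real (card Sp) * 2 ^ (3 * b))" by (simp add: be)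
  also have "\<dots> \<le> 2 * (3 * real n / 2 ^ (31 * b) * 2 ^ (3 * b))" by (intro mult_left_mono mult_right_mono card_Sp) auto
  also have "\<dots> = 6 * real n / 2 ^ (28 * b)" by (simp add: field_simps flip: power_add)
  also have "\<dots> \<le> real n / 2 ^ (3 * b)"
  proof -
    have "(6::real) \<le> 2 ^ 3" by simp
    also have "\<dots> \<le> 2 ^ (25 * b)" using b50 by (intro power_increasing) auto
    finally have "6 * real n * 2 ^ (3 * b) \<le> 2 ^ (25 * b) * real n * 2 ^ (3 * b)" by (intro mult_right_mono) auto
    also have "\<dots> = real n * 2 ^ (28 * b)" by (simp flip: power_add)
    finally show ?thesis by (simp add: field_simps)
  qed
  finally have 2: "real (card ?H2) \<le> real n / 2 ^ (3 * b)" .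
  have "{k. k < N \<and> hard d h k} \<subseteq> ?H1 \<union> ?H2" by (auto simp: hard_def ql_def Sp_def)
  then have "card {k. k < N \<and> hard d h k} \<le> card ?H1 + card ?H2" by (intro le_trans[OF card_mono card_Un_le]) auto
  then show ?thesis using 1 2 by linarith
qed

text \<open>There are \<open>2 ^ (2 * b)\<close> entries in each of at most
  \<open>2 * n / 2 ^ (3 * b)\<close> cells. An entry takes \<open>16 * b\<close> bits, up to a
  remainder that \<open>bits_add_le\<close> bounds by the sum of all cell sizes.\<close>

lemma length_hrec: "real (length (cat (hrec d h) N)) \<le> 33 * (real b + 1) * X"
proof -
  let ?H = "{k. k < N \<and> hard d h k}"
  have "length (cat (hrec d h) N) = (\<Sum>k<N. length (hrec d h k))" by (rule length_cat)
  also have "\<dots> = (\<Sum>k\<in>?H. dg d * bits (ql k))"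
    by (rule sum.mono_neutral_cong_right) (auto simp: hrec_def ql_def)
  also have "\<dots> \<le> (\<Sum>k\<in>?H. dg d * (16 * b) + dg d * (ql k div 2 ^ (16 * b)))"
    by (intro sum_mono) (metis bits_add_le distrib_left mult_le_mono2)
  also have "\<dots> = card ?H * (dg d * (16 * b)) + dg d * (\<Sum>k\<in>?H. ql k div 2 ^ (16 * b))" by (simp add: sum.distrib sum_distrib_left)
  finally have "real (length (cat (hrec d h) N)) \<le> real (card ?H * (dg d * (16 * b)) + dg d * (\<Sum>k\<in>?H. ql k div 2 ^ (16 * b)))" by (simp only: of_nat_le_iff)
  also have "\<dots> = real (card ?H) * (2 ^ (2 * b) * (16 * real b)) + 2 ^ (2 * b) * real (\<Sum>k\<in>?H. ql k div 2 ^ (16 * b))" by (simp add: g)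
  also have "\<dots> \<le> 2 * real n / 2 ^ (3 * b) * (2 ^ (2 * b) * (16 * real b)) + 2 ^ (2 * b) * (real n / 2 ^ (16 * b))"
  proof (intro add_mono mult_right_mono mult_left_mono card_hard)
    have "real (\<Sum>k\<in>?H. ql k div 2 ^ (16 * b)) \<le> (\<Sum>k\<in>?H. real (ql k) / 2 ^ (16 * b))"
      unfolding of_nat_sum by (intro sum_mono) (metis of_nat_numeral of_nat_power of_nat_div_le)
    also have "\<dots> = real (\<Sum>k\<in>?H. ql k) / 2 ^ (16 * b)" by (simp add: sum_divide_distrib)
    also have "\<dots> \<le> real n / 2 ^ (16 * b)"
    proof -
      have "(\<Sum>k\<in>?H. ql k) \<le> (\<Sum>k<N. ql k)" by (intro sum_mono2) auto
      then have "(\<Sum>k\<in>?H. ql k) \<le> n" using sum_ql[of N] by linarith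
      then show ?thesis by (intro divide_right_mono) (auto simp del: of_nat_sum)
    qed
    finally show "real (\<Sum>k\<in>?H. ql k div 2 ^ (16 * b)) \<le> real n / 2 ^ (16 * b)" .
  qed auto
  also have "\<dots> = 32 * real b * X + real n / 2 ^ (14 * b)"
  proof -
    have "2 * real n / 2 ^ (3 * b) * (2 ^ (2 * b) * (16 * real b)) = 32 * real b * X"
      unfolding X_def by (simp add: field_simps flip: power_add)
    moreover have "(2::real) ^ (2 * b) * (real n / 2 ^ (16 * b)) = real n / 2 ^ (14 * b)" by (simp add: field_simps flip: power_add)
    ultimately show ?thesis by simp
  qed
  also have "\<dots> \<le> 32 * real b * X + X" using n_div_le[of "14 * b"] b50 by simp
  also have "\<dots> \<le> 33 * (real b + 1) * X" using X_pos by (simp add: algebra_simps)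
  finally show ?thesis .
qed

subsection \<open>Directories and tables\<close>

text \<open>The block length \<open>2 ^ (4 * b)\<close> matches the width of a full field up to the
  factor 64, so three full fields per block cost 192 bits per entry. With \<open>p = 16 * b\<close>
  the values, polynomial in \<open>2 ^ b\<close> per element, leave only \<open>X\<close>.\<close>

lemma length_ma_general:
  assumes "mono A" "real (A (N * dga d)) \<le> 2 ^ (8 * b) * real n" "real (N * dga d) \<le> Y" "N = M div dga d + 1"
  shows "real (length (ma (dW d) (dga d) N A)) \<le> (192 + 16 * real b) * Y + X"
proof -
  have g0: "0 < dga d" by (simp add: ga)
  have "length (ma (dW d) (dga d) N A) \<le> 3 * dW d * N + dga d * (N * (16 * b) + A (N * dga d) div 2 ^ (16 * b))"
    by (rule length_ma_le[OF assms(1)])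
  then have "real (length (ma (dW d) (dga d) N A)) \<le> real (3 * dW d * N + dga d * (N * (16 * b) + A (N * dga d) div 2 ^ (16 * b)))"
    by (simp only: of_nat_le_iff)
  also have "\<dots> = 3 * (real (dW d) * real N) + 16 * real b * real (N * dga d) + 2 ^ (4 * b) * real (A (N * dga d) div 2 ^ (16 * b))"
    by (simp add: ga algebra_simps)
  also have "real (dW d) * real N \<le> 64 * real (N * dga d)"
  proof -
    have "real (dW d) \<le> real (2 ^ (4 * b + 6))" using W by (simp only: of_nat_le_iff)
    then have "real (dW d) * real N \<le> (2 ^ (4 * b + 6)) * real N" by (intro mult_right_mono) auto
    then show ?thesis by (simp add: ga power_add algebra_simps)
  qed
  also have "2 ^ (4 * b) * real (A (N * dga d) div 2 ^ (16 * b)) \<le> X"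
  proof -
    have "real (A (N * dga d) div 2 ^ (16 * b)) \<le> real (A (N * dga d)) / real (2 ^ (16 * b))" by (rule of_nat_div_le)
    also have "\<dots> \<le> 2 ^ (8 * b) * real n / real (2 ^ (16 * b))" by (intro divide_right_mono assms) auto
    finally have "2 ^ (4 * b) * real (A (N * dga d) div 2 ^ (16 * b)) \<le> 2 ^ (4 * b) * (2 ^ (8 * b) * real n / 2 ^ (16 * b))" by (intro mult_left_mono) auto
    also have "\<dots> = real n / 2 ^ (4 * b)" by (simp add: field_simps flip: power_add)
    finally show ?thesis using n_div_le[of "4 * b"] by simp
  qed
  finally have "real (length (ma (dW d) (dga d) N A)) \<le> 3 * (64 * real (N * dga d)) + 16 * real b * real (N * dga d) + X" by simp
  also have "\<dots> = (192 + 16 * real b) * real (N * dga d) + X" by (simp add: algebra_simps)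
  also have "\<dots> \<le> (192 + 16 * real b) * Y + X" using assms(3) by (intro add_mono mult_left_mono) auto
  finally show ?thesis .
qed

lemma NBga: "real (dNB d * dga d) \<le> 8 * X" "nb d + 2 < dNB d * dga d"
proof -
  have g0: "0 < dga d" by (simp add: ga)
  have "dNB d * dga d \<le> nb d + 2 + dga d" unfolding NB by simp
  then have "real (dNB d * dga d) \<le> real (nb d + 2 + dga d)" by (simp only: of_nat_le_iff)
  then have "real (dNB d * dga d) \<le> real (nb d) + 2 + 2 ^ (4 * b)" using ga by (simp only: of_nat_add of_nat_numeral of_nat_power)
  then show "real (dNB d * dga d) \<le> 8 * X" using nb_le_X pow_le_X[of "4 * b"] pow_le_X[of 1] b50 by simp
  show "nb d + 2 < dNB d * dga d" unfolding NB using dividend_less_times_div[OF g0, of "nb d + 2"] by (simp add: algebra_simps)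
qed

lemma NCga: "real (dNC d * dga d) \<le> 8 * X" "dU d div dg d + 2 < dNC d * dga d"
proof -
  have g0: "0 < dga d" by (simp add: ga)
  have "dNC d * dga d \<le> dU d div dg d + 2 + dga d" unfolding NC by simp
  then have "real (dNC d * dga d) \<le> real (dU d div dg d + 2 + dga d)" by (simp only: of_nat_le_iff)
  then have "real (dNC d * dga d) \<le> real (dU d div dg d) + 2 + 2 ^ (4 * b)" using ga by (simp only: of_nat_add of_nat_numeral of_nat_power)
  moreover have "real (dU d div dg d) \<le> 3 * X"
  proof -
    have "real (dU d div dg d) \<le> real (dU d) / real (dg d)" by (rule of_nat_div_le)
    also have "\<dots> \<le> real (3 * n * 2 ^ b) / real (dg d)" using Ub by (intro divide_right_mono) (simp_all only: of_nat_le_iff of_nat_0_le_iff)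
    also have "\<dots> = 3 * X" unfolding X_def g by (simp add: field_simps flip: power_add)
    finally show ?thesis .
  qed
  ultimately show "real (dNC d * dga d) \<le> 8 * X" using pow_le_X[of "4 * b"] pow_le_X[of 1] b50 by simp
  show "dU d div dg d + 2 < dNC d * dga d" unfolding NC using dividend_less_times_div[OF g0, of "dU d div dg d + 2"] by (simp add: algebra_simps)
qed

lemma length_ma_NB: "mono A \<Longrightarrow> real (A (dNB d * dga d)) \<le> 2 ^ (8 * b) * real n \<Longrightarrow> real (length (ma (dW d) (dga d) (dNB d) A)) \<le> 1600 * (real b + 1) * X"
  and length_ma_NC: "mono A \<Longrightarrow> real (A (dNC d * dga d)) \<le> 2 ^ (8 * b) * real n \<Longrightarrow> real (length (ma (dW d) (dga d) (dNC d) A)) \<le> 1600 * (real b + 1) * X"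
proof -
  have *: "(192 + 16 * real b) * (8 * X) + X \<le> 1600 * (real b + 1) * X"
    using X_pos by (simp add: algebra_simps)
  show "mono A \<Longrightarrow> real (A (dNB d * dga d)) \<le> 2 ^ (8 * b) * real n \<Longrightarrow> real (length (ma (dW d) (dga d) (dNB d) A)) \<le> 1600 * (real b + 1) * X"
    using length_ma_general[OF _ _ NBga(1) NB] * by (meson order_trans)
  show "mono A \<Longrightarrow> real (A (dNC d * dga d)) \<le> 2 ^ (8 * b) * real n \<Longrightarrow> real (length (ma (dW d) (dga d) (dNC d) A)) \<le> 1600 * (real b + 1) * X"
    using length_ma_general[OF _ _ NCga(1) NC] * by (meson order_trans)
qed

lemma sum_gap_le_span:
  "mono (h :: nat \<Rightarrow> nat) \<Longrightarrow> (\<Sum>r<k. h (a + r + 1) - h (a + r)) = h (a + k) - h a"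
  using sum_diff_telescope[of "\<lambda>r. h (a + r)" k] by (simp add: mono_def)

text \<open>All codes are below \<open>2 ^ (33 * b * 2 ^ (3 * b))\<close>, whose exponent, even with
  the remaining factors, is below \<open>2 ^ (4 * b)\<close>; and \<open>n\<close> is at least two
  to that power.\<close>

lemma length_tables: "real ((2 * (dNI d * dbe d) + dNI d * dD d) * dW d) \<le> X"
proof -
  have "2 * (dNI d * dbe d) + dNI d * dD d = dNI d * (2 * 2 ^ (3 * b) + 2 ^ (32 * b))" by (simp add: be D algebra_simps)
  also have "\<dots> \<le> dNI d * 2 ^ (33 * b)"
  proof (rule mult_le_mono2)
    have "2 * 2 ^ (3 * b) = (2::nat) ^ (3 * b + 1)" "(2::nat) ^ (33 * b) = 2 ^ b * 2 ^ (32 * b)" by (simp_all flip: power_add)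
    moreover have "(2::nat) ^ (3 * b + 1) \<le> 2 ^ (32 * b)" by (rule power_increasing) (use b50 in auto)
    moreover have "2 * 2 ^ (32 * b) \<le> (2::nat) ^ b * 2 ^ (32 * b)" using pow_4b(4) by (intro mult_le_mono1) linarith
    ultimately show "2 * 2 ^ (3 * b) + 2 ^ (32 * b) \<le> (2::nat) ^ (33 * b)" by linarith
  qed
  finally have "(2 * (dNI d * dbe d) + dNI d * dD d) * dW d \<le> dNI d * 2 ^ (33 * b) * 2 ^ (4 * b + 6)" by (intro mult_le_mono W)
  also have "\<dots> = 2 ^ (33 * b * 2 ^ (3 * b) + (37 * b + 6))" unfolding NI by (simp flip: power_add)
  finally have "(2 * (dNI d * dbe d) + dNI d * dD d) * dW d * 2 ^ b \<le> 2 ^ (33 * b * 2 ^ (3 * b) + (37 * b + 6)) * 2 ^ b" by (rule mult_le_mono1)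
  also have "\<dots> = 2 ^ (33 * b * 2 ^ (3 * b) + (38 * b + 6))" by (simp flip: power_add)
  also have "\<dots> \<le> 2 ^ 2 ^ (4 * b)" by (rule power_increasing) (use pow_4b b50 in linarith, simp)
  also have "\<dots> \<le> n" by (rule n1)
  finally have "real ((2 * (dNI d * dbe d) + dNI d * dD d) * dW d * 2 ^ b) \<le> real n" by (simp only: of_nat_le_iff)
  then show ?thesis unfolding X_def by (simp add: field_simps)
qed

subsection \<open>Codes\<close>

definition Y :: real where "Y = real n / 2 ^ (b div 2)"

lemma X_le_Y: "X \<le> Y" unfolding X_def Y_def by (intro divide_left_mono power_increasing) auto

text \<open>Every gap \<open>x\<close> costs at most \<open>?l0 + x * ?l1\<close> plus a small
  error, including the \<open>e1\<close> extra bits of a repetition. Summed over all blocks, the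
  first term occurs about \<open>n\<close> times and the gaps add up to at most \<open>dU d\<close>,
  which gives the entropy.\<close>

lemma length_codes:
  assumes cb: "\<And>gs. gs \<in> gdom d \<Longrightarrow> real (bits (c gs)) \<le> 1 + sum_list (map (\<lambda>x. - log 2 (pg n (dU d) (dD d) (1 / 2 ^ (b div 2)) x)) gs)"
    and e1: "e1 = 0 \<or> e1 \<le> b div 4 \<and> n * 2 ^ b \<le> dU d" and U0: "0 < dU d"
  shows "real (4 * Pu d h c (nb d)) + real e1 * real (Zc d h (nb d * dbe d)) \<le>
    real n * log 2 (real (dU d + n) / real n) + real (dU d) * log 2 (real (dU d + n) / real (dU d)) + 40 * Y"
proof -
  let ?ep = "1 / 2 ^ (b div 2) :: real" and ?l0 = "log 2 (real (dU d + n) / real n)" and ?l1 = "log 2 (real (dU d + n) / real (dU d))"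
  let ?span = "\<lambda>j. Fh d h (Suc j) - Fh d h j" and ?z = "\<lambda>j. \<Sum>i<dbe d. exs d h (j * dbe d + i)"
  let ?p = "\<lambda>x. - log 2 (pg n (dU d) (dD d) ?ep x)"
  have be0: "0 < dbe d" by (simp add: be)
  have e1b: "e1 \<le> b" using e1 by auto
  have "(2::real) ^ 2 \<le> 2 ^ (b div 2)" using b50 by (intro power_increasing) auto
  then have ep: "0 < ?ep" "?ep \<le> 1 / 4" by (auto simp: field_simps)
  note pgf = pg_facts[OF n_pos U0 _ ep, of "dD d"]
  have l0: "0 \<le> ?l0" "0 \<le> ?l1" using n_pos U0 by auto
  have l0b: "?l0 \<le> real b + 2"
  proof -
    have "real (dU d) \<le> real (3 * n * 2 ^ b)" using Ub by (simp only: of_nat_le_iff)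
    moreover have "real n * 1 \<le> real n * 2 ^ b" by (rule mult_left_mono) auto
    ultimately have "real (dU d + n) \<le> 4 * (real n * 2 ^ b)" by simp
    then have "real (dU d + n) / real n \<le> 2 ^ (b + 2)" using n_pos by (simp add: field_simps)
    then have "?l0 \<le> log 2 (2 ^ (b + 2))" using n_pos by (subst log_le_cancel_iff) auto
    also have "\<dots> = real b + 2" by (subst log_nat_power) (auto simp del: power_add power_add_numeral)
    finally show ?thesis .
  qed
  \<comment> \<open>This inequality finances the extra space: a zero gap may cost
    \<open>?l0\<close>, which is at least \<open>b\<close> when \<open>e1\<close> is positive, but
    its code takes only \<open>b div 2\<close> bits, and \<open>e1\<close> is at most
    \<open>b div 4\<close>.\<close>
  have gap: "?p x + real e1 * of_bool (x = 0) \<le> ?l0 + real x * ?l1 + 8 * ?ep" for x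
  proof (cases "x = 0 \<and> e1 \<noteq> 0")
    case True
    then have e: "e1 \<le> b div 4" "n * 2 ^ b \<le> dU d" using e1 by auto
    have "real (n * 2 ^ b) \<le> real (dU d)" using e by (simp only: of_nat_le_iff)
    then have "2 ^ b \<le> real (dU d + n) / real n" using n_pos by (simp add: field_simps)
    then have "log 2 (2 ^ b) \<le> ?l0" using n_pos by (subst log_le_cancel_iff) (auto simp: add_nonneg_pos)
    then have "real b \<le> ?l0" by (simp add: log_nat_power)
    moreover have "?p 0 \<le> log 2 (1 / ?ep)" by (rule pgf(4)) (simp add: D)
    moreover have "log 2 (1 / ?ep) = real (b div 2)" by (simp add: log_nat_power)
    moreover have "real (b div 2) + real e1 \<le> real b" using e(1) by linarith
    moreover have "of_bool (x = 0) = (1::real)" "real x * ?l1 = 0" "?p x = ?p 0" using True by auto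
    moreover have "0 \<le> 8 * ?ep" by simp
    ultimately show ?thesis by (simp only: mult_1_right)
  next
    case False
    then have "real e1 * of_bool (x = 0) = 0" by auto
    then show ?thesis using pgf(5)[of x] D by (simp only:) simp
  qed
  \<comment> \<open>The 4 consists of one bit of the Shannon code and three of rounding. In a sparse
    block all positions have extra space, which is charged to the last term.\<close>
  have blk: "real (length (rcd d h c j)) + real e1 * real (?z j) \<le>
     4 + real (dbe d) * (?l0 + 8 * ?ep) + real (?span j) * ?l1 + of_bool (j \<in> Sp) * (real (dbe d) * real (dW d + b))" for j
  proof (cases "sparse d h j")
    case True
    have "?z j \<le> (\<Sum>i<dbe d. 1)" by (rule sum_mono) (simp add: exs_def)
    then have z: "e1 * ?z j \<le> b * dbe d" using e1b by (intro mult_le_mono) auto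
    have l: "length (rcd d h c j) = dbe d * dW d" using True by (simp add: rcd_def length_arr)
    have "length (rcd d h c j) + e1 * ?z j \<le> dbe d * (dW d + b)" using z l by (simp add: algebra_simps)
    then have "real (length (rcd d h c j) + e1 * ?z j) \<le> real (dbe d * (dW d + b))" by (simp only: of_nat_le_iff)
    moreover have "0 \<le> 4 + real (dbe d) * (?l0 + 8 * ?ep) + real (?span j) * ?l1" using l0 ep by (intro add_nonneg_nonneg mult_nonneg_nonneg) auto
    ultimately show ?thesis using True by (simp add: Sp_def)
  next
    case False
    obtain k where k: "dbe d = Suc k" using be0 gr0_conv_Suc by blast
    let ?g = "\<lambda>r. h (j * dbe d + r + 1) - h (j * dbe d + r)"
    have z: "?z j = (\<Sum>r<k. of_bool (?g r = 0))"
    proof -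
      have "?z j = (\<Sum>r<k. exs d h (j * dbe d + Suc r))" using False be0 by (simp only: k sum.lessThan_Suc_shift) (simp add: exs_def flip: k)
      also have "\<dots> = (\<Sum>r<k. of_bool (?g r = 0))"
      proof (rule sum.cong[OF refl])
        fix r assume r: "r \<in> {..<k}"
        have "(j * dbe d + Suc r) div dbe d = j" "(j * dbe d + Suc r) mod dbe d = Suc r"
          using r k div_mult_self3[of "dbe d" j "Suc r"] mod_mult_self3[of j "dbe d" "Suc r"] by (simp_all del: div_mult_self3 mod_mult_self3)
        moreover have "h (j * dbe d + r) \<le> h (j * dbe d + r + 1)" using mono_h by (auto simp: mono_def)
        ultimately show "exs d h (j * dbe d + Suc r) = of_bool (?g r = 0)" using False by (auto simp: exs_def)
      qed
      finally show ?thesis .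
    qed
    have gs: "gaps d h j = map ?g [0..<k]" unfolding gaps_def k by simp
    have "length (rcd d h c j) = 4 * ln4 (c (gaps d h j))" using False by (simp add: rcd_def)
    then have "real (length (rcd d h c j)) \<le> real (bits (c (gaps d h j)) + 3)" unfolding ln4_def by linarith
    also have "\<dots> \<le> 4 + sum_list (map ?p (gaps d h j))" using cb[OF gaps_in_gdom[OF so False]] by simp
    also have "sum_list (map ?p (gaps d h j)) = (\<Sum>r<k. ?p (?g r))" unfolding gs by (simp add: comp_def interv_sum_list_conv_sum_set_nat atLeast0LessThan)
    finally have "real (length (rcd d h c j)) + real e1 * real (?z j) \<le> 4 + (\<Sum>r<k. ?p (?g r) + real e1 * of_bool (?g r = 0))"
      unfolding z sum.distrib sum_distrib_left[symmetric] of_nat_sum of_nat_of_bool by linarith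
    also have "(\<Sum>r<k. ?p (?g r) + real e1 * of_bool (?g r = 0)) \<le> (\<Sum>r<k. ?l0 + real (?g r) * ?l1 + 8 * ?ep)" by (intro sum_mono gap)
    also have "\<dots> = real k * (?l0 + 8 * ?ep) + real (\<Sum>r<k. ?g r) * ?l1"
      unfolding sum.distrib sum_distrib_right[symmetric] of_nat_sum by (simp add: distrib_left)
    also have "\<dots> \<le> real (dbe d) * (?l0 + 8 * ?ep) + real (?span j) * ?l1"
    proof (intro add_mono mult_right_mono)
      have "(\<Sum>r<k. ?g r) = h (j * dbe d + k) - h (j * dbe d)" by (rule sum_gap_le_span[OF mono_h])
      moreover have "h (j * dbe d + k) \<le> h (Suc j * dbe d)" by (rule monoD[OF mono_h]) (simp add: k)
      ultimately show "real (\<Sum>r<k. ?g r) \<le> real (?span j)" unfolding Fh_def by (simp only: of_nat_le_iff diff_le_mono)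
      show "0 \<le> ?l0 + 8 * ?ep" using l0 ep by simp
    qed (use l0 k in auto)
    finally show ?thesis using False by (simp add: Sp_def)
  qed
  have Z: "Zc d h (nb d * dbe d) = (\<Sum>j<nb d. ?z j)"
    unfolding Zc_def min.idem sum.nat_group[symmetric] by (subst sum.atLeastLessThan_shift_0) (simp add: atLeast0LessThan comp_def)
  have W4: "4 dvd dW d" using so by (simp add: seq_ok_def)
  have "real (4 * Pu d h c (nb d)) + real e1 * real (Zc d h (nb d * dbe d)) = (\<Sum>j<nb d. real (length (rcd d h c j)) + real e1 * real (?z j))"
    unfolding Z Pu_sum[OF W4 order_refl] by (simp add: sum.distrib sum_distrib_left)
  also have "\<dots> \<le> (\<Sum>j<nb d. 4 + real (dbe d) * (?l0 + 8 * ?ep) + real (?span j) * ?l1 + of_bool (j \<in> Sp) * (real (dbe d) * real (dW d + b)))"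
    by (intro sum_mono blk)
  also have "\<dots> = 4 * real (nb d) + real (nb d * dbe d) * (?l0 + 8 * ?ep) + real (\<Sum>j<nb d. ?span j) * ?l1 + real (card Sp) * (real (dbe d) * real (dW d + b))"
  proof -
    have "(\<Sum>j<nb d. of_bool (j \<in> Sp)) = real (card Sp)" using finite_Sp by (simp add: Int_absorb1)
    moreover have "(\<Sum>j<nb d. 4 + real (dbe d) * (?l0 + 8 * ?ep)) = 4 * real (nb d) + real (nb d * dbe d) * (?l0 + 8 * ?ep)" by (simp add: distrib_left)
    ultimately show ?thesis unfolding sum.distrib sum_distrib_right[symmetric] of_nat_sum by (simp only:)
  qed
  also have "\<dots> \<le> 8 * X + (real n * ?l0 + X + 16 * Y) + real (dU d) * ?l1 + 3 * X"
  proof (intro add_mono mult_right_mono)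
    show "4 * real (nb d) \<le> 8 * X" using nb_le_X by simp
    show "real (\<Sum>j<nb d. ?span j) \<le> real (dU d)" using sum_span[of "nb d"] by (simp only: of_nat_le_iff)
    have "real (nb d * dbe d) \<le> real (n + dbe d)" using nb_be(1) by (simp only: of_nat_le_iff)
    then have nbb: "real (nb d * dbe d) \<le> real n + 2 ^ (3 * b)" by (simp add: be)
    have "real (nb d * dbe d) * ?l0 \<le> (real n + 2 ^ (3 * b)) * ?l0" by (intro mult_right_mono nbb l0)
    also have "\<dots> \<le> real n * ?l0 + X"
    proof -
      have "b + 2 \<le> 2 ^ b" using pow_4b(1) b50 by linarith
      then have "real (b + 2) \<le> real (2 ^ b)" by (simp only: of_nat_le_iff)
      then have "?l0 \<le> 2 ^ b" using l0b by simp
      then have "2 ^ (3 * b) * ?l0 \<le> 2 ^ (3 * b) * 2 ^ b" by (intro mult_left_mono) auto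
      also have "\<dots> = 2 ^ (4 * b)" by (simp flip: power_add)
      also have "\<dots> \<le> X" by (rule pow_le_X) simp
      finally show ?thesis by (simp add: algebra_simps)
    qed
    moreover have "real (nb d * dbe d) * (8 * ?ep) \<le> (2 * real n) * (8 * ?ep)"
      using order_trans[OF nbb, of "2 * real n"] pow_le_n'[of "3 * b"] by (intro mult_right_mono) (linarith, simp)
    ultimately show "real (nb d * dbe d) * (?l0 + 8 * ?ep) \<le> real n * ?l0 + X + 16 * Y" unfolding Y_def by (simp add: algebra_simps)
    have "dW d + b \<le> 2 ^ (5 * b)"
    proof -
      have "(2::nat) ^ (4 * b + 6) = 64 * 2 ^ (4 * b)" "(2::nat) ^ (5 * b) = 2 ^ b * 2 ^ (4 * b)" by (simp add: power_add, simp flip: power_add)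
      moreover have "65 * 2 ^ (4 * b) \<le> (2::nat) ^ b * 2 ^ (4 * b)" using pow_4b(4) by (intro mult_le_mono1) linarith
      ultimately show ?thesis using W pow_4b(2) by linarith
    qed
    then have "dbe d * (dW d + b) \<le> 2 ^ (3 * b) * 2 ^ (5 * b)" unfolding be by (rule mult_le_mono2)
    also have "\<dots> = 2 ^ (8 * b)" by (simp flip: power_add)
    finally have "real (dbe d * (dW d + b)) \<le> real (2 ^ (8 * b))" by (simp only: of_nat_le_iff)
    then have "real (card Sp) * (real (dbe d) * real (dW d + b)) \<le> real (card Sp) * 2 ^ (8 * b)" by (intro mult_left_mono) (simp only: of_nat_mult of_nat_power of_nat_numeral, simp)
    also have "\<dots> \<le> 3 * X" by (rule card_Sp_mult) simp
    finally show "real (card Sp) * (real (dbe d) * real (dW d + b)) \<le> 3 * X" .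
  qed (use l0 in auto)
  finally show ?thesis using X_le_Y X_pos by linarith
qed

text \<open>A binary source has at most one bit of entropy per symbol. With the tangent
  \<open>ln x <= x - 1\<close> at the uniform distribution the linear terms of the two summands
  cancel. It gives a rough bound for the codes, used to keep addresses within a word.\<close>

lemma entropy_le: "real n * log 2 (real (dU d + n) / real n) + real (dU d) * log 2 (real (dU d + n) / real (dU d)) \<le> real (dU d + n)" if U0: "0 < dU d"
proof -
  let ?N = "real (dU d + n)"
  have *: "a * log 2 (?N / a) \<le> a + (?N / 2 - a) * (1 / ln 2)" if "0 < a" for a
  proof -
    have "log 2 (x / a) = log 2 2 + log 2 (x / 2 / a)" if "0 < x" for x using that \<open>0 < a\<close> by (simp add: log_divide log_mult)
    from this[of ?N] have "log 2 (?N / a) = log 2 2 + log 2 (?N / 2 / a)" using n_pos by simp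
    moreover have "log 2 (?N / 2 / a) \<le> (?N / 2 / a - 1) / ln 2"
      unfolding log_def using that n_pos by (intro divide_right_mono ln_le_minus_one) (auto simp: add_nonneg_pos)
    ultimately have "a * log 2 (?N / a) \<le> a * (1 + (?N / 2 / a - 1) / ln 2)" using that by (intro mult_left_mono) auto
    also have "\<dots> = a + (?N / 2 - a) * (1 / ln 2)" using that by (simp add: field_simps)
    finally show ?thesis .
  qed
  have "(?N / 2 - real n) * (1 / ln 2) + (?N / 2 - real (dU d)) * (1 / ln 2) = 0" unfolding distrib_right[symmetric] by (simp add: field_simps)
  moreover have "0 < real n" "0 < real (dU d)" "?N = real (dU d) + real n" using n_pos U0 by auto
  ultimately show ?thesis using *[of "real n"] *[of "real (dU d)"] by linarith
qed

lemma Y_small: "100000 * (real b + 1) * Y \<le> real n" if "200 \<le> b"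
proof -
  define k where "k = b div 2"
  have 1: "400000 * (x + 1) \<le> 2 ^ x" if "100 \<le> x" for x :: nat
    using that by (induction x rule: dec_induct) auto
  have "b \<le> 2 * k + 1" unfolding k_def by simp
  then have "b + 1 \<le> 4 * (k + 1)" by simp
  then have "100000 * (b + 1) \<le> 100000 * (4 * (k + 1))" by (rule mult_le_mono2)
  moreover have "400000 * (k + 1) \<le> 2 ^ k" using 1[of k] that unfolding k_def by simp
  ultimately have "100000 * (b + 1) \<le> 2 ^ k" by simp
  then have "real (100000 * (b + 1)) \<le> real (2 ^ k)" by (simp only: of_nat_le_iff)
  then have "real (100000 * (b + 1)) * Y \<le> real (2 ^ k) * Y" unfolding Y_def by (intro mult_right_mono) auto
  then show ?thesis unfolding Y_def k_def by (simp add: algebra_simps)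
qed

text \<open>The filling of the last block repeats the sentinel and may be counted although it lies
  beyond \<open>n\<close>. It is outweighed by the first positions of the nonsparse blocks, which
  are never counted: \<open>dbe d + card Sp <= nb d\<close>.\<close>

lemma Zc_le: "Zc d h i \<le> n"
proof -
  let ?z = "\<lambda>j. \<Sum>i<dbe d. exs d h (j * dbe d + i)"
  obtain k where k: "dbe d = Suc k" using so gr0_conv_Suc unfolding seq_ok_def by blast
  have z: "?z j + 1 \<le> dbe d + of_bool (j \<in> Sp)" for j
  proof -
    have "exs d h (j * dbe d) = of_bool (j \<in> Sp)" using so by (simp add: exs_def Sp_def seq_ok_def)
    moreover have "(\<Sum>i<k. exs d h (j * dbe d + Suc i)) \<le> (\<Sum>i<k. 1)" by (rule sum_mono) (simp add: exs_def)
    moreover have "?z j = exs d h (j * dbe d) + (\<Sum>i<k. exs d h (j * dbe d + Suc i))" using sum.lessThan_Suc_shift[of "\<lambda>i. exs d h (j * dbe d + i)" k] by (simp only: k[symmetric] add_0_right)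
    ultimately show ?thesis using k by simp
  qed
  have Z: "Zc d h (nb d * dbe d) = (\<Sum>j<nb d. ?z j)"
    unfolding Zc_def min.idem sum.nat_group[symmetric] by (subst sum.atLeastLessThan_shift_0) (simp add: atLeast0LessThan comp_def)
  have "(\<Sum>j<nb d. ?z j + 1) \<le> (\<Sum>j<nb d. dbe d + of_bool (j \<in> Sp))" by (intro sum_mono z)
  moreover have "(\<Sum>j<nb d. of_bool (j \<in> Sp)) = card Sp" using finite_Sp by (simp add: Int_absorb1)
  ultimately have "Zc d h (nb d * dbe d) + nb d \<le> nb d * dbe d + card Sp" unfolding Z sum.distrib by simp
  moreover have "dbe d + card Sp \<le> nb d"
  proof -
    have "real n < real (nb d * dbe d)" using nb_be(2) by (simp only: of_nat_less_iff)
    then have 1: "real n / 2 ^ (3 * b) < real (nb d)" by (simp add: be field_simps)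
    have "real (card Sp) * 2 ^ (29 * b) \<le> 3 * X" by (rule card_Sp_mult) simp
    moreover have "real n / 2 ^ b \<le> real n / 1" by (intro divide_left_mono) auto
    then have "3 * X \<le> 3 * real n" unfolding X_def by simp
    ultimately have 2: "real (card Sp) * 2 ^ (29 * b) \<le> 3 * real n" by linarith
    have "(2::real) ^ (29 * b) = 2 ^ (3 * b) * 2 ^ (26 * b)" by (simp flip: power_add)
    moreover have "(2::real) ^ 3 \<le> 2 ^ (26 * b)" using b50 by (intro power_increasing) auto
    ultimately have "2 ^ (3 * b) * 2 ^ 3 \<le> (2::real) ^ (29 * b)" by simp
    then have "real (card Sp) * (2 ^ (3 * b) * 2 ^ 3) \<le> 3 * real n" using mult_left_mono[of "2 ^ (3 * b) * 2 ^ 3" "(2::real) ^ (29 * b)" "real (card Sp)"] 2 by linarith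
    then have 3: "real (card Sp) \<le> (real n / 2 ^ (3 * b)) * (3 / 8)" by (simp add: field_simps)
    have "2 ^ (6 * b + 1) \<le> real n" by (rule pow_le_n') (use b50 in simp)
    then have "2 ^ (3 * b) * 2 \<le> real n / 2 ^ (3 * b)" by (simp add: field_simps flip: power_add)
    then have "real (dbe d) * 2 \<le> real n / 2 ^ (3 * b)" by (simp add: be)
    then show ?thesis using 1 3 by (simp only: flip: of_nat_le_iff[where 'a = real]) simp
  qed
  moreover have "Zc d h i \<le> Zc d h (nb d * dbe d)" unfolding Zc_def by (intro sum_mono2) auto
  ultimately show ?thesis using nb_be(1) by linarith
qed

lemma real_le_pow: "real b + 1 \<le> 2 ^ b"
proof -
  have "b + 1 \<le> 2 ^ b" using pow_4b(1) b50 by linarith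
  then have "real (b + 1) \<le> real (2 ^ b)" by (simp only: of_nat_le_iff)
  then show ?thesis by simp
qed

text \<open>Crude bounds suffice here, since the estimate for monotone arrays divides the largest
  value by \<open>2 ^ (16 * b)\<close>.\<close>

lemma directory_bounds:
  assumes P: "real (Pu d h c (nb d)) \<le> real (dU d) + 2 * real n"
  shows "mono (Fh d h)" "mono (Pu d h c)" "mono (\<lambda>j. Zc d h (j * dbe d))" "mono (Ic d h)" "mono (Hp d h)"
    "real (Fh d h i) \<le> 2 ^ (8 * b) * real n" "real (Pu d h c i) \<le> 2 ^ (8 * b) * real n" "real (Zc d h i) \<le> 2 ^ (8 * b) * real n"
    "real (Ic d h i) \<le> 2 ^ (8 * b) * real n" "real (Hp d h i) \<le> 2 ^ (8 * b) * real n"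
proof -
  show "mono (Fh d h)" "mono (Ic d h)" using Fh_mono Ic_mono by (auto simp: mono_def)
  show "mono (Pu d h c)" "mono (Hp d h)" by (auto simp: mono_def Pu_def Hp_def intro!: sum_mono2)
  show "mono (\<lambda>j. Zc d h (j * dbe d))" by (auto simp: mono_def intro!: Zc_mono)
  have U: "real (dU d) \<le> 3 * real n * 2 ^ b" using Ub[folded of_nat_le_iff[where 'a = real]] by simp
  have 1: "real n * 1 \<le> real n * 2 ^ b" by (rule mult_left_mono) auto
  have "(8::real) * 2 ^ b \<le> 2 ^ 3 * 2 ^ b" by simp
  also have "\<dots> \<le> 2 ^ (8 * b)" unfolding power_add[symmetric] using b50 by (intro power_increasing) auto
  finally have "real n * (8 * 2 ^ b) \<le> real n * 2 ^ (8 * b)" by (rule mult_left_mono) simp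
  then have B: "8 * (real n * 2 ^ b) \<le> 2 ^ (8 * b) * real n" by (simp add: mult_ac)
  show "real (Fh d h i) \<le> 2 ^ (8 * b) * real n" using h_le_U[OF so, of "i * dbe d"] U B unfolding Fh_def by linarith
  have "Pu d h c i \<le> Pu d h c (nb d)" unfolding Pu_def by (intro sum_mono2) auto
  then show "real (Pu d h c i) \<le> 2 ^ (8 * b) * real n" using P U B 1 by linarith
  show "real (Zc d h i) \<le> 2 ^ (8 * b) * real n" using Zc_le[of i] B 1 by linarith
  show "real (Ic d h i) \<le> 2 ^ (8 * b) * real n" using cv_le[of d h "i * dg d"] B 1 unfolding Ic_def by linarith
  have "real (Hp d h i) \<le> 33 * (real b + 1) * X" using length_hrec[of i] unfolding Hp_def length_cat .
  also have "\<dots> \<le> 33 * 2 ^ b * X" using X_pos real_le_pow by (intro mult_right_mono mult_left_mono) auto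
  also have "\<dots> = 33 * real n" unfolding X_def by simp
  also have "\<dots> \<le> 33 * (2 ^ b * real n)" using 1 by (simp add: mult.commute)
  also have "\<dots> \<le> 2 ^ b * (2 ^ b * real n)"
  proof (rule mult_right_mono)
    show "33 \<le> (2::real) ^ b" using pow_4b(4) of_nat_le_iff[where 'a = real, of 33 "2 ^ b"] by simp
  qed auto
  also have "\<dots> = 2 ^ (2 * b) * real n" by (simp add: mult_2 power_add)
  also have "\<dots> \<le> 2 ^ (8 * b) * real n" by (intro mult_right_mono power_increasing) auto
  finally show "real (Hp d h i) \<le> 2 ^ (8 * b) * real n" .
qed

lemma length_directories:
  assumes P: "real (Pu d h c (nb d)) \<le> real (dU d) + 2 * real n"
  shows "real (length (ma (dW d) (dga d) (dNB d) (Fh d h))) + real (length (ma (dW d) (dga d) (dNB d) (Pu d h c))) +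
    real (length (ma (dW d) (dga d) (dNB d) (\<lambda>j. Zc d h (j * dbe d)))) + real (length (ma (dW d) (dga d) (dNC d) (Ic d h))) +
    real (length (ma (dW d) (dga d) (dNC d) (Hp d h))) \<le> 8000 * (real b + 1) * X"
  using length_ma_NB[OF directory_bounds(1,6)[OF P]] length_ma_NB[OF directory_bounds(2,7)[OF P]] length_ma_NB[OF directory_bounds(3,8)[OF P]]
    length_ma_NC[OF directory_bounds(4,9)[OF P]] length_ma_NC[OF directory_bounds(5,10)[OF P]] by linarith

end

section \<open>Hashing parameters\<close>

lemma bits_mult_le: "bits (x * y) \<le> bits x + bits y"
proof (rule bits_le)
  show "x * y < 2 ^ (bits x + bits y)" unfolding power_add by (rule mult_strict_mono) (auto simp: less_bits)
qed

lemma two_Suc_le_pow: "2 * (x + 1) \<le> 2 ^ (bits x + 3)" "2 * (x + 2) \<le> 2 ^ (bits x + 3)"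
  using less_bits[of x] by (simp_all add: power_add)

text \<open>With \<open>R\<close> bounding \<open>pa\<close> and \<open>ph\<close>, the logarithm
  \<open>pb\<close> is replaced by a linear bound with slope 1/4096, and \<open>K0\<close> makes the
  other quotients equally flat; a slope of 1/64 in \<open>R\<close> covers all factors.\<close>

lemma overhead_le:
  assumes "pb P = bits (pa P) + 3" "pa P \<le> R" "ph P \<le> R"
  shows "2 * (e0 P + 96 * ed P) \<le> 16000 + R div 64"
proof -
  define x y z t where "x = R div 64" and "y = R div 4096" and "z = ph P div K0" and "t = (ph P + pa P + 2 * pb P) div K0"
  have "R \<le> x * 64 + 63" unfolding x_def by simp
  moreover have "y * 4096 \<le> R" "z * 100000 \<le> ph P" "t * 100000 \<le> ph P + pa P + 2 * pb P"
    unfolding y_def z_def t_def K0_def by (rule div_times_less_eq_dividend)+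
  moreover have "pb P \<le> 15 + y"
    using bits_add_le[of "pa P" 12] div_le_mono[OF assms(2), of 4096] assms(1) by (simp add: y_def)
  ultimately have "2 * ((2 * pb P + 121 + t) + 96 * (81 + z)) \<le> 16000 + x" using assms(2,3) by simp
  then show ?thesis unfolding e0_def ed_def x_def z_def t_def .
qed

text \<open>The overhead per element is logarithmic in the number of bits \<open>pu\<close>, which
  is O(lg n + lg lg lg m). If the lg lg lg m part is at most \<open>2 ^ (4 * b + 20)\<close>, the
  overhead is below \<open>b div 4\<close>. Otherwise lg lg m is so much larger than
  \<open>n\<close> that \<open>lam div n\<close> covers it, and \<open>n\<close> times that is only
  \<open>lam\<close>.\<close>

lemma ex_prm:
  fixes ys :: "nat list"
  assumes w: "64 \<le> w" and n: "length ys = n" "0 < n" "n < 2 ^ w" and m: "set ys \<subseteq> {..<m}" "0 < m" "m \<le> 2 ^ w" and s: "s \<le> w"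
    and N: "N = bits n" "N \<le> 2 ^ (4 * b + 4)" and b: "100000 \<le> b" and v0: "v0 = max 1 (bits (m - 1))" and lam: "lam = bits v0"
  obtains P where "\<And>xs. sorted xs \<Longrightarrow> set xs \<subseteq> set ys \<Longrightarrow> length xs \<le> n \<Longrightarrow> (\<forall>x\<in>set xs. \<forall>y\<in>set xs. x div 2 ^ s = y div 2 ^ s) \<Longrightarrow> node_ok P w s xs"
    "2 * (e0 P + 96 * ed P) \<le> b div 4 + lam div n"
    "\<forall>f\<in>{pq, pq', pu, ph, pa, pb}. f P < 2 ^ w \<and> f P < 2 ^ (2 * N + lam + 8)"
proof -
  let ?v = "max 1 (bits (m - 1))"
  \<comment> \<open>The minimum belongs to the case that the keys are short already, where the
    modulus 0, the identity, is used.\<close>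
  define u where "u x = min x (2 * N + bits x + 3)" for x
  have red: "\<exists>q<2 ^ u x. inj_on (\<lambda>x. x mod q) S \<and> (\<forall>y<2 ^ x. y mod q < 2 ^ u x)"
    if "finite S" "S \<subseteq> {..<(2::nat) ^ x}" "card S \<le> n" for S and x :: nat
  proof (rule ex_reduction[OF that])
    have "x \<le> u x" if "u x \<noteq> 2 * N + bits x + 3" using that by (simp add: u_def min_def split: if_splits)
    moreover have "2 * (x * n ^ 2 + 1) < 2 ^ (2 * N + bits x + 3)"
    proof -
      have "bits (x * (n * n)) \<le> bits x + (N + N)" using bits_mult_le[of x "n * n"] bits_mult_le[of n n] N by linarith
      then have "(2::nat) ^ bits (x * (n * n)) \<le> 2 ^ (bits x + (N + N))" by (intro power_increasing) auto
      with less_bits[of "x * (n * n)"] have "x * (n * n) < 2 ^ (bits x + (N + N))" by (rule less_le_trans)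
      then have "x * n ^ 2 < 2 ^ (2 * N + bits x)" by (simp add: power2_eq_square mult_2 add_ac)
      then show ?thesis by (simp add: power_add)
    qed
    ultimately show "x \<le> u x \<or> 2 * (x * n\<^sup>2 + 1) < 2 ^ u x" by metis
  qed
  have ysv: "set ys \<subseteq> {..<2 ^ v0}"
  proof
    fix x assume "x \<in> set ys"
    then have "x \<le> m - 1" using m by fastforce
    also have "\<dots> < 2 ^ bits (m - 1)" by (rule less_bits)
    also have "\<dots> \<le> (2::nat) ^ v0" unfolding v0 by (intro power_increasing) auto
    finally show "x \<in> {..<2 ^ v0}" by simp
  qed
  have cn: "card (set ys) \<le> n" using n card_length by blast
  obtain q where q: "q < 2 ^ u v0" "inj_on (\<lambda>x. x mod q) (set ys)" "\<forall>y<2 ^ v0. y mod q < 2 ^ u v0"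
    using red[OF _ ysv cn] by auto
  let ?S = "(\<lambda>x. x mod q) ` set ys"
  obtain q' where q': "q' < 2 ^ u (u v0)" "inj_on (\<lambda>x. x mod q') ?S" "\<forall>y<2 ^ u v0. y mod q' < 2 ^ u (u v0)"
    using red[of ?S "u v0"] q ysv le_trans[OF card_image_le cn] by (auto simp: subset_iff)
  define P where "P = \<lparr>pq = q, pq' = q', pu = u (u v0), ph = bits N + 1, pa = bits (u (u v0)) + 3, pb = bits (bits (u (u v0)) + 3) + 3\<rparr>"
  have zf: "zf P = (\<lambda>x. x mod q') \<circ> (\<lambda>x. x mod q)" by (auto simp: zf_def P_def)
  have "m - 1 < 2 ^ w" using m by linarith
  then have vw: "v0 \<le> w" using w bits_le[of "m - 1" w] by (simp add: v0)
  have uu: "u x \<le> x" "0 < x \<Longrightarrow> 0 < u x" for x by (auto simp: u_def)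
  have puw: "u (u v0) \<le> w" "u v0 \<le> w" using vw uu(1)[of v0] uu(1)[of "u v0"] by linarith+
  have Nw: "N \<le> w" using bits_le[of n w] n N by simp
  have bw: "bits x \<le> 4 + x div 16" for x using bits_add_le[of x 4] by simp
  have paw: "bits (u (u v0)) + 3 \<le> 7 + w div 16" using bw[of "u (u v0)"] div_le_mono[OF puw(1), of 16] by linarith
  have pbw: "bits (bits (u (u v0)) + 3) + 3 \<le> 8 + w div 16" using bw[of "bits (u (u v0)) + 3"] div_le_mono[OF paw, of 16] w by linarith
  have phw: "bits N + 1 \<le> 5 + w div 16" using bw[of N] div_le_mono[OF Nw, of 16] by linarith
  have w16: "8 + w div 16 \<le> w" using div_times_less_eq_dividend[of w 16] w by linarith
  have v00: "0 < v0" by (simp add: v0)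
  have Kw: "K0 < 2 ^ w"
  proof -
    have "(2::nat) ^ 17 \<le> 2 ^ w" using w by (intro power_increasing) auto
    then show ?thesis by (simp add: K0_def)
  qed
  have lamu: "u (u v0) \<le> 2 * N + 3 + bits (2 * N + lam + 3)" "u v0 \<le> 2 * N + lam + 3"
  proof -
    show 1: "u v0 \<le> 2 * N + lam + 3" unfolding u_def lam by simp
    have "u (u v0) \<le> 2 * N + bits (u v0) + 3" unfolding u_def[of "u v0"] by simp
    then show "u (u v0) \<le> 2 * N + 3 + bits (2 * N + lam + 3)" using bits_mono[OF 1] by linarith
  qed
  show thesis
  proof (rule that[of P])
    fix xs assume xs: "sorted xs" "set xs \<subseteq> set ys" "length xs \<le> n" "\<forall>x\<in>set xs. \<forall>y\<in>set xs. x div 2 ^ s = y div 2 ^ s"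
    have "inj_on (zf P) (set ys)" unfolding zf using q(2) q'(2) by (rule comp_inj_on)
    then have i: "inj_on (zf P) (set xs)" by (rule inj_on_subset) (rule xs)
    have z: "zf P x < 2 ^ pu P" if "x \<in> set xs" for x
      using that xs ysv q(3) q'(3) unfolding zf by (auto simp: P_def subset_iff)
    have "bits (length xs) < 2 ^ (bits N + 1)" using bits_mono[OF xs(3)] less_bits[of N] N by simp
    moreover have "pu P \<le> w" "0 < pu P" "ph P \<le> w" "pa P \<le> w" "pb P \<le> w" using puw paw pbw phw w16 uu(2)[OF uu(2)[OF v00]] unfolding P_def prm.simps by linarith+
    moreover have "2 * (pu P + 1) \<le> 2 ^ pa P" "2 * (pa P + 2) \<le> 2 ^ pb P" unfolding P_def prm.simps by (rule two_Suc_le_pow)+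
    ultimately show "node_ok P w s xs" unfolding node_ok_def using xs(1,4) i z Kw s by (intro conjI) (simp_all only: P_def prm.simps, auto)
  next
    have "x < 2 ^ w" if "x \<le> 8 + w div 16" for x using that w less_exp[of w] by linarith
    then have w1: "f P < 2 ^ w" if "f \<in> {ph, pa, pb}" for f using that paw pbw phw by (auto simp: P_def intro!: le_less_trans[OF _ less_exp[of w]]) (use w in linarith)+
    have "u (u v0) \<le> u v0" by (rule uu)
    moreover have "(2::nat) ^ u (u v0) \<le> 2 ^ u v0" by (rule power_increasing) (simp_all add: uu)
    moreover have "(2::nat) ^ u v0 \<le> 2 ^ w" "(2::nat) ^ u v0 \<le> 2 ^ (2 * N + lam + 8)" using puw lamu by (auto intro!: power_increasing)
    moreover have "u (u v0) < 2 ^ u (u v0)" by (rule less_exp)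
    ultimately have w2: "f P < 2 ^ w \<and> f P < 2 ^ (2 * N + lam + 8)" if "f \<in> {pq, pq', pu}" for f
      using that q(1) q'(1) by (elim insertE emptyE; simp only: P_def prm.simps; linarith)
    have "bits (u (u v0)) \<le> 2 * N + lam + 3" using bits_le_self[of "u (u v0)"] uu(1)[of "u v0"] lamu(2) by linarith
    moreover have "bits (bits (u (u v0)) + 3) \<le> bits (u (u v0)) + 3" "bits N \<le> N" by (rule bits_le_self)+
    ultimately have "f P \<le> 2 * N + lam + 9" if "f \<in> {ph, pa, pb}" for f using that by (auto simp: P_def)
    moreover have "x + 9 < 2 ^ (x + 8)" for x :: nat
    proof -
      have "(2::nat) ^ (x + 8) = 256 * 2 ^ x" by (simp add: power_add)
      then show ?thesis using less_exp[of x] by linarith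
    qed
    ultimately have "f P < 2 ^ (2 * N + lam + 8)" if "f \<in> {ph, pa, pb}" for f using that le_less_trans by blast
    then show "\<forall>f\<in>{pq, pq', pu, ph, pa, pb}. f P < 2 ^ w \<and> f P < 2 ^ (2 * N + lam + 8)" using w1 w2 by auto
  next
    let ?q = "bits lam"
    define B :: nat where "B = 2 ^ (4 * b)"
    have B: "1 \<le> B" "N \<le> 16 * B" using N(2) by (simp_all add: B_def power_add)
    have q2: "u (u v0) \<le> 3 * N + 10 + ?q"
    proof -
      have "2 * N + lam + 3 \<le> (2 * N + 4) * (lam + 1)" using le_add1[of lam "(2 * N + 3) * lam"] by (simp add: algebra_simps)
      then have "bits (2 * N + lam + 3) \<le> bits (2 * N + 4) + bits (lam + 1)" using le_trans[OF bits_mono bits_mult_le] by blast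
      moreover have "bits (2 * N + 4) \<le> N + 4"
      proof (rule bits_le)
        have "(2::nat) ^ (N + 4) = 16 * 2 ^ N" by (simp add: power_add)
        then show "2 * N + 4 < 2 ^ (N + 4)" using less_exp[of N] by linarith
      qed
      moreover have "bits (lam + 1) \<le> ?q + 1" using less_bits[of lam] by (intro bits_le) simp
      ultimately show ?thesis using lamu(1) by linarith
    qed
    have phb: "bits N \<le> 4 * b + 5" using B by (intro bits_le) (simp add: power_add flip: B_def)
    show "2 * (e0 P + 96 * ed P) \<le> b div 4 + lam div n"
    proof (cases "?q \<le> 2 ^ (4 * b + 20)")
      case True
      have "u (u v0) < 2 ^ (4 * b + 21)" using q2 True B by (simp add: power_add flip: B_def)
      then have "bits (u (u v0)) \<le> 4 * b + 21" by (rule bits_le)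
      then have "2 * (e0 P + 96 * ed P) \<le> 16000 + (4 * b + 24) div 64" using phb by (intro overhead_le) (auto simp: P_def)
      also have "\<dots> \<le> b div 4" using b by linarith
      finally show ?thesis by simp
    next
      case False
      then have q3: "2 ^ 20 * 2 ^ (4 * b) < ?q" by (simp add: power_add)
      have lam0: "0 < lam" using q3 by (cases lam) auto
      have NQ: "16 * N + 100000 \<le> ?q" using B q3 by (simp flip: B_def)
      have "u (u v0) < 2 ^ (bits ?q + 1)" using q2 NQ less_bits[of ?q] by simp
      then have "bits (u (u v0)) \<le> bits ?q + 1" by (rule bits_le)
      moreover have "4 * b + 20 \<le> bits ?q"
        using False less_bits[of ?q] power_increasing[of "bits ?q" "4 * b + 20" "2::nat"] by linarith
      ultimately have "2 * (e0 P + 96 * ed P) \<le> 16000 + (bits ?q + 4) div 64" using phb by (intro overhead_le) (auto simp: P_def)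
      \<comment> \<open>The overhead is now logarithmic in \<open>?q\<close>, whereas
        \<open>lam\<close> is at least \<open>2 ^ (?q - 1)\<close> and \<open>n\<close> is below
        \<open>2 ^ N\<close>.\<close>
      also have "\<dots> \<le> ?q - 1 - N" using bits_le_self[of ?q] NQ by linarith
      also have "\<dots> \<le> 2 ^ (?q - 1 - N)" by (rule less_imp_le[OF less_exp])
      also have "\<dots> = 2 ^ (?q - 1) div 2 ^ N" using NQ by (subst power_diff) auto
      also have "\<dots> \<le> lam div 2 ^ N" by (intro div_le_mono bits_ge lam0)
      also have "\<dots> \<le> lam div n" using less_bits[of n] n N by (intro div_le_mono2) auto
      finally show ?thesis by simp
    qed
  qed
qed

section \<open>Slots of the bins\<close>

text \<open>Consecutive positions of one bin have the same high part, so every position but the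
  bin's first repeats its predecessor, unless a block starts there.\<close>

lemma exs_in_bin:
  assumes so: "seq_ok d h c" and v: "v < dU d" and i: "cv d h v < i" "i < cv d h (v + 1)" "i mod dbe d \<noteq> 0"
  shows "exs d h i = 1"
proof -
  have "v \<le> h (i - 1)" "h i < v + 1"
    using cv_iff[OF so, of v "i - 1"] cv_iff[OF so, of "v + 1" i] v i by auto
  moreover have "h (i - 1) \<le> h i" using so by (auto simp: seq_ok_def mono_def)
  ultimately have "h i = h (i - 1)" by linarith
  then show ?thesis using i by (simp add: exs_def)
qed

lemma card_multiples_le: "0 < (q::nat) \<Longrightarrow> card {i. a \<le> i \<and> i < a + k \<and> i mod q = 0} \<le> k div q + 1"
proof -
  assume q: "0 < q"
  let ?A = "{i. a \<le> i \<and> i < a + k \<and> i mod q = 0}"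
  have "inj_on (\<lambda>i. i div q) ?A" by (rule inj_onI) (metis (mono_tags, lifting) mem_Collect_eq div_mult_mod_eq)
  then have "card ?A = card ((\<lambda>i. i div q) ` ?A)" by (rule card_image[symmetric])
  also have "\<dots> \<le> card {(a + q - 1) div q..<(a + q - 1) div q + (k div q + 1)}"
  proof (rule card_mono)
    show "(\<lambda>i. i div q) ` ?A \<subseteq> {(a + q - 1) div q..<(a + q - 1) div q + (k div q + 1)}"
    proof
      fix j assume "j \<in> (\<lambda>i. i div q) ` ?A"
      then obtain i where i: "j = i div q" "a \<le> i" "i < a + k" "i mod q = 0" by auto
      then have ij: "i = j * q" by (metis add.right_neutral div_mult_mod_eq)
      have "(a + q - 1) div q \<le> (j * q + (q - 1)) div q" using i ij q by (intro div_le_mono) linarith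
      also have "\<dots> = j" using q by (subst div_mult_self3) auto
      finally have 1: "(a + q - 1) div q \<le> j" .
      have "a + k \<le> a + (k div q * q + (q - 1))" using q mod_less_divisor[OF q, of k] div_mult_mod_eq[of k q] by linarith
      then have "j * q < a + (q - 1) + k div q * q" using i ij by linarith
      also have "\<dots> = a + q - 1 + k div q * q" using q by simp
      also have "\<dots> < ((a + q - 1) div q + 1) * q + k div q * q" using q dividend_less_times_div[OF q, of "a + q - 1"] by (simp add: algebra_simps)
      also have "\<dots> = ((a + q - 1) div q + (k div q + 1)) * q" by (simp add: algebra_simps)
      finally have "j < (a + q - 1) div q + (k div q + 1)" by (simp only: mult_less_cancel2)
      then show "j \<in> {(a + q - 1) div q..<(a + q - 1) div q + (k div q + 1)}" using 1 by simp
    qed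
  qed simp
  finally show ?thesis by simp
qed

text \<open>Only the first position of the bin and the block starts inside it can lack extra space,
  at most \<open>k div 16 + 2\<close> positions. So at least half of the \<open>k\<close> positions
  have it; hence the factor 2 in the bound on the overhead.\<close>

lemma slots_ge:
  assumes so: "seq_ok d h c" and v: "v < dU d" and k: "k = cv d h (v + 1) - cv d h v" "16 \<le> k" and be: "16 \<le> dbe d"
  shows "k \<le> 2 * (Zc d h (cv d h (v + 1)) - Zc d h (cv d h v))"
proof -
  let ?a = "cv d h v" and ?b = "cv d h (v + 1)"
  have ab: "?a \<le> ?b" by (rule cv_mono) simp
  have "dn d < nb d * dbe d" using dividend_less_times_div[of "dbe d" "dn d"] be by (simp add: nb_def algebra_simps)
  then have "?b \<le> nb d * dbe d" using cv_le[of d h "v + 1"] by linarith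
  then have "Zc d h ?b = (\<Sum>i<?b. exs d h i)" "Zc d h ?a = (\<Sum>i<?a. exs d h i)" using ab by (simp_all add: Zc_def min_absorb1)
  moreover have "(\<Sum>i<?b. exs d h i) = (\<Sum>i<?a. exs d h i) + (\<Sum>i\<in>{?a..<?b}. exs d h i)"
    using sum.atLeastLessThan_concat[OF le0 ab, of "exs d h"] by (simp add: atLeast0LessThan)
  ultimately have Z: "Zc d h ?b - Zc d h ?a = (\<Sum>i\<in>{?a..<?b}. exs d h i)" by simp
  let ?M = "{i. ?a \<le> i \<and> i < ?a + k \<and> i mod dbe d = 0}"
  have fin: "finite ?M" by (rule finite_subset[of _ "{..<?a + k}"]) auto
  have "card {?a..<?b} - card (insert ?a ?M) \<le> card ({?a..<?b} - insert ?a ?M)" by (rule diff_card_le_card_Diff) (use fin in simp)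
  also have "\<dots> = (\<Sum>i\<in>{?a..<?b} - insert ?a ?M. 1)" by simp
  also have "\<dots> \<le> (\<Sum>i\<in>{?a..<?b} - insert ?a ?M. exs d h i)"
  proof (rule sum_mono)
    fix i assume i: "i \<in> {?a..<?b} - insert ?a ?M"
    then have "?a < i" "i < ?b" "i mod dbe d \<noteq> 0" using k ab by auto
    then show "1 \<le> exs d h i" using exs_in_bin[OF so v] by simp
  qed
  also have "\<dots> \<le> (\<Sum>i\<in>{?a..<?b}. exs d h i)" by (intro sum_mono2) auto
  finally have "card {?a..<?b} - card (insert ?a ?M) \<le> Zc d h ?b - Zc d h ?a" using Z by simp
  moreover have "card (insert ?a ?M) \<le> k div dbe d + 2" using card_multiples_le[of "dbe d" ?a k] be card_insert_le_m1[of "card ?M + 1" ?M ?a] fin by (simp add: card_insert_if)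
  moreover have "k div dbe d \<le> k div 16" using be by (intro div_le_mono2) auto
  ultimately show ?thesis using k by (simp only: card_atLeastLessThan) linarith
qed

section \<open>The header\<close>

text \<open>The familiar \<open>x & (x - 1)\<close> clears the lowest set bit; subtracting the
  result from \<open>x\<close> isolates it.\<close>

lemma and_pred: "Bit_Operations.and (2 ^ l * (2 * q + 1)) (2 ^ l * (2 * q + 1) - 1) = 2 ^ l * (2 * (q::nat))"
proof (induction l)
  case (Suc l)
  let ?x = "2 ^ l * (2 * q + 1)"
  have "0 < ?x" by simp
  then have "2 * ?x - 1 = 2 * (?x - 1) + 1" by linarith
  moreover have "Bit_Operations.and (2 * x) (2 * y + 1) = 2 * Bit_Operations.and x y" for x y :: nat by (subst and_rec) simp
  ultimately have "Bit_Operations.and (2 * ?x) (2 * ?x - 1) = 2 * Bit_Operations.and ?x (?x - 1)" by metis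
  then show ?case using Suc by (simp add: mult.assoc)
qed (simp add: and_rec[of "Suc _"])

text \<open>The prefix \<open>0\<^sup>l 1\<close> makes the lowest set bit of the first word equal to \<open>2\<^sup>l\<close>, from which the field
  width, and hence everything else, can be read off.\<close>

definition hdr :: "nat \<Rightarrow> nat list \<Rightarrow> bool list" where
  "hdr W ps = tobits (bits W + 1) (2 ^ bits W) @ tobits (bits W) (bits W) @ tobits (bits W) W @ arr W ps"

lemma length_hdr: "length (hdr W ps) = 3 * bits W + 1 + length ps * W" by (simp add: hdr_def)

lemma get_get: "a + k \<le> l \<Longrightarrow> get bs 0 l div 2 ^ a mod 2 ^ k = get bs a k"
  by (rule bit_eqI) (auto simp: bit_get simp flip: drop_bit_eq_div take_bit_eq_mod bit_take_bit_iff simp: bit_take_bit_iff bit_drop_bit_eq)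

lemma lowest_bit:
  assumes "x mod 2 ^ (l + 1) = 2 ^ l"
  shows "x - Bit_Operations.and x (x - 1) = (2::nat) ^ l" "Bit_Operations.and x (x - 1) \<le> x"
proof -
  from assms have "x = 2 ^ l * (2 * (x div 2 ^ (l + 1)) + 1)" using div_mult_mod_eq[of x "2 ^ (l + 1)"] by (simp add: algebra_simps)
  then obtain q where "x = 2 ^ l * (2 * q + 1)" by blast
  then show "x - Bit_Operations.and x (x - 1) = 2 ^ l" "Bit_Operations.and x (x - 1) \<le> x" using and_pred[of l q] by (simp_all add: algebra_simps)
qed

text \<open>The isolated bit yields \<open>2 ^ l\<close> but not \<open>l\<close>, for want of a
  logarithm. With divisions by powers alone, \<open>X div (2 * 2 ^ l) mod 2 ^ l\<close> reads the
  second field, which contains \<open>l\<close>; after that ordinary field access is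
  possible.\<close>

lemma cmp_hdr:
  assumes wf: "wf V" and i: "i \<le> 64" and ok: "\<And>Z. Z \<in> V \<Longrightarrow> sub (bb Z) 0 (hdr (W Z) (ps Z)) \<and> 0 < W Z \<and> 3 * bits (W Z) + 1 \<le> ww Z \<and>
     3 * bits (W Z) + 1 + 64 * W Z < 2 ^ ww Z \<and> i < length (ps Z) \<and> ps Z ! i < 2 ^ W Z \<and> ps Z ! i < 2 ^ ww Z"
  shows "cmp V (\<lambda>Z. ps Z ! i)"
proof -
  note p = wf_pos[OF wf]
  define X where "X Z = pack (ww Z) (bb Z) 0" for Z :: st
  let ?l = "\<lambda>Z. bits (W Z)"
  have Xg: "X Z = get (bb Z) 0 (ww Z)" for Z by (simp add: X_def pack_get)
  have hd: "sub (bb Z) 0 (tobits (?l Z + 1) (2 ^ ?l Z))" "sub (bb Z) (?l Z + 1) (tobits (?l Z) (?l Z))"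
    "sub (bb Z) (?l Z + 1 + ?l Z) (tobits (?l Z) (W Z))" "sub (bb Z) (?l Z + 1 + ?l Z + ?l Z) (arr (W Z) (ps Z))" if "Z \<in> V" for Z
    using ok[OF that] by (simp_all add: hdr_def sub_append)
  have l0: "0 < ?l Z" "?l Z < 2 ^ ?l Z" "W Z < 2 ^ ?l Z" if "Z \<in> V" for Z using ok[OF that] bits_pos less_exp less_bits by blast+
  have Xm: "X Z mod 2 ^ (?l Z + 1) = 2 ^ ?l Z" if "Z \<in> V" for Z
    using get_get[of 0 "?l Z + 1" "ww Z" "bb Z"] ok[OF that] sub_get[OF hd(1)[OF that]] by (simp add: Xg)
  have Xw: "X Z < 2 ^ ww Z" for Z unfolding Xg by (rule get_less)
  have X0: "0 < X Z" if "Z \<in> V" for Z using Xm[OF that] by (cases "X Z") auto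
  have cX: "cmp V X" unfolding X_def by (rule cmp_load[OF cmp_0])
  have "cmp V (\<lambda>Z. X Z - Bit_Operations.and (X Z) (X Z - 1))"
    by (intro cmp_sub cmp_and cX cmp_1 p) (use X0 Xw lowest_bit(2)[OF Xm] in \<open>auto simp: Suc_le_eq\<close>)
  then have cY: "cmp V (\<lambda>Z. 2 ^ ?l Z)" by (rule cmp_cong) (rule lowest_bit(1), rule Xm)
  have "2 * (2::nat) ^ ?l Z < 2 ^ ww Z" if "Z \<in> V" for Z
  proof -
    have "(2::nat) ^ (?l Z + 1) < 2 ^ ww Z" using ok[OF that] l0[OF that] by (intro power_strict_increasing) linarith+
    then show ?thesis by simp
  qed
  then have "cmp V (\<lambda>Z. X Z div (2 * 2 ^ ?l Z) mod 2 ^ ?l Z)" by (intro cmp_mod cmp_div cmp_mul cX cY cmp_small wf) auto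
  then have cl: "cmp V ?l"
  proof (rule cmp_cong)
    fix Z assume v: "Z \<in> V"
    show "X Z div (2 * 2 ^ ?l Z) mod 2 ^ ?l Z = ?l Z"
      using get_get[of "?l Z + 1" "?l Z" "ww Z" "bb Z"] ok[OF v] sub_get[OF hd(2)[OF v]] l0[OF v] by (simp add: Xg)
  qed
  have w: "3 * ?l Z + 1 < 2 ^ ww Z" "?l Z \<le> ww Z" if "Z \<in> V" for Z using ok[OF that] by linarith+
  have c1: "cmp V (\<lambda>Z. ?l Z + 1 + ?l Z)" by (intro cmp_add cl cmp_1 p; drule w; linarith)
  have cW: "cmp V W"
  proof (rule cmp_field[OF wf c1 cl])
    fix Z assume v: "Z \<in> V"
    have "(2::nat) ^ ?l Z \<le> 2 ^ ww Z" using w[OF v] by (intro power_increasing) auto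
    then show "sub (bb Z) (?l Z + 1 + ?l Z) (tobits (?l Z) (W Z)) \<and> W Z < 2 ^ ?l Z \<and> W Z < 2 ^ ww Z \<and> ?l Z + 1 + ?l Z < 2 ^ ww Z"
      using hd(3)[OF v] l0[OF v] w[OF v] by linarith
  qed
  have c2: "cmp V (\<lambda>Z. ?l Z + 1 + ?l Z + ?l Z)" by (intro cmp_add[OF c1] cl; drule w; linarith)
  show ?thesis
  proof (rule cmp_arr[OF wf c2 cW cmp_small[OF wf i]])
    fix Z assume v: "Z \<in> V"
    have "i * W Z \<le> 64 * W Z" by (rule mult_le_mono1[OF i])
    then have "?l Z + 1 + ?l Z + ?l Z + i * W Z < 2 ^ ww Z" using ok[OF v] by linarith
    then show "sub (bb Z) (?l Z + 1 + ?l Z + ?l Z) (arr (W Z) (ps Z)) \<and> i < length (ps Z) \<and> ps Z ! i < 2 ^ W Z \<and> ps Z ! i < 2 ^ ww Z \<and>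
       ?l Z + 1 + ?l Z + ?l Z + i * W Z < 2 ^ ww Z" using hd(4)[OF v] ok[OF v] by blast
  qed
qed

definition hdr_ok :: "nat \<Rightarrow> bool list \<Rightarrow> nat \<Rightarrow> nat list \<Rightarrow> bool" where
  "hdr_ok w bs W ps \<longleftrightarrow> sub bs 0 (hdr W ps) \<and> 0 < W \<and> 3 * bits W + 1 \<le> w \<and> 3 * bits W + 1 + 64 * W < 2 ^ w \<and> (\<forall>x\<in>set ps. x < 2 ^ W \<and> x < 2 ^ w)"

lemma cmp_hdr_ok: "wf V \<Longrightarrow> i \<le> 64 \<Longrightarrow> (\<And>Z. Z \<in> V \<Longrightarrow> hdr_ok (ww Z) (bb Z) (W Z) (ps Z) \<and> i < length (ps Z)) \<Longrightarrow> cmp V (\<lambda>Z. ps Z ! i)"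
  by (rule cmp_hdr[where W = W]) (auto simp: hdr_ok_def)

lemma square16_le_pow2: "64 \<le> x \<Longrightarrow> x * x * 16 \<le> (2::nat) ^ x"
proof (induction x rule: dec_induct)
  case (step x)
  have "2 * x + 1 \<le> x * x" using mult_le_mono1[of 64 x x] step(1) by linarith
  then show ?case using step by (simp add: algebra_simps)
qed simp

lemma hdr_room: "64 \<le> w \<Longrightarrow> W \<le> 9 * w \<Longrightarrow> 3 * bits W + 1 \<le> w \<and> 3 * bits W + 1 + 64 * W < 2 ^ w"
proof -
  assume a: "64 \<le> w" "W \<le> 9 * w"
  have "bits W \<le> 6 + W div 2 ^ 6" by (rule bits_add_le)
  also have "\<dots> \<le> 6 + (9 * w) div 64" using div_le_mono[OF a(2), of 64] by simp
  finally have "bits W \<le> 6 + (9 * w) div 64" .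
  moreover have "(9 * w) div 64 * 64 \<le> 9 * w" by simp
  ultimately have 1: "3 * bits W + 1 \<le> w" using a by linarith
  have "w * w * 16 \<le> 2 ^ w" by (rule square16_le_pow2[OF a(1)])
  moreover have "64 * w \<le> w * w" using a by (intro mult_le_mono1)
  ultimately show ?thesis using 1 a by linarith
qed

section \<open>Layout of the bit string\<close>

lemma sub_concat: "i < length T \<Longrightarrow> sub (xs @ concat T @ zs) (length xs + length (concat (take i T))) (T ! i)"
proof -
  assume "i < length T"
  then have "T = take i T @ T ! i # drop (Suc i) T" by (rule id_take_nth_drop)
  then have "concat T = concat (take i T) @ T ! i @ concat (drop (Suc i) T)" by (metis concat.simps(2) concat_append)
  then show ?thesis using sub_prefix[of "xs @ concat (take i T)" "T ! i" "concat (drop (Suc i) T) @ zs"] by simp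
qed

definition plist :: "ds \<Rightarrow> prm \<Rightarrow> nat \<Rightarrow> nat \<Rightarrow> nat \<Rightarrow> nat list" where
  "plist d P s e bL = [1, dn d, dU d, dbe d, dg d, dD d, dW d, dga d, dNB d, dNC d, dNI d, bS d, bZt d, bR d, bF d, bP d, bZ d, bI d, bH d, bHR d, bC d,
     s, e, bL, pq P, pq' P, pu P, ph P, pa P, pb P]"

lemma cmp_plist:
  assumes wf: "wf V" and ok: "\<And>Z. Z \<in> V \<Longrightarrow> hdr_ok (ww Z) (bb Z) (W Z) (plist (d Z) (P Z) (s Z) (e Z) (bL Z))"
  shows "dcmp V d" "pcmp V P" "cmp V s" "cmp V e" "cmp V bL"
proof -
  have c: "cmp V (\<lambda>Z. plist (d Z) (P Z) (s Z) (e Z) (bL Z) ! i)" if "i < 30" for i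
    by (rule cmp_hdr_ok[OF wf, where W = W]) (use that ok in \<open>auto simp: plist_def\<close>)
  show "dcmp V d" unfolding dcmp_def
    using c[of 1] c[of 2] c[of 3] c[of 4] c[of 5] c[of 6] c[of 7] c[of 8] c[of 9] c[of 10] c[of 11] c[of 12] c[of 13] c[of 14] c[of 15] c[of 16] c[of 17] c[of 18] c[of 19] c[of 20]
    by (simp add: plist_def)
  show "pcmp V P" unfolding pcmp_def using c[of 24] c[of 25] c[of 26] c[of 27] c[of 28] c[of 29] by (simp add: plist_def)
  show "cmp V s" "cmp V e" "cmp V bL" using c[of 21] c[of 22] c[of 23] by (simp_all add: plist_def)
qed

text \<open>Addresses depend on the lengths of the parts, and the lengths on all other components of
  the record. Filling in the addresses afterwards avoids circularity, since the encoded objects do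
  not change.\<close>

definition bu :: "ds \<Rightarrow> (nat \<Rightarrow> nat) \<Rightarrow> nat \<Rightarrow> ds" where
  "bu d B C = d\<lparr>bS := B 0, bZt := B 1, bR := B 2, bF := B 3, bP := B 4, bZ := B 5, bI := B 6, bH := B 7, bHR := B 8, bC := C\<rparr>"

lemma bu_simps [simp]: "dn (bu d B C) = dn d" "dU (bu d B C) = dU d" "dbe (bu d B C) = dbe d" "dg (bu d B C) = dg d" "dD (bu d B C) = dD d"
  "dW (bu d B C) = dW d" "dga (bu d B C) = dga d" "dNB (bu d B C) = dNB d" "dNC (bu d B C) = dNC d" "dNI (bu d B C) = dNI d"
  "bS (bu d B C) = B 0" "bZt (bu d B C) = B 1" "bR (bu d B C) = B 2" "bF (bu d B C) = B 3" "bP (bu d B C) = B 4" "bZ (bu d B C) = B 5"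
  "bI (bu d B C) = B 6" "bH (bu d B C) = B 7" "bHR (bu d B C) = B 8" "bC (bu d B C) = C"
  by (simp_all add: bu_def)

lemma bu_fns [simp]: "nb (bu d B C) = nb d" "gdom (bu d B C) = gdom d" "Fh (bu d B C) = Fh d" "sparse (bu d B C) = sparse d" "gaps (bu d B C) = gaps d"
  by (simp_all add: fun_eq_iff nb_def gdom_def Fh_def sparse_def gaps_def)
lemma bu_fns2 [simp]: "rcd (bu d B C) = rcd d" "cv (bu d B C) = cv d" "exs (bu d B C) = exs d" "gl (bu d B C) = gl d"
  by (simp_all add: fun_eq_iff rcd_def cv_def exs_def gl_def)
lemma bu_fns3 [simp]: "Pu (bu d B C) = Pu d" "Zc (bu d B C) = Zc d" "Ic (bu d B C) = Ic d" "tabS (bu d B C) = tabS d" "tabZ (bu d B C) = tabZ d" "tabR (bu d B C) = tabR d"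
  by (simp_all add: fun_eq_iff Pu_def Zc_def Ic_def tabS_def tabZ_def tabR_def)
lemma bu_fns4 [simp]: "hard (bu d B C) = hard d" "la (bu d B C) = la d" by (simp_all add: fun_eq_iff hard_def la_def)
lemma bu_fns5 [simp]: "hrec (bu d B C) = hrec d" "low (bu d B C) = low d" by (simp_all add: fun_eq_iff hrec_def low_def)
lemma bu_fns6 [simp]: "Hp (bu d B C) = Hp d" "seq_ok (bu d B C) = seq_ok d" by (simp_all add: fun_eq_iff Hp_def seq_ok_def)

definition segs :: "ds \<Rightarrow> (nat \<Rightarrow> nat) \<Rightarrow> (nat list \<Rightarrow> nat) \<Rightarrow> prm \<Rightarrow> nat \<Rightarrow> nat \<Rightarrow> nat list \<Rightarrow> bool list list" where
  "segs d h c P s e ys = [arr (dW d) (map (tabS d c) [0..<dNI d * dbe d]), arr (dW d) (map (tabZ d c) [0..<dNI d * dbe d]), arr (dW d) (map (tabR d c) [0..<dNI d * dD d]),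
     ma (dW d) (dga d) (dNB d) (Fh d h), ma (dW d) (dga d) (dNB d) (Pu d h c), ma (dW d) (dga d) (dNB d) (\<lambda>j. Zc d h (j * dbe d)), ma (dW d) (dga d) (dNC d) (Ic d h),
     ma (dW d) (dga d) (dNC d) (Hp d h), cat (hrec d h) (dU d div dg d + 1), low d h P s e ys]"

lemma length_low:
  assumes "\<forall>v<dU d. length (enc A0 P s (bin s ys v)) \<le> la d h s e (v + 1) - la d h s e v"
  shows "length (low d h P s e ys) = la d h s e (dU d)"
proof -
  have "length (low d h P s e ys) = (\<Sum>v<dU d. la d h s e (Suc v) - la d h s e v)"
    unfolding low_def length_cat using assms by (intro sum.cong refl) (simp add: length_padto)
  also have "\<dots> = la d h s e (dU d) - la d h s e 0" by (rule sum_diff_telescope) (rule la_mono)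
  finally show ?thesis by (simp add: la_def cv_def cnt_def Zc_def)
qed

text \<open>The codes come last, so they alone may extend past bit \<open>2 ^ w\<close>. Everything
  before them, counting up to three bits of alignment, has length at most \<open>t\<close> and is
  addressed bitwise.\<close>

lemma layout:
  fixes d :: ds and ys :: "nat list" and s e w Wp :: nat and P :: prm and c :: "nat list \<Rightarrow> nat"
  defines "h \<equiv> hf s (dU d) ys" and "ps \<equiv> [1, dn d, dU d, dbe d, dg d, dD d, dW d, dga d, dNB d, dNC d, dNI d, s, e, pq P, pq' P, pu P, ph P, pa P, pb P]"
  defines "t \<equiv> 3 * bits Wp + 4 + 30 * Wp + length (concat (segs d h c P s e ys))"
  assumes so: "seq_ok d h c" and cw: "\<forall>gs\<in>gdom d. bits (c gs) + 3 \<le> w"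
    and nums: "dU d < 2 ^ dW d" "dbe d * dD d < 2 ^ dW d" "dbe d * dD d < 2 ^ w" "dU d + dbe d + dg d < 2 ^ w" "dn d < 2 ^ w" "nb d + 2 < 2 ^ w"
      "nb d + 2 < dNB d * dga d" "dU d div dg d + 2 < dNC d * dga d" "dNI d * dbe d < 2 ^ w" "dNI d * dD d < 2 ^ w"
    and mas: "\<forall>(N, A)\<in>{(dNB d, Fh d h), (dNB d, Pu d h c), (dNB d, \<lambda>j. Zc d h (j * dbe d)), (dNC d, Ic d h), (dNC d, Hp d h)}.
      mono A \<and> A (N * dga d) < 2 ^ w \<and> A (N * dga d) < 2 ^ dW d \<and> length (ma (dW d) (dga d) N A) < 2 ^ dW d"
    and ys: "length ys = dn d" "sorted ys" "\<forall>v. node_ok P w s (bin s ys v)"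
      "\<forall>v<dU d. length (enc A0 P s (bin s ys v)) \<le> la d h s e (v + 1) - la d h s e v"
    and t: "t < 2 ^ Wp" "t + Pu d h c (nb d) < 2 ^ w" and ps: "\<forall>x\<in>set ps. x < 2 ^ Wp \<and> x < 2 ^ w"
    and Wp: "0 < Wp" "3 * bits Wp + 1 \<le> w" "3 * bits Wp + 1 + 64 * Wp < 2 ^ w"
  shows "\<exists>bs d' bL. top_ok d' c P s e bL ys w bs \<and> hdr_ok w bs Wp (plist d' P s e bL) \<and> dU d' = dU d \<and> length bs \<le> t + 4 * Pu d h c (nb d)"
proof -
  define T where "T = segs d h c P s e ys"
  define H where "H = 3 * bits Wp + 1 + 30 * Wp"
  define B where "B i = H + length (concat (take i T))" for i
  \<comment> \<open>The next multiple of four bits, in units of four bits.\<close>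
  define C where "C = (H + length (concat T) + 3) div 4"
  define d' where "d' = bu d B C"
  define X where "X = hdr Wp (plist d' P s e (B 9))"
  define Z where "Z = replicate (4 * C - (H + length (concat T))) False @ cat (rcd d h c) (nb d)"
  let ?bs = "X @ concat T @ Z"
  have lX: "length X = H" by (simp add: X_def length_hdr plist_def H_def)
  have lT: "length T = 10" by (simp add: T_def segs_def)
  have W4: "4 dvd dW d" using so by (simp add: seq_ok_def)
  have C4: "H + length (concat T) \<le> 4 * C" "4 * C \<le> H + length (concat T) + 3" unfolding C_def by simp_all
  have t': "t = H + length (concat T) + 3" by (simp add: t_def H_def T_def)
  have Ct: "C \<le> t" using C4 t' by linarith
  have sT: "sub ?bs (B i) (T ! i)" if "i < 10" for i
    using sub_concat[of i T X Z] that lT lX by (simp add: B_def)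
  have Bt: "B i + length (T ! i) < 2 ^ w" "B i \<le> t" if "i < 10" for i
  proof -
    have "concat T = concat (take i T) @ T ! i @ concat (drop (Suc i) T)" using id_take_nth_drop[of i T] that lT by (metis concat.simps(2) concat_append)
    then have "B i + length (T ! i) \<le> H + length (concat T)" unfolding B_def by simp
    then show "B i + length (T ! i) < 2 ^ w" "B i \<le> t" using t t' by linarith+
  qed
  have sC: "sub ?bs (4 * C) (cat (rcd d h c) (nb d))"
  proof -
    have "length (X @ concat T @ replicate (4 * C - (H + length (concat T))) False) = 4 * C" using C4 lX by simp
    then show ?thesis using sub_prefix[of "X @ concat T @ replicate (4 * C - (H + length (concat T))) False" "cat (rcd d h c) (nb d)" "[]"]
      by (simp add: Z_def)
  qed
  have lrc: "length (cat (rcd d h c) (nb d)) = 4 * Pu d h c (nb d)" by (simp add: length_cat Pu_sum[OF W4])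
  have Ti: "T ! 0 = arr (dW d) (map (tabS d c) [0..<dNI d * dbe d])" "T ! 1 = arr (dW d) (map (tabZ d c) [0..<dNI d * dbe d])"
    "T ! 2 = arr (dW d) (map (tabR d c) [0..<dNI d * dD d])" "T ! 3 = ma (dW d) (dga d) (dNB d) (Fh d h)" "T ! 4 = ma (dW d) (dga d) (dNB d) (Pu d h c)"
    "T ! 5 = ma (dW d) (dga d) (dNB d) (\<lambda>j. Zc d h (j * dbe d))" "T ! 6 = ma (dW d) (dga d) (dNC d) (Ic d h)" "T ! 7 = ma (dW d) (dga d) (dNC d) (Hp d h)"
    "T ! 8 = cat (hrec d h) (dU d div dg d + 1)" "T ! 9 = low d h P s e ys" by (simp_all add: T_def segs_def)
  have dms: "dms_ok d' h c w ?bs"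
  proof -
    have tab: "tab_at d' w ?bs (B i) N f" if "i < 10" "T ! i = arr (dW d) (map f [0..<N])" for i N f
      using sT[OF that(1)] Bt(1)[OF that(1)] that(2) by (simp add: tab_at_def d'_def)
    have mat: "ma_at d' w ?bs (B i) N A" if "i < 10" "T ! i = ma (dW d) (dga d) N A"
      "(N, A) \<in> {(dNB d, Fh d h), (dNB d, Pu d h c), (dNB d, \<lambda>j. Zc d h (j * dbe d)), (dNC d, Ic d h), (dNC d, Hp d h)}" for i N A
      using sT[OF that(1)] Bt(1)[OF that(1)] that(2) bspec[OF mas that(3)] by (simp add: ma_at_def d'_def)
    show ?thesis unfolding dms_ok_def
    proof (intro conjI)
      show "seq_ok d' h c" "\<forall>gs\<in>gdom d'. bits (c gs) + 3 \<le> w" using so cw by (simp_all add: d'_def)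
      show "bHR d' + length (cat (hrec d' h) (dU d' div dg d' + 1)) < 2 ^ w" "sub ?bs (bHR d') (cat (hrec d' h) (dU d' div dg d' + 1))"
        using sT[of 8] Bt(1)[of 8] Ti(9) by (simp_all add: d'_def)
      show "sub ?bs (4 * bC d') (cat (rcd d' h c) (nb d'))" using sC by (simp add: d'_def)
      show "bC d' + Pu d' h c (nb d') < 2 ^ w" using t(2) Ct by (simp add: d'_def)
      show "tab_at d' w ?bs (bS d') (dNI d' * dbe d') (tabS d' c)" "tab_at d' w ?bs (bZt d') (dNI d' * dbe d') (tabZ d' c)" "tab_at d' w ?bs (bR d') (dNI d' * dD d') (tabR d' c)"
        using tab[OF _ Ti(1)] tab[OF _ Ti(2)] tab[OF _ Ti(3)] by (simp_all add: d'_def)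
      show "ma_at d' w ?bs (bF d') (dNB d') (Fh d' h)" "ma_at d' w ?bs (bP d') (dNB d') (Pu d' h c)" "ma_at d' w ?bs (bZ d') (dNB d') (\<lambda>j. Zc d' h (j * dbe d'))"
        "ma_at d' w ?bs (bI d') (dNC d') (Ic d' h)" "ma_at d' w ?bs (bH d') (dNC d') (Hp d' h)"
        using mat[OF _ Ti(4)] mat[OF _ Ti(5)] mat[OF _ Ti(6)] mat[OF _ Ti(7)] mat[OF _ Ti(8)] by (simp_all add: d'_def)
    qed (use nums in \<open>simp_all add: d'_def\<close>)
  qed
  have "top_ok d' c P s e (B 9) ys w ?bs"
    unfolding top_ok_def using dms ys sT[of 9] Bt(1)[of 9] Ti(10) length_low[OF ys(4)] by (simp add: d'_def h_def)
  moreover have "hdr_ok w ?bs Wp (plist d' P s e (B 9))"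
  proof -
    have "sub ?bs 0 X" using sub_prefix[of "[]" X] by simp
    moreover have "x < 2 ^ Wp \<and> x < 2 ^ w" if x: "x \<in> set (plist d' P s e (B 9))" for x
    proof -
      have "set (plist d' P s e (B 9)) \<subseteq> set ps \<union> B ` {..<10} \<union> {C}" by (auto simp: plist_def ps_def d'_def)
      then consider "x \<in> set ps" | "x \<le> t" using x Bt(2) Ct by blast
      then show ?thesis using ps t by cases auto
    qed
    ultimately show ?thesis unfolding hdr_ok_def X_def using Wp by blast
  qed
  moreover have "length ?bs \<le> t + 4 * Pu d h c (nb d)" using C4 t' lX lrc by (simp add: Z_def)
  ultimately show ?thesis using d'_def bu_simps(2) by metis
qed

section \<open>Large multisets\<close>

text \<open>About a quarter of lg lg n: the same quarter as for bins, applied to the bit length of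
  \<open>n\<close>, so that \<open>2 ^ (4 * bof n)\<close> does not exceed lg n.\<close>

definition bof :: "nat \<Rightarrow> nat" where "bof n = tau (bits n - 1)"

text \<open>9000 exceeds 8000 for the five directories, 33 for explicit cells, 1 for tables, 40 for
  codes and 4 for the change of universe. The header contributes \<open>132 * bits n + 2116\<close>,
  and the step from entropy to binomial coefficient \<open>2 * bits n\<close>.\<close>

definition slack :: "nat \<Rightarrow> real" where
  "slack n = 9000 * (real (bof n) + 1) * (real n / 2 ^ (bof n div 2)) + 134 * real (bits n) + 2116"

text \<open>About lg lg m; the maximum keeps it positive for \<open>m = 1\<close>.\<close>

definition lam :: "nat \<Rightarrow> nat" where "lam m = bits (max 1 (bits (m - 1)))"

locale large =
  fixes ys :: "nat list" and m w :: nat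
  assumes ys: "sorted ys" "set ys \<subseteq> {..<m}" and m: "0 < m" "m + length ys \<le> 2 ^ w" and w: "64 \<le> w" and b0: "100000 \<le> bof (length ys)"
begin

definition n where "n = length ys"
definition N where "N = bits n"
definition b where "b = bof n"
text \<open>If positive, the largest exponent with \<open>2 ^ s * n * 2 ^ b <= m\<close>. Then
  \<open>U\<close> lies between \<open>n * 2 ^ b\<close> and twice that: the lower bound makes zero
  gaps expensive in the ideal code, the upper bound keeps the directories small.\<close>

definition s where "s = (if m < n * 2 ^ b then 0 else bits (m div (n * 2 ^ b)) - 1)"
definition U where "U = (m - 1) div 2 ^ s + 1"
definition d where "d = \<lparr>dn = n, dU = U, dbe = 2 ^ (3 * b), dg = 2 ^ (2 * b), dD = 2 ^ (32 * b), dW = 4 * N, dga = 2 ^ (4 * b),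
  dNB = (n div 2 ^ (3 * b) + 1 + 2) div 2 ^ (4 * b) + 1, dNC = (U div 2 ^ (2 * b) + 2) div 2 ^ (4 * b) + 1, dNI = 2 ^ (33 * b * 2 ^ (3 * b)),
  bS = 0, bZt = 0, bR = 0, bF = 0, bP = 0, bZ = 0, bI = 0, bH = 0, bHR = 0, bC = 0\<rparr>"
definition h where "h = hf s U ys"
text \<open>The part of the extra space \<open>e\<close> that the block codes pay for; the rest,
  \<open>lam m div n\<close> for each of at most \<open>n\<close> positions, adds up to
  \<open>lam m\<close>. Without low bits no extra space is needed.\<close>

definition e1 where "e1 = (if s = 0 then 0 else b div 4)"
definition e where "e = (if s = 0 then 0 else b div 4 + lam m div n)"
text \<open>With this weight a zero gap costs at most \<open>b div 2\<close> bits, while all other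
  gaps lose only O(1 / 2^(b/2)) bits each.\<close>

definition ep :: real where "ep = 1 / 2 ^ (b div 2)"

lemma d_simps: "dn d = n" "dU d = U" "dbe d = 2 ^ (3 * b)" "dg d = 2 ^ (2 * b)" "dD d = 2 ^ (32 * b)" "dW d = 4 * N" "dga d = 2 ^ (4 * b)"
  "dNB d = (nb d + 2) div 2 ^ (4 * b) + 1" "dNC d = (U div 2 ^ (2 * b) + 2) div 2 ^ (4 * b) + 1" "dNI d = 2 ^ (33 * b * 2 ^ (3 * b))"
  by (simp_all add: d_def nb_def)

lemma b: "100000 \<le> b" "50 \<le> b" "200 \<le> b" using b0 by (simp_all add: b_def n_def)

lemma N: "2 ^ (4 * b) \<le> N - 1" "0 < N" "N \<le> 2 ^ (4 * b + 4)" "n < 2 ^ N" "0 < n" "2 ^ 2 ^ (4 * b) \<le> n"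
proof -
  have bt: "b = tau (N - 1)" by (simp add: b_def N_def bof_def)
  then have N1: "0 < N - 1" using b by (cases "N - 1") (auto simp: tau_def)
  show 1: "2 ^ (4 * b) \<le> N - 1" unfolding bt by (rule tau_bound(1)[OF N1])
  show "0 < N" using N1 by simp
  have "N - 1 < 2 ^ (4 * b + 4)" unfolding bt by (rule tau_bound)
  then show "N \<le> 2 ^ (4 * b + 4)" by linarith
  show "n < 2 ^ N" unfolding N_def by (rule less_bits)
  show n0: "0 < n" using N1 by (cases n) (auto simp: N_def)
  have "(2::nat) ^ 2 ^ (4 * b) \<le> 2 ^ (N - 1)" using 1 by (intro power_increasing) auto
  then show "2 ^ 2 ^ (4 * b) \<le> n" using bits_ge[OF n0] unfolding N_def by linarith
qed

lemma nw: "n < 2 ^ w" "m < 2 ^ w" "m \<le> 2 ^ w" "N \<le> w" "m + n \<le> 2 ^ w"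
proof -
  have mn: "m + n \<le> 2 ^ w" using m by (simp add: n_def)
  then show "n < 2 ^ w" "m < 2 ^ w" "m \<le> 2 ^ w" "m + n \<le> 2 ^ w" using m N(5) by linarith+
  then show "N \<le> w" unfolding N_def by (intro bits_le)
qed

lemmas b4 = pow_4b_aux[OF b(2)]

lemma s_up: "m < 2 * 2 ^ s * (n * 2 ^ b)" and s_lo: "s = 0 \<or> 2 ^ s * (n * 2 ^ b) \<le> m"
proof -
  let ?k = "n * 2 ^ b"
  have k: "0 < ?k" using N by simp
  have "m < 2 * 2 ^ s * ?k \<and> (s = 0 \<or> 2 ^ s * ?k \<le> m)"
  proof (cases "m < ?k")
    case True then show ?thesis by (auto simp: s_def)
  next
    case False
    let ?q = "m div ?k"
    have q: "0 < ?q" using False k by (simp add: div_greater_zero_iff)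
    have s: "s = bits ?q - 1" using False by (simp add: s_def)
    have "2 ^ s \<le> ?q" unfolding s by (rule bits_ge[OF q])
    then have 1: "2 ^ s * ?k \<le> m" using mult_le_mono1[of "2 ^ s" ?q ?k] div_times_less_eq_dividend[of m ?k] by linarith
    have "?q < 2 ^ bits ?q" by (rule less_bits)
    moreover have "(2::nat) ^ bits ?q = 2 * 2 ^ s" using bits_pos[OF q] unfolding s by (simp flip: power_Suc)
    ultimately have "(?q + 1) * ?k \<le> 2 * 2 ^ s * ?k" by (intro mult_le_mono1) simp
    moreover have "m < (?q + 1) * ?k" using dividend_less_times_div[OF k, of m] by (simp add: algebra_simps)
    ultimately show ?thesis using 1 by linarith
  qed
  then show "m < 2 * 2 ^ s * (n * 2 ^ b)" "s = 0 \<or> 2 ^ s * (n * 2 ^ b) \<le> m" by auto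
qed

lemma U: "U \<le> m" "U \<le> 2 * (n * 2 ^ b)" "0 < U" "x < m \<Longrightarrow> x div 2 ^ s < U" "s \<noteq> 0 \<Longrightarrow> n * 2 ^ b \<le> U"
proof -
  have "(m - 1) div 2 ^ s \<le> m - 1" by simp
  then show "U \<le> m" using m unfolding U_def by linarith
  have "m - 1 < 2 * (n * 2 ^ b) * 2 ^ s" using s_up by (simp add: mult_ac)
  then have "(m - 1) div 2 ^ s < 2 * (n * 2 ^ b)" by (rule less_mult_imp_div_less)
  then show "U \<le> 2 * (n * 2 ^ b)" unfolding U_def by linarith
  show "0 < U" by (simp add: U_def)
  show "x div 2 ^ s < U" if "x < m" using that div_le_mono[of x "m - 1" "2 ^ s"] unfolding U_def by linarith
  assume "s \<noteq> 0"
  then have "2 ^ s * (n * 2 ^ b) \<le> m" using s_lo by simp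
  also have "\<dots> \<le> 2 ^ s * U" using dividend_less_times_div[of "2 ^ s" "m - 1"] by (simp add: U_def algebra_simps)
  finally show "n * 2 ^ b \<le> U" by simp
qed

lemma s_le: "s \<le> w" "s < 2 ^ lam m"
proof -
  have 1: "s \<le> bits (m - 1)"
  proof (cases "s = 0")
    case False
    have "2 ^ s * 2 \<le> 2 ^ s * (n * 2 ^ b)"
      using N(5) b4(4) mult_le_mono[of 1 n 2 "2 ^ b"] by (intro mult_le_mono2) simp
    then have "2 ^ s \<le> m - 1" using False s_lo one_le_power[of "2::nat" s] by linarith
    then have "2 ^ s < (2::nat) ^ bits (m - 1)" using less_bits[of "m - 1"] by linarith
    then show ?thesis by simp
  qed simp
  moreover have "bits (m - 1) \<le> w" using nw by (intro bits_le) simp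
  ultimately show "s \<le> w" by simp
  have "s \<le> max 1 (bits (m - 1))" using 1 by simp
  then show "s < 2 ^ lam m" unfolding lam_def using less_bits le_less_trans by blast
qed

lemma lam_le: "lam m \<le> w" "0 < lam m"
proof -
  have "bits (m - 1) \<le> w" using nw by (intro bits_le) simp
  then have "max 1 (bits (m - 1)) \<le> w" using w by simp
  then show "lam m \<le> w" unfolding lam_def using bits_le_self le_trans by blast
  show "0 < lam m" unfolding lam_def by (rule bits_pos) simp
qed

lemma ep: "0 < ep" "ep \<le> 1 / 4"
proof -
  have "(2::real) ^ 2 \<le> 2 ^ (b div 2)" using b by (intro power_increasing) auto
  then show "0 < ep" "ep \<le> 1 / 4" by (auto simp: ep_def field_simps)
qed

lemma ex_codes:
  obtains c where "inj_on c (gdom d)" "\<And>gs. gs \<in> gdom d \<Longrightarrow> c gs < dNI d" "\<And>gs. gs \<in> gdom d \<Longrightarrow> bits (c gs) \<le> 33 * b * 2 ^ (3 * b)"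
    "\<And>gs. gs \<in> gdom d \<Longrightarrow> real (bits (c gs)) \<le> 1 + sum_list (map (\<lambda>x. - log 2 (pg n U (dD d) ep x)) gs)"
proof -
  have D: "0 < dD d" by (simp add: d_simps)
  note pgf = pg_facts[OF N(5) U(3) D ep]
  obtain c where c: "inj_on c (gdom d)" "\<And>gs. gs \<in> gdom d \<Longrightarrow> real (bits (c gs)) \<le> 1 + sum_list (map (\<lambda>x. - log 2 (pg n U (dD d) ep x)) gs)"
    using ex_block_code[of "dD d" "pg n U (dD d) ep" "dbe d - 1"] pgf(1,2) unfolding gdom_def by blast
  have bc: "bits (c gs) \<le> 33 * b * 2 ^ (3 * b)" if gs: "gs \<in> gdom d" for gs
  proof -
    \<comment> \<open>The uniform admixture bounds the code of a single gap by
      \<open>32 * b + b div 2\<close> bits; 33 leaves room for the additional bit of the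
      block.\<close>
    have "log 2 (real (dD d) / ep) = log 2 (2 ^ (32 * b + b div 2))" by (simp add: d_simps ep_def power_add)
    also have "\<dots> = real (32 * b + b div 2)" by (subst log_nat_power) auto
    finally have l: "- log 2 (pg n U (dD d) ep x) \<le> real (33 * b)" for x using pgf(3)[of x] by linarith
    have "sum_list (map (\<lambda>x. - log 2 (pg n U (dD d) ep x)) gs) \<le> sum_list (map (\<lambda>x. real (33 * b)) gs)" by (intro sum_list_mono l)
    also have "\<dots> = real (length gs) * real (33 * b)" by (simp add: sum_list_triv)
    finally have "real (bits (c gs)) \<le> real (1 + length gs * (33 * b))" using c(2)[OF gs] by simp
    then have "bits (c gs) \<le> 1 + length gs * (33 * b)" by (simp only: of_nat_le_iff)
    also have "\<dots> \<le> (length gs + 1) * (33 * b)" using b by simp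
    also have "length gs + 1 = 2 ^ (3 * b)" using gs by (simp add: gdom_def d_simps)
    finally show ?thesis by (simp add: mult.commute)
  qed
  moreover have "c gs < dNI d" if "gs \<in> gdom d" for gs
    unfolding d_simps using less_bits[of "c gs"] power_increasing[OF bc[OF that], of "2::nat"] by linarith
  ultimately show thesis using that c by blast
qed

lemma seq_ok_h: "inj_on c (gdom d) \<Longrightarrow> (\<And>gs. gs \<in> gdom d \<Longrightarrow> c gs < dNI d) \<Longrightarrow> seq_ok d h c"
proof -
  assume c: "inj_on c (gdom d)" "\<And>gs. gs \<in> gdom d \<Longrightarrow> c gs < dNI d"
  have lt: "h i < U" if "i < n" for i
  proof -
    have "ys ! i < m" using ys(2) nth_mem[of i ys] that unfolding n_def by blast
    then show ?thesis using that U(4) by (simp add: h_def hf_def n_def)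
  qed
  have ge: "h i = U" if "\<not> i < n" for i using that by (simp add: h_def hf_def n_def)
  have "h i \<le> h j" if "i \<le> j" for i j
  proof (cases "j < n")
    case True then show ?thesis using that sorted_nth_mono[OF ys(1), of i j] by (simp add: h_def hf_def n_def div_le_mono)
  next
    case False then show ?thesis using ge[of j] ge[of i] lt[of i] by (cases "i < n") auto
  qed
  then have "mono h" by (simp add: mono_def)
  then show ?thesis unfolding seq_ok_def using c lt ge N(2) by (auto simp: d_simps)
qed

lemma space_h: "seq_ok d h c \<Longrightarrow> space d h c b"
proof (unfold_locales)
  show "dW d \<le> 2 ^ (4 * b + 6)" using N(3) by (simp add: d_simps power_add)
  show "dU d \<le> 3 * dn d * 2 ^ b" using U(2) by (simp add: d_simps)
qed (use b N(6) in \<open>auto simp: d_simps\<close>)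

text \<open>Scanned bins and bins without low bits need just \<open>s\<close> bits per element. A
  larger bin has extra space at half of its positions or more, and \<open>e\<close> bits at each of
  these cover twice the overhead per element.\<close>

lemma fits:
  assumes so: "seq_ok d h c" and P: "\<forall>v. node_ok P w s (bin s ys v)" "2 * (e0 P + 96 * ed P) \<le> b div 4 + lam m div n" and v: "v < dU d"
  shows "length (enc A0 P s (bin s ys v)) \<le> la d h s e (v + 1) - la d h s e v"
proof -
  let ?k = "length (bin s ys v)"
  have cv: "cv d h x = cnt (\<lambda>x. x div 2 ^ s) ys x" for x unfolding h_def by (rule cv_hf) (simp add: d_simps n_def)
  have k: "?k = cv d h (v + 1) - cv d h v" unfolding cv by (rule length_seg)
  have le: "cv d h v \<le> cv d h (v + 1)" by (rule cv_mono) simp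
  have Zle: "Zc d h (cv d h v) \<le> Zc d h (cv d h (v + 1))" by (rule Zc_mono[OF le])
  have la: "la d h s e (v + 1) - la d h s e v = s * ?k + e * (Zc d h (cv d h (v + 1)) - Zc d h (cv d h v))"
    unfolding la_def k using le Zle by (simp add: diff_mult_distrib2 mult_le_mono2)
  show ?thesis
  proof (cases "s = 0 \<or> ?k \<le> K0")
    case True
    have "length (enc A0 P s (bin s ys v)) \<le> s * ?k" using True by (auto simp: A0_def eval_nat_numeral plain_def)
    then show ?thesis unfolding la by simp
  next
    case False
    have "length (enc A0 P s (bin s ys v)) \<le> ?k * (s + e0 P + A0 * ed P)" using length_enc_le[of P w s "bin s ys v" A0] P(1) by simp
    also have "\<dots> = s * ?k + ?k * (e0 P + 96 * ed P)" by (simp add: algebra_simps A0_def)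
    also have "?k * (e0 P + 96 * ed P) \<le> e * (Zc d h (cv d h (v + 1)) - Zc d h (cv d h v))"
    proof -
      have "16 \<le> dbe d" using power_increasing[of 4 "3 * b" "2::nat"] b by (simp add: d_simps)
      then have "?k \<le> 2 * (Zc d h (cv d h (v + 1)) - Zc d h (cv d h v))" using False by (intro slots_ge[OF so v k]) (auto simp: K0_def)
      then have "?k * (e0 P + 96 * ed P) \<le> 2 * (Zc d h (cv d h (v + 1)) - Zc d h (cv d h v)) * (e0 P + 96 * ed P)" by (rule mult_le_mono1)
      also have "\<dots> = 2 * (e0 P + 96 * ed P) * (Zc d h (cv d h (v + 1)) - Zc d h (cv d h v))" by (simp only: mult_ac)
      also have "\<dots> \<le> e * (Zc d h (cv d h (v + 1)) - Zc d h (cv d h v))" using P(2) False by (intro mult_le_mono1) (simp add: e_def)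
      finally show ?thesis .
    qed
    finally show ?thesis unfolding la by simp
  qed
qed

lemma header_small: "300000 * w \<le> 2 ^ w" "132 * b \<le> w" "4 * N \<le> n" "b \<le> N"
proof -
  have "2 ^ b \<le> (2::nat) ^ (4 * b)" by (rule power_increasing) auto
  then show bN: "132 * b \<le> w" "b \<le> N" using b4(1) N(1) nw by linarith+
  then have 3: "300000 \<le> w" using b by linarith
  then have "300000 * w \<le> w * w" by (rule mult_le_mono1)
  then show "300000 * w \<le> 2 ^ w" using square_le_pow2[of w] 3 by linarith
  have "132 * b < N" using N(1,2) b4(1) \<open>2 ^ b \<le> 2 ^ (4 * b)\<close> by linarith
  then have N16: "16 \<le> N - 1" using b by linarith
  have "4 * (x + 1) \<le> 2 ^ x" if "16 \<le> x" for x :: nat using that by (induction x rule: dec_induct) auto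
  from this[OF N16] have "4 * N \<le> 2 ^ (N - 1)" using N(2) by simp
  also have "\<dots> \<le> n" unfolding N_def by (rule bits_ge[OF N(5)])
  finally show "4 * N \<le> n" .
qed

text \<open>Code lengths plus \<open>e1\<close> bits per repetition give the entropy for
  \<open>U\<close>, hence lg C(U+n,n); adding \<open>s * n\<close> gives lg C(m+n,n) up to O(n /
  2^b). Besides this total, every address and parameter has to fit into a word and into a header
  field.\<close>

lemma ex_large:
  "\<exists>bs d c P s e bL Wp. top_ok d c P s e bL ys w bs \<and> hdr_ok w bs Wp (plist d P s e bL) \<and> (\<forall>x<m. x div 2 ^ s < dU d) \<and>
     real (length bs) \<le> log 2 (real (m + length ys choose length ys)) + slack (length ys) + 133 * real (lam m)"
proof -
  obtain c where c: "inj_on c (gdom d)" "\<And>gs. gs \<in> gdom d \<Longrightarrow> c gs < dNI d" "\<And>gs. gs \<in> gdom d \<Longrightarrow> bits (c gs) \<le> 33 * b * 2 ^ (3 * b)"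
    "\<And>gs. gs \<in> gdom d \<Longrightarrow> real (bits (c gs)) \<le> 1 + sum_list (map (\<lambda>x. - log 2 (pg n U (dD d) ep x)) gs)"
    using ex_codes by blast
  have so: "seq_ok d h c" by (rule seq_ok_h[OF c(1,2)])
  interpret S: space d h c b by (rule space_h[OF so])
  have Sn: "S.n = n" by (simp add: d_simps)
  define Y where "Y = real n / 2 ^ (b div 2)"
  have SY: "S.Y = Y" unfolding S.Y_def Y_def Sn ..
  obtain P where P: "\<And>xs. sorted xs \<Longrightarrow> set xs \<subseteq> set ys \<Longrightarrow> length xs \<le> n \<Longrightarrow> (\<forall>x\<in>set xs. \<forall>y\<in>set xs. x div 2 ^ s = y div 2 ^ s) \<Longrightarrow> node_ok P w s xs"
    "2 * (e0 P + 96 * ed P) \<le> b div 4 + lam m div n" "\<forall>f\<in>{pq, pq', pu, ph, pa, pb}. f P < 2 ^ w \<and> f P < 2 ^ (2 * N + lam m + 8)"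
    using ex_prm[OF w _ N(5) nw(1) ys(2) m(1) nw(3) s_le(1) N_def N(3) b(1) refl lam_def] by (metis n_def)
  have bin: "\<forall>v. node_ok P w s (bin s ys v)"
  proof
    fix v
    have "sorted (map (\<lambda>x. x div 2 ^ s) ys)" using ys(1) by (auto simp: sorted_iff_nth_mono intro: div_le_mono)
    then have set: "set (bin s ys v) = {x \<in> set ys. x div 2 ^ s = v}" by (rule set_seg)
    have "length (bin s ys v) \<le> n" using length_seg[of "\<lambda>x. x div 2 ^ s" ys v] cnt_le[of "\<lambda>x. x div 2 ^ s" ys "v + 1"] unfolding n_def by linarith
    then show "node_ok P w s (bin s ys v)" using set by (intro P(1) sorted_seg ys) auto
  qed
  have fit: "\<forall>v<dU d. length (enc A0 P s (bin s ys v)) \<le> la d h s e (v + 1) - la d h s e v" using fits[OF so bin P(2)] by blast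
  have codes: "real (4 * Pu d h c (nb d)) + real e1 * real (Zc d h (nb d * dbe d)) \<le>
    real n * log 2 (real (U + n) / real n) + real U * log 2 (real (U + n) / real U) + 40 * Y"
    using S.length_codes[of e1, unfolded Sn d_simps(2), folded ep_def, OF c(4)] U SY by (auto simp: e1_def)
  have Y0: "0 \<le> Y" "100000 * (real b + 1) * Y \<le> real n" using S.Y_small[OF b(3)] SY Sn by (simp_all add: Y_def)
  have bY: "Y * 1 \<le> Y * (real b + 1)" using Y0 by (intro mult_left_mono) auto
  have XY: "(real b + 1) * S.X \<le> (real b + 1) * Y" "S.X \<le> Y" "S.X * 1 \<le> S.X * (real b + 1)" using S.X_le_Y SY S.X_pos by (auto intro: mult_left_mono)
  define x where "x = (real b + 1) * S.X"
  define y where "y = (real b + 1) * Y"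
  have y1: "100000 * y \<le> real n" "Y \<le> y" "S.X \<le> x" "x \<le> y" using Y0 bY XY by (simp_all add: x_def y_def mult_ac)
  then have y: "100000 * y \<le> real n" "Y \<le> y" "0 \<le> y" "S.X \<le> y" "x \<le> y" "S.X \<le> x" "0 < x" using Y0(1) XY(2) S.X_pos by linarith+
  have nZ: "real n + real m \<le> 2 ^ w" using nw(5)[folded of_nat_le_iff[where 'a = real]] by simp
  have UZ: "real U \<le> real m" using U by simp
  \<comment> \<open>A rough bound that ignores the value of the entropy; it is all that word sizes
    and directories require.\<close>
  have Pub: "4 * real (Pu d h c (nb d)) \<le> real U + real n + 40 * Y"
    using codes S.entropy_le[unfolded Sn d_simps(2), OF U(3)] by simp (smt (verit) of_nat_0_le_iff mult_nonneg_nonneg)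
  have Pu2: "real (Pu d h c (nb d)) \<le> real (dU d) + 2 * real S.n" using Pub y unfolding Sn d_simps(2) by linarith
  note bounds = S.directory_bounds[OF Pu2, unfolded Sn]
  have la: "real (la d h s e (dU d)) \<le> real s * real n + real e * real (Zc d h (nb d * dbe d))"
  proof -
    have "cv d h (dU d) \<le> n" using cv_le[of d h] by (simp add: d_simps)
    moreover have "Zc d h (cv d h (dU d)) \<le> Zc d h (nb d * dbe d)" using cv_le[of d h "dU d"] S.nb_be(2) by (intro Zc_mono) linarith
    ultimately have "la d h s e (dU d) \<le> s * n + e * Zc d h (nb d * dbe d)" unfolding la_def by (intro add_mono mult_le_mono2)
    then show ?thesis by (simp only: flip: of_nat_mult of_nat_add of_nat_le_iff[where 'a = real])
  qed
  define z where "z = Zc d h (nb d * dbe d)"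
  have z: "z \<le> n" unfolding z_def using S.Zc_le Sn by simp
  have ez: "e * z \<le> e1 * z + lam m" "e \<le> b + lam m"
  proof -
    have "lam m div n * z \<le> lam m div n * n" using z by (rule mult_le_mono2)
    then have "lam m div n * z \<le> lam m" using div_times_less_eq_dividend[of "lam m" n] by linarith
    then show "e * z \<le> e1 * z + lam m" by (simp add: e_def e1_def distrib_right)
    show "e \<le> b + lam m" by (auto simp: e_def intro!: add_mono)
  qed
  \<comment> \<open>Header fields must hold addresses up to \<open>t\<close>, which is below a
    constant times \<open>2 ^ (2 * N + 2 * lam m)\<close>, and the moduli. Their width depends on lg
    n and lg lg m only, not on \<open>w\<close>.\<close>
  define Wp where "Wp = 4 * N + 4 * lam m + 64"
  define t where "t = 3 * bits Wp + 4 + 30 * Wp + length (concat (segs d h c P s e ys))"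
  have segs: "real (length (concat (segs d h c P s e ys))) \<le> 8034 * y + real (la d h s e (dU d))"
  proof -
    have "real (length (concat (segs d h c P s e ys))) = real ((2 * (dNI d * dbe d) + dNI d * dD d) * dW d) +
      (real (length (ma (dW d) (dga d) (dNB d) (Fh d h))) + real (length (ma (dW d) (dga d) (dNB d) (Pu d h c))) +
      real (length (ma (dW d) (dga d) (dNB d) (\<lambda>j. Zc d h (j * dbe d)))) + real (length (ma (dW d) (dga d) (dNC d) (Ic d h))) +
      real (length (ma (dW d) (dga d) (dNC d) (Hp d h)))) + real (length (cat (hrec d h) (dU d div dg d + 1))) + real (la d h s e (dU d))"
      unfolding segs_def length_low[OF fit, symmetric] by (simp add: algebra_simps)
    moreover have "8000 * (real b + 1) * S.X = 8000 * x" "33 * (real b + 1) * S.X = 33 * x" by (simp_all add: x_def)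
    ultimately show ?thesis using S.length_tables S.length_directories[OF Pu2] S.length_hrec[of "dU d div dg d + 1"] y by linarith
  qed
  have "bits Wp \<le> Wp" by (rule bits_le_self)
  then have "3 * bits Wp + 4 + 30 * Wp \<le> 132 * N + 132 * lam m + 2116" unfolding Wp_def by simp
  then have "real t \<le> real (132 * N + 132 * lam m + 2116) + real (length (concat (segs d h c P s e ys)))" unfolding t_def by (simp only: of_nat_add[symmetric] of_nat_le_iff add_le_cancel_right)
  then have t1: "real t \<le> 132 * real N + 132 * real (lam m) + 2116 + 8034 * y + real s * real n + real e * real z"
    using segs la unfolding z_def by simp
  have tot: "real (t + 4 * Pu d h c (nb d)) \<le> log 2 (real (m + n choose n)) + slack n + 133 * real (lam m)"
  proof -
    have "real (e * z) \<le> real (e1 * z + lam m)" using ez(1) by (simp only: of_nat_le_iff)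
    moreover have "real n * log 2 (real (U + n) / real n) + real U * log 2 (real (U + n) / real U) \<le> log 2 (real (U + n choose n)) + log 2 (real (U + n + 1))"
      by (rule entropy_le_log_binomial[OF N(5) U(3)])
    moreover have "real s * real n + log 2 (real (U + n choose n)) \<le> log 2 (real (m + n choose n)) + 4 * real n / 2 ^ b"
    proof (rule log_binomial_scale[OF N(5) _ U_def m(1)])
      show "s = 0 \<or> 2 ^ s * real n * 2 ^ b \<le> real m"
      proof (cases "s = 0")
        case False
        then have "real (2 ^ s * (n * 2 ^ b)) \<le> real m" using s_lo by (simp only: of_nat_le_iff) simp
        then show ?thesis by (simp add: mult.assoc)
      qed simp
    qed simp
    moreover have "4 * real n / 2 ^ b \<le> 4 * y" using y(4) unfolding S.X_def Sn by simp
    moreover have "log 2 (real (U + n + 1)) \<le> 2 * real N"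
    proof -
      have "5 * 2 ^ b \<le> n"
      proof -
        have "5 * 2 ^ b \<le> 2 ^ b * (2::nat) ^ b" using b4(4) by (intro mult_le_mono1) linarith
        also have "\<dots> \<le> n" using S.pow_le_n[of "b + b"] Sn by (simp add: power_add)
        finally show ?thesis .
      qed
      then have "n * (5 * 2 ^ b) \<le> n * n" by (rule mult_le_mono2)
      moreover have "n \<le> n * 2 ^ b" by simp
      ultimately have "U + n + 1 \<le> n * n" using U(2) N(5) by linarith
      also have "\<dots> \<le> 2 ^ N * 2 ^ N" using N(4) by (intro mult_le_mono) auto
      finally have "real (U + n + 1) \<le> real (2 ^ (2 * N))" by (simp only: of_nat_le_iff mult_2 power_add)
      then have "log 2 (real (U + n + 1)) \<le> log 2 (2 ^ (2 * N))" by (subst log_le_cancel_iff) auto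
      also have "\<dots> = real (2 * N)" by (subst log_nat_power) auto
      finally show ?thesis by simp
    qed
    moreover have "slack n = 9000 * y + 134 * real N + 2116" unfolding slack_def y_def Y_def b_def N_def by simp
    ultimately show ?thesis using t1 codes[folded z_def] y by simp
  qed
  \<comment> \<open>The codes may have more than \<open>2 ^ w\<close> bits when \<open>m + n\<close>
    is close to \<open>2 ^ w\<close>. Counted in units of four bits they use about a quarter of the
    address range, and the low bits, present only if \<open>m >= n * 2 ^ b\<close>, use a small
    fraction.\<close>
  have tw: "t + Pu d h c (nb d) < 2 ^ w"
  proof -
    have h1: "1000 * (132 * N + 132 * lam m + 2116) \<le> 2 ^ w" using header_small(1) nw(4) lam_le(1) header_small(2) b(1) by simp
    have h2: "1000 * (s * n) \<le> 2 ^ w \<and> 100 * (e * z) \<le> 2 ^ w"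
    proof (cases "s = 0")
      case True then show ?thesis by (simp add: e_def)
    next
      case False
      then have sm: "2 ^ s * (n * 2 ^ b) \<le> 2 ^ w" using s_lo nw by linarith
      have "s * n * 1000 \<le> 2 ^ s * n * 2 ^ b" using less_exp[of s] b4(4) by (intro mult_le_mono) auto
      also have "\<dots> = 2 ^ s * (n * 2 ^ b)" by (simp only: mult_ac)
      finally have 1: "1000 * (s * n) \<le> 2 ^ w" using sm by linarith
      have "132 * b * n \<le> 2 ^ b * n" by (intro mult_le_mono1 b4)
      moreover have "2 ^ b * n \<le> 2 ^ s * (n * 2 ^ b)" by simp
      moreover have "132 * b * n = 132 * (b * n)" by simp
      ultimately have 2: "132 * (b * n) \<le> 2 ^ w" using sm by linarith
      have "e1 * z \<le> b div 4 * n" using z by (intro mult_le_mono) (auto simp: e1_def)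
      moreover have "4 * (b div 4) * n \<le> b * n" by (intro mult_le_mono1) simp
      moreover have "4 * (b div 4) * n = 4 * (b div 4 * n)" by simp
      ultimately show ?thesis using 1 2 ez(1) lam_le(1) header_small(1) by linarith
    qed
    have "real (1000 * (132 * N + 132 * lam m + 2116)) \<le> real (2 ^ w)" "real (1000 * (s * n)) \<le> real (2 ^ w)" "real (100 * (e * z)) \<le> real (2 ^ w)"
      using h1 h2 by (simp_all only: of_nat_le_iff)
    then have "real t + real (Pu d h c (nb d)) < real (2 ^ w)" using t1 Pub y nZ UZ N(5) by simp
    then show ?thesis by (simp only: of_nat_add[symmetric] of_nat_less_iff)
  qed
  have tW: "t < 2 ^ Wp"
  proof -
    let ?R = "(2::nat) ^ (2 * N + 2 * lam m)"
    have R: "2 ^ (N + lam m) \<le> ?R" "2 ^ N * 2 ^ N \<le> ?R" "2 ^ N \<le> ?R" "2 ^ lam m \<le> ?R" unfolding power_add[symmetric] by (intro power_increasing; simp)+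
    have "s * n \<le> 2 ^ lam m * 2 ^ N" using s_le N by (intro mult_le_mono) auto
    then have sn: "s * n \<le> ?R" using R(1) by (simp add: power_add mult.commute)
    have "b div 4 \<le> 2 ^ N" "z \<le> 2 ^ N" using z N(4) header_small(4) less_exp[of N] div_le_dividend[of b 4] by linarith+
    then have "e1 \<le> 2 ^ N" "z \<le> 2 ^ N" by (simp_all add: e1_def)
    then have "e1 * z \<le> 2 ^ N * 2 ^ N" by (rule mult_le_mono)
    then have "e1 * z \<le> ?R" using R(2) by linarith
    moreover note sn
    moreover have "N \<le> ?R" "lam m \<le> ?R" "n \<le> ?R" "1 \<le> ?R" using less_exp[of N] less_exp[of "lam m"] N R by (linarith | simp)+
    ultimately have "132 * N + 132 * lam m + 2116 + n + s * n + e * z \<le> 2384 * ?R" using ez(1) by linarith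
    then have "real (132 * N + 132 * lam m + 2116 + n + s * n + e * z) \<le> real (2384 * ?R)" by (simp only: of_nat_le_iff)
    then have "real t \<le> real (2384 * ?R)" using t1 y by simp
    then have "t \<le> 2384 * ?R" by (simp only: of_nat_le_iff)
    also have "\<dots> < 2 ^ 12 * ?R" by simp
    also have "\<dots> = 2 ^ (2 * N + 2 * lam m + 12)" by (simp add: power_add)
    also have "\<dots> \<le> 2 ^ Wp" unfolding Wp_def by (intro power_increasing) auto
    finally show ?thesis .
  qed
  have NWp: "2 ^ N \<le> (2::nat) ^ Wp" "2 ^ N \<le> (2::nat) ^ dW d" "2 ^ N * 2 ^ N \<le> (2::nat) ^ dW d" "2 ^ N * 2 ^ N \<le> (2::nat) ^ Wp"
    unfolding Wp_def d_simps power_add[symmetric] by (intro power_increasing; simp)+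
  have small: "x < 2 ^ w \<and> x < 2 ^ Wp \<and> x < 2 ^ dW d" if "x \<le> n" for x using that nw(1) N(4) NWp by linarith
  have rsmall: "k \<le> n" if "real k \<le> 10000 * x" for k using that y by simp
  have pw: "2 ^ k \<le> n" if "k \<le> 100 * b" for k using S.pow_le_n[OF that] Sn by simp
  have Un: "U < 2 ^ N * 2 ^ N" "2 ^ (8 * b) * n < 2 ^ N * 2 ^ N"
  proof -
    have "n * (2 ^ b * 2) \<le> n * n" using pw[of "b + 1"] b by (intro mult_le_mono2) simp
    moreover have "n * n < 2 ^ N * 2 ^ N" using N(4) by (intro mult_strict_mono) auto
    moreover have "2 ^ (8 * b) * n \<le> n * n" using pw[of "8 * b"] by (intro mult_le_mono1) simp
    ultimately show "U < 2 ^ N * 2 ^ N" "2 ^ (8 * b) * n < 2 ^ N * 2 ^ N" using U(2) by linarith+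
  qed
  have NBC: "dNB d * dga d \<le> n" "dNC d * dga d \<le> n" using S.NBga(1) S.NCga(1) y by (intro rsmall, linarith)+
  have dNI: "dNI d * dbe d \<le> n" "dNI d * dD d \<le> n" "dNI d \<le> n"
  proof -
    have "(2 * (dNI d * dbe d) + dNI d * dD d) * 1 \<le> (2 * (dNI d * dbe d) + dNI d * dD d) * dW d" using N(2) by (intro mult_le_mono2) (simp add: d_simps)
    moreover have "(2 * (dNI d * dbe d) + dNI d * dD d) * dW d \<le> n" using S.length_tables y by (intro rsmall) linarith
    ultimately have "2 * (dNI d * dbe d) + dNI d * dD d \<le> n" by (simp only: mult_1_right)
    then show 1: "dNI d * dbe d \<le> n" "dNI d * dD d \<le> n" by linarith+
    then show "dNI d \<le> n" using mult_le_mono2[of 1 "dD d" "dNI d"] le_trans[of "dNI d" "dNI d * dD d" n] unfolding d_simps(5) by simp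
  qed
  have mas: "\<forall>(N, A)\<in>{(dNB d, Fh d h), (dNB d, Pu d h c), (dNB d, \<lambda>j. Zc d h (j * dbe d)), (dNC d, Ic d h), (dNC d, Hp d h)}.
      mono A \<and> A (N * dga d) < 2 ^ w \<and> A (N * dga d) < 2 ^ dW d \<and> length (ma (dW d) (dga d) N A) < 2 ^ dW d"
  proof -
    have dwA: "x < 2 ^ dW d" if "real x \<le> 2 ^ (8 * b) * real n" for x
    proof -
      have "real x \<le> real (2 ^ (8 * b) * n)" using that by simp
      then have "x \<le> 2 ^ (8 * b) * n" by (simp only: of_nat_le_iff)
      then show ?thesis using Un(2) NWp(3) by linarith
    qed
    have lm: "k < 2 ^ dW d" if "real k \<le> 1600 * (real b + 1) * S.X" for k
    proof -
      have "1600 * (real b + 1) * S.X = 1600 * x" by (simp add: x_def)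
      then have "k \<le> n" using that y by (intro rsmall) linarith
      then show ?thesis using small by blast
    qed
    have Fw: "Fh d h i < 2 ^ w" for i using h_le_U[OF so, of "i * dbe d"] U(1) nw(2) unfolding Fh_def d_simps(2) by linarith
    have Puw: "Pu d h c i < 2 ^ w" for i
    proof -
      have "Pu d h c i \<le> Pu d h c (nb d)" unfolding Pu_def by (intro sum_mono2) auto
      then show ?thesis using tw by linarith
    qed
    have Zw: "Zc d h i < 2 ^ w" "Ic d h i < 2 ^ w" for i using S.Zc_le[of i] cv_le[of d h "i * dg d"] nw(1) unfolding Ic_def d_simps(1) by linarith+
    have Hw: "Hp d h i < 2 ^ w" for i
    proof -
      have "real (Hp d h i) \<le> 33 * (real b + 1) * S.X" using S.length_hrec[of i] unfolding Hp_def length_cat .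
      moreover have "33 * (real b + 1) * S.X = 33 * x" by (simp add: x_def)
      ultimately have "Hp d h i \<le> n" using y by (intro rsmall) linarith
      then show ?thesis using small by blast
    qed
    note ml = S.length_ma_NB[unfolded Sn] S.length_ma_NC[unfolded Sn]
    show ?thesis
      using bounds(1-5) Fw Puw Zw Hw dwA[OF bounds(6)] dwA[OF bounds(7)] dwA[OF bounds(8)] dwA[OF bounds(9)] dwA[OF bounds(10)]
        lm[OF ml(1)[OF bounds(1,6)]] lm[OF ml(1)[OF bounds(2,7)]] lm[OF ml(1)[OF bounds(3,8)]] lm[OF ml(2)[OF bounds(4,9)]] lm[OF ml(2)[OF bounds(5,10)]]
      by simp
  qed
  have cw: "\<forall>gs\<in>gdom d. bits (c gs) + 3 \<le> w"
  proof
    fix gs assume "gs \<in> gdom d"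
    then show "bits (c gs) + 3 \<le> w" using c(3)[of gs] b4(2,3) b(1) N(1) nw(4) by simp
  qed
  have n35: "dbe d * dD d \<le> n" "dbe d + dg d < n" "nb d + 2 < n"
  proof -
    show "dbe d * dD d \<le> n" using pw[of "35 * b"] by (simp add: d_simps flip: power_add)
    have "dbe d + dg d \<le> 2 ^ (3 * b) + 2 ^ (3 * b)" using power_increasing[of "2 * b" "3 * b" "2::nat"] by (simp add: d_simps)
    also have "\<dots> < 2 ^ (3 * b + 2)" by simp
    also have "\<dots> \<le> n" using b by (intro pw) simp
    finally show "dbe d + dg d < n" .
    show "nb d + 2 < n" using S.NBga(2) NBC(1) by linarith
  qed
  have dgp: "0 < dga d" by (simp add: d_simps)
  have ps: "\<forall>x\<in>set [1, dn d, dU d, dbe d, dg d, dD d, dW d, dga d, dNB d, dNC d, dNI d, s, e, pq P, pq' P, pu P, ph P, pa P, pb P]. x < 2 ^ Wp \<and> x < 2 ^ w"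
  proof -
    have a: "\<forall>x\<in>set [1, dn d, dbe d, dg d, dD d, dW d, dga d, dNB d, dNC d, dNI d]. x \<le> n"
      using N(5) pw[of "3 * b"] pw[of "2 * b"] pw[of "32 * b"] pw[of "4 * b"] header_small(3) dNI(3) le_trans[OF _ NBC(1)] le_trans[OF _ NBC(2)] dgp
      by (simp add: d_simps(1-7))
    have "s < 2 ^ w" using s_le(1) less_exp[of w] by linarith
    moreover have "2 ^ lam m \<le> (2::nat) ^ Wp" unfolding Wp_def by (intro power_increasing) auto
    moreover have "e \<le> Wp" "e \<le> 2 * w" using ez(2) header_small(2,4) lam_le(1) unfolding Wp_def by linarith+
    moreover have "Wp < 2 ^ Wp" by (rule less_exp)
    ultimately have b: "x < 2 ^ Wp \<and> x < 2 ^ w" if "x = s \<or> x = e" for x using that s_le(2) header_small(1) w by (elim disjE) linarith+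
    have "2 ^ (2 * N + lam m + 8) \<le> (2::nat) ^ Wp" unfolding Wp_def by (intro power_increasing) auto
    then have p: "f P < 2 ^ Wp \<and> f P < 2 ^ w" if "f \<in> {pq, pq', pu, ph, pa, pb}" for f using P(3) that less_le_trans by blast
    have u: "dU d < 2 ^ Wp \<and> dU d < 2 ^ w" using Un(1) NWp(4) U(1) nw(2) unfolding d_simps(2) by linarith
    show ?thesis using a b p u small by auto
  qed
  have hU: "hf s (dU d) ys = h" by (simp add: h_def d_simps)
  have room: "0 < Wp" "3 * bits Wp + 1 \<le> w" "3 * bits Wp + 1 + 64 * Wp < 2 ^ w" using hdr_room[OF w, of Wp] nw(4) lam_le(1) w by (auto simp: Wp_def)
  have U2: "dU d < 2 ^ dW d" "dU d + dbe d + dg d < 2 ^ w" using Un(1) NWp(3) n35(2) U(1) nw(5) unfolding d_simps(2) by linarith+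
  have lys: "length ys = dn d" by (simp add: d_simps n_def)
  note L = layout[where d = d and ys = ys and s = s and e = e and w = w and P = P and c = c and Wp = Wp, unfolded hU, folded t_def]
  have sm: "dbe d * dD d < 2 ^ dW d" "dbe d * dD d < 2 ^ w" "dn d < 2 ^ w" "nb d + 2 < 2 ^ w" "dNI d * dbe d < 2 ^ w" "dNI d * dD d < 2 ^ w"
    using small[OF n35(1)] small[of n] small[OF less_imp_le[OF n35(3)]] small[OF dNI(1)] small[OF dNI(2)] by (simp_all add: d_simps(1))
  obtain bs d' bL where R: "top_ok d' c P s e bL ys w bs" "hdr_ok w bs Wp (plist d' P s e bL)" "dU d' = dU d" "length bs \<le> t + 4 * Pu d h c (nb d)"
    using L[OF so cw U2(1) sm(1,2) U2(2) sm(3,4) S.NBga(2) S.NCga(2) sm(5,6) mas lys ys(1) bin fit tW tw ps room] by blast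
  have "real (length bs) \<le> real (t + 4 * Pu d h c (nb d))" using R(4) by (simp only: of_nat_le_iff)
  then have "real (length bs) \<le> log 2 (real (m + length ys choose length ys)) + slack (length ys) + 133 * real (lam m)" using tot unfolding n_def by linarith
  moreover have "\<forall>x<m. x div 2 ^ s < dU d'" using U(4) R(3) by (simp add: d_simps)
  ultimately show ?thesis using R by blast
qed

end

section \<open>Rank and select in terms of the sorted list\<close>

lemma fo_sorted: "sorted ys \<Longrightarrow> x \<in> set ys \<Longrightarrow> length (filter (\<lambda>y. y < x) ys) = fo ys x"
proof (induction ys)
  case (Cons a ys)
  show ?case
  proof (cases "a = x")
    case True
    then have "filter (\<lambda>y. y < x) ys = []" using Cons.prems by (auto simp: filter_empty_conv)
    then show ?thesis using True by (simp add: fo_def)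
  next
    case False
    then have "a < x" using Cons.prems by fastforce
    then show ?thesis using False Cons by (simp add: fo_def)
  qed
qed simp

abbreviation sl :: "nat multiset \<Rightarrow> nat list" where "sl M \<equiv> sorted_list_of_multiset M"

lemma length_sl: "length (sl M) = size M" by (metis mset_sorted_list_of_multiset size_mset)

lemma mrank_eq: "mrank x M = (if fo (sl M) x < size M then int (fo (sl M) x) else -1)"
proof -
  have "size (filter_mset (\<lambda>y. y < x) M) = length (filter (\<lambda>y. y < x) (sl M))"
    by (metis mset_filter mset_sorted_list_of_multiset size_mset)
  moreover have "x \<in># M \<longleftrightarrow> fo (sl M) x < size M" using fo_less_iff[of "sl M" x] by (simp add: length_sl)
  ultimately show ?thesis using fo_sorted[of "sl M" x] fo_less_iff[of "sl M" x] by (auto simp: mrank_def length_sl)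
qed

text \<open>Equal elements share the index of their first occurrence as rank. Entry
  \<open>i - 1\<close> has rank at most \<open>i - 1\<close>, and an element of such rank first
  occurs no later than there, so it is no larger.\<close>

lemma mselect_eq: "i \<in> {1..size M} \<Longrightarrow> mselect i M = sl M ! (i - 1)"
proof -
  assume i: "i \<in> {1..size M}"
  let ?y = "sl M ! (i - 1)"
  have l: "i - 1 < length (sl M)" using i by (auto simp: length_sl)
  then have y: "?y \<in># M" by (metis nth_mem set_sorted_list_of_multiset)
  have fy: "fo (sl M) ?y \<le> i - 1"
  proof (rule ccontr)
    assume "\<not> ?thesis"
    then have "i - 1 < length (takeWhile (\<lambda>z. z \<noteq> ?y) (sl M))" by (simp add: fo_def)
    then have "takeWhile (\<lambda>z. z \<noteq> ?y) (sl M) ! (i - 1) \<noteq> ?y" using set_takeWhileD[OF nth_mem] by fastforce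
    then show False using \<open>i - 1 < length (takeWhile _ _)\<close> by (simp add: takeWhile_nth)
  qed
  show ?thesis unfolding mselect_def
  proof (rule Max_eqI)
    show "?y \<in> {x \<in> set_mset M. mrank x M \<le> int i - 1}" using y fy i l by (auto simp: mrank_eq)
    fix x assume x: "x \<in> {x \<in> set_mset M. mrank x M \<le> int i - 1}"
    then have xs: "x \<in> set (sl M)" by simp
    then have f: "fo (sl M) x < length (sl M)" by (simp add: fo_less_iff)
    then have "fo (sl M) x < i" using x i by (simp add: mrank_eq length_sl)
    then have "fo (sl M) x \<le> i - 1" by linarith
    then have "sl M ! fo (sl M) x \<le> ?y" using l by (intro sorted_nth_mono) auto
    then show "x \<le> ?y" by (simp add: fo_nth[OF xs])
  qed simp
qed

section \<open>The three representations\<close>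

text \<open>One cell per answer. The selections start right behind the \<open>m\<close> ranks, so
  the address \<open>m - 1 + i\<close> is formed from the argument \<open>m - 1\<close> without
  needing \<open>m\<close> itself.\<close>

definition tab_ok :: "nat \<Rightarrow> nat \<Rightarrow> nat multiset \<Rightarrow> bool list \<Rightarrow> bool" where
  "tab_ok w m M bs \<longleftrightarrow> (\<forall>x<m. get bs (w * x) w = nat (mrank x M mod 2 ^ w)) \<and> (\<forall>i\<in>{1..size M}. get bs (w * (m - 1 + i)) w = mselect i M)"

text \<open>The header is a tag, the field width and the address of the list. Tag 0 distinguishes
  this case from \<open>plist\<close>, which begins with 1.\<close>

definition sml_ok :: "nat \<Rightarrow> nat list \<Rightarrow> bool list \<Rightarrow> nat list \<Rightarrow> bool" where
  "sml_ok w ys bs ps \<longleftrightarrow> length ps = 3 \<and> ps ! 0 = 0 \<and> sub bs (ps ! 2) (arr (ps ! 1) ys) \<and> ps ! 2 + length ys * ps ! 1 < 2 ^ w \<and>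
     (\<forall>y\<in>set ys. y < 2 ^ (ps ! 1) \<and> y < 2 ^ w)"

definition lrg_ok :: "nat \<Rightarrow> nat \<Rightarrow> nat list \<Rightarrow> bool list \<Rightarrow> nat list \<Rightarrow> bool" where
  "lrg_ok w m ys bs ps \<longleftrightarrow> (\<exists>d c P s e bL. ps = plist d P s e bL \<and> top_ok d c P s e bL ys w bs \<and> (\<forall>x<m. x div 2 ^ s < dU d))"

text \<open>All situations in which the two fixed programs must be correct. Tabulated answers are
  recognized by the word size, the other two representations by the tag in the header.\<close>

definition states :: "nat \<Rightarrow> nat \<Rightarrow> st set" where
  "states k n0 = {Z. 0 < ww Z \<and> length (aa Z) = 4 \<and> aa Z ! 1 = size (MM Z) \<and> aa Z ! 2 = mm Z - 1 \<and> aa Z ! 3 = ww Z \<and> 0 < mm Z \<and>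
     mm Z + size (MM Z) \<le> 2 ^ ww Z \<and> set_mset (MM Z) \<subseteq> {..<mm Z} \<and>
     (if ww Z < 2 ^ k then tab_ok (ww Z) (mm Z) (MM Z) (bb Z)
      else \<exists>W ps. hdr_ok (ww Z) (bb Z) W ps \<and>
        (sml_ok (ww Z) (sl (MM Z)) (bb Z) ps \<and> size (MM Z) < n0 \<or> lrg_ok (ww Z) (mm Z) (sl (MM Z)) (bb Z) ps))}"

text \<open>The constant \<open>2 ^ k\<close> itself need not fit into a short word. Shifting
  \<open>k\<close> times by 1 and testing for zero needs only the constants 0 and 1.\<close>

lemma cmp_wide: "pos V \<Longrightarrow> (\<And>Z. Z \<in> V \<Longrightarrow> aa Z ! 3 = ww Z) \<Longrightarrow> cmpP V (\<lambda>Z. ww Z < 2 ^ k)"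
proof -
  assume V: "pos V" "\<And>Z. Z \<in> V \<Longrightarrow> aa Z ! 3 = ww Z"
  have "cmp V (\<lambda>Z. ww Z div 2 ^ k)"
  proof (induction k)
    case 0 then show ?case using cmp_ww[OF V(2)] by simp
  next
    case (Suc k)
    from cmp_shr[OF this cmp_1[OF V(1)]] show ?case by (simp add: div_mult2_eq[symmetric] mult.commute)
  qed
  then have "cmpP V (\<lambda>Z. ww Z div 2 ^ k = 0)" by (intro cmp_eq V(1) cmp_0)
  moreover have "x div 2 ^ k = 0 \<longleftrightarrow> x < 2 ^ k" for x :: nat by (simp add: div_eq_0_iff)
  ultimately show ?thesis by simp
qed

lemma cmp_all_ones: "pos V \<Longrightarrow> cmp V (\<lambda>Z. 2 ^ ww Z - 1)"
proof (rule cmp_bin[OF cmp_0 cmp_1, where f = Sub])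
  fix Z :: st
  have "(0 - 1) mod 2 ^ ww Z = (2 ^ ww Z - 1 :: int)" by (simp add: zmod_minus1)
  then show "eval_binop (ww Z) Sub 0 1 = 2 ^ ww Z - 1" by (simp add: nat_diff_distrib nat_power_eq)
qed

text \<open>The tag is read from the header and decides between scanning a list of fewer than
  \<open>n0\<close> elements and the query on the compressed structure.\<close>

lemma
  assumes "6 \<le> k" "n0 < 2 ^ 2 ^ k" and V: "V \<subseteq> states k n0" "\<And>Z. Z \<in> V \<Longrightarrow> 2 ^ k \<le> ww Z"
  shows cmp_univ_fo: "cmp V X \<Longrightarrow> (\<And>Z. Z \<in> V \<Longrightarrow> X Z < mm Z) \<Longrightarrow> cmp V (\<lambda>Z. fo (sl (MM Z)) (X Z))"
    and cmp_univ_nth: "cmp V I \<Longrightarrow> (\<And>Z. Z \<in> V \<Longrightarrow> I Z < size (MM Z)) \<Longrightarrow> cmp V (\<lambda>Z. sl (MM Z) ! I Z)"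
proof -
  let ?ys = "\<lambda>Z. sl (MM Z)"
  have k64: "64 \<le> (2::nat) ^ k" using power_increasing[OF assms(1), of "2::nat"] by simp
  have U: "aa Z ! 1 = size (MM Z)" "mm Z + size (MM Z) \<le> 2 ^ ww Z" "set (?ys Z) \<subseteq> {..<mm Z}" "0 < mm Z" if "Z \<in> V" for Z
    using V(1) that by (auto simp: states_def)
  have wf: "wf V" unfolding wf_def
  proof
    fix Z assume v: "Z \<in> V"
    have "8 \<le> ww Z" using V(2)[OF v] k64 by linarith
    then show "8 \<le> ww Z \<and> length (aa Z) = 4 \<and> aa Z ! 3 = ww Z" using V(1) v by (auto simp: states_def)
  qed
  have "\<forall>Z\<in>V. \<exists>W ps. hdr_ok (ww Z) (bb Z) W ps \<and>
        (sml_ok (ww Z) (?ys Z) (bb Z) ps \<and> size (MM Z) < n0 \<or> lrg_ok (ww Z) (mm Z) (?ys Z) (bb Z) ps)"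
    using V unfolding states_def by (fastforce simp: not_less[symmetric])
  then obtain W ps where W: "\<And>Z. Z \<in> V \<Longrightarrow> hdr_ok (ww Z) (bb Z) (W Z) (ps Z) \<and>
        (sml_ok (ww Z) (?ys Z) (bb Z) (ps Z) \<and> size (MM Z) < n0 \<or> lrg_ok (ww Z) (mm Z) (?ys Z) (bb Z) (ps Z))"
    unfolding bchoice_iff by blast
  have p: "lrg_ok w m ys bs qs \<Longrightarrow> qs ! 0 = 1 \<and> length qs = 30" for w m ys bs qs by (auto simp: lrg_ok_def plist_def)
  have c0: "cmp V (\<lambda>Z. ps Z ! 0)" by (rule cmp_hdr_ok[OF wf, where W = W]) (use W p in \<open>fastforce simp: sml_ok_def\<close>)+
  then have t: "cmpP V (\<lambda>Z. ps Z ! 0 = 0)" by (intro cmp_eq wf_pos wf cmp_0)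
  let ?S = "V \<inter> {Z. ps Z ! 0 = 0}" and ?L = "V \<inter> {Z. ps Z ! 0 \<noteq> 0}"
  have wS: "wf ?S" and wL: "wf ?L" by (intro wf_inter wf)+
  have S: "sml_ok (ww Z) (?ys Z) (bb Z) (ps Z)" "size (MM Z) < n0" "hdr_ok (ww Z) (bb Z) (W Z) (ps Z)" if "Z \<in> ?S" for Z
    using W[of Z] p[of "ww Z" "mm Z" "?ys Z" "bb Z" "ps Z"] that by auto
  have cS: "cmp ?S (\<lambda>Z. ps Z ! i)" if "i < 3" for i
    by (rule cmp_hdr_ok[OF wS, where W = W]) (use S that in \<open>auto simp: sml_ok_def\<close>)
  have nthS: "cmp A (\<lambda>Z. ?ys Z ! I Z)" if "A \<subseteq> ?S" "cmp A I" "\<And>Z. Z \<in> A \<Longrightarrow> I Z < size (MM Z)" for A I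
  proof (rule cmp_arr[OF wf_sub[OF wS that(1)] cmp_mono[OF cS[of 2] that(1)] cmp_mono[OF cS[of 1] that(1)] that(2)])
    fix Z assume v: "Z \<in> A"
    then have s: "sml_ok (ww Z) (?ys Z) (bb Z) (ps Z)" using S that(1) by blast
    have "I Z * ps Z ! 1 \<le> length (?ys Z) * ps Z ! 1" using that(3)[OF v] by (simp add: length_sl)
    then have "ps Z ! 2 + I Z * ps Z ! 1 < 2 ^ ww Z" using s unfolding sml_ok_def by linarith
    then show "sub (bb Z) (ps Z ! 2) (arr (ps Z ! 1) (?ys Z)) \<and> I Z < length (?ys Z) \<and> ?ys Z ! I Z < 2 ^ (ps Z ! 1) \<and> ?ys Z ! I Z < 2 ^ ww Z \<and> ps Z ! 2 + I Z * ps Z ! 1 < 2 ^ ww Z"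
      using s that(3)[OF v] nth_mem[of "I Z" "?ys Z"] unfolding sml_ok_def by (auto simp: length_sl simp del: set_sorted_list_of_multiset)
  qed simp_all
  have "\<forall>Z\<in>?L. \<exists>d c P s e bL. ps Z = plist d P s e bL \<and> top_ok d c P s e bL (?ys Z) (ww Z) (bb Z) \<and> (\<forall>x<mm Z. x div 2 ^ s < dU d)"
  proof
    fix Z assume v: "Z \<in> ?L"
    then have "lrg_ok (ww Z) (mm Z) (?ys Z) (bb Z) (ps Z)" using W[of Z] by (auto simp: sml_ok_def)
    then show "\<exists>d c P s e bL. ps Z = plist d P s e bL \<and> top_ok d c P s e bL (?ys Z) (ww Z) (bb Z) \<and> (\<forall>x<mm Z. x div 2 ^ s < dU d)"
      unfolding lrg_ok_def .
  qed
  then obtain d c P s e bL where L: "\<And>Z. Z \<in> ?L \<Longrightarrow> ps Z = plist (d Z) (P Z) (s Z) (e Z) (bL Z) \<and>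
       top_ok (d Z) (c Z) (P Z) (s Z) (e Z) (bL Z) (?ys Z) (ww Z) (bb Z) \<and> (\<forall>x<mm Z. x div 2 ^ s Z < dU (d Z))"
    unfolding bchoice_iff by blast
  have "hdr_ok (ww Z) (bb Z) (W Z) (plist (d Z) (P Z) (s Z) (e Z) (bL Z))" if "Z \<in> ?L" for Z using L[OF that] W[of Z] that by simp
  note cL = cmp_plist[OF wL this]
  note T = wL cL L[THEN conjunct2, THEN conjunct1]
  show "cmp V (\<lambda>Z. fo (?ys Z) (X Z))" if X: "cmp V X" "\<And>Z. Z \<in> V \<Longrightarrow> X Z < mm Z"
  proof -
    have 1: "cmp ?L (\<lambda>Z. fo (?ys Z) (X Z))" by (rule cmp_top_fo[OF T cmp_inter[OF X(1)]]) (use L X(2) in \<open>blast+\<close>)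
    have 2: "cmp ?S (\<lambda>Z. fo (?ys Z) (X Z))"
    proof (rule cmp_scan[OF wS cmp_inter[OF X(1)], where K = n0])
      show "cmp ?S (\<lambda>Z. length (?ys Z))" by (rule cmp_cong[OF cmp_arg[of 1]]) (use U in \<open>auto simp: length_sl\<close>)
      fix Z assume v: "Z \<in> ?S"
      have "(2::nat) ^ 2 ^ k \<le> 2 ^ ww Z" using V(2)[of Z] v by (intro power_increasing) auto
      then show "length (?ys Z) \<le> n0 \<and> n0 < 2 ^ ww Z" using S(2)[OF v] assms(2) unfolding length_sl by linarith
    next
      fix i assume i: "i < n0"
      show "cmp (?S \<inter> {Z. i < length (?ys Z)}) (\<lambda>Z. ?ys Z ! i)"
      proof (rule nthS)
        show "cmp (?S \<inter> {Z. i < length (?ys Z)}) (\<lambda>Z. i)"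
        proof (rule cmp_const)
          fix Z assume "Z \<in> ?S \<inter> {Z. i < length (?ys Z)}"
          then have "i < size (MM Z)" "Z \<in> V" by (auto simp: length_sl)
          then show "i < 2 ^ ww Z" using U(2)[of Z] by linarith
        qed
      qed (auto simp: length_sl)
    qed
    from cmp_if[OF t 2 1] show ?thesis by (simp only: if_cancel)
  qed
  show "cmp V (\<lambda>Z. ?ys Z ! I Z)" if I: "cmp V I" "\<And>Z. Z \<in> V \<Longrightarrow> I Z < size (MM Z)"
  proof -
    have "?ys Z ! I Z < 2 ^ ww Z" if "Z \<in> V" for Z
    proof -
      have "?ys Z ! I Z \<in> set (?ys Z)" using I(2)[OF that] by (intro nth_mem) (simp add: length_sl)
      then have "?ys Z ! I Z < mm Z" using U(3)[OF that] by blast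
      then show ?thesis using U(2)[OF that] by linarith
    qed
    then have 1: "cmp ?L (\<lambda>Z. ?ys Z ! I Z)" by (intro cmp_top_nth[OF T cmp_inter[OF I(1)]]) (use I(2) in \<open>auto simp: length_sl\<close>)
    have 2: "cmp ?S (\<lambda>Z. ?ys Z ! I Z)" by (rule nthS[OF _ cmp_inter[OF I(1)]]) (use I(2) in auto)
    from cmp_if[OF t 2 1] show ?thesis by (simp only: if_cancel)
  qed
qed

lemma cmp_rank:
  assumes k: "6 \<le> k" "n0 < 2 ^ 2 ^ k"
  shows "cmp (states k n0 \<inter> {Z. aa Z ! 0 < mm Z}) (\<lambda>Z. nat (mrank (aa Z ! 0) (MM Z) mod 2 ^ ww Z))" (is "cmp ?V ?F")
proof -
  have p: "pos ?V" by (auto simp: pos_def states_def)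
  have t: "cmpP ?V (\<lambda>Z. ww Z < 2 ^ k)" by (rule cmp_wide[OF p]) (auto simp: states_def)
  let ?T = "?V \<inter> {Z. ww Z < 2 ^ k}" and ?B = "?V \<inter> {Z. \<not> ww Z < 2 ^ k}"
  have 1: "cmp ?T ?F" by (rule cmp_cong[OF cmp_load[OF cmp_arg[of 0]]]) (auto simp: states_def tab_ok_def pack_get)
  have 2: "cmp ?B ?F"
  proof -
    have f: "cmp ?B (\<lambda>Z. fo (sl (MM Z)) (aa Z ! 0))" by (rule cmp_univ_fo[OF k _ _ cmp_arg]) auto
    have "cmp ?B (\<lambda>Z. if fo (sl (MM Z)) (aa Z ! 0) < aa Z ! 1 then fo (sl (MM Z)) (aa Z ! 0) else 2 ^ ww Z - 1)"
      by (intro cmp_if cmp_less f cmp_arg cmp_inter[OF f] cmp_all_ones pos_inter p) simp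
    then show ?thesis
    proof (rule cmp_cong)
      fix Z assume v: "Z \<in> ?B"
      then have s: "aa Z ! 1 = size (MM Z)" "mm Z + size (MM Z) \<le> 2 ^ ww Z" by (auto simp: states_def)
      have "nat (- 1 mod 2 ^ ww Z) = 2 ^ ww Z - 1" by (simp add: zmod_minus1 nat_diff_distrib nat_power_eq)
      moreover have "nat (int x mod 2 ^ ww Z) = x" if "x < size (MM Z)" for x
      proof -
        have "int x < 2 ^ ww Z" using that s(2) by (metis le_add2 le_trans less_le_trans of_nat_less_iff of_nat_numeral of_nat_power)
        then show ?thesis by simp
      qed
      ultimately show "(if fo (sl (MM Z)) (aa Z ! 0) < aa Z ! 1 then fo (sl (MM Z)) (aa Z ! 0) else 2 ^ ww Z - 1) = ?F Z"
        unfolding s(1) mrank_eq by simp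
    qed
  qed
  from cmp_if[OF t 1 2] show ?thesis by (simp only: if_cancel)
qed

lemma cmp_select:
  assumes k: "6 \<le> k" "n0 < 2 ^ 2 ^ k"
  shows "cmp (states k n0 \<inter> {Z. aa Z ! 0 \<in> {1..size (MM Z)}}) (\<lambda>Z. mselect (aa Z ! 0) (MM Z))" (is "cmp ?V ?F")
proof -
  have p: "pos ?V" by (auto simp: pos_def states_def)
  have t: "cmpP ?V (\<lambda>Z. ww Z < 2 ^ k)" by (rule cmp_wide[OF p]) (auto simp: states_def)
  let ?T = "?V \<inter> {Z. ww Z < 2 ^ k}" and ?B = "?V \<inter> {Z. \<not> ww Z < 2 ^ k}"
  have b: "mm Z - 1 + aa Z ! 0 < 2 ^ ww Z" if "Z \<in> ?V" for Z
  proof -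
    have "0 < mm Z" "mm Z + size (MM Z) \<le> 2 ^ ww Z" "aa Z ! 0 \<le> size (MM Z)" using that by (auto simp: states_def)
    then show ?thesis by linarith
  qed
  have "cmp ?V (\<lambda>Z. aa Z ! 2 + aa Z ! 0)" by (intro cmp_add cmp_arg) (use b in \<open>auto simp: states_def\<close>)
  from cmp_load[OF cmp_inter[OF this]] have 1: "cmp ?T ?F" by (rule cmp_cong) (auto simp: states_def tab_ok_def pack_get)
  have "cmp ?V (\<lambda>Z. aa Z ! 0 - 1)"
    by (intro cmp_sub cmp_arg cmp_1 p) (use b in \<open>auto intro: le_less_trans[OF le_add2]\<close>)
  from cmp_inter[OF this] have "cmp ?B (\<lambda>Z. sl (MM Z) ! (aa Z ! 0 - 1))" by (rule cmp_univ_nth[OF k, rotated 2]) auto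
  then have 2: "cmp ?B ?F" by (rule cmp_cong) (simp add: mselect_eq)
  from cmp_if[OF t 1 2] show ?thesis by (simp only: if_cancel)
qed

lemma ex_tab:
  assumes "0 < m" "m + size M \<le> 2 ^ w" "set_mset M \<subseteq> {..<m}"
  shows "\<exists>bs. tab_ok w m M bs \<and> length bs = (m + size M) * w"
proof -
  let ?vs = "map (\<lambda>x. nat (mrank x M mod 2 ^ w)) [0..<m] @ map (\<lambda>i. mselect (i + 1) M) [0..<size M]"
  have s: "sub (arr w ?vs) 0 (arr w ?vs)" using sub_prefix[of "[]" "arr w ?vs" "[]"] by simp
  have sel: "mselect i M < 2 ^ w" if "i \<in> {1..size M}" for i
  proof -
    have "sl M ! (i - 1) \<in> set (sl M)" using that by (intro nth_mem) (auto simp: length_sl)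
    then have "mselect i M < m" using assms(3) mselect_eq[OF that] by auto
    then show ?thesis using assms(2) by linarith
  qed
  have "nat (mrank x M mod 2 ^ w) < 2 ^ w" for x by (simp add: nat_less_iff)
  then have "\<forall>x<m. get (arr w ?vs) (w * x) w = nat (mrank x M mod 2 ^ w)"
    using sub_arr[OF s] by (simp add: nth_append mult.commute)
  moreover have "\<forall>i\<in>{1..size M}. get (arr w ?vs) (w * (m - 1 + i)) w = mselect i M"
  proof
    fix i assume i: "i \<in> {1..size M}"
    have j: "m - 1 + i < length ?vs" "?vs ! (m - 1 + i) = mselect i M" using i assms(1) by (auto simp: nth_append)
    show "get (arr w ?vs) (w * (m - 1 + i)) w = mselect i M" using sub_arr[OF s j(1)] j(2) sel[OF i] by (simp add: mult.commute)
  qed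
  ultimately show ?thesis unfolding tab_ok_def by (intro exI[of _ "arr w ?vs"]) simp
qed

text \<open>For \<open>m = 1\<close> the double logarithm is that of 0, which is 0 by convention. So
  it is never negative, and adding a multiple of it can only enlarge a bound.\<close>

lemma lam_le_log: "1 \<le> m \<Longrightarrow> real (lam m) \<le> log 2 (log 2 (real m)) + 2 \<and> 0 \<le> log 2 (log 2 (real m))"
proof (cases "m = 1")
  case True
  have "bits 1 \<le> 1" by (rule bits_le) simp
  then show ?thesis using True by (simp add: lam_def log_def)
next
  case False
  assume "1 \<le> m"
  then have m: "2 \<le> m" using False by linarith
  let ?l = "log 2 (real m)"
  have "log 2 2 \<le> ?l" using m by (subst log_le_cancel_iff) auto
  then have l: "1 \<le> ?l" by simp
  have "real (bits (m - 1)) \<le> log 2 (real (m - 1)) + 1" using m by (intro bits_le_log) simp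
  also have "log 2 (real (m - 1)) \<le> ?l" using m by (subst log_le_cancel_iff) auto
  finally have b: "real (max 1 (bits (m - 1))) \<le> 2 * ?l" using l by auto
  have "real (lam m) \<le> log 2 (real (max 1 (bits (m - 1)))) + 1" unfolding lam_def by (intro bits_le_log) simp
  also have "log 2 (real (max 1 (bits (m - 1)))) \<le> log 2 (2 * ?l)" using b l by (subst log_le_cancel_iff) auto
  also have "\<dots> = 1 + log 2 ?l" using l by (simp add: log_mult)
  finally show ?thesis using l by simp
qed

text \<open>Since C(m+n,n) is at least ((m+n)/n)^n, plain fields of \<open>bits (m - 1)\<close> bits
  exceed the information bound by at most \<open>lg n + 1\<close> bits per element, a constant for
  bounded \<open>n\<close>. The header costs O(lg lg m).\<close>

lemma ex_sml:
  assumes w: "64 \<le> w" "size M \<le> w" and m: "0 < m" "m + size M \<le> 2 ^ w" "set_mset M \<subseteq> {..<m}"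
  shows "\<exists>bs W ps. hdr_ok w bs W ps \<and> sml_ok w (sl M) bs ps \<and>
    real (length bs) \<le> log 2 (real (m + size M choose size M)) + real (size M * size M + size M + 49) + 6 * real (lam m)"
proof -
  let ?n = "size M"
  define f where "f = bits (m - 1)"
  define W where "W = bits f + 8"
  define A where "A = 3 * bits W + 1 + 3 * W"
  let ?bs = "hdr W [0, f, A] @ arr f (sl M)"
  have fw: "f \<le> w" unfolding f_def using m by (intro bits_le) linarith
  have Ww: "W \<le> w + 8" using bits_le_self[of f] fw by (simp add: W_def)
  have room: "3 * bits W + 1 \<le> w \<and> 3 * bits W + 1 + 64 * W < 2 ^ w" using Ww w by (intro hdr_room) auto
  have A: "A \<le> 6 * W + 1" "A < 2 ^ w" "A < 2 ^ W" using bits_le_self[of W] room big_word[of W] by (auto simp: A_def W_def)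
  have lA: "length (hdr W [0, f, A]) = A" by (simp add: length_hdr A_def)
  have "f < 2 ^ W" using less_bits[of f] power_increasing[of "bits f" W "2::nat"] by (simp add: W_def) (meson le_add1 less_le_trans one_le_numeral power_increasing)
  moreover have "f < 2 ^ w" using fw less_exp[of w] by linarith
  moreover have "sub ?bs 0 (hdr W [0, f, A])" using sub_prefix[of "[]" "hdr W [0, f, A]"] by simp
  ultimately have hdr: "hdr_ok w ?bs W [0, f, A]" unfolding hdr_ok_def using A room by (auto simp: W_def)
  have "size M * f \<le> w * w" using w fw by (intro mult_le_mono)
  moreover have "64 * w \<le> w * w" using w(1) by (rule mult_le_mono1)
  moreover have "w * w * 16 \<le> 2 ^ w" by (rule square16_le_pow2[OF w(1)])
  ultimately have An: "A + size M * f < 2 ^ w" using A(1) Ww w(1) by linarith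
  have "\<forall>y\<in>set (sl M). y < 2 ^ f \<and> y < 2 ^ w"
  proof
    fix y assume "y \<in> set (sl M)"
    then have y: "y < m" using m(3) by auto
    then have "y \<le> m - 1" by linarith
    then show "y < 2 ^ f \<and> y < 2 ^ w" unfolding f_def using less_bits[of "m - 1"] y m(2) by linarith
  qed
  moreover have "sub ?bs A (arr f (sl M))" using sub_prefix[of "hdr W [0, f, A]" "arr f (sl M)" "[]"] lA by simp
  ultimately have sml: "sml_ok w (sl M) ?bs [0, f, A]" unfolding sml_ok_def using An by (simp add: length_sl)
  have "real (n * f) \<le> log 2 (real (m + n choose n)) + real (n * n + n)" for n
  proof (cases "n = 0 \<or> m = 1")
    case True
    have "1 \<le> real (m + n choose n)" using zero_less_binomial[of n "m + n"] by linarith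
    then have "0 \<le> log 2 (real (m + n choose n))" by simp
    moreover have "real (n * f) = 0" using True by (auto simp: f_def)
    ultimately show ?thesis by linarith
  next
    case False
    then have n: "0 < n" and m2: "0 < m - 1" using m(1) by auto
    have "(real (m + n) / real n) ^ n \<le> real (m + n choose n)" by (rule binomial_ge_n_over_k_pow_k) simp
    then have "log 2 ((real (m + n) / real n) ^ n) \<le> log 2 (real (m + n choose n))" using n by (subst log_le_cancel_iff) auto
    then have 1: "real n * (log 2 (real (m + n)) - log 2 (real n)) \<le> log 2 (real (m + n choose n))" using n by (simp add: log_nat_power log_divide)
    have "real n \<le> 2 ^ n" using less_exp[of n] by (simp add: less_imp_le)
    then have "log 2 (real n) \<le> log 2 (2 ^ n)" using n by (subst log_le_cancel_iff) auto
    then have 2: "log 2 (real n) \<le> real n" by (simp add: log_nat_power)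
    have "real f \<le> log 2 (real (m - 1)) + 1" unfolding f_def by (rule bits_le_log[OF m2])
    also have "log 2 (real (m - 1)) \<le> log 2 (real (m + n))" using m2 by (subst log_le_cancel_iff) auto
    finally have "real f \<le> (log 2 (real (m + n)) - log 2 (real n)) + real n + 1" using 2 by linarith
    then have "real n * real f \<le> real n * ((log 2 (real (m + n)) - log 2 (real n)) + real n + 1)" by (intro mult_left_mono) auto
    then show ?thesis using 1 by (simp add: distrib_left)
  qed
  from this[of ?n] have "real (?n * f) \<le> log 2 (real (m + ?n choose ?n)) + real (?n * ?n + ?n)" .
  moreover have "length ?bs \<le> 6 * lam m + 49 + ?n * f"
  proof -
    have "bits f \<le> lam m" unfolding f_def lam_def by (rule bits_mono) simp
    then show ?thesis using A(1) lA by (simp add: length_sl W_def)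
  qed
  then have "real (length ?bs) \<le> real (6 * lam m + 49 + ?n * f)" by (simp only: of_nat_le_iff)
  ultimately have "real (length ?bs) \<le> log 2 (real (m + ?n choose ?n)) + real (?n * ?n + ?n + 49) + 6 * real (lam m)" by simp
  then show ?thesis using hdr sml by blast
qed

section \<open>The redundancy is sublinear\<close>

lemma bof_ge: "2 ^ 2 ^ (4 * B) \<le> n \<Longrightarrow> B \<le> bof n"
proof -
  assume "2 ^ 2 ^ (4 * B) \<le> n"
  then have "(2::nat) ^ 2 ^ (4 * B) < 2 ^ bits n" using less_bits[of n] by linarith
  then have "2 ^ (4 * B) < bits n" by simp
  then have "2 ^ (4 * B) \<le> bits n - 1" by linarith
  then have "(2::nat) ^ (4 * B) < 2 ^ bits (bits n - 1)" using less_bits[of "bits n - 1"] by linarith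
  then have "4 * B < bits (bits n - 1)" by simp
  then show ?thesis unfolding bof_def tau_def by linarith
qed

lemma slack_nonneg: "0 \<le> slack n" unfolding slack_def by simp

text \<open>One third of \<open>c * n\<close> covers the term with (b + 1) / 2^(b/2), where squares
  are below powers of two; one sixth covers \<open>bits n\<close>, linearized by
  \<open>bits_add_le\<close>, and one sixth the constants.\<close>

lemma slack_small:
  assumes c: "0 < (c::real)"
  shows "eventually (\<lambda>n. slack n + a \<le> c * real n) sequentially"
proof -
  obtain K :: nat where K: "108000 / c \<le> real K" using real_arch_simple by blast
  define B where "B = 2 * (K + 4)"
  obtain p :: nat where p: "804 / c < 2 ^ p" using real_arch_pow[of 2 "804 / c"] by auto
  obtain n2 :: nat where n2: "3 * (134 * real p + 2116 + \<bar>a\<bar>) * 2 / c \<le> real n2" using real_arch_simple by blast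
  have "slack n + a \<le> c * real n" if n: "max n2 (2 ^ 2 ^ (4 * B)) \<le> n" for n
  proof -
    define k where "k = bof n div 2"
    have "B \<le> bof n" using n by (intro bof_ge) simp
    then have "B div 2 \<le> k" unfolding k_def by (rule div_le_mono)
    then have k: "K + 4 \<le> k" by (simp add: B_def)
    have "bof n + 1 \<le> 4 * k" using k unfolding k_def by linarith
    then have b1: "real (bof n) + 1 \<le> 4 * real k" by (simp flip: of_nat_Suc add: add.commute)
    have "k * k \<le> 2 ^ k" using k by (intro square_le_pow2) simp
    then have k2: "real k * real k \<le> 2 ^ k" by (metis of_nat_le_iff of_nat_mult of_nat_numeral of_nat_power)
    have k0: "0 < real k" using k by simp
    have "(real (bof n) + 1) / 2 ^ k \<le> (4 * real k) / (real k * real k)" using b1 k2 k0 by (intro frac_le) auto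
    also have "\<dots> = 4 / real k" using k0 by simp
    finally have "9000 * ((real (bof n) + 1) / 2 ^ k) \<le> 9000 * (4 / real k)" by (rule mult_left_mono) simp
    also have "\<dots> = 36000 / real k" by simp
    also have "\<dots> \<le> c / 3"
    proof -
      have "108000 / c \<le> real k" using K k by linarith
      then show ?thesis using c k0 by (simp add: field_simps)
    qed
    finally have "9000 * ((real (bof n) + 1) / 2 ^ k) * real n \<le> c / 3 * real n" by (intro mult_right_mono) auto
    then have 1: "9000 * (real (bof n) + 1) * (real n / 2 ^ (bof n div 2)) \<le> c / 3 * real n" by (simp add: k_def)
    have "real (bits n) \<le> real (p + n div 2 ^ p)" using bits_add_le[of n p] by (simp only: of_nat_le_iff)
    also have "\<dots> \<le> real p + real n / 2 ^ p" using of_nat_div_le[of n "2 ^ p"] by simp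
    finally have "134 * real (bits n) \<le> 134 * real p + 134 / 2 ^ p * real n" by simp
    moreover have "134 / 2 ^ p * real n \<le> c / 6 * real n" using p c by (intro mult_right_mono) (auto simp: field_simps)
    moreover have "134 * real p + 2116 + a \<le> c / 6 * real n"
    proof -
      have "3 * (134 * real p + 2116 + \<bar>a\<bar>) * 2 / c \<le> real n" using n2 n by linarith
      then have "3 * (134 * real p + 2116 + \<bar>a\<bar>) * 2 \<le> c * real n" using c by (simp add: field_simps)
      then show ?thesis by (simp add: field_simps)
    qed
    moreover have "c / 3 * real n + c / 6 * real n + c / 6 * real n \<le> c * real n" using c by (simp add: field_simps)
    ultimately show ?thesis using 1 unfolding slack_def by linarith
  qed
  then show ?thesis unfolding eventually_sequentially by blast
qed

lemma answers_mono: "answers w P T bs as v \<Longrightarrow> T \<le> T' \<Longrightarrow> answers w P T' bs as v"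
  unfolding answers_def using le_trans by blast

text \<open>In a short word \<open>m + n <= 2 ^ w\<close> bounds everything by a constant, so tables
  are affordable. In a longer word \<open>n < n0 < k\<close> makes \<open>n\<close> smaller than
  \<open>w\<close>, and a list suffices; the remaining multisets are large. The 266 is twice 133,
  from \<open>lam m <= lg lg m + 2\<close>.\<close>

lemma ex_rep:
  assumes k: "6 \<le> k" "n0 < k" and n0: "\<And>n. n0 \<le> n \<Longrightarrow> 100000 \<le> bof n"
    and w: "0 < w" "0 < m" "m + size M \<le> 2 ^ w" "set_mset M \<subseteq> {..<m}"
  shows "\<exists>bs. (\<forall>as. length as = 4 \<and> as ! 1 = size M \<and> as ! 2 = m - 1 \<and> as ! 3 = w \<longrightarrow> \<lparr>ww = w, bb = bs, aa = as, mm = m, MM = M\<rparr> \<in> states k n0) \<and>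
    real (length bs) \<le> log 2 (real (m + size M choose size M)) + (slack (size M) + 266 + (if size M < 2 ^ 2 ^ k then real (2 ^ 2 ^ k * 2 ^ k + n0 * n0 + n0 + 49) else 0)) +
      133 * log 2 (log 2 (real m))"
proof -
  let ?n = "size M"
  have l: "real (lam m) \<le> log 2 (log 2 (real m)) + 2" "0 \<le> log 2 (log 2 (real m))" using lam_le_log[of m] w(2) by auto
  have C: "0 \<le> log 2 (real (m + ?n choose ?n))" using zero_less_binomial[of ?n "m + ?n"] by (simp add: Suc_le_eq)
  note s0 = slack_nonneg[of ?n]
  have kk: "k < 2 ^ k" by (rule less_exp)
  have n0k: "n0 < 2 ^ 2 ^ k" using kk less_exp[of "2 ^ k"] k by linarith
  show ?thesis
  proof (cases "w < 2 ^ k")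
    case True
    obtain bs where bs: "tab_ok w m M bs" "length bs = (m + ?n) * w" using ex_tab[OF w(2-4)] by blast
    have p: "(2::nat) ^ w \<le> 2 ^ 2 ^ k" using True by (intro power_increasing) auto
    have "(m + ?n) * w \<le> 2 ^ 2 ^ k * 2 ^ k" using w(3) p True by (intro mult_le_mono) linarith+
    then have "real (length bs) \<le> real (2 ^ 2 ^ k * 2 ^ k + n0 * n0 + n0 + 49)" unfolding bs(2) of_nat_le_iff by linarith
    moreover have "?n < 2 ^ 2 ^ k" using w(2,3) p by linarith
    ultimately have "real (length bs) \<le> log 2 (real (m + ?n choose ?n)) + (slack ?n + 266 + (if ?n < 2 ^ 2 ^ k then real (2 ^ 2 ^ k * 2 ^ k + n0 * n0 + n0 + 49) else 0)) + 133 * log 2 (log 2 (real m))"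
      using C l(2) s0 by (simp only: if_True)
    then show ?thesis using bs(1) w True by (intro exI[of _ bs]) (simp add: states_def del: of_nat_add of_nat_mult of_nat_power)
  next
    case False
    have w64: "64 \<le> w" using power_increasing[OF k(1), of "2::nat"] False by simp
    show ?thesis
    proof (cases "?n < n0")
      case True
      have nw: "?n \<le> w" using True False k kk by linarith
      obtain bs W ps where bs: "hdr_ok w bs W ps" "sml_ok w (sl M) bs ps"
        "real (length bs) \<le> log 2 (real (m + ?n choose ?n)) + real (?n * ?n + ?n + 49) + 6 * real (lam m)"
        using ex_sml[OF w64 nw w(2-4)] by blast
      have "?n * ?n \<le> n0 * n0" using True by (intro mult_le_mono) auto
      then have "?n * ?n + ?n + 49 \<le> 2 ^ 2 ^ k * 2 ^ k + n0 * n0 + n0 + 49" using True by linarith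
      then have "real (?n * ?n + ?n + 49) \<le> real (2 ^ 2 ^ k * 2 ^ k + n0 * n0 + n0 + 49)" by (simp only: of_nat_le_iff)
      moreover have "?n < 2 ^ 2 ^ k" using True n0k by linarith
      ultimately have "real (length bs) \<le> log 2 (real (m + ?n choose ?n)) + (slack ?n + 266 + (if ?n < 2 ^ 2 ^ k then real (2 ^ 2 ^ k * 2 ^ k + n0 * n0 + n0 + 49) else 0)) + 133 * log 2 (log 2 (real m))"
        using bs(3) l s0 by (simp only: if_True)
      then show ?thesis using bs(1,2) w False True by (intro exI[of _ bs]) (auto simp: states_def simp del: of_nat_add of_nat_mult of_nat_power)
    next
      case nn: False
      have "large (sl M) m w" using w w64 n0[of ?n] nn by unfold_locales (auto simp: length_sl)
      then obtain bs d c P s e bL Wp where bs: "top_ok d c P s e bL (sl M) w bs" "hdr_ok w bs Wp (plist d P s e bL)" "\<forall>x<m. x div 2 ^ s < dU d"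
        "real (length bs) \<le> log 2 (real (m + ?n choose ?n)) + slack ?n + 133 * real (lam m)"
        using large.ex_large[of "sl M" m w] unfolding length_sl by blast
      have "lrg_ok w m (sl M) bs (plist d P s e bL)" unfolding lrg_ok_def using bs(1,3) by blast
      moreover have "0 \<le> (if ?n < 2 ^ 2 ^ k then real (2 ^ 2 ^ k * 2 ^ k + n0 * n0 + n0 + 49) else 0)" by simp
      then have "real (length bs) \<le> log 2 (real (m + ?n choose ?n)) + (slack ?n + 266 + (if ?n < 2 ^ 2 ^ k then real (2 ^ 2 ^ k * 2 ^ k + n0 * n0 + n0 + 49) else 0)) + 133 * log 2 (log 2 (real m))"
        using bs(4) l by linarith
      ultimately show ?thesis using bs(2) w False by (intro exI[of _ bs]) (auto simp: states_def simp del: of_nat_add of_nat_mult of_nat_power)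
    qed
  qed
qed

theorem theorem6p3:
  "\<exists>(f :: nat \<Rightarrow> real) (C :: real).
     f \<in> o(\<lambda>n. real n) \<and>
     (\<forall>\<kappa> :: real. \<exists>(Pr :: prog) (Ps :: prog) (T :: nat).
        \<forall>(m :: nat) (n :: nat) (w :: nat) (M :: nat multiset).
          m \<ge> 1 \<longrightarrow> word_size_theta \<kappa> (m + n) w \<longrightarrow> size M = n \<longrightarrow> set_mset M \<subseteq> {..<m} \<longrightarrow>
          (\<exists>bs :: bool list.
             real (length bs) \<le> real_of_int (info_bound n (m + n)) + f n + C * log 2 (log 2 (real m)) \<and>
             indexable_multiset_rep w Pr Ps T m M bs))"
proof -
  obtain n0 where n0: "\<And>n. n0 \<le> n \<Longrightarrow> 100000 \<le> bof n" using bof_ge[of 100000] by blast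
  \<comment> \<open>Large enough that words not tabulated have at least 64 bits and can hold
    \<open>n0\<close>.\<close>
  define k where "k = n0 + 6"
  have k: "6 \<le> k" "n0 < k" by (simp_all add: k_def)
  have k2: "n0 < 2 ^ 2 ^ k" using k less_exp[of k] less_exp[of "2 ^ k"] by linarith
  define f where "f n = slack n + 266 + (if n < 2 ^ 2 ^ k then real (2 ^ 2 ^ k * 2 ^ k + n0 * n0 + n0 + 49) else 0)" for n
  have f: "f \<in> o(\<lambda>n. real n)"
  proof (rule landau_o.smallI)
    fix c :: real assume "0 < c"
    then have "eventually (\<lambda>n. slack n + 266 \<le> c * real n) sequentially" by (rule slack_small)
    moreover have "eventually (\<lambda>n. 2 ^ 2 ^ k \<le> n) sequentially" by (rule eventually_ge_at_top)
    ultimately show "eventually (\<lambda>n. norm (f n) \<le> c * norm (real n)) sequentially"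
    proof eventually_elim
      case (elim n)
      then have "f n = slack n + 266" unfolding f_def by simp
      then show ?case using elim slack_nonneg[of n] by simp
    qed
  qed
  obtain er where er: "\<forall>Z\<in>states k n0 \<inter> {Z. aa Z ! 0 < mm Z}. ev (ww Z) (pack (ww Z) (bb Z)) (aa Z) er = nat (mrank (aa Z ! 0) (MM Z) mod 2 ^ ww Z)"
    using cmp_rank[OF k(1) k2] unfolding cmp_def by blast
  obtain es where es: "\<forall>Z\<in>states k n0 \<inter> {Z. aa Z ! 0 \<in> {1..size (MM Z)}}. ev (ww Z) (pack (ww Z) (bb Z)) (aa Z) es = mselect (aa Z ! 0) (MM Z)"
    using cmp_select[OF k(1) k2] unfolding cmp_def by blast
  define T where "T = clen er + clen es + 2"
  have main: "\<exists>bs. real (length bs) \<le> real_of_int (info_bound n (m + n)) + f n + 133 * log 2 (log 2 (real m)) \<and>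
     indexable_multiset_rep w (prog_of er) (prog_of es) T m M bs"
    if m: "m \<ge> 1" and ws: "word_size_theta \<kappa> (m + n) w" and M: "size M = n" "set_mset M \<subseteq> {..<m}" for \<kappa> m n w M
  proof -
    have w: "1 \<le> real w" "log 2 (real (m + n)) \<le> real w" using ws by (auto simp: word_size_theta_def)
    \<comment> \<open>The lower constant 1 of the word size enters here: elements, positions and the
      number \<open>m + n\<close> of tabulated answers are within the range of a word.\<close>
    have "real (m + n) \<le> 2 powr real w" using w(2) m by (subst (asm) log_le_iff) auto
    then have "real (m + n) \<le> real (2 ^ w)" by (simp add: powr_realpow)
    then have mn: "m + size M \<le> 2 ^ w" using M(1) by (simp only: of_nat_le_iff)
    have w0: "0 < w" "0 < m" using w(1) m by auto
    obtain bs where bs: "\<And>as. length as = 4 \<Longrightarrow> as ! 1 = size M \<Longrightarrow> as ! 2 = m - 1 \<Longrightarrow> as ! 3 = w \<Longrightarrow> \<lparr>ww = w, bb = bs, aa = as, mm = m, MM = M\<rparr> \<in> states k n0"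
      and len: "real (length bs) \<le> log 2 (real (m + n choose n)) + f n + 133 * log 2 (log 2 (real m))"
      using ex_rep[OF k n0 w0 mn M(2)] unfolding f_def M(1) by blast
    have "log 2 (real (m + n choose n)) \<le> real_of_int (info_bound n (m + n))" unfolding info_bound_def by simp
    then have "real (length bs) \<le> real_of_int (info_bound n (m + n)) + f n + 133 * log 2 (log 2 (real m))" using len by linarith
    moreover have "indexable_multiset_rep w (prog_of er) (prog_of es) T m M bs"
      unfolding indexable_multiset_rep_def
    proof (intro conjI allI impI ballI)
      fix x assume x: "x < m"
      have "ev w (pack w bs) [x, size M, m - 1, w] er = nat (mrank x M mod 2 ^ w)"
        using bspec[OF er, of "\<lparr>ww = w, bb = bs, aa = [x, size M, m - 1, w], mm = m, MM = M\<rparr>"] bs[of "[x, size M, m - 1, w]"] x by simp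
      then have "answers w (prog_of er) (clen er + 1) bs [x, size M, m - 1, w] (mrank x M)" by (intro answers_prog_of) simp_all
      then show "answers w (prog_of er) T bs [x, size M, m - 1, w] (mrank x M)" by (rule answers_mono) (simp add: T_def)
    next
      fix i assume i: "i \<in> {1..size M}"
      have e: "ev w (pack w bs) [i, size M, m - 1, w] es = mselect i M"
        using bspec[OF es, of "\<lparr>ww = w, bb = bs, aa = [i, size M, m - 1, w], mm = m, MM = M\<rparr>"] bs[of "[i, size M, m - 1, w]"] i by simp
      have "sl M ! (i - 1) \<in> set (sl M)" using i by (intro nth_mem) (auto simp: length_sl)
      then have "mselect i M < m" using M(2) mselect_eq[OF i] by auto
      then have "mselect i M < 2 ^ w" using mn by linarith
      then have "int (mselect i M) = int (mselect i M) mod 2 ^ w" by (metis mod_less of_nat_mod of_nat_numeral of_nat_power)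
      then have "answers w (prog_of es) (clen es + 1) bs [i, size M, m - 1, w] (int (mselect i M))" using e by (intro answers_prog_of) simp_all
      then show "answers w (prog_of es) T bs [i, size M, m - 1, w] (int (mselect i M))" by (rule answers_mono) (simp add: T_def)
    qed
    ultimately show ?thesis by blast
  qed
  show ?thesis by (intro exI[of _ f] exI[of _ 133] conjI f allI) (use main in blast)
qed

end
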